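(* Let $u$ be a weak supersolution of $-\operatorname{div}\mathcal{B}(x,u,\nabla u)+\mathcal{L}(u)=0$ in $\Omega$ such that $u\ge0$ in $B_R(x_0)\subset\Omega$, and let $0<l<\kappa(p-1)$, where $\kappa=\frac N{N-p}$ if $1<p<N$ and $\kappa=2$ if $p\ge N$. Then there exists $c=c(N,p,s,\Lambda,C_1,C_2)$ (also allowed to depend on $l$) such that $$\Big(\frac1{|B_{r/2}(x_0)|}\int_{B_{r/2}(x_0)}u^l\,dx\Big)^{1/l}\le c\operatorname*{ess\,inf}_{B_r(x_0)}u+c\Big(\frac rR\Big)^{\frac p{p-1}}\mathrm{Tail}(u^-;x_0,R)$$ whenever $B_r(x_0)\subset B_{R/2}(x_0)$ and $r\in(0,1]$.
   Context: $\Omega\subset\mathbb{R}^N$ ($N\ge2$) is a bounded smooth domain, $1<p<\infty$, $0<s<1$. $\mathcal{B}:\Omega\times\mathbb{R}\times\mathbb{R}^N\to\mathbb{R}^N$ is measurable in $x$ and continuous in $(u,\zeta)$, and satisfies (H1): $\mathcal{B}(x,u,\zeta)\cdot\zeta\ge C_1|\zeta|^p$ and $|\mathcal{B}(x,u,\zeta)|\le C_2|\zeta|^{p-1}$ for a.e. $x\in\Omega$ and all $(u,\zeta)\in\mathbb{R}^{N+1}$, with constants $C_1,C_2>0$. $K$ is a measurable kernel, symmetric in $x,y$, with $\Lambda^{-1}|x-y|^{-N-ps}\le K(x,y)\le\Lambda|x-y|^{-N-ps}$ for some $\Lambda\ge1$; $d\mu=K(x,y)\,dx\,dy$. $\mathcal{L}(u)(x)=\mathrm{P.V.}\int_{\mathbb{R}^N}|u(x)-u(y)|^{p-2}(u(x)-u(y))K(x,y)\,dy$.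 A function $u\in L^\infty(\mathbb{R}^N)\cap W^{1,p}_{\rm loc}(\Omega)$ is a weak supersolution if for every $\Omega'\Subset\Omega$ and every nonnegative $\phi\in W^{1,p}_0(\Omega')$ (extended by zero), $\int_{\Omega'}\mathcal{B}(x,u,\nabla u)\cdot\nabla\phi\,dx+\int_{\mathbb{R}^N}\int_{\mathbb{R}^N}|u(x)-u(y)|^{p-2}(u(x)-u(y))(\phi(x)-\phi(y))\,d\mu\ge0$. The tail is $\mathrm{Tail}(v;x_0,r)=\big(r^p\int_{\mathbb{R}^N\setminus B_r(x_0)}\frac{|v(y)|^{p-1}}{|y-x_0|^{N+ps}}dy\big)^{1/(p-1)}$. $k^-=\max\{-k,0\}$. *)

theory Defs
  imports "HOL-Analysis.Analysis"
begin

fun Ck_fun :: "nat \<Rightarrow> ('a::euclidean_space \<Rightarrow> real) \<Rightarrow> bool" where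
  "Ck_fun 0 f \<longleftrightarrow> continuous_on UNIV f"
| "Ck_fun (Suc k) f \<longleftrightarrow> f differentiable_on UNIV \<and>
      (\<forall>b\<in>Basis. Ck_fun k (\<lambda>x. frechet_derivative f (at x) b))"

definition smooth_fun :: "('a::euclidean_space \<Rightarrow> real) \<Rightarrow> bool" where
  "smooth_fun f \<longleftrightarrow> (\<forall>k. Ck_fun k f)"

definition smooth_bounded_domain :: "'a::euclidean_space set \<Rightarrow> bool" where
  "smooth_bounded_domain \<Omega> \<longleftrightarrow> bounded \<Omega> \<and> connected \<Omega> \<and> \<Omega> \<noteq> {} \<and>
     (\<exists>\<rho>. smooth_fun \<rho> \<and> \<Omega> = {x. \<rho> x < 0} \<and>
          (\<forall>x. \<rho> x = 0 \<longrightarrow> frechet_derivative \<rho> (at x) \<noteq> (\<lambda>v. 0)))"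

definition test_fun :: "'a::euclidean_space set \<Rightarrow> ('a \<Rightarrow> real) \<Rightarrow> bool" where
  "test_fun U \<phi> \<longleftrightarrow> smooth_fun \<phi> \<and> compact (closure {x. \<phi> x \<noteq> 0}) \<and>
     closure {x. \<phi> x \<noteq> 0} \<subseteq> U"

definition cgrad :: "('a::euclidean_space \<Rightarrow> real) \<Rightarrow> 'a \<Rightarrow> 'a" where
  "cgrad \<phi> x = (\<Sum>b\<in>Basis. frechet_derivative \<phi> (at x) b *\<^sub>R b)"

definition Lp_loc :: "real \<Rightarrow> 'a::euclidean_space set \<Rightarrow> ('a \<Rightarrow> real) \<Rightarrow> bool" where
  "Lp_loc p U f \<longleftrightarrow> (\<forall>C. compact C \<and> C \<subseteq> U \<longrightarrow>
      set_borel_measurable lebesgue C f \<and> set_integrable lebesgue C (\<lambda>x. \<bar>f x\<bar> powr p))"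

definition Lp_on :: "real \<Rightarrow> 'a::euclidean_space set \<Rightarrow> ('a \<Rightarrow> real) \<Rightarrow> bool" where
  "Lp_on p U f \<longleftrightarrow> set_borel_measurable lebesgue U f \<and>
      set_integrable lebesgue U (\<lambda>x. \<bar>f x\<bar> powr p)"

definition weak_grad_on :: "'a::euclidean_space set \<Rightarrow> ('a \<Rightarrow> real) \<Rightarrow> ('a \<Rightarrow> 'a) \<Rightarrow> bool" where
  "weak_grad_on U u g \<longleftrightarrow>
     (\<forall>C. compact C \<and> C \<subseteq> U \<longrightarrow> set_integrable lebesgue C u \<and>
          (\<forall>b\<in>Basis. set_integrable lebesgue C (\<lambda>x. g x \<bullet> b))) \<and>
     (\<forall>\<phi>. test_fun U \<phi> \<longrightarrow> (\<forall>b\<in>Basis.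
          (LINT x:U|lebesgue. u x * frechet_derivative \<phi> (at x) b)
            = - (LINT x:U|lebesgue. (g x \<bullet> b) * \<phi> x)))"

definition W1p_loc :: "real \<Rightarrow> 'a::euclidean_space set \<Rightarrow> ('a \<Rightarrow> real) \<Rightarrow> bool" where
  "W1p_loc p U u \<longleftrightarrow> Lp_loc p U u \<and>
     (\<exists>g. weak_grad_on U u g \<and> Lp_loc p U (\<lambda>x. norm (g x)))"

definition W1p0 :: "real \<Rightarrow> 'a::euclidean_space set \<Rightarrow> ('a \<Rightarrow> real) \<Rightarrow> bool" where
  "W1p0 p U \<phi> \<longleftrightarrow> (\<forall>x. x \<notin> U \<longrightarrow> \<phi> x = 0) \<and> Lp_on p U \<phi> \<and>
     (\<exists>g. weak_grad_on U \<phi> g \<and> Lp_on p U (\<lambda>x. norm (g x)) \<and>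
        (\<exists>\<psi>::nat \<Rightarrow> 'a \<Rightarrow> real. (\<forall>k. test_fun U (\<psi> k)) \<and>
           (\<lambda>k. LINT x:U|lebesgue. \<bar>\<psi> k x - \<phi> x\<bar> powr p) \<longlonglongrightarrow> 0 \<and>
           (\<lambda>k. LINT x:U|lebesgue. norm (cgrad (\<psi> k) x - g x) powr p) \<longlonglongrightarrow> 0))"

definition Linf :: "('a::euclidean_space \<Rightarrow> real) \<Rightarrow> bool" where
  "Linf u \<longleftrightarrow> u \<in> borel_measurable lebesgue \<and> (\<exists>M. AE x in lebesgue. \<bar>u x\<bar> \<le> M)"

definition ppow :: "real \<Rightarrow> real \<Rightarrow> real" where
  "ppow p t = \<bar>t\<bar> powr (p - 2) * t"

text \<open>Weak supersolution of -div B(x,u,grad u) + L(u) = 0 in Omega, where the nonlocal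
operator has kernel K (d mu = K(x,y) dx dy).\<close>
definition weak_supersolution ::
  "real \<Rightarrow> 'a::euclidean_space set \<Rightarrow> ('a \<Rightarrow> real \<Rightarrow> 'a \<Rightarrow> 'a) \<Rightarrow> ('a \<Rightarrow> 'a \<Rightarrow> real)
     \<Rightarrow> ('a \<Rightarrow> real) \<Rightarrow> bool" where
  "weak_supersolution p \<Omega> \<B> K u \<longleftrightarrow> Linf u \<and> W1p_loc p \<Omega> u \<and>
     (\<forall>g. weak_grad_on \<Omega> u g \<longrightarrow>
       (\<forall>\<Omega>' \<phi> h. open \<Omega>' \<and> compact (closure \<Omega>') \<and> closure \<Omega>' \<subseteq> \<Omega> \<and>
           W1p0 p \<Omega>' \<phi> \<and> (\<forall>x. 0 \<le> \<phi> x) \<and> weak_grad_on \<Omega>' \<phi> h \<longrightarrow>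
         0 \<le> (LINT x:\<Omega>'|lebesgue. \<B> x (u x) (g x) \<bullet> h x)
            + (\<integral>z. ppow p (u (fst z) - u (snd z)) * (\<phi> (fst z) - \<phi> (snd z))
                    * K (fst z) (snd z) \<partial>(lebesgue :: ('a \<times> 'a) measure))))"

definition Tail :: "real \<Rightarrow> real \<Rightarrow> ('a::euclidean_space \<Rightarrow> real) \<Rightarrow> 'a \<Rightarrow> real \<Rightarrow> real" where
  "Tail p s v x0 r = (r powr p * (LINT y:(UNIV - ball x0 r)|lebesgue.
       \<bar>v y\<bar> powr (p - 1) / dist y x0 powr (real DIM('a) + p * s))) powr (1 / (p - 1))"

definition neg_part :: "real \<Rightarrow> real" where
  "neg_part k = max (- k) 0"

definition ess_inf_on :: "'a::euclidean_space set \<Rightarrow> ('a \<Rightarrow> real) \<Rightarrow> real" where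
  "ess_inf_on A u = Sup {z. AE x in lebesgue. x \<in> A \<longrightarrow> z \<le> u x}"

definition kappa :: "nat \<Rightarrow> real \<Rightarrow> real" where
  "kappa N p = (if p < real N then real N / (real N - p) else 2)"

end

theory Submission
 imports Defs
begin

text \<open>
 Put \<open>v = u + d\<close>, where \<open>d\<close> is slightly larger than \<open>(r/R)^(p/(p-1)) Tail(u^-; x0, R)\<close>. Testing the equation
 with \<open>\<eta>^p v^(1-q)\<close>, \<open>q > 1\<close>, gives a Caccioppoli inequality: the choice of \<open>d\<close> makes the contribution of
 \<open>u^-\<close> outside the ball of radius \<open>R\<close> comparable to the local terms, and near the diagonal the nonlocal term
 has a good sign up to such terms. With the Sobolev inequality this yields a reverse Hoelder inequality for every
 power \<open>\<alpha> <= l/\<kappa> < p - 1\<close> of \<open>v\<close>, negative ones included, for an exponent \<open>\<kappa>\<close> slightly below the Sobolev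
 exponent. The case \<open>\<alpha> = 0\<close> and the Poincare inequality bound the mean oscillation of \<open>ln v\<close>. Moser iteration
 and the lemma of Bombieri and Giusti, applied to \<open>v\<close> and to \<open>1/v\<close>, then bound the \<open>L^l\<close> mean of \<open>v\<close> by its
 essential infimum.

 Test functions in \<open>W_0^(1,p)\<close> and the Sobolev and Poincare inequalities for \<open>v\<close> are obtained from
 continuously differentiable approximations of \<open>u\<close>, produced by mollification.
\<close>

abbreviation nn_lborel :: "('a::euclidean_space => ennreal) => ennreal" (binder "LBNN " 10)
 where "nn_lborel f \<equiv> integral\<^sup>N lborel f"

lemma Ck_fun_Suc_D: "Ck_fun (Suc k) f ==> Ck_fun k f"
proof (induction k arbitrary: f)
 case 0
 then show ?case by (auto intro: differentiable_imp_continuous_on)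
next
 case (Suc k)
 then show ?case by (metis Ck_fun.simps(2))
qed

lemma Ck_fun_SucI:
 fixes f :: "'a::euclidean_space => real"
 assumes "\<And>x. (f has_derivative f' x) (at x)"
  and "\<And>b. b \<in> Basis ==> Ck_fun k (\<lambda>x. f' x b)"
 shows "Ck_fun (Suc k) f"
proof -
 have *: "frechet_derivative f (at x) = f' x" for x
  using assms(1) frechet_derivative_at by metis
 then show ?thesis using assms
  by (auto simp: differentiable_on_def differentiable_def intro: has_derivative_at_withinI)
qed

lemma Ck_fun_deriv:
 assumes "Ck_fun (Suc k) f"
 shows "(f has_derivative frechet_derivative f (at x)) (at x)"
 using assms by (auto simp: differentiable_on_def frechet_derivative_works)

lemma Ck_fun_const: "Ck_fun k (\<lambda>x. c)"
proof (induction k arbitrary: c)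
 case 0
 then show ?case by simp
next
 case (Suc k)
 show ?case by (rule Ck_fun_SucI[where f' = "\<lambda>x h. 0"]) (auto simp: Suc)
qed

lemma Ck_fun_add: "Ck_fun k f ==> Ck_fun k g ==> Ck_fun k (\<lambda>x. f x + g x)"
proof (induction k arbitrary: f g)
 case 0
 then show ?case by (auto intro: continuous_intros)
next
 case (Suc k)
 show ?case
  by (rule Ck_fun_SucI[OF has_derivative_add[OF Ck_fun_deriv[OF Suc.prems(1)] Ck_fun_deriv[OF Suc.prems(2)]]])
   (use Suc in auto)
qed

lemma Ck_fun_mult: "Ck_fun k f ==> Ck_fun k g ==> Ck_fun k (\<lambda>x. f x * g x)"
proof (induction k arbitrary: f g)
 case 0
 then show ?case by (auto intro: continuous_intros)
next
 case (Suc k)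
 have f: "Ck_fun k f" and g: "Ck_fun k g"
  using Suc.prems by (auto intro: Ck_fun_Suc_D simp del: Ck_fun.simps)
 have df: "Ck_fun k (\<lambda>x. frechet_derivative f (at x) b)" "Ck_fun k (\<lambda>x. frechet_derivative g (at x) b)"
  if "b \<in> Basis" for b
  using Suc.prems that by auto
 show ?case
  by (rule Ck_fun_SucI[OF has_derivative_mult[OF Ck_fun_deriv[OF Suc.prems(1)] Ck_fun_deriv[OF Suc.prems(2)]]])
   (intro Ck_fun_add Suc.IH f g df)
qed

lemma Ck_fun_inner: "Ck_fun k (\<lambda>x. x \<bullet> c)"
proof (cases k)
 case 0
 have "continuous_on UNIV (\<lambda>x. x \<bullet> c)"
  by (intro continuous_on_inner continuous_on_id continuous_on_const)
 then show ?thesis unfolding 0 Ck_fun.simps .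
next
 case (Suc n)
 have "((\<lambda>x. x \<bullet> c) has_derivative (\<lambda>h. h \<bullet> c)) (at x)" for x
  by (rule bounded_linear_imp_has_derivative[OF bounded_linear_inner_left])
 then have "Ck_fun (Suc n) (\<lambda>x. x \<bullet> c)"
  by (rule Ck_fun_SucI) (rule Ck_fun_const)
 then show ?thesis unfolding Suc .
qed

lemma Ck_fun_affine:
 "Ck_fun k f ==> Ck_fun k (\<lambda>x. c * f (a + t *\<^sub>R x))"
proof (induction k arbitrary: f c)
 case 0
 have "continuous_on UNIV (\<lambda>x. a + t *\<^sub>R x)" by (intro continuous_intros)
 with 0 have "continuous_on UNIV (\<lambda>x. f (a + t *\<^sub>R x))"
  using continuous_on_compose2[of UNIV f UNIV "\<lambda>x. a + t *\<^sub>R x"] by simp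
 then show ?case by (simp add: continuous_on_mult_left)
next
 case (Suc k)
 have lin: "linear (frechet_derivative f (at x))" for x
  by (rule has_derivative_linear[OF Ck_fun_deriv[OF Suc.prems]])
 have "((\<lambda>x. c * f (a + t *\<^sub>R x)) has_derivative
   (\<lambda>h. c * frechet_derivative f (at (a + t *\<^sub>R x)) (t *\<^sub>R h))) (at x)" for x
 proof -
  have "((\<lambda>x. a + t *\<^sub>R x) has_derivative (\<lambda>h. t *\<^sub>R h)) (at x)"
   by (auto intro!: derivative_eq_intros)
  then have "((\<lambda>x. f (a + t *\<^sub>R x)) has_derivative
   (\<lambda>h. frechet_derivative f (at (a + t *\<^sub>R x)) (t *\<^sub>R h))) (at x)"
   by (rule has_derivative_compose[OF _ Ck_fun_deriv[OF Suc.prems]])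
  then show ?thesis by (rule has_derivative_mult_right)
 qed
 moreover have "Ck_fun k (\<lambda>x. c * frechet_derivative f (at (a + t *\<^sub>R x)) (t *\<^sub>R b))" if "b \<in> Basis" for b
 proof -
  have "Ck_fun k (\<lambda>x. (c * t) * frechet_derivative f (at (a + t *\<^sub>R x)) b)"
   by (rule Suc.IH) (use Suc.prems that in auto)
  moreover have "c * frechet_derivative f (at (a + t *\<^sub>R x)) (t *\<^sub>R b) =
    (c * t) * frechet_derivative f (at (a + t *\<^sub>R x)) b" for x
   using linear_cmul[OF lin] by simp
  ultimately show ?thesis by (simp only:)
 qed
 ultimately show ?case by (rule Ck_fun_SucI)
qed

definition exp_inv :: "nat => real => real" where
 "exp_inv n t = (if t > 0 then exp (- (1 / t)) / t ^ n else 0)"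

lemma exp_inv_tendsto_0: "((\<lambda>t. exp (- (1 / t)) / t ^ n) \<longlongrightarrow> 0) (at_right (0::real))"
proof -
 have "((\<lambda>x::real. x ^ n / exp x) \<longlongrightarrow> 0) at_top"
  by (rule tendsto_power_div_exp_0)
 then have "((\<lambda>t::real. inverse t ^ n / exp (inverse t)) \<longlongrightarrow> 0) (at_right 0)"
  by (rule filterlim_compose[OF _ filterlim_inverse_at_top_right])
 then show ?thesis
  by (simp add: exp_minus divide_simps power_inverse mult.commute)
qed

lemma exp_inv_deriv:
 "(exp_inv n has_real_derivative (exp_inv (n + 2) t - n * exp_inv (n + 1) t)) (at t)"
proof (cases t "0::real" rule: linorder_cases)
 case less
 have "((\<lambda>t. 0) has_real_derivative 0) (at t)" by simp
 then have "(exp_inv n has_real_derivative 0) (at t)"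
  by (rule DERIV_cong_ev[THEN iffD1, rotated -1])
   (use less in \<open>auto simp: exp_inv_def intro!: eventually_nhds_in_open[of "{..<0}", THEN eventually_mono]\<close>)
 then show ?thesis using less by (simp add: exp_inv_def)
next
 case equal
 have "((\<lambda>h. exp_inv n h / h) \<longlongrightarrow> 0) (at 0)"
 proof (rule filterlim_split_at)
  have "eventually (\<lambda>h. exp_inv n h / h = 0) (at_left (0::real))"
   by (rule eventually_mono[OF eventually_at_left_real[of "-1" "0::real"]]) (auto simp: exp_inv_def)
  then show "((\<lambda>h. exp_inv n h / h) \<longlongrightarrow> 0) (at_left 0)"
   by (rule tendsto_eventually)
  have ev: "eventually (\<lambda>h. exp (- (1 / h)) / h ^ (n+1) = exp_inv n h / h) (at_right (0::real))"
   by (rule eventually_mono[OF eventually_at_right_real[of "0::real" 1]]) (auto simp: exp_inv_def)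
  show "((\<lambda>h. exp_inv n h / h) \<longlongrightarrow> 0) (at_right 0)"
   using exp_inv_tendsto_0[of "n+1"] tendsto_cong[OF ev] by blast
 qed
 then show ?thesis using equal by (simp add: has_field_derivative_iff exp_inv_def)
next
 case greater
 have "((\<lambda>t. exp (- (1 / t)) / t ^ n) has_real_derivative
   ((exp (- (1 / t)) * (1 / t^2)) * t ^ n - exp (- (1 / t)) * (n * t ^ (n - 1))) / (t ^ n * t ^ n)) (at t)"
  using greater by (auto intro!: derivative_eq_intros simp: power2_eq_square divide_simps)
 moreover have "((exp (- (1 / t)) * (1 / t^2)) * t ^ n - exp (- (1 / t)) * (n * t ^ (n - 1))) / (t ^ n * t ^ n)
   = exp_inv (n + 2) t - n * exp_inv (n + 1) t"
  using greater
  by (cases n) (auto simp: exp_inv_def divide_simps power2_eq_square algebra_simps)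
 ultimately have "((\<lambda>t. exp (- (1 / t)) / t ^ n) has_real_derivative
   exp_inv (n + 2) t - n * exp_inv (n + 1) t) (at t)" by simp
 then show ?thesis
  by (rule DERIV_cong_ev[THEN iffD1, rotated -1])
   (use greater in \<open>auto simp: exp_inv_def intro!: eventually_nhds_in_open[of "{0<..}", THEN eventually_mono]\<close>)
qed

lemma Ck_fun_exp_inv: "Ck_fun k (\<lambda>x::'a::euclidean_space. exp_inv n (1 - x \<bullet> x))"
proof (induction k arbitrary: n)
 case 0
 have "continuous_on UNIV (exp_inv n)"
  by (meson DERIV_isCont continuous_at_imp_continuous_on exp_inv_deriv)
 then have "continuous_on UNIV (\<lambda>x::'a. exp_inv n (1 - x \<bullet> x))"
  by (rule continuous_on_compose2) (auto intro!: continuous_intros)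
 then show ?case by simp
next
 case (Suc k)
 let ?D = "\<lambda>x::'a. exp_inv (n + 2) (1 - x \<bullet> x) + (- real n) * exp_inv (n + 1) (1 - x \<bullet> x)"
 show ?case
 proof (rule Ck_fun_SucI)
  fix x :: 'a
  have *: "((\<lambda>x::'a. 1 - x \<bullet> x) has_derivative (\<lambda>h. - 2 * (h \<bullet> x))) (at x)"
   by (auto intro!: derivative_eq_intros simp: inner_commute)
  show "((\<lambda>x. exp_inv n (1 - x \<bullet> x)) has_derivative (\<lambda>h. ?D x * (- 2 * (x \<bullet> h)))) (at x)"
   using has_derivative_compose[OF * exp_inv_deriv[of n, unfolded has_field_derivative_def]]
   by (simp add: inner_commute)
 next
  fix b :: 'a
  show "Ck_fun k (\<lambda>x. ?D x * (- 2 * (x \<bullet> b)))"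
   by (intro Ck_fun_mult Ck_fun_add Ck_fun_const Ck_fun_inner Suc)
 qed
qed

definition bump :: "'a::euclidean_space => real" where
 "bump x = exp_inv 0 (1 - x \<bullet> x)"

lemma bump_smooth: "Ck_fun k bump"
 using Ck_fun_exp_inv[of k 0] by (simp add: bump_def[abs_def])

lemma bump_nonneg: "0 <= bump x"
 by (simp add: bump_def exp_inv_def)

lemma bump_eq_0: "norm x >= 1 ==> bump x = 0"
proof -
 assume "norm x >= 1"
 then have "x \<bullet> x >= 1" by (simp add: dot_square_norm)
 then show "bump x = 0" by (simp add: bump_def exp_inv_def)
qed

lemma bump_pos: "norm x < 1 ==> bump x > 0"
 by (simp add: bump_def exp_inv_def dot_square_norm power_less_one_iff)

lemma bump_cont: "continuous_on UNIV bump"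
 using bump_smooth[of 0] by simp

lemma integrable_cont_compact_support:
 fixes f :: "'a::euclidean_space => 'b::euclidean_space"
 assumes "continuous_on UNIV f" "compact S" "\<And>x. x \<notin> S ==> f x = 0"
 shows "integrable lborel f"
proof -
 have "set_integrable lborel S f"
  using borel_integrable_compact[OF assms(2), of f] assms(1) continuous_on_subset
  by (auto simp: set_integrable_def)
 moreover have "indicator S x *\<^sub>R f x = f x" for x using assms(3)[of x] by (auto simp: indicator_def)
 ultimately show ?thesis by (simp add: set_integrable_def)
qed

lemma bump_integrable: "integrable lborel (bump :: 'a::euclidean_space => real)"
 by (rule integrable_cont_compact_support[OF bump_cont, of "cball 0 1"]) (auto simp: bump_eq_0)

lemma bump_integral_pos: "integral\<^sup>L lborel (bump :: 'a::euclidean_space => real) > 0"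
proof -
 have "integral\<^sup>L lborel (bump :: 'a => real) \<noteq> 0"
 proof
  assume "(integral\<^sup>L lborel (bump :: 'a => real)) = 0"
  then have "AE x::'a in lborel. bump x = 0"
   using integral_nonneg_eq_0_iff_AE[OF bump_integrable] bump_nonneg by auto
  then have "AE x::'a in lborel. x \<notin> ball 0 1"
  proof eventually_elim
   case (elim x)
   then show ?case using bump_pos[of x] by auto
  qed
  then have "emeasure lborel (ball (0::'a) 1) = 0"
   by (subst (asm) AE_iff_measurable[where N = "ball 0 1"]) auto
  then show False using emeasure_lborel_ball_finite content_ball_pos[of 1 "0::'a"]
   by (simp add: measure_def)
 qed
 moreover have "integral\<^sup>L lborel (bump :: 'a => real) >= 0"
  by (rule integral_nonneg_AE) (auto simp: bump_nonneg)
 ultimately show ?thesis by linarith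
qed

definition molly :: "'a::euclidean_space => real" where
 "molly x = bump x / (integral\<^sup>L lborel (bump :: 'a => real))"

lemma molly_smooth: "Ck_fun k (molly :: 'a::euclidean_space => real)"
 using Ck_fun_mult[OF bump_smooth[where 'a='a] Ck_fun_const[of k "1 / integral\<^sup>L lborel (bump :: 'a => real)"]]
 by (simp only: molly_def[abs_def] times_divide_eq_right mult_1_right)

lemma molly_nonneg: "0 <= molly x"
 unfolding molly_def by (intro divide_nonneg_nonneg bump_nonneg less_imp_le[OF bump_integral_pos])

lemma molly_eq_0: "norm x >= 1 ==> molly x = 0"
 by (simp add: molly_def bump_eq_0)

lemma molly_cont: "continuous_on UNIV molly"
 using molly_smooth[of 0] by simp

lemma molly_integrable: "integrable lborel (molly :: 'a::euclidean_space => real)"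
 unfolding molly_def[abs_def] by (rule integrable_divide[OF bump_integrable])

lemma molly_integral: "integral\<^sup>L lborel (molly :: 'a::euclidean_space => real) = 1"
 using bump_integral_pos[where 'a='a] by (simp add: molly_def[abs_def])

subsection \<open>Mollification\<close>

lemma nn_integral_lborel_affine:
 fixes f :: "'a::euclidean_space => ennreal"
 assumes [measurable]: "f \<in> borel_measurable borel" and c: "c \<noteq> 0"
 shows "(LBNN x. f x) = ennreal (\<bar>c\<bar> ^ DIM('a)) * (LBNN x. f (t + c *\<^sub>R x))"
 by (subst lborel_affine[OF c, of t])
   (simp add: nn_integral_density nn_integral_distr nn_integral_cmult)

lemma integrable_lborel_affine:
 fixes f :: "'a::euclidean_space => 'b::{banach, second_countable_topology}"
 assumes f: "integrable lborel f" and c: "c \<noteq> 0"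
 shows "integrable lborel (\<lambda>x. f (t + c *\<^sub>R x))"
proof -
 have [measurable]: "f \<in> borel_measurable borel" using f by auto
 have "(LBNN x. norm (f x)) < \<infinity>" using f by (simp add: integrable_iff_bounded)
 then have "ennreal (\<bar>c\<bar> ^ DIM('a)) * (LBNN x. norm (f (t + c *\<^sub>R x))) < \<infinity>"
  using nn_integral_lborel_affine[of "\<lambda>x. ennreal (norm (f x))" c t] c by simp
 then have "(LBNN x. norm (f (t + c *\<^sub>R x))) < \<infinity>"
  using c by (auto simp: ennreal_mult_less_top)
 then show ?thesis by (simp add: integrable_iff_bounded)
qed

lemma integral_lborel_affine:
 fixes f :: "'a::euclidean_space => 'b::{banach, second_countable_topology}"
 assumes [measurable]: "f \<in> borel_measurable borel" and c: "c \<noteq> 0"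
 shows "(LBINT x. f x) = (\<bar>c\<bar> ^ DIM('a)) *\<^sub>R (LBINT x. f (t + c *\<^sub>R x))"
 by (subst lborel_affine[OF c, of t]) (simp add: integral_density integral_distr)

lemma integrable_bounded_compact_support:
 fixes f :: "'a::euclidean_space => 'b::{banach, second_countable_topology}"
 assumes [measurable]: "f \<in> borel_measurable borel"
  and "\<And>y. norm (f y) <= M" "\<And>y. y \<notin> cball x r ==> f y = 0"
 shows "integrable lborel f"
proof (rule Bochner_Integration.integrable_bound)
 show "integrable lborel (\<lambda>y. M * indicat_real (cball x r) y)"
  using emeasure_lborel_cball_finite[of x r] by (intro integrable_mult_right) (simp add: less_top)
 show "AE y in lborel. norm (f y) <= norm (M * indicat_real (cball x r) y)"
 proof (intro AE_I2)
  fix y show "norm (f y) <= norm (M * indicat_real (cball x r) y)"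
   using assms(2,3)[of y] by (cases "y \<in> cball x r") (auto simp: indicator_def)
 qed
qed simp

definition C1g :: "('a::euclidean_space => real) => ('a => 'a) => bool" where
 "C1g f G \<longleftrightarrow> (\<forall>x. (f has_derivative (\<lambda>h. G x \<bullet> h)) (at x)) \<and> continuous_on UNIV G"

lemma C1g_D: "C1g f G ==> (f has_derivative (\<lambda>h. G x \<bullet> h)) (at x)"
 by (simp add: C1g_def)

lemma C1g_cont: "C1g f G ==> continuous_on UNIV f" "C1g f G ==> continuous_on UNIV G"
 by (auto simp: C1g_def intro!: continuous_at_imp_continuous_on has_derivative_continuous)

lemma C1g_borel: "C1g f G ==> f \<in> borel_measurable borel" "C1g f G ==> G \<in> borel_measurable borel"
 by (auto dest: C1g_cont intro: borel_measurable_continuous_onI)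

lemma C1g_frechet: "C1g f G ==> frechet_derivative f (at x) = (\<lambda>h. G x \<bullet> h)"
 using C1g_D frechet_derivative_at by metis

lemma cgrad_inner:
 assumes "f differentiable at x"
 shows "cgrad f x \<bullet> h = frechet_derivative f (at x) h"
proof -
 have lin: "linear (frechet_derivative f (at x))"
  using assms frechet_derivative_works has_derivative_linear by blast
 have "frechet_derivative f (at x) h = frechet_derivative f (at x) (\<Sum>b\<in>Basis. (h \<bullet> b) *\<^sub>R b)"
  by (simp add: euclidean_representation)
 also have "\<dots> = (\<Sum>b\<in>Basis. (h \<bullet> b) * frechet_derivative f (at x) b)"
  by (simp add: linear_sum[OF lin] linear_cmul[OF lin])
 also have "\<dots> = cgrad f x \<bullet> h"
  unfolding cgrad_def inner_sum_left by (rule sum.cong) (auto simp: inner_commute)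
 finally show ?thesis ..
qed

lemma Ck_fun_imp_C1g:
 assumes "Ck_fun (Suc k) f" shows "C1g f (cgrad f)"
proof -
 have d: "f differentiable at x" for x
  using assms by (auto simp: differentiable_on_def)
 have "(f has_derivative (\<lambda>h. cgrad f x \<bullet> h)) (at x)" for x
  using d[of x] by (simp add: cgrad_inner frechet_derivative_works[symmetric])
 moreover have "continuous_on UNIV (cgrad f)"
 proof -
  have "Ck_fun 0 (\<lambda>x. frechet_derivative f (at x) b)" if "b \<in> Basis" for b
  proof -
   have "Ck_fun k (\<lambda>x. frechet_derivative f (at x) b)" using assms that by simp
   then show ?thesis by (induction k) (auto dest: Ck_fun_Suc_D simp del: Ck_fun.simps)
  qed
  then show ?thesis unfolding cgrad_def[abs_def]
   by (intro continuous_on_sum continuous_on_scaleR continuous_on_const) auto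
 qed
 ultimately show ?thesis by (simp add: C1g_def)
qed

lemma C1g_supp:
 assumes "C1g f G" "\<And>x. norm x > r ==> f x = 0" "norm x > r"
 shows "G x = 0"
proof -
 have "open {x::'a. norm x > r}" by (intro open_Collect_less continuous_intros)
 then have "((\<lambda>_. 0) has_derivative (\<lambda>h. G x \<bullet> h)) (at x)"
  by (intro has_derivative_transform_within_open[OF C1g_D[OF assms(1)], of "{x. norm x > r}"])
   (use assms in auto)
 then have "(\<lambda>h. G x \<bullet> h) = (\<lambda>h. 0)"
  using has_derivative_unique[OF _ has_derivative_const] by blast
 then show ?thesis by (metis inner_eq_zero_iff)
qed

lemma unif_cont_compact_support:
 fixes G :: "'a::euclidean_space => 'b::real_normed_vector"
 assumes "continuous_on UNIV G" "\<And>x. norm x > r ==> G x = 0" "e > 0"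
 obtains d where "d > 0" "\<And>x y. dist x y < d ==> dist (G x) (G y) < e"
proof -
 have "uniformly_continuous_on (cball 0 (r+1)) G"
  by (intro compact_uniformly_continuous continuous_on_subset[OF assms(1)]) auto
 then obtain d where d: "d > 0" "\<And>x y. x \<in> cball 0 (r+1) ==> y \<in> cball 0 (r+1) ==> dist x y < d ==> dist (G x) (G y) < e"
  unfolding uniformly_continuous_on_def using assms(3) by (metis dist_commute)
 show ?thesis
 proof (rule that[of "min d 1"])
  fix x y :: 'a assume xy: "dist x y < min d 1"
  show "dist (G x) (G y) < e"
  proof (cases "norm x <= r + 1 \<and> norm y <= r + 1")
   case True
   then show ?thesis using d(2)[of x y] xy by auto
  next
   case False
   have "norm x <= norm y + dist x y" "norm y <= norm x + dist x y"
    by (metis add.commute dist_norm norm_triangle_sub, metis dist_commute dist_norm norm_triangle_sub)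
   then have "norm x > r" "norm y > r" using False xy by auto
   then show ?thesis using assms by simp
  qed
 qed (use d in auto)
qed

lemma mvt_grad:
 assumes "C1g f G"
 obtains t where "0 < t" "t < 1" "f (z + h) - f z = G (z + t *\<^sub>R h) \<bullet> h"
proof -
 have D: "((\<lambda>t. f (z + t *\<^sub>R h)) has_real_derivative G (z + t *\<^sub>R h) \<bullet> h) (at t)" for t
 proof -
  have "((\<lambda>t. z + t *\<^sub>R h) has_derivative (\<lambda>s. s *\<^sub>R h)) (at t)"
   by (auto intro!: derivative_eq_intros)
  from has_derivative_compose[OF this C1g_D[OF assms]]
  have "((\<lambda>t. f (z + t *\<^sub>R h)) has_derivative (\<lambda>s. G (z + t *\<^sub>R h) \<bullet> (s *\<^sub>R h))) (at t)" .
  moreover have "(\<lambda>s. G (z + t *\<^sub>R h) \<bullet> (s *\<^sub>R h)) = (*) (G (z + t *\<^sub>R h) \<bullet> h)"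
   by (auto simp: fun_eq_iff)
  ultimately show ?thesis by (simp only: has_field_derivative_def)
 qed
 obtain t where "0 < t" "t < 1" "f (z + 1 *\<^sub>R h) - f (z + 0 *\<^sub>R h) = (1 - 0) * (G (z + t *\<^sub>R h) \<bullet> h)"
  using MVT2[of 0 1 "\<lambda>t. f (z + t *\<^sub>R h)" "\<lambda>t. G (z + t *\<^sub>R h) \<bullet> h"] D by auto
 then show ?thesis using that by auto
qed

lemma C1_conv:
 fixes f \<psi> :: "'a::euclidean_space => real"
 assumes \<psi>: "C1g \<psi> G" and supp: "\<And>x. norm x > r ==> \<psi> x = 0"
  and [measurable]: "f \<in> borel_measurable borel" and M: "\<And>y. \<bar>f y\<bar> <= M"
 shows "C1g (\<lambda>x. LBINT y. \<psi> (x - y) * f y) (\<lambda>x. LBINT y. f y *\<^sub>R G (x - y))"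
proof -
 have G0: "G x = 0" if "norm x > r" for x
  by (rule C1g_supp[OF \<psi>, of r]) (use supp that in auto)
 have [measurable]: "\<psi> \<in> borel_measurable borel" "G \<in> borel_measurable borel"
  using C1g_borel[OF \<psi>] by auto
 have "M >= 0" using M[of 0] by linarith
 have bdd: "\<exists>B. \<forall>x. norm (H x) <= B" if "continuous_on UNIV H" "\<And>x. norm x > r ==> H x = 0"
  for H :: "'a => 'c::real_normed_vector"
 proof -
  have "compact (H ` cball 0 r)"
   by (intro compact_continuous_image continuous_on_subset[OF that(1)]) auto
  then obtain B where B: "\<And>x. x \<in> cball 0 r ==> norm (H x) <= B"
   using compact_imp_bounded bounded_iff by (metis imageI)
  have "norm (H x) <= max B 0" for x
   using B[of x] that(2)[of x] by (cases "norm x > r") auto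
  then show ?thesis by blast
 qed
 obtain B1 where B1: "\<And>x. \<bar>\<psi> x\<bar> <= B1" using bdd[of \<psi>] C1g_cont[OF \<psi>] supp by auto
 obtain B2 where B2: "\<And>x. norm (G x) <= B2" using bdd[of G] C1g_cont[OF \<psi>] G0 by auto
 have i1: "integrable lborel (\<lambda>y. \<psi> (x - y) * f y)" for x
 proof (rule integrable_bounded_compact_support[of _ "B1 * M" x r])
  show "norm (\<psi> (x - y) * f y) <= B1 * M" for y
   using B1[of "x-y"] M[of y] by (auto simp: abs_mult intro!: mult_mono)
  show "\<psi> (x - y) * f y = 0" if "y \<notin> cball x r" for y
   using supp[of "x-y"] that by (auto simp: dist_norm)
 qed auto
 have i2: "integrable lborel (\<lambda>y. f y *\<^sub>R G (x - y))" for x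
 proof (rule integrable_bounded_compact_support[of _ "M * B2" x r])
  show "norm (f y *\<^sub>R G (x - y)) <= M * B2" for y
   using B2[of "x-y"] M[of y] \<open>M >= 0\<close> by (auto intro!: mult_mono)
  show "f y *\<^sub>R G (x - y) = 0" if "y \<notin> cball x r" for y
   using G0[of "x-y"] that by (auto simp: dist_norm)
 qed auto
 define V where "V = measure lborel (cball (0::'a) (r+1))"
 have V: "measure lborel (cball x (r+1)) = V" for x :: 'a
  unfolding V_def by (cases "r + 1 >= 0") (auto simp: content_cball)
 have V0: "V >= 0" by (simp add: V_def)
 have est: "norm (LBINT y. H y) <= e * V"
  if [measurable]: "H \<in> borel_measurable borel" and "\<And>y. norm (H y) <= e" "\<And>y. y \<notin> cball x (r+1) ==> H y = 0"
  for H :: "'a => 'c::euclidean_space" and e x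
 proof -
  have "integrable lborel H" by (rule integrable_bounded_compact_support) (use that in auto)
  moreover have "integrable lborel (\<lambda>y. e * indicat_real (cball x (r+1)) y)"
   using emeasure_lborel_cball_finite[of x "r+1"] by (intro integrable_mult_right) (simp add: less_top)
  moreover have "norm (H y) <= e * indicat_real (cball x (r+1)) y" for y
   using that(2,3)[of y] by (cases "y \<in> cball x (r+1)") auto
  ultimately have "norm (LBINT y. H y) <= (LBINT y. e * indicat_real (cball x (r+1)) y)"
   by (rule Bochner_Integration.integral_norm_bound_integral)
  then show ?thesis using V by simp
 qed
 have out: "x' - y \<notin> cball 0 r" if "y \<notin> cball x (r+1)" "dist x' x < 1" for x x' y :: 'a
  using that dist_triangle[of x y x'] by (auto simp: dist_norm norm_minus_commute)
 have D: "((\<lambda>x. LBINT y. \<psi> (x - y) * f y) has_derivative (\<lambda>h. (LBINT y. f y *\<^sub>R G (x - y)) \<bullet> h)) (at x)" for x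
  unfolding has_derivative_at_alt
 proof (intro conjI allI impI)
  show "bounded_linear (\<lambda>h. (LBINT y. f y *\<^sub>R G (x - y)) \<bullet> h)" by (rule bounded_linear_inner_right)
  fix e :: real assume e: "e > 0"
  have "0 < e / (M * V + 1)" using e \<open>M >= 0\<close> V0 by (intro divide_pos_pos) (auto simp: add_nonneg_pos)
  then obtain d where d: "d > 0" "\<And>x y. dist x y < d ==> dist (G x) (G y) < e / (M * V + 1)"
   using unif_cont_compact_support[OF C1g_cont(2)[OF \<psi>] G0] by metis
  show "\<exists>d>0. \<forall>x'. norm (x' - x) < d --> norm ((LBINT y. \<psi> (x' - y) * f y) - (LBINT y. \<psi> (x - y) * f y)
    - (LBINT y. f y *\<^sub>R G (x - y)) \<bullet> (x' - x)) <= e * norm (x' - x)"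
  proof (intro exI conjI allI impI)
   show "min d 1 > 0" using d by auto
   fix x' assume x': "norm (x' - x) < min d 1"
   define H where "H y = (\<psi> (x' - y) - \<psi> (x - y) - G (x - y) \<bullet> (x' - x)) * f y" for y
   have "(LBINT y. \<psi> (x' - y) * f y) - (LBINT y. \<psi> (x - y) * f y)
    - (LBINT y. f y *\<^sub>R G (x - y)) \<bullet> (x' - x) = (LBINT y. H y)"
   proof -
    have i3: "integrable lborel (\<lambda>y. (f y *\<^sub>R G (x - y)) \<bullet> (x' - x))"
     by (rule integrable_inner_left) (rule i2)
    have "H = (\<lambda>y. \<psi> (x' - y) * f y - \<psi> (x - y) * f y - (f y *\<^sub>R G (x - y)) \<bullet> (x' - x))"
     by (auto simp: H_def fun_eq_iff algebra_simps)
    then have "(LBINT y. H y) = (LBINT y. \<psi> (x' - y) * f y - \<psi> (x - y) * f y)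
      - (LBINT y. (f y *\<^sub>R G (x - y)) \<bullet> (x' - x))"
     using i1 i3 by (simp only: Bochner_Integration.integral_diff Bochner_Integration.integrable_diff)
    moreover have "(LBINT y. (f y *\<^sub>R G (x - y)) \<bullet> (x' - x)) = (LBINT y. f y *\<^sub>R G (x - y)) \<bullet> (x' - x)"
     by (rule integral_inner_left) (rule i2)
    ultimately show ?thesis using i1 by (simp only: Bochner_Integration.integral_diff)
   qed
   moreover have "norm (LBINT y. H y) <= (e / (M * V + 1) * norm (x' - x) * M) * V"
   proof (rule est[of H _ x])
    show "H \<in> borel_measurable borel" unfolding H_def by measurable
    show "norm (H y) <= e / (M * V + 1) * norm (x' - x) * M" for y
    proof -
     obtain t where t: "0 < t" "t < 1"
      "\<psi> ((x - y) + (x' - x)) - \<psi> (x - y) = G ((x - y) + t *\<^sub>R (x' - x)) \<bullet> (x' - x)"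
      using mvt_grad[OF \<psi>] by metis
     have "t * norm (x' - x) <= 1 * norm (x' - x)" using t by (intro mult_right_mono) auto
     then have "dist ((x - y) + t *\<^sub>R (x' - x)) (x - y) < d" using t x' by (auto simp: dist_norm)
     then have "norm (G ((x - y) + t *\<^sub>R (x' - x)) - G (x - y)) <= e / (M * V + 1)"
      using d(2) by (force simp: dist_norm less_imp_le)
     then have "\<bar>(G ((x - y) + t *\<^sub>R (x' - x)) - G (x - y)) \<bullet> (x' - x)\<bar> <= e / (M * V + 1) * norm (x' - x)"
      by (meson Cauchy_Schwarz_ineq2 mult_right_mono norm_ge_zero order_trans)
     moreover have "\<psi> (x' - y) - \<psi> (x - y) - G (x - y) \<bullet> (x' - x) = (G ((x - y) + t *\<^sub>R (x' - x)) - G (x - y)) \<bullet> (x' - x)"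
      using t(3) by (simp add: algebra_simps)
     ultimately have "\<bar>\<psi> (x' - y) - \<psi> (x - y) - G (x - y) \<bullet> (x' - x)\<bar> <= e / (M * V + 1) * norm (x' - x)"
      by simp
     then have "\<bar>\<psi> (x' - y) - \<psi> (x - y) - G (x - y) \<bullet> (x' - x)\<bar> * \<bar>f y\<bar> <= e / (M * V + 1) * norm (x' - x) * M"
      by (rule mult_mono[OF _ M]) (use e \<open>M >= 0\<close> V0 in auto)
     then show ?thesis by (simp only: H_def real_norm_def abs_mult)
    qed
    show "H y = 0" if "y \<notin> cball x (r+1)" for y
     using out[OF that, of x'] out[OF that, of x] x' supp[of "x'-y"] supp[of "x-y"] G0[of "x-y"]
     by (auto simp: H_def dist_norm norm_minus_commute)
   qed
   moreover have "(e / (M * V + 1) * norm (x' - x) * M) * V <= e * norm (x' - x)"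
   proof -
    have "M * V / (M * V + 1) <= 1" using mult_nonneg_nonneg[OF \<open>M >= 0\<close> V0] by simp
    then have "(e * norm (x' - x)) * (M * V / (M * V + 1)) <= (e * norm (x' - x)) * 1"
     using e by (intro mult_left_mono) auto
    then show ?thesis by (simp add: mult_ac)
   qed
   ultimately show "norm ((LBINT y. \<psi> (x' - y) * f y) - (LBINT y. \<psi> (x - y) * f y)
    - (LBINT y. f y *\<^sub>R G (x - y)) \<bullet> (x' - x)) <= e * norm (x' - x)" by simp
  qed
 qed
 have cont: "continuous_on UNIV (\<lambda>x. LBINT y. f y *\<^sub>R G (x - y))"
  unfolding continuous_on_iff
 proof (intro ballI allI impI)
  fix x :: 'a and e :: real assume e: "e > 0"
  have e': "0 < e / (M * V + 1)" using e \<open>M >= 0\<close> V0 by (intro divide_pos_pos) (auto simp: add_nonneg_pos)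
  then obtain d where d: "d > 0" "\<And>x y. dist x y < d ==> dist (G x) (G y) < e / (M * V + 1)"
   using unif_cont_compact_support[OF C1g_cont(2)[OF \<psi>] G0] by metis
  show "\<exists>d>0. \<forall>x'\<in>UNIV. dist x' x < d --> dist (LBINT y. f y *\<^sub>R G (x' - y)) (LBINT y. f y *\<^sub>R G (x - y)) < e"
  proof (intro exI conjI ballI impI)
   show "min d 1 > 0" using d by auto
   fix x' :: 'a assume x': "dist x' x < min d 1"
   define H where "H y = f y *\<^sub>R (G (x' - y) - G (x - y))" for y
   have "(LBINT y. f y *\<^sub>R G (x' - y)) - (LBINT y. f y *\<^sub>R G (x - y)) = (LBINT y. H y)"
    unfolding H_def using i2[of x] i2[of x'] by (simp add: scaleR_diff_right)
   moreover have "norm (LBINT y. H y) <= (M * (e / (M * V + 1))) * V"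
   proof (rule est[of H _ x])
    show "H \<in> borel_measurable borel" unfolding H_def by measurable
    show "norm (H y) <= M * (e / (M * V + 1))" for y
    proof -
     have "norm (G (x' - y) - G (x - y)) <= e / (M * V + 1)"
      using d(2)[of "x'-y" "x-y"] x' by (simp add: dist_norm less_imp_le)
     then have "\<bar>f y\<bar> * norm (G (x' - y) - G (x - y)) <= M * (e / (M * V + 1))"
      using M[of y] \<open>M >= 0\<close> by (intro mult_mono) auto
     then show ?thesis by (simp only: H_def norm_scaleR)
    qed
    show "H y = 0" if "y \<notin> cball x (r+1)" for y
     using out[OF that, of x'] out[OF that, of x] x' G0[of "x'-y"] G0[of "x-y"]
     by (auto simp: H_def)
   qed
   moreover have "(M * (e / (M * V + 1))) * V < e"
   proof -
    have "M * V / (M * V + 1) < 1" using mult_nonneg_nonneg[OF \<open>M >= 0\<close> V0] by simp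
    then have "e * (M * V / (M * V + 1)) < e * 1"
     using e by (intro mult_strict_left_mono) auto
    then show ?thesis by (simp add: mult_ac)
   qed
   ultimately show "dist (LBINT y. f y *\<^sub>R G (x' - y)) (LBINT y. f y *\<^sub>R G (x - y)) < e"
    by (simp add: dist_norm)
  qed
 qed
 show ?thesis using D cont by (simp add: C1g_def)
qed

lemma Ck_conv:
 fixes f \<psi> :: "'a::euclidean_space => real"
 assumes "\<And>k. Ck_fun k \<psi>" and "\<And>x. norm x > r ==> \<psi> x = 0"
  and "f \<in> borel_measurable borel" and "\<And>y. \<bar>f y\<bar> <= M"
 shows "Ck_fun k (\<lambda>x. LBINT y. \<psi> (x - y) * f y)"
 using assms(1,2)
proof (induction k arbitrary: \<psi>)
 case 0
 show ?case using C1g_cont(1)[OF C1_conv[OF Ck_fun_imp_C1g[OF 0(1)] 0(2) assms(3,4)]] by simp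
next
 case (Suc k)
 note C = Ck_fun_imp_C1g[OF Suc.prems(1)]
 note C1 = C1_conv[OF C Suc.prems(2) assms(3,4)]
 have G0: "cgrad \<psi> x = 0" if "norm x > r" for x
  by (rule C1g_supp[OF C, of r]) (use Suc.prems(2) that in auto)
 have d: "\<psi> differentiable at x" for x
  using Suc.prems(1)[of "Suc 0"] by (auto simp: differentiable_on_def)
 show ?case
 proof (rule Ck_fun_SucI[OF C1g_D[OF C1]])
  fix b :: 'a assume b: "b \<in> Basis"
  let ?p = "\<lambda>x. frechet_derivative \<psi> (at x) b"
  have p: "?p x = cgrad \<psi> x \<bullet> b" for x using cgrad_inner[OF d] by simp
  have "Ck_fun k (\<lambda>x. LBINT y. ?p (x - y) * f y)"
  proof (rule Suc.IH)
   show "Ck_fun j ?p" for j using Suc.prems(1)[of "Suc j"] b by simp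
   show "?p x = 0" if "norm x > r" for x
    using G0[OF that] by (simp add: p)
  qed
  moreover have "(LBINT y. f y *\<^sub>R cgrad \<psi> (x - y)) \<bullet> b = (LBINT y. ?p (x - y) * f y)" for x
  proof -
   have "(LBINT y. (f y *\<^sub>R cgrad \<psi> (x - y)) \<bullet> b) = (LBINT y. ?p (x - y) * f y)"
    by (simp add: p mult.commute)
   moreover have "(LBINT y. (f y *\<^sub>R cgrad \<psi> (x - y)) \<bullet> b) = (LBINT y. f y *\<^sub>R cgrad \<psi> (x - y)) \<bullet> b"
   proof (rule integral_inner_left)
    have "compact (cgrad \<psi> ` cball 0 r)"
     by (intro compact_continuous_image continuous_on_subset[OF C1g_cont(2)[OF C]]) auto
    then obtain B where B: "\<And>x. x \<in> cball 0 r ==> norm (cgrad \<psi> x) <= B"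
     using compact_imp_bounded bounded_iff by (metis imageI)
    have [measurable]: "cgrad \<psi> \<in> borel_measurable borel" "f \<in> borel_measurable borel"
     using C1g_borel[OF C] assms by auto
    have "M >= 0" using assms(4)[of 0] by linarith
    show "integrable lborel (\<lambda>y. f y *\<^sub>R cgrad \<psi> (x - y))"
    proof (rule integrable_bounded_compact_support[of _ "M * max B 0" x r])
     show "norm (f y *\<^sub>R cgrad \<psi> (x - y)) <= M * max B 0" for y
      using assms(4)[of y] \<open>M >= 0\<close> B[of "x-y"] G0[of "x-y"]
      by (cases "norm (x - y) > r") (auto intro!: mult_mono)
     show "f y *\<^sub>R cgrad \<psi> (x - y) = 0" if "y \<notin> cball x r" for y
      using G0[of "x-y"] that by (auto simp: dist_norm)
    qed measurable
   qed
   ultimately show ?thesis by simp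
  qed
  ultimately show "Ck_fun k (\<lambda>x. (LBINT y. f y *\<^sub>R cgrad \<psi> (x - y)) \<bullet> b)" by simp
 qed
qed

text \<open>Convolving with the constant function 1 gives a constant, whose gradient vanishes.\<close>
lemma integral_gradient_eq_0:
 fixes F :: "'a::euclidean_space => real"
 assumes F: "C1g F G" and supp: "\<And>x. norm x > r ==> F x = 0"
 shows "(LBINT x. G x) = 0"
proof -
 have [measurable]: "F \<in> borel_measurable borel" "G \<in> borel_measurable borel"
  using C1g_borel[OF F] by auto
 have "(LBINT y. F (x - y) * 1) = (LBINT y. F y)" for x
  using integral_lborel_affine[of F "-1" x] by simp
 moreover have "C1g (\<lambda>x. LBINT y. F (x - y) * 1) (\<lambda>x. LBINT y. 1 *\<^sub>R G (x - y))"
  by (rule C1_conv[OF F supp, of r "\<lambda>_. 1" 1]) auto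
 ultimately have "C1g (\<lambda>x. LBINT y. F y) (\<lambda>x. LBINT y. 1 *\<^sub>R G (x - y))"
  by (simp only:)
 from C1g_D[OF this, of 0]
 have "((\<lambda>x::'a. LBINT y. F y) has_derivative (\<lambda>h. (LBINT y. 1 *\<^sub>R G (0 - y)) \<bullet> h)) (at 0)" .
 then have "(\<lambda>h. (LBINT y. 1 *\<^sub>R G (0 - y)) \<bullet> h) = (\<lambda>h. 0)"
  using has_derivative_unique[OF _ has_derivative_const] by blast
 then have "(LBINT y. 1 *\<^sub>R G (0 - y)) = 0" by (metis inner_eq_zero_iff)
 then show ?thesis using integral_lborel_affine[of G "-1" 0] by simp
qed

definition moll :: "real => ('a::euclidean_space => 'b::euclidean_space) => 'a => 'b" where
 "moll e f x = (LBINT z. molly z *\<^sub>R f (x - e *\<^sub>R z))"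

lemma molly_borel [measurable]: "molly \<in> borel_measurable borel"
 by (rule borel_measurable_continuous_onI[OF molly_cont])

lemma molly_nn_integral: "(LBNN z. ennreal (molly (z::'a::euclidean_space))) = 1"
proof -
 have "(LBNN z. ennreal (molly (z::'a))) = ennreal (integral\<^sup>L lborel (molly :: 'a => real))"
  by (intro nn_integral_eq_integral molly_integrable AE_I2 molly_nonneg)
 then show ?thesis by (simp add: molly_integral)
qed

lemma molly_bounded: "\<exists>B>0. \<forall>x::'a::euclidean_space. molly x <= B"
proof -
 have "compact (molly ` cball (0::'a) 1)"
  by (intro compact_continuous_image continuous_on_subset[OF molly_cont]) auto
 then obtain B where B: "\<And>x::'a. x \<in> cball 0 1 ==> norm (molly x) <= B"
  using compact_imp_bounded bounded_iff by (metis imageI)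
 have "molly x <= max B 1" for x :: 'a
  using B[of x] molly_eq_0[of x] by (cases "norm x <= 1") auto
 then show ?thesis by (intro exI[of _ "max B 1"]) auto
qed

lemma moll_alt:
 fixes f :: "'a::euclidean_space => 'b::euclidean_space"
 assumes [measurable]: "f \<in> borel_measurable borel" and e: "e > 0"
 shows "moll e f x = (1 / e ^ DIM('a)) *\<^sub>R (LBINT y. molly ((1/e) *\<^sub>R (x - y)) *\<^sub>R f y)"
proof -
 have "(LBINT y. molly ((1/e) *\<^sub>R (x - y)) *\<^sub>R f y)
   = (\<bar>-e\<bar> ^ DIM('a)) *\<^sub>R (LBINT z. molly ((1/e) *\<^sub>R (x - (x + (-e) *\<^sub>R z))) *\<^sub>R f (x + (-e) *\<^sub>R z))"
  using e by (intro integral_lborel_affine) auto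
 then show ?thesis using e by (simp add: moll_def)
qed

lemma powr_tangent:
 assumes "1 <= p" "0 <= t" "0 < s"
 shows "s powr p + p * s powr (p - 1) * (t - s) <= (t::real) powr p"
proof -
 have "p * (t / s) - p + 1 <= (t / s) powr p"
 proof (cases "t = 0")
  case False
  then have "((t / s) powr p) powr (1/p) * 1 powr (1 - 1/p) <= (1/p) * (t/s) powr p + (1 - 1/p) * 1"
   using assms by (intro Youngs_inequality_0) auto
  then have "t / s <= (1/p) * (t/s) powr p + (1 - 1/p)"
   using assms by (simp add: powr_powr)
  then have "p * (t / s) <= p * ((1/p) * (t/s) powr p + (1 - 1/p))"
   using assms by (intro mult_left_mono) auto
  then show ?thesis using assms by (simp add: algebra_simps)
 qed (use assms in auto)
 then have "s powr p * (p * (t / s) - p + 1) <= s powr p * (t / s) powr p"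
  by (intro mult_left_mono) auto
 also have "\<dots> = t powr p" using assms by (simp add: powr_divide)
 finally show ?thesis using assms by (simp add: powr_diff field_simps)
qed

lemma powr_sum_le:
 assumes "1 <= p" "0 <= a" "0 <= b"
 shows "(a + b :: real) powr p <= 2 powr p * (a powr p + b powr p)"
proof -
 have "(a + b) powr p <= (2 * max a b) powr p" using assms by (intro powr_mono2) auto
 also have "\<dots> = 2 powr p * max a b powr p" using assms by (simp add: powr_mult)
 also have "\<dots> <= 2 powr p * (a powr p + b powr p)"
  by (intro mult_left_mono) (auto simp: max_def)
 finally show ?thesis .
qed

lemma moll_jensen:
 fixes f :: "'a::euclidean_space => 'b::euclidean_space"
 assumes [measurable]: "f \<in> borel_measurable borel" and p: "1 <= p"
 shows "ennreal (norm (moll e f x) powr p) <= (LBNN z. ennreal (molly z * norm (f (x - e *\<^sub>R z)) powr p))"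
proof (cases "moll e f x = 0 \<or> (LBNN z. ennreal (molly z * norm (f (x - e *\<^sub>R z)) powr p)) = \<infinity>")
 case True
 then show ?thesis by auto
next
 case False
 define s where "s = norm (moll e f x)"
 define t where "t z = norm (f (x - e *\<^sub>R z))" for z
 have [measurable]: "t \<in> borel_measurable borel" unfolding t_def by measurable
 have s: "s > 0" using False by (simp add: s_def)
 have i1: "integrable lborel (\<lambda>z. molly z *\<^sub>R f (x - e *\<^sub>R z))"
  using False not_integrable_integral_eq unfolding moll_def by blast
 have i2: "integrable lborel (\<lambda>z. molly z * t z)"
  using integrable_norm[OF i1] by (simp add: t_def molly_nonneg)
 have i3: "integrable lborel (\<lambda>z. molly z * t z powr p)"
  using False by (intro integrableI_bounded) (auto simp: t_def molly_nonneg less_top abs_mult)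
 have "s <= (LBINT z. norm (molly z *\<^sub>R f (x - e *\<^sub>R z)))"
  unfolding s_def moll_def by (rule integral_norm_bound)
 then have m: "s <= (LBINT z. molly z * t z)" by (simp add: t_def molly_nonneg)
 have "s powr p <= s powr p + p * s powr (p - 1) * ((LBINT z. molly z * t z) - s)"
  using m s p by auto
 also have "\<dots> = (LBINT z. (s powr p - p * s powr (p-1) * s) * molly z + p * s powr (p-1) * (molly z * t z))"
  using i2 molly_integrable[where 'a='a]
  by (simp only: Bochner_Integration.integral_add integrable_mult_right integral_mult_right_zero molly_integral)
   (simp add: algebra_simps)
 also have "\<dots> <= (LBINT z. molly z * t z powr p)"
 proof (rule integral_mono)
  show "integrable lborel (\<lambda>z. (s powr p - p * s powr (p-1) * s) * molly z + p * s powr (p-1) * (molly z * t z))"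
   using i2 molly_integrable[where 'a='a] by (intro Bochner_Integration.integrable_add integrable_mult_right)
  fix z :: 'a
  have "molly z * (s powr p + p * s powr (p - 1) * (t z - s)) <= molly z * t z powr p"
   using powr_tangent[OF p _ s, of "t z"] by (intro mult_left_mono molly_nonneg) (auto simp: t_def)
  then show "(s powr p - p * s powr (p-1) * s) * molly z + p * s powr (p-1) * (molly z * t z) <= molly z * t z powr p"
   by (simp add: algebra_simps)
 qed (rule i3)
 finally have "ennreal (s powr p) <= ennreal (LBINT z. molly z * t z powr p)" by (rule ennreal_leI)
 also have "\<dots> = (LBNN z. ennreal (molly z * t z powr p))"
  using i3 by (intro nn_integral_eq_integral[symmetric]) (auto simp: molly_nonneg)
 finally show ?thesis by (simp add: s_def t_def)
qed

lemma moll_borel [measurable]: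
 fixes f :: "'a::euclidean_space => 'b::euclidean_space"
 assumes [measurable]: "f \<in> borel_measurable borel"
 shows "moll e f \<in> borel_measurable borel"
proof -
 have "(\<lambda>x. LBINT z. molly z *\<^sub>R f (x - e *\<^sub>R z)) \<in> borel_measurable borel"
  by (rule lborel.borel_measurable_lebesgue_integral) measurable
 then show ?thesis by (simp add: moll_def[abs_def])
qed

lemma moll_Lp_le:
 fixes f :: "'a::euclidean_space => 'b::euclidean_space"
 assumes [measurable]: "f \<in> borel_measurable borel" and p: "1 <= p"
 shows "(LBNN x. ennreal (norm (moll e f x) powr p)) <= (LBNN x. ennreal (norm (f x) powr p))"
proof -
 have "(LBNN x. ennreal (norm (moll e f x) powr p))
   <= (LBNN x. LBNN z. ennreal (molly z * norm (f (x - e *\<^sub>R z)) powr p))"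
  by (intro nn_integral_mono moll_jensen p) auto
 also have "\<dots> = (LBNN z. LBNN x. ennreal (molly z * norm (f (x - e *\<^sub>R z)) powr p))"
  by (rule lborel_pair.Fubini') measurable
 also have "\<dots> = (LBNN z. ennreal (molly (z::'a)) * (LBNN x. ennreal (norm (f x) powr p)))"
 proof (rule nn_integral_cong)
  fix z :: 'a
  have "(LBNN x. ennreal (molly z * norm (f (x - e *\<^sub>R z)) powr p))
    = ennreal (molly z) * (LBNN x. ennreal (norm (f (x - e *\<^sub>R z)) powr p))"
   by (simp add: ennreal_mult molly_nonneg nn_integral_cmult)
  also have "(LBNN x. ennreal (norm (f (x - e *\<^sub>R z)) powr p)) = (LBNN x. ennreal (norm (f x) powr p))"
   using nn_integral_lborel_affine[of "\<lambda>x. ennreal (norm (f x) powr p)" 1 "- (e *\<^sub>R z)"]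
   by (simp add: algebra_simps)
  finally show "(LBNN x. ennreal (molly z * norm (f (x - e *\<^sub>R z)) powr p))
    = ennreal (molly z) * (LBNN x. ennreal (norm (f x) powr p))" .
 qed
 also have "\<dots> = (LBNN x. ennreal (norm (f x) powr p))"
  by (simp add: nn_integral_multc molly_nn_integral)
 finally show ?thesis .
qed

lemma Lp_dense_bounded:
 fixes f :: "'a::euclidean_space => 'b::euclidean_space"
 assumes [measurable]: "f \<in> borel_measurable borel" and p: "1 <= p"
  and fin: "(LBNN x. ennreal (norm (f x) powr p)) < \<infinity>" and e: "0 < e"
 obtains n :: nat where "(LBNN x. ennreal (norm (f x - (if norm (f x) <= n \<and> norm x <= n then f x else 0)) powr p)) < ennreal e"
proof -
 let ?g = "\<lambda>(n::nat) x. if norm (f x) <= n \<and> norm x <= n then f x else 0"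
 have "(\<lambda>n. LBNN x. ennreal (norm (f x - ?g n x) powr p)) \<longlonglongrightarrow> (\<integral>\<^sup>+x. 0 \<partial>(lborel::'a measure))"
 proof (rule nn_integral_dominated_convergence[where w = "\<lambda>x. ennreal (norm (f x) powr p)"])
  show "AE x in lborel. ennreal (norm (f x - ?g n x) powr p) <= ennreal (norm (f x) powr p)" for n
   by (auto intro!: ennreal_leI)
  show "AE x in lborel. (\<lambda>n. ennreal (norm (f x - ?g n x) powr p)) \<longlonglongrightarrow> 0"
  proof (rule AE_I2)
   fix x
   obtain m :: nat where m: "max (norm (f x)) (norm x) <= m" using real_arch_simple by blast
   have "eventually (\<lambda>n. ennreal (norm (f x - ?g n x) powr p) = 0) sequentially"
    using eventually_ge_at_top[of m] by eventually_elim (use m in auto)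
   then show "(\<lambda>n. ennreal (norm (f x - ?g n x) powr p)) \<longlonglongrightarrow> 0" by (rule tendsto_eventually)
  qed
 qed (use fin in auto)
 then have "eventually (\<lambda>n. (LBNN x. ennreal (norm (f x - ?g n x) powr p)) < ennreal e) sequentially"
  using e by (intro order_tendstoD(2)[where y = 0]) auto
 then show ?thesis using that by (auto simp: eventually_sequentially)
qed

lemma Lp_dense_continuous:
 fixes f :: "'a::euclidean_space => 'b::euclidean_space"
 assumes f [measurable]: "f \<in> borel_measurable borel" and p: "1 <= p"
  and fin: "(LBNN x. ennreal (norm (f x) powr p)) < \<infinity>" and e: "0 < e"
 obtains c r where "continuous_on UNIV c" "\<And>x. norm x > r ==> c x = 0"
  "(LBNN x. ennreal (norm (f x - c x) powr p)) < ennreal e"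
proof -
 define e' where "e' = e / (2 * 2 powr p)"
 have e': "e' > 0" using e by (simp add: e'_def)
 obtain n :: nat where n: "(LBNN x. ennreal (norm (f x - (if norm (f x) <= n \<and> norm x <= n then f x else 0)) powr p)) < ennreal e'"
  using Lp_dense_bounded[OF f p fin e'] .
 define h where "h x = (if norm (f x) <= n \<and> norm x <= n then f x else 0)" for x
 have [measurable]: "h \<in> borel_measurable borel" unfolding h_def by measurable
 have hn: "norm (h x) <= n" for x by (auto simp: h_def)
 have "h measurable_on UNIV"
  by (rule lebesgue_measurable_imp_measurable_on) (auto intro: measurable_completion)
 then obtain N g where N: "negligible N" and g: "\<And>n. continuous_on UNIV (g n)"
   "\<And>x. x \<notin> N ==> (\<lambda>n. g n x) \<longlonglongrightarrow> h x"
  unfolding measurable_on_def by auto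
 define c where "c m x = (max 0 (min 1 (real n + 1 - norm x))) *\<^sub>R closest_point (cball 0 (real n)) (g m x)" for m x
 have cont_cp: "continuous_on UNIV (closest_point (cball (0::'b) (real n)))"
  by (rule continuous_on_closest_point) auto
 have cc: "continuous_on UNIV (c m)" for m
  unfolding c_def by (intro continuous_intros continuous_on_compose2[OF cont_cp g(1)]) auto
 have [measurable]: "c m \<in> borel_measurable borel" for m
  by (rule borel_measurable_continuous_onI[OF cc])
 have cs: "c m x = 0" if "norm x > real n + 1" for m x using that by (simp add: c_def)
 have cn: "norm (c m x) <= n" for m x
 proof -
  have "norm (closest_point (cball 0 (real n)) (g m x)) <= n"
   using closest_point_in_set[of "cball (0::'b) (real n)" "g m x"] by auto
  then have "max 0 (min 1 (real n + 1 - norm x)) * norm (closest_point (cball 0 (real n)) (g m x)) <= 1 * real n"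
   by (intro mult_mono) auto
  then show ?thesis by (simp add: c_def)
 qed
 define S where "S = cball (0::'a) (real n + 1)"
 define K where "K = ennreal ((2 * real n) powr p)"
 have [measurable]: "S \<in> sets borel" by (simp add: S_def)
 have "(\<lambda>m. LBNN x. ennreal (norm (h x - c m x) powr p)) \<longlonglongrightarrow> (\<integral>\<^sup>+x. 0 \<partial>(lborel::'a measure))"
 proof (rule nn_integral_dominated_convergence[where w = "\<lambda>x. K * indicator S x"])
  show "AE x in lborel. ennreal (norm (h x - c m x) powr p) <= K * indicator S x" for m
  proof (rule AE_I2)
   fix x
   have "norm (h x - c m x) <= 2 * real n" using hn[of x] cn[of m x] norm_triangle_ineq4[of "h x" "c m x"] by linarith
   then have "norm (h x - c m x) powr p <= (2 * real n) powr p" using p by (intro powr_mono2) auto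
   moreover have "h x = 0 \<and> c m x = 0" if "x \<notin> cball 0 (real n + 1)" using that cs[of x m] by (auto simp: h_def)
   ultimately show "ennreal (norm (h x - c m x) powr p) <= K * indicator S x"
    by (cases "x \<in> cball 0 (real n + 1)") (auto intro!: ennreal_leI simp: S_def K_def)
  qed
  show "(LBNN x. K * indicator S x) < \<infinity>"
   using emeasure_lborel_cball_finite[of "0::'a" "real n + 1"]
   by (subst nn_integral_cmult_indicator) (auto simp: ennreal_mult_less_top S_def K_def)
  have "AE x in lborel. x \<notin> N"
  proof -
   have "N \<in> null_sets lebesgue" using N negligible_iff_null_sets by auto
   then have "AE x in lebesgue. x \<notin> N" by (rule AE_not_in)
   then show ?thesis by (simp add: AE_completion_iff)
  qed
  then show "AE x in lborel. (\<lambda>m. ennreal (norm (h x - c m x) powr p)) \<longlonglongrightarrow> 0"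
  proof eventually_elim
   case (elim x)
   have "(\<lambda>m. closest_point (cball 0 (real n)) (g m x)) \<longlonglongrightarrow> closest_point (cball 0 (real n)) (h x)"
    using g(2)[OF elim] by (rule continuous_on_tendsto_compose[OF cont_cp]) auto
   moreover have "closest_point (cball 0 (real n)) (h x) = h x" using hn[of x] by (intro closest_point_self) auto
   ultimately have "(\<lambda>m. c m x) \<longlonglongrightarrow> (max 0 (min 1 (real n + 1 - norm x))) *\<^sub>R h x"
    unfolding c_def by (intro tendsto_intros) auto
   moreover have "(max 0 (min 1 (real n + 1 - norm x))) *\<^sub>R h x = h x" by (auto simp: h_def)
   ultimately have "(\<lambda>m. norm (h x - c m x)) \<longlonglongrightarrow> norm (h x - h x)" by (intro tendsto_intros) auto
   then have "(\<lambda>m. norm (h x - c m x) powr p) \<longlonglongrightarrow> 0 powr p"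
    using p by (intro tendsto_powr') auto
   then show ?case using tendsto_ennrealI by fastforce
  qed
  show "(\<lambda>x. ennreal (norm (h x - c m x) powr p)) \<in> borel_measurable lborel" for m by measurable
  show "(\<lambda>x. K * indicator S x) \<in> borel_measurable lborel" by measurable
 qed simp
 then have "eventually (\<lambda>m. (LBNN x. ennreal (norm (h x - c m x) powr p)) < ennreal e') sequentially"
  using e' by (intro order_tendstoD(2)[where y = 0]) auto
 then obtain m where m: "(LBNN x. ennreal (norm (h x - c m x) powr p)) < ennreal e'"
  by (auto simp: eventually_sequentially)
 have "(LBNN x. ennreal (norm (f x - c m x) powr p))
   <= (LBNN x. ennreal (2 powr p) * (ennreal (norm (f x - h x) powr p) + ennreal (norm (h x - c m x) powr p)))"
 proof (rule nn_integral_mono)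
  fix x
  have "norm (f x - c m x) powr p <= (norm (f x - h x) + norm (h x - c m x)) powr p"
   using norm_triangle_ineq[of "f x - h x" "h x - c m x"] p by (intro powr_mono2) auto
  also have "\<dots> <= 2 powr p * (norm (f x - h x) powr p + norm (h x - c m x) powr p)"
   using p by (intro powr_sum_le) auto
  finally show "ennreal (norm (f x - c m x) powr p) <= ennreal (2 powr p) * (ennreal (norm (f x - h x) powr p) + ennreal (norm (h x - c m x) powr p))"
   by (simp add: ennreal_mult[symmetric] ennreal_plus[symmetric] del: ennreal_plus)
 qed
 also have "\<dots> = ennreal (2 powr p) * ((LBNN x. ennreal (norm (f x - h x) powr p)) + (LBNN x. ennreal (norm (h x - c m x) powr p)))"
  by (simp add: nn_integral_cmult nn_integral_add)
 also have "\<dots> < ennreal (2 powr p) * (ennreal e' + ennreal e')"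
  using n m unfolding h_def[symmetric] by (intro ennreal_mult_strict_left_mono add_strict_mono) auto
 also have "\<dots> = ennreal e" using e'
  by (simp add: ennreal_mult[symmetric] ennreal_plus[symmetric] del: ennreal_plus) (simp add: e'_def)
 finally show ?thesis using that[of "c m" "real n + 1"] cc cs by auto
qed

lemma moll_integrand_integrable:
 fixes f :: "'a::euclidean_space => 'b::euclidean_space"
 assumes f [measurable]: "f \<in> borel_measurable borel" and p: "1 <= p" and e: "e > 0"
  and fin: "(LBNN x. ennreal (norm (f x) powr p)) < \<infinity>"
 shows "integrable lborel (\<lambda>z. molly z *\<^sub>R f (x - e *\<^sub>R z))"
proof -
 obtain B where B: "B > 0" "\<And>z::'a. molly z <= B" using molly_bounded by blast
 have "integrable lborel (\<lambda>x. norm (f x) powr p)"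
  using fin by (intro integrableI_bounded) auto
 from integrable_lborel_affine[OF this, of "-e" x]
 have i: "integrable lborel (\<lambda>z. norm (f (x - e *\<^sub>R z)) powr p)" using e by simp
 show ?thesis
 proof (rule Bochner_Integration.integrable_bound)
  show "integrable lborel (\<lambda>z. molly z + B * norm (f (x - e *\<^sub>R z)) powr p)"
   by (intro Bochner_Integration.integrable_add integrable_mult_right i molly_integrable)
  show "AE z in lborel. norm (molly z *\<^sub>R f (x - e *\<^sub>R z)) <= norm (molly z + B * norm (f (x - e *\<^sub>R z)) powr p)"
  proof (rule AE_I2)
   fix z :: 'a
   define t where "t = norm (f (x - e *\<^sub>R z))"
   have "t >= 0" by (simp add: t_def)
   have t: "t <= 1 + t powr p"
   proof (cases "t <= 1")
    case True
    then show ?thesis using powr_ge_zero[of t p] by linarith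
   next
    case False
    then have "t powr 1 <= t powr p" using p by (intro powr_mono) auto
    then show ?thesis using False by simp
   qed
   have "molly z * t <= molly z * (1 + t powr p)" by (intro mult_left_mono t molly_nonneg)
   also have "\<dots> <= molly z + B * t powr p" using B(2)[of z] by (simp add: algebra_simps mult_right_mono)
   finally show "norm (molly z *\<^sub>R f (x - e *\<^sub>R z)) <= norm (molly z + B * norm (f (x - e *\<^sub>R z)) powr p)"
    using molly_nonneg[of z] B by (simp add: t_def[symmetric])
  qed
 qed measurable
qed

lemma moll_continuous_close:
 fixes c :: "'a::euclidean_space => 'b::euclidean_space"
 assumes c: "continuous_on UNIV c" and d: "\<And>x y. dist x y < d ==> dist (c x) (c y) < w" and e: "0 < e" "e < d" and w: "0 < w"
 shows "norm (moll e c x - c x) <= w"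
proof -
 have [measurable]: "c \<in> borel_measurable borel" using c by (rule borel_measurable_continuous_onI)
 have i1: "integrable lborel (\<lambda>z. molly z *\<^sub>R c x)" by (rule integrable_scaleR_left) (rule molly_integrable)
 have bd: "norm (molly z *\<^sub>R (c (x - e *\<^sub>R z) - c x)) <= w * molly z" for z
 proof (cases "norm z < 1")
  case True
  have "e * norm z < d" using True e by (smt (verit) mult_less_cancel_left2)
  then have "norm (c (x - e *\<^sub>R z) - c x) < w" using d[of "x - e *\<^sub>R z" x] e by (simp add: dist_norm)
  then have "molly z * norm (c (x - e *\<^sub>R z) - c x) <= molly z * w"
   by (intro mult_left_mono molly_nonneg) auto
  then show ?thesis using molly_nonneg[of z] by (simp add: mult.commute)
 qed (simp add: molly_eq_0)
 have i2: "integrable lborel (\<lambda>z. molly z *\<^sub>R (c (x - e *\<^sub>R z) - c x))"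
  by (rule Bochner_Integration.integrable_bound[OF integrable_mult_right[OF molly_integrable, of w]])
   (use bd w in \<open>auto simp: abs_mult molly_nonneg\<close>)
 have "moll e c x = (LBINT z. molly z *\<^sub>R (c (x - e *\<^sub>R z) - c x) + molly z *\<^sub>R c x)"
  by (simp add: moll_def scaleR_diff_right)
 also have "\<dots> = (LBINT z. molly z *\<^sub>R (c (x - e *\<^sub>R z) - c x)) + c x"
  using i1 i2 molly_integrable[where 'a='a] by (simp add: molly_integral)
 finally have "norm (moll e c x - c x) <= (\<integral>z. w * molly z \<partial>(lborel :: 'a measure))"
  using Bochner_Integration.integral_norm_bound_integral[OF i2 integrable_mult_right[OF molly_integrable, of w]] bd
  by simp
 then show ?thesis by (simp add: molly_integral)
qed

lemma moll_supp:
 assumes "\<And>x. x \<notin> S ==> f x = 0" "\<And>y. y \<in> S ==> dist x y >= e" "e > 0"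
 shows "moll e f x = 0"
proof -
 have "molly z *\<^sub>R f (x - e *\<^sub>R z) = 0" for z
 proof (cases "norm z < 1")
  case True
  then have "dist x (x - e *\<^sub>R z) < e" using assms(3) by (simp add: dist_norm)
  then show ?thesis using assms(1,2)[of "x - e *\<^sub>R z"] by force
 qed (simp add: molly_eq_0)
 then show ?thesis by (simp only: moll_def integral_zero)
qed

lemma nn_integral_cmult_add3:
 assumes [measurable]: "A \<in> borel_measurable M" "B \<in> borel_measurable M" "C \<in> borel_measurable M"
 shows "(\<integral>\<^sup>+x. k * (A x + (B x + C x)) \<partial>M) = k * (integral\<^sup>N M A + (integral\<^sup>N M B + integral\<^sup>N M C))"
 by (simp add: nn_integral_cmult nn_integral_add)

lemma moll_Lp_tendsto:
 fixes f :: "'a::euclidean_space => 'b::euclidean_space"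
 assumes f [measurable]: "f \<in> borel_measurable borel" and p: "1 <= p"
  and fin: "(LBNN x. ennreal (norm (f x) powr p)) < \<infinity>"
  and em: "\<And>n. 0 < em n" "em \<longlonglongrightarrow> 0"
 shows "(\<lambda>n. LBNN x. ennreal (norm (moll (em n) f x - f x) powr p)) \<longlonglongrightarrow> 0"
proof (rule order_tendstoI)
 fix a :: ennreal assume "a < 0" then show "\<forall>\<^sub>F n in sequentially. a < (LBNN x. ennreal (norm (moll (em n) f x - f x) powr p))" by simp
next
 fix a :: ennreal assume "0 < a"
 then obtain a' where a': "0 < a'" "a' < a" using dense by blast
 then obtain eps where eps: "eps > 0" "a' = ennreal eps"
  by (cases a') (auto simp: ennreal_less_zero_iff)
 define P where "P = 2 powr p * 2 powr p"
 have P: "P > 0" by (simp add: P_def)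
 define q where "q = eps / (4 * P)"
 have q: "q > 0" using eps P by (simp add: q_def)
 obtain c r where c: "continuous_on UNIV c" "\<And>x. norm x > r ==> c x = 0"
  and fc: "(LBNN x. ennreal (norm (f x - c x) powr p)) < ennreal q"
  by (rule Lp_dense_continuous[OF f p fin q]) (rule that)
 have [measurable]: "c \<in> borel_measurable borel" using c(1) by (rule borel_measurable_continuous_onI)
 define V where "V = measure lborel (cball (0::'a) (r+1))"
 have V0: "V >= 0" by (simp add: V_def)
 define w where "w = (q / (V + 1)) powr (1/p)"
 have w: "w > 0" using q V0 by (simp add: w_def)
 have wp: "w powr p = q / (V + 1)" using q V0 p by (simp add: w_def powr_powr)
 obtain d where d: "d > 0" "\<And>x y. dist x y < d ==> dist (c x) (c y) < w"
  using unif_cont_compact_support[OF c w] by metis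
 have "eventually (\<lambda>n. em n < min d 1) sequentially"
  using em(2) d(1) by (intro order_tendstoD(2)[of em 0]) auto
 then show "\<forall>\<^sub>F n in sequentially. (LBNN x. ennreal (norm (moll (em n) f x - f x) powr p)) < a"
 proof eventually_elim
  case (elim n)
  define e where "e = em n"
  have e: "e > 0" "e < d" "e < 1" using elim em by (auto simp: e_def)
  have finc: "(LBNN x. ennreal (norm (c x) powr p)) < \<infinity>"
  proof -
   have "continuous_on UNIV (\<lambda>x. norm (c x) powr p)" using c(1) p by (intro continuous_intros continuous_on_powr') auto
   then have "integrable lborel (\<lambda>x. norm (c x) powr p)"
    by (rule integrable_cont_compact_support[of _ "cball 0 r"]) (use c(2) in auto)
   then show ?thesis by (simp add: integrable_iff_bounded)
  qed
  have lin: "moll e f x - moll e c x = moll e (\<lambda>x. f x - c x) x" for x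
   unfolding moll_def scaleR_diff_right
   by (rule Bochner_Integration.integral_diff[symmetric])
    (intro moll_integrand_integrable[OF _ p e(1)] fin finc; measurable)+
  have b2: "(LBNN x. ennreal (norm (moll e c x - c x) powr p)) <= ennreal q"
  proof -
   have "(LBNN x. ennreal (norm (moll e c x - c x) powr p)) <= (LBNN x. ennreal (w powr p) * indicator (cball (0::'a) (r+1)) x)"
   proof (rule nn_integral_mono)
    fix x :: 'a
    show "ennreal (norm (moll e c x - c x) powr p) <= ennreal (w powr p) * indicator (cball (0::'a) (r+1)) x"
    proof (cases "x \<in> cball 0 (r+1)")
     case True
     have "norm (moll e c x - c x) powr p <= w powr p"
      using moll_continuous_close[OF c(1) d(2) e(1,2) w] p by (intro powr_mono2) auto
     then show ?thesis using True by (simp add: ennreal_leI)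
    next
     case False
     have "moll e c x = 0"
     proof (rule moll_supp[where S = "cball 0 r"])
      show "c x = 0" if "x \<notin> cball 0 r" for x using c(2)[of x] that by auto
      show "dist x y >= e" if "y \<in> cball 0 r" for y
       using that False e norm_triangle_sub[of x y] by (auto simp: dist_norm)
     qed (use e in auto)
     then show ?thesis using False c(2)[of x] by auto
    qed
   qed
   also have "\<dots> = ennreal (w powr p) * emeasure lborel (cball (0::'a) (r+1))"
    by (rule nn_integral_cmult_indicator) simp
   also have "emeasure lborel (cball (0::'a) (r+1)) = ennreal V"
    unfolding V_def by (rule emeasure_eq_ennreal_measure) (use emeasure_lborel_cball_finite[of "0::'a" "r+1"] in auto)
   also have "ennreal (w powr p) * ennreal V = ennreal (q / (V+1) * V)"
    unfolding wp using V0 q by (intro ennreal_mult[symmetric]) auto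
   also have "\<dots> <= ennreal q" using q V0 by (intro ennreal_leI) (simp add: field_simps)
   finally show ?thesis .
  qed
  have b1: "(LBNN x. ennreal (norm (moll e f x - moll e c x) powr p)) <= ennreal q"
   unfolding lin using moll_Lp_le[of "\<lambda>x. f x - c x" p e] p fc by (auto intro: order_trans less_imp_le)
  have b3: "(LBNN x. ennreal (norm (c x - f x) powr p)) <= ennreal q"
   using fc by (simp add: norm_minus_commute less_imp_le)
  have "(LBNN x. ennreal (norm (moll e f x - f x) powr p))
   <= (LBNN x. ennreal P * (ennreal (norm (moll e f x - moll e c x) powr p) + (ennreal (norm (moll e c x - c x) powr p) + ennreal (norm (c x - f x) powr p))))"
  proof (rule nn_integral_mono)
   fix x :: 'a
   let ?A = "norm (moll e f x - moll e c x)" and ?B = "norm (moll e c x - c x)" and ?C = "norm (c x - f x)"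
   have "norm (moll e f x - f x) <= ?A + (?B + ?C)"
    using norm_triangle_ineq[of "moll e f x - moll e c x" "moll e c x - f x"] norm_triangle_ineq[of "moll e c x - c x" "c x - f x"] by simp
   then have "norm (moll e f x - f x) powr p <= (?A + (?B + ?C)) powr p" using p by (intro powr_mono2) auto
   also have "\<dots> <= 2 powr p * (?A powr p + (?B + ?C) powr p)" using p by (intro powr_sum_le) auto
   also have "\<dots> <= 2 powr p * (2 powr p * ?A powr p + 2 powr p * (?B powr p + ?C powr p))"
    using p powr_sum_le[OF p, of ?B ?C] ge_one_powr_ge_zero[of 2 p] mult_right_mono[of 1 "2 powr p" "?A powr p"]
    by (intro mult_left_mono add_mono) auto
   also have "\<dots> = P * (?A powr p + (?B powr p + ?C powr p))" by (simp add: P_def algebra_simps)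
   finally show "ennreal (norm (moll e f x - f x) powr p) <= ennreal P * (ennreal (?A powr p) + (ennreal (?B powr p) + ennreal (?C powr p)))"
    using P by (simp add: ennreal_mult[symmetric] ennreal_plus[symmetric] ennreal_leI del: ennreal_plus)
  qed
  also have "\<dots> = ennreal P * ((LBNN x. ennreal (norm (moll e f x - moll e c x) powr p)) + ((LBNN x. ennreal (norm (moll e c x - c x) powr p)) + (LBNN x. ennreal (norm (c x - f x) powr p))))"
  proof (rule nn_integral_cmult_add3)
   define mf mc where "mf = moll e f" and "mc = moll e c"
   have [measurable]: "mf \<in> borel_measurable borel" "mc \<in> borel_measurable borel"
    unfolding mf_def mc_def by (rule moll_borel, fact)+
   show "(\<lambda>x. ennreal (norm (moll e f x - moll e c x) powr p)) \<in> borel_measurable lborel"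
    "(\<lambda>x. ennreal (norm (moll e c x - c x) powr p)) \<in> borel_measurable lborel"
    "(\<lambda>x. ennreal (norm (c x - f x) powr p)) \<in> borel_measurable lborel"
    unfolding mf_def[symmetric] mc_def[symmetric] by measurable
  qed
  also have "\<dots> <= ennreal P * (ennreal q + (ennreal q + ennreal q))"
   using b1 b2 b3 by (intro mult_left_mono add_mono) auto
  also have "\<dots> = ennreal (P * (q + (q + q)))"
  proof -
   have "0 <= P" "0 <= q" using P q by auto
   then show ?thesis by (simp add: ennreal_plus[symmetric] ennreal_mult[symmetric] del: ennreal_plus)
  qed
  also have "\<dots> <= ennreal eps" using P q eps by (intro ennreal_leI) (simp add: q_def)
  finally show ?case using a' eps by (auto simp: e_def intro: le_less_trans)
 qed
qed

subsection \<open>Functions approximable by continuously differentiable ones\<close>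

lemma C1g_mult:
 assumes "C1g f F" "C1g g G"
 shows "C1g (\<lambda>x. f x * g x) (\<lambda>x. f x *\<^sub>R G x + g x *\<^sub>R F x)"
 unfolding C1g_def
proof (intro conjI allI)
 fix x
 show "((\<lambda>x. f x * g x) has_derivative (\<lambda>h. (f x *\<^sub>R G x + g x *\<^sub>R F x) \<bullet> h)) (at x)"
  using has_derivative_mult[OF C1g_D[OF assms(1), of x] C1g_D[OF assms(2), of x]]
  by (simp add: inner_add_left mult.commute)
 show "continuous_on UNIV (\<lambda>x. f x *\<^sub>R G x + g x *\<^sub>R F x)"
  using C1g_cont[OF assms(1)] C1g_cont[OF assms(2)] by (intro continuous_intros)
qed

lemma C1g_compose:
 assumes "C1g f G" and "\<And>x. (F has_real_derivative F' (f x)) (at (f x))"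
  and "continuous_on I F'" and "\<And>x. f x \<in> I"
 shows "C1g (\<lambda>x. F (f x)) (\<lambda>x. F' (f x) *\<^sub>R G x)"
 unfolding C1g_def
proof (intro conjI allI)
 fix x
 show "((\<lambda>x. F (f x)) has_derivative (\<lambda>h. (F' (f x) *\<^sub>R G x) \<bullet> h)) (at x)"
  using has_derivative_compose[OF C1g_D[OF assms(1), of x] assms(2)[unfolded has_field_derivative_def]] by simp
 have "continuous_on UNIV (\<lambda>x. F' (f x))"
  by (rule continuous_on_compose2[OF assms(3) C1g_cont(1)[OF assms(1)]]) (use assms(4) in auto)
 then show "continuous_on UNIV (\<lambda>x. F' (f x) *\<^sub>R G x)"
  using C1g_cont[OF assms(1)] by (intro continuous_intros)
qed

text \<open>
 The approximants take values in the same interval \<open>[a, b]\<close> as \<open>w\<close>, so that \<open>F\<close> only needs to be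
 differentiable there in the chain rule; the case of interest is a power of \<open>t + d\<close> on \<open>[0, M]\<close>.
\<close>

definition sobC :: "real => 'a::euclidean_space set => 'a set => real => real => ('a => real) => ('a => 'a) => bool" where
 "sobC p S Z a b w g \<longleftrightarrow> w \<in> borel_measurable borel \<and> g \<in> borel_measurable borel \<and> (\<forall>x. w x \<in> {a..b}) \<and>
   (LBNN x. ennreal (norm (g x) powr p) * indicator S x) < \<infinity> \<and>
   (\<exists>wk Gk. (\<forall>k. C1g (wk k) (Gk k)) \<and> (\<forall>k x. wk k x \<in> {a..b}) \<and> (\<forall>k x. x \<notin> Z --> wk k x = 0) \<and>
    (AE x in lborel. x \<in> S --> (\<lambda>k. wk k x) \<longlonglongrightarrow> w x) \<and>
    (\<lambda>k::nat. LBNN x. ennreal (norm (Gk k x - g x) powr p) * indicator S x) \<longlonglongrightarrow> 0)"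

lemma sobCE:
 assumes "sobC p S Z a b w g"
 obtains wk Gk where "w \<in> borel_measurable borel" "g \<in> borel_measurable borel" "\<And>x. w x \<in> {a..b}"
  "(LBNN x. ennreal (norm (g x) powr p) * indicator S x) < \<infinity>"
  "\<And>k. C1g (wk k) (Gk k)" "\<And>k x. wk k x \<in> {a..b}" "\<And>k x. x \<notin> Z ==> wk k x = 0"
  "AE x in lborel. x \<in> S --> (\<lambda>k. wk k x) \<longlonglongrightarrow> w x"
  "(\<lambda>k::nat. LBNN x. ennreal (norm (Gk k x - g x) powr p) * indicator S x) \<longlonglongrightarrow> 0"
 using assms unfolding sobC_def
 by (elim conjE exE) (rule that; (assumption | erule spec | (drule spec)+, erule mp, assumption | (drule spec)+, assumption))

lemma nn_integral_cmult_add2: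
 assumes [measurable]: "A \<in> borel_measurable M" "B \<in> borel_measurable M"
 shows "(\<integral>\<^sup>+x. k * (A x + B x) \<partial>M) = k * (integral\<^sup>N M A + integral\<^sup>N M B)"
 by (simp add: nn_integral_cmult nn_integral_add)

lemma nn_integral_tendsto_0_add:
 assumes "\<And>k::nat. A k \<in> borel_measurable M" "\<And>k. B k \<in> borel_measurable M"
  and "(\<lambda>k. \<integral>\<^sup>+x. A k x \<partial>M) \<longlonglongrightarrow> 0" "(\<lambda>k. \<integral>\<^sup>+x. B k x \<partial>M) \<longlonglongrightarrow> 0"
  and "c < \<infinity>" "\<And>k x. f k x <= c * (A k x + B k x)"
 shows "(\<lambda>k. \<integral>\<^sup>+x. f k x \<partial>M) \<longlonglongrightarrow> (0::ennreal)"
proof (rule tendsto_sandwich[where f = "\<lambda>_. 0"])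
 show "\<forall>\<^sub>F k in sequentially. (\<integral>\<^sup>+x. f k x \<partial>M) <= c * ((\<integral>\<^sup>+x. A k x \<partial>M) + (\<integral>\<^sup>+x. B k x \<partial>M))"
 proof (rule always_eventually, rule allI)
  fix k
  have "(\<integral>\<^sup>+x. f k x \<partial>M) <= (\<integral>\<^sup>+x. c * (A k x + B k x) \<partial>M)" by (intro nn_integral_mono assms)
  also have "\<dots> = c * ((\<integral>\<^sup>+x. A k x \<partial>M) + (\<integral>\<^sup>+x. B k x \<partial>M))"
   using assms(1,2) by (simp add: nn_integral_cmult nn_integral_add)
  finally show "(\<integral>\<^sup>+x. f k x \<partial>M) <= c * ((\<integral>\<^sup>+x. A k x \<partial>M) + (\<integral>\<^sup>+x. B k x \<partial>M))" .
 qed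
 have "(\<lambda>k. c * ((\<integral>\<^sup>+x. A k x \<partial>M) + (\<integral>\<^sup>+x. B k x \<partial>M))) \<longlonglongrightarrow> c * (0 + 0)"
  by (rule ennreal_tendsto_cmult[OF _ tendsto_add[OF assms(3,4)]]) (use assms(5) in simp)
 then show "(\<lambda>k. c * ((\<integral>\<^sup>+x. A k x \<partial>M) + (\<integral>\<^sup>+x. B k x \<partial>M))) \<longlonglongrightarrow> 0" by simp
qed auto

lemma norm_add_powr_le:
 assumes "1 <= p"
 shows "norm (a + b) powr p <= 2 powr p * (norm a powr p + norm b powr p)"
 by (rule order_trans[OF powr_mono2[OF _ _ norm_triangle_ineq] powr_sum_le]) (use assms in auto)

lemma ennreal_norm_add_powr_le:
 assumes "1 <= p" "norm a <= norm c" "norm b <= norm d"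
 shows "ennreal (norm (a + b) powr p) * indicator S x
  <= ennreal (2 powr p) * (ennreal (norm c powr p) * indicator S x + ennreal (norm d powr p) * indicator S x)"
proof -
 have "norm (a + b) powr p <= 2 powr p * (norm a powr p + norm b powr p)" by (rule norm_add_powr_le[OF assms(1)])
 also have "\<dots> <= 2 powr p * (norm c powr p + norm d powr p)"
  using assms by (intro mult_left_mono add_mono powr_mono2) auto
 finally have "ennreal (norm (a + b) powr p) <= ennreal (2 powr p) * (ennreal (norm c powr p) + ennreal (norm d powr p))"
  by (simp add: ennreal_mult[symmetric] ennreal_plus[symmetric] ennreal_leI del: ennreal_plus)
 then show ?thesis by (cases "x \<in> S") auto
qed

lemma continuous_on_interval_borel:
 fixes F :: "real => real"
 assumes "continuous_on {a..b} F" and [measurable]: "w \<in> borel_measurable borel" and "\<And>x. w x \<in> {a..b}"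
 shows "(\<lambda>x. F (w x)) \<in> borel_measurable borel"
proof -
 have ab: "a <= b" using assms(3)[of undefined] by auto
 have "continuous_on UNIV (\<lambda>t. F (max a (min b t)))"
  by (rule continuous_on_compose2[OF assms(1)]) (use ab in \<open>auto intro!: continuous_intros\<close>)
 then have [measurable]: "(\<lambda>t. F (max a (min b t))) \<in> borel_measurable borel" by (rule borel_measurable_continuous_onI)
 have "(\<lambda>x. F (max a (min b (w x)))) \<in> borel_measurable borel" by measurable
 moreover have "max a (min b (w x)) = w x" for x using assms(3)[of x] by auto
 ultimately show ?thesis by simp
qed

lemma sobC_chain:
 assumes sob: "sobC p S Z a b w g" and p: "1 <= p" and S [measurable]: "S \<in> sets borel"
  and F: "\<And>t. t \<in> {a..b} ==> (F has_real_derivative F' t) (at t)" and F': "continuous_on {a..b} F'"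
  and Z: "Z = UNIV \<or> F 0 = 0"
 obtains a' b' where "sobC p S Z a' b' (\<lambda>x. F (w x)) (\<lambda>x. F' (w x) *\<^sub>R g x)"
proof -
 obtain wk Gk where w [measurable]: "w \<in> borel_measurable borel" and g [measurable]: "g \<in> borel_measurable borel"
  and wab: "\<And>x. w x \<in> {a..b}"
  and fin: "(LBNN x. ennreal (norm (g x) powr p) * indicator S x) < \<infinity>"
  and C1: "\<And>k. C1g (wk k) (Gk k)" and wkab: "\<And>k x. wk k x \<in> {a..b}" and wkZ: "\<And>k x. x \<notin> Z ==> wk k x = 0"
  and AE: "AE x in lborel. x \<in> S --> (\<lambda>k. wk k x) \<longlonglongrightarrow> w x"
  and Lp: "(\<lambda>k. LBNN x. ennreal (norm (Gk k x - g x) powr p) * indicator S x) \<longlonglongrightarrow> 0"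
  by (rule sobCE[OF sob]) (rule that)
 note [measurable] = C1g_borel[OF C1]
 have Fc: "continuous_on {a..b} F"
  by (intro continuous_at_imp_continuous_on ballI) (rule DERIV_isCont[OF F])
 obtain a' b' where Fab: "\<And>t. t \<in> {a..b} ==> F t \<in> {a'..b'}"
 proof -
  have "bounded (F ` {a..b})" by (intro compact_imp_bounded compact_continuous_image Fc) auto
  then obtain B where B: "\<forall>y\<in>F ` {a..b}. norm y <= B" unfolding bounded_iff by blast
  have "F t \<in> {-B..B}" if "t \<in> {a..b}" for t
  proof -
   have "norm (F t) <= B" using B that by blast
   then show ?thesis by (auto simp: abs_le_iff)
  qed
  then show ?thesis by (rule that)
 qed
 obtain B where B: "\<And>t. t \<in> {a..b} ==> \<bar>F' t\<bar> <= B"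
 proof -
  have "bounded (F' ` {a..b})" by (intro compact_imp_bounded compact_continuous_image F') auto
  then obtain B where B: "\<forall>y\<in>F' ` {a..b}. norm y <= B" unfolding bounded_iff by blast
  show ?thesis by (rule that[of B]) (metis B imageI real_norm_def)
 qed
 have B0: "B >= 0" using B[OF wab[of undefined]] by linarith
 have [measurable]: "(\<lambda>x. F (w x)) \<in> borel_measurable borel" by (rule continuous_on_interval_borel[OF Fc w wab])
 have [measurable]: "(\<lambda>x. F' (w x)) \<in> borel_measurable borel" by (rule continuous_on_interval_borel[OF F' w wab])
 have [measurable]: "(\<lambda>x. F' (wk k x)) \<in> borel_measurable borel" for k by (rule continuous_on_interval_borel[OF F' _ wkab]) measurable
 have "sobC p S Z a' b' (\<lambda>x. F (w x)) (\<lambda>x. F' (w x) *\<^sub>R g x)"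
  unfolding sobC_def
 proof (intro conjI exI[of _ "\<lambda>k x. F (wk k x)"] exI[of _ "\<lambda>k x. F' (wk k x) *\<^sub>R Gk k x"] allI impI)
  show "(LBNN x. ennreal (norm (F' (w x) *\<^sub>R g x) powr p) * indicator S x) < \<infinity>"
  proof -
   have "(LBNN x. ennreal (norm (F' (w x) *\<^sub>R g x) powr p) * indicator S x)
    <= (LBNN x. ennreal (B powr p) * (ennreal (norm (g x) powr p) * indicator S x))"
   proof (rule nn_integral_mono)
    fix x
    have "norm (F' (w x) *\<^sub>R g x) powr p <= (B * norm (g x)) powr p"
     using B[OF wab[of x]] p by (intro powr_mono2) (auto intro!: mult_right_mono)
    also have "\<dots> = B powr p * norm (g x) powr p" using B0 by (simp add: powr_mult)
    finally show "ennreal (norm (F' (w x) *\<^sub>R g x) powr p) * indicator S x <= ennreal (B powr p) * (ennreal (norm (g x) powr p) * indicator S x)"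
     by (cases "x \<in> S") (auto simp: ennreal_mult[symmetric] intro!: ennreal_leI)
   qed
   also have "\<dots> = ennreal (B powr p) * (LBNN x. ennreal (norm (g x) powr p) * indicator S x)"
    by (rule nn_integral_cmult) measurable
   also have "\<dots> < \<infinity>" using fin by (simp add: ennreal_mult_less_top)
   finally show ?thesis .
  qed
  fix k
  show "C1g (\<lambda>x. F (wk k x)) (\<lambda>x. F' (wk k x) *\<^sub>R Gk k x)"
   by (rule C1g_compose[OF C1 _ F' wkab]) (rule F[OF wkab])
  show "F (wk k x) \<in> {a'..b'}" for x by (rule Fab[OF wkab])
  show "F (wk k x) = 0" if "x \<notin> Z" for x using wkZ[OF that] Z that by auto
 next
  show "AE x in lborel. x \<in> S --> (\<lambda>k. F (wk k x)) \<longlonglongrightarrow> F (w x)"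
   using AE
  proof eventually_elim
   case (elim x)
   then show ?case using isCont_tendsto_compose[OF DERIV_isCont[OF F[OF wab[of x]]]] by blast
  qed
  show "(\<lambda>k. LBNN x. ennreal (norm (F' (wk k x) *\<^sub>R Gk k x - F' (w x) *\<^sub>R g x) powr p) * indicator S x) \<longlonglongrightarrow> 0"
  proof (rule nn_integral_tendsto_0_add[where c = "ennreal (2 powr p)"
     and A = "\<lambda>k x. ennreal (norm (B *\<^sub>R (Gk k x - g x)) powr p) * indicator S x"
     and B = "\<lambda>k x. ennreal (norm ((F' (wk k x) - F' (w x)) *\<^sub>R g x) powr p) * indicator S x"])
   show "(\<lambda>k. LBNN x. ennreal (norm (B *\<^sub>R (Gk k x - g x)) powr p) * indicator S x) \<longlonglongrightarrow> 0"
   proof -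
    have "(LBNN x. ennreal (norm (B *\<^sub>R (Gk k x - g x)) powr p) * indicator S x)
     = ennreal (B powr p) * (LBNN x. ennreal (norm (Gk k x - g x) powr p) * indicator S x)" for k
     using B0 by (subst nn_integral_cmult[symmetric]) (auto simp: powr_mult ennreal_mult mult.assoc)
    moreover have "(\<lambda>k. ennreal (B powr p) * (LBNN x. ennreal (norm (Gk k x - g x) powr p) * indicator S x)) \<longlonglongrightarrow> ennreal (B powr p) * 0"
     by (rule ennreal_tendsto_cmult[OF _ Lp]) simp
    ultimately show ?thesis by simp
   qed
   have "(\<lambda>k. LBNN x. ennreal (norm ((F' (wk k x) - F' (w x)) *\<^sub>R g x) powr p) * indicator S x) \<longlonglongrightarrow> (\<integral>\<^sup>+x. 0 \<partial>(lborel::'a measure))"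
   proof (rule nn_integral_dominated_convergence[where w = "\<lambda>x. ennreal ((2 * B) powr p) * (ennreal (norm (g x) powr p) * indicator S x)"])
    show "(LBNN x. ennreal ((2 * B) powr p) * (ennreal (norm (g x) powr p) * indicator S x)) < \<infinity>"
     using fin by (subst nn_integral_cmult) (auto simp: ennreal_mult_less_top)
    show "AE x in lborel. ennreal (norm ((F' (wk k x) - F' (w x)) *\<^sub>R g x) powr p) * indicator S x
      <= ennreal ((2 * B) powr p) * (ennreal (norm (g x) powr p) * indicator S x)" for k
    proof (rule AE_I2)
     fix x
     have "\<bar>F' (wk k x) - F' (w x)\<bar> <= 2 * B" using B[OF wab[of x]] B[OF wkab[of k x]] by linarith
     then have "norm ((F' (wk k x) - F' (w x)) *\<^sub>R g x) powr p <= (2 * B * norm (g x)) powr p"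
      using p by (intro powr_mono2) (auto intro!: mult_right_mono)
     also have "\<dots> = (2 * B) powr p * norm (g x) powr p" using B0 by (simp add: powr_mult)
     finally show "ennreal (norm ((F' (wk k x) - F' (w x)) *\<^sub>R g x) powr p) * indicator S x
       <= ennreal ((2 * B) powr p) * (ennreal (norm (g x) powr p) * indicator S x)"
      by (cases "x \<in> S") (auto simp: ennreal_mult[symmetric] intro!: ennreal_leI)
    qed
    show "AE x in lborel. (\<lambda>k. ennreal (norm ((F' (wk k x) - F' (w x)) *\<^sub>R g x) powr p) * indicator S x) \<longlonglongrightarrow> 0"
     using AE
    proof eventually_elim
     case (elim x)
     show ?case
     proof (cases "x \<in> S")
      case True
      then have "(\<lambda>k. wk k x) \<longlonglongrightarrow> w x" using elim by auto
      then have "(\<lambda>k. F' (wk k x)) \<longlonglongrightarrow> F' (w x)"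
       by (rule continuous_on_tendsto_compose[OF F']) (use wab wkab in auto)
      then have "(\<lambda>k. norm ((F' (wk k x) - F' (w x)) *\<^sub>R g x)) \<longlonglongrightarrow> norm ((F' (w x) - F' (w x)) *\<^sub>R g x)"
       by (intro tendsto_intros)
      then have "(\<lambda>k. norm ((F' (wk k x) - F' (w x)) *\<^sub>R g x) powr p) \<longlonglongrightarrow> 0 powr p"
       using p by (intro tendsto_powr') auto
      then have "(\<lambda>k. ennreal (norm ((F' (wk k x) - F' (w x)) *\<^sub>R g x) powr p)) \<longlonglongrightarrow> ennreal (0 powr p)"
       by (rule tendsto_ennrealI)
      then show ?thesis using True by simp
     qed simp
    qed
   qed measurable
   then show "(\<lambda>k. LBNN x. ennreal (norm ((F' (wk k x) - F' (w x)) *\<^sub>R g x) powr p) * indicator S x) \<longlonglongrightarrow> 0" by simp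
   fix k x
   have "F' (wk k x) *\<^sub>R Gk k x - F' (w x) *\<^sub>R g x = F' (wk k x) *\<^sub>R (Gk k x - g x) + (F' (wk k x) - F' (w x)) *\<^sub>R g x"
    by (simp add: algebra_simps)
   moreover have "norm (F' (wk k x) *\<^sub>R (Gk k x - g x)) <= norm (B *\<^sub>R (Gk k x - g x))"
    using B[OF wkab[of k x]] B0 by (auto intro!: mult_right_mono)
   ultimately show "ennreal (norm (F' (wk k x) *\<^sub>R Gk k x - F' (w x) *\<^sub>R g x) powr p) * indicator S x
     <= ennreal (2 powr p) * (ennreal (norm (B *\<^sub>R (Gk k x - g x)) powr p) * indicator S x
      + ennreal (norm ((F' (wk k x) - F' (w x)) *\<^sub>R g x) powr p) * indicator S x)"
    by (simp only: ennreal_norm_add_powr_le[OF p] order_refl)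
  qed auto
 qed (use Fab wab in auto)
 then show ?thesis by (rule that)
qed

lemma sobC_mult:
 assumes sob: "sobC p S Z a b w g" and p: "1 <= p" and S [measurable]: "S \<in> sets borel" and Sfin: "emeasure lborel S < \<infinity>"
  and \<eta>: "C1g \<eta> G\<eta>" and A: "\<And>x. \<bar>\<eta> x\<bar> <= A" "\<And>x. norm (G\<eta> x) <= A" and Z': "\<And>x. x \<notin> Z' ==> \<eta> x = 0"
 obtains a' b' where "sobC p S Z' a' b' (\<lambda>x. \<eta> x * w x) (\<lambda>x. \<eta> x *\<^sub>R g x + w x *\<^sub>R G\<eta> x)"
proof -
 obtain wk Gk where w [measurable]: "w \<in> borel_measurable borel" and g [measurable]: "g \<in> borel_measurable borel"
  and wab: "\<And>x. w x \<in> {a..b}"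
  and fin: "(LBNN x. ennreal (norm (g x) powr p) * indicator S x) < \<infinity>"
  and C1: "\<And>k. C1g (wk k) (Gk k)" and wkab: "\<And>k x. wk k x \<in> {a..b}" and wkZ: "\<And>k x. x \<notin> Z ==> wk k x = 0"
  and AE: "AE x in lborel. x \<in> S --> (\<lambda>k. wk k x) \<longlonglongrightarrow> w x"
  and Lp: "(\<lambda>k. LBNN x. ennreal (norm (Gk k x - g x) powr p) * indicator S x) \<longlonglongrightarrow> 0"
  by (rule sobCE[OF sob]) (rule that)
 note [measurable] = C1g_borel[OF C1] C1g_borel[OF \<eta>]
 define M where "M = max \<bar>a\<bar> \<bar>b\<bar>"
 have M: "\<bar>w x\<bar> <= M" "\<bar>wk k x\<bar> <= M" for x k using wab[of x] wkab[of k x] by (auto simp: M_def abs_le_iff)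
 have A0: "A >= 0" using A(1)[of undefined] by linarith
 have M0: "M >= 0" by (simp add: M_def)
 have Sf: "(LBNN x. ennreal c * indicator S x) < \<infinity>" for c
  using Sfin by (subst nn_integral_cmult_indicator) (auto simp: ennreal_mult_less_top)
 have pr: "\<eta> x * t \<in> {- (A * M)..A * M}" if "\<bar>t\<bar> <= M" for x t
 proof -
  have "\<bar>\<eta> x * t\<bar> <= A * M" using that A(1)[of x] A0 by (auto simp: abs_mult intro!: mult_mono)
  then show ?thesis by (simp add: abs_le_iff)
 qed
 have "sobC p S Z' (- (A * M)) (A * M) (\<lambda>x. \<eta> x * w x) (\<lambda>x. \<eta> x *\<^sub>R g x + w x *\<^sub>R G\<eta> x)"
  unfolding sobC_def
 proof (intro conjI exI[of _ "\<lambda>k x. \<eta> x * wk k x"] exI[of _ "\<lambda>k x. \<eta> x *\<^sub>R Gk k x + wk k x *\<^sub>R G\<eta> x"] allI impI)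
  show "(LBNN x. ennreal (norm (\<eta> x *\<^sub>R g x + w x *\<^sub>R G\<eta> x) powr p) * indicator S x) < \<infinity>"
  proof -
   have "(LBNN x. ennreal (norm (\<eta> x *\<^sub>R g x + w x *\<^sub>R G\<eta> x) powr p) * indicator S x)
    <= (LBNN x. ennreal (2 powr p) * (ennreal (norm (A *\<^sub>R g x) powr p) * indicator S x + ennreal (norm (M * A) powr p) * indicator S x))"
   proof (rule nn_integral_mono, rule ennreal_norm_add_powr_le[OF p])
    fix x
    show "norm (\<eta> x *\<^sub>R g x) <= norm (A *\<^sub>R g x)" using A(1)[of x] A0 by (auto intro!: mult_right_mono)
    show "norm (w x *\<^sub>R G\<eta> x) <= norm (M * A)" using A(2)[of x] M(1)[of x] A0 M0 by (auto simp: abs_mult intro!: mult_mono)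
   qed
   also have "\<dots> = ennreal (2 powr p) * ((LBNN x. ennreal (norm (A *\<^sub>R g x) powr p) * indicator S x) + (LBNN x. ennreal (norm (M * A) powr p) * indicator S x))"
    by (rule nn_integral_cmult_add2) measurable
   also have "(LBNN x. ennreal (norm (A *\<^sub>R g x) powr p) * indicator S x) = ennreal (A powr p) * (LBNN x. ennreal (norm (g x) powr p) * indicator S x)"
    using A0 by (subst nn_integral_cmult[symmetric]) (auto simp: powr_mult ennreal_mult mult.assoc)
   also have "ennreal (2 powr p) * (ennreal (A powr p) * (LBNN x. ennreal (norm (g x) powr p) * indicator S x)
     + (LBNN x. ennreal (norm (M * A) powr p) * indicator S x)) < \<infinity>"
   proof -
    have "ennreal u * (ennreal v * I + J) < \<infinity>" if "I < \<infinity>" "J < \<infinity>" for u v I J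
     using that by (simp add: ennreal_mult_less_top)
    then show ?thesis using fin Sf[of "norm (M * A) powr p"] by blast
   qed
   finally show ?thesis .
  qed
  fix k
  show "C1g (\<lambda>x. \<eta> x * wk k x) (\<lambda>x. \<eta> x *\<^sub>R Gk k x + wk k x *\<^sub>R G\<eta> x)" by (rule C1g_mult[OF \<eta> C1])
  show "\<eta> x * wk k x \<in> {- (A * M)..A * M}" for x by (rule pr[OF M(2)])
 next
  show "AE x in lborel. x \<in> S --> (\<lambda>k. \<eta> x * wk k x) \<longlonglongrightarrow> \<eta> x * w x"
   using AE by eventually_elim (auto intro!: tendsto_intros)
  show "(\<lambda>k. LBNN x. ennreal (norm (\<eta> x *\<^sub>R Gk k x + wk k x *\<^sub>R G\<eta> x - (\<eta> x *\<^sub>R g x + w x *\<^sub>R G\<eta> x)) powr p) * indicator S x) \<longlonglongrightarrow> 0"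
  proof (rule nn_integral_tendsto_0_add[where c = "ennreal (2 powr p)"
     and A = "\<lambda>k x. ennreal (norm (A *\<^sub>R (Gk k x - g x)) powr p) * indicator S x"
     and B = "\<lambda>k x. ennreal (norm (A * (wk k x - w x)) powr p) * indicator S x"])
   have "(LBNN x. ennreal (norm (A *\<^sub>R (Gk k x - g x)) powr p) * indicator S x)
     = ennreal (A powr p) * (LBNN x. ennreal (norm (Gk k x - g x) powr p) * indicator S x)" for k
    using A0 by (subst nn_integral_cmult[symmetric]) (auto simp: powr_mult ennreal_mult mult.assoc)
   moreover have "(\<lambda>k. ennreal (A powr p) * (LBNN x. ennreal (norm (Gk k x - g x) powr p) * indicator S x)) \<longlonglongrightarrow> ennreal (A powr p) * 0"
    by (rule ennreal_tendsto_cmult[OF _ Lp]) simp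
   ultimately show "(\<lambda>k. LBNN x. ennreal (norm (A *\<^sub>R (Gk k x - g x)) powr p) * indicator S x) \<longlonglongrightarrow> 0" by simp
   have "(\<lambda>k. LBNN x. ennreal (norm (A * (wk k x - w x)) powr p) * indicator S x) \<longlonglongrightarrow> (\<integral>\<^sup>+x. 0 \<partial>(lborel::'a measure))"
   proof (rule nn_integral_dominated_convergence[where w = "\<lambda>x. ennreal ((A * (2 * M)) powr p) * indicator S x"])
    show "(LBNN x. ennreal ((A * (2 * M)) powr p) * indicator S x) < \<infinity>" by (rule Sf)
    show "AE x in lborel. ennreal (norm (A * (wk k x - w x)) powr p) * indicator S x
      <= ennreal ((A * (2 * M)) powr p) * indicator S x" for k
    proof (rule AE_I2)
     fix x
     have "\<bar>wk k x - w x\<bar> <= 2 * M" using M(1)[of x] M(2)[of k x] by linarith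
     then have "norm (A * (wk k x - w x)) powr p <= (A * (2 * M)) powr p"
      using p A0 by (intro powr_mono2) (auto simp: abs_mult intro!: mult_left_mono)
     then show "ennreal (norm (A * (wk k x - w x)) powr p) * indicator S x
       <= ennreal ((A * (2 * M)) powr p) * indicator S x"
      by (cases "x \<in> S") (auto intro!: ennreal_leI)
    qed
    show "AE x in lborel. (\<lambda>k. ennreal (norm (A * (wk k x - w x)) powr p) * indicator S x) \<longlonglongrightarrow> 0"
     using AE
    proof eventually_elim
     case (elim x)
     show ?case
     proof (cases "x \<in> S")
      case True
      then have "(\<lambda>k. wk k x) \<longlonglongrightarrow> w x" using elim by auto
      then have "(\<lambda>k. norm (A * (wk k x - w x))) \<longlonglongrightarrow> norm (A * (w x - w x))"
       by (intro tendsto_intros)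
      then have "(\<lambda>k. norm (A * (wk k x - w x)) powr p) \<longlonglongrightarrow> 0 powr p"
       using p by (intro tendsto_powr') auto
      then have "(\<lambda>k. ennreal (norm (A * (wk k x - w x)) powr p)) \<longlonglongrightarrow> ennreal (0 powr p)"
       by (rule tendsto_ennrealI)
      then show ?thesis using True by simp
     qed simp
    qed
   qed measurable
   then show "(\<lambda>k. LBNN x. ennreal (norm (A * (wk k x - w x)) powr p) * indicator S x) \<longlonglongrightarrow> 0" by simp
   fix k x
   have "\<eta> x *\<^sub>R Gk k x + wk k x *\<^sub>R G\<eta> x - (\<eta> x *\<^sub>R g x + w x *\<^sub>R G\<eta> x) = \<eta> x *\<^sub>R (Gk k x - g x) + (wk k x - w x) *\<^sub>R G\<eta> x"
    by (simp add: algebra_simps)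
   moreover have "norm (\<eta> x *\<^sub>R (Gk k x - g x)) <= norm (A *\<^sub>R (Gk k x - g x))"
    using A(1)[of x] A0 by (auto intro!: mult_right_mono)
   moreover have "norm ((wk k x - w x) *\<^sub>R G\<eta> x) <= norm (A * (wk k x - w x))"
    using mult_left_mono[OF A(2)[of x], of "\<bar>wk k x - w x\<bar>"] A0 by (simp add: abs_mult mult.commute)
   ultimately show "ennreal (norm (\<eta> x *\<^sub>R Gk k x + wk k x *\<^sub>R G\<eta> x - (\<eta> x *\<^sub>R g x + w x *\<^sub>R G\<eta> x)) powr p) * indicator S x
     <= ennreal (2 powr p) * (ennreal (norm (A *\<^sub>R (Gk k x - g x)) powr p) * indicator S x
      + ennreal (norm (A * (wk k x - w x)) powr p) * indicator S x)"
    by (simp only: ennreal_norm_add_powr_le[OF p])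
  qed auto
 qed (use pr[OF M(1)] Z' in auto)
 then show ?thesis by (rule that)
qed

lemma C1g_zero_open:
 assumes "C1g f G" "open T" "\<And>x. x \<in> T ==> f x = 0" "x \<in> T"
 shows "G x = 0"
proof -
 have "((\<lambda>_. 0) has_derivative (\<lambda>h. G x \<bullet> h)) (at x)"
  by (intro has_derivative_transform_within_open[OF C1g_D[OF assms(1)] assms(2)]) (use assms in auto)
 then have "(\<lambda>h. G x \<bullet> h) = (\<lambda>h. 0)"
  using has_derivative_unique[OF _ has_derivative_const] by blast
 then show ?thesis by (metis inner_eq_zero_iff)
qed

lemma C1g_reflect:
 assumes "C1g f G" shows "C1g (\<lambda>y. f (x - y)) (\<lambda>y. - G (x - y))"
 unfolding C1g_def
proof (intro conjI allI)
 fix y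
 have "((\<lambda>y. x - y) has_derivative (\<lambda>h. - h)) (at y)" by (auto intro!: derivative_eq_intros)
 from has_derivative_compose[OF this C1g_D[OF assms]]
 show "((\<lambda>y. f (x - y)) has_derivative (\<lambda>h. - G (x - y) \<bullet> h)) (at y)" by simp
 have "continuous_on UNIV (\<lambda>y. G (x - y))"
  by (rule continuous_on_compose2[OF C1g_cont(2)[OF assms]]) (auto intro!: continuous_intros)
 then show "continuous_on UNIV (\<lambda>y. - G (x - y))" by (intro continuous_intros)
qed

lemma C1g_cmult: "C1g f G ==> C1g (\<lambda>x. c * f x) (\<lambda>x. c *\<^sub>R G x)"
 unfolding C1g_def by (auto intro!: continuous_intros derivative_eq_intros)

lemma C1g_unique: "C1g f G ==> cgrad f x = G x"
 using C1g_frechet[of f G x] by (simp add: cgrad_def euclidean_representation)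

lemma nn_integral_tendsto_0_imp_integral:
 fixes f :: "nat => 'b => real"
 assumes "\<And>k x. 0 <= f k x" "\<And>k. f k \<in> borel_measurable M" "(\<lambda>k. \<integral>\<^sup>+x. ennreal (f k x) \<partial>M) \<longlonglongrightarrow> 0"
 shows "(\<lambda>k. \<integral>x. f k x \<partial>M) \<longlonglongrightarrow> 0"
proof -
 have "(\<integral>x. f k x \<partial>M) = enn2real (\<integral>\<^sup>+x. ennreal (f k x) \<partial>M)" for k
  by (rule integral_eq_nn_integral) (use assms in auto)
 moreover have "(\<lambda>k. enn2real (\<integral>\<^sup>+x. ennreal (f k x) \<partial>M)) \<longlonglongrightarrow> 0"
  by (rule tendsto_enn2real) (use assms(3) in auto)
 ultimately show ?thesis by simp
qed

lemma le_eps_powr: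
 assumes "0 < (e::real)" "0 <= t" "1 <= p"
 shows "t <= e + e powr (1 - p) * t powr p"
proof (cases "t <= e")
 case True
 then show ?thesis using assms by (simp add: add_increasing2)
next
 case False
 then have t: "t > e" "t > 0" using assms by auto
 have "t = t powr (1 - p) * t powr p" using t by (simp add: powr_add[symmetric])
 also have "\<dots> <= e powr (1 - p) * t powr p" using t assms by (intro mult_right_mono powr_mono2') auto
 finally show ?thesis using assms by linarith
qed

lemma Lp_tendsto_imp_L1:
 fixes n :: "nat => 'a::euclidean_space => real"
 assumes [measurable]: "\<And>k. n k \<in> borel_measurable borel" "S \<in> sets borel" and S: "emeasure lborel S < \<infinity>"
  and n0: "\<And>k x. 0 <= n k x" and p: "1 <= p"
  and lim: "(\<lambda>k. LBNN x. ennreal (n k x powr p) * indicator S x) \<longlonglongrightarrow> 0"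
 shows "(\<lambda>k. LBNN x. ennreal (n k x) * indicator S x) \<longlonglongrightarrow> 0"
proof (rule order_tendstoI)
 fix a :: ennreal assume "a < 0" then show "\<forall>\<^sub>F k in sequentially. a < (LBNN x. ennreal (n k x) * indicator S x)" by simp
next
 fix a :: ennreal assume "0 < a"
 then obtain a' where a': "0 < a'" "a' < a" using dense by blast
 then obtain eps where eps: "eps > 0" "a' = ennreal eps"
  by (cases a') (auto simp: ennreal_less_zero_iff)
 define V where "V = measure lborel S"
 have V: "emeasure lborel S = ennreal V" unfolding V_def using S by (intro emeasure_eq_ennreal_measure) auto
 have V0: "V >= 0" by (simp add: V_def)
 define e where "e = eps / (2 * (V + 1))"
 have e: "e > 0" using eps V0 by (simp add: e_def)
 define c where "c = e powr (1 - p)"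
 have c: "c > 0" using e by (simp add: c_def)
 have "\<forall>\<^sub>F k in sequentially. (LBNN x. ennreal (n k x powr p) * indicator S x) < ennreal (eps / (2 * c))"
  using lim eps c by (intro order_tendstoD(2)[OF lim]) auto
 then show "\<forall>\<^sub>F k in sequentially. (LBNN x. ennreal (n k x) * indicator S x) < a"
 proof eventually_elim
  case (elim k)
  have "(LBNN x. ennreal (n k x) * indicator S x) <= (LBNN x. 1 * (ennreal e * indicator S x + ennreal c * (ennreal (n k x powr p) * indicator S x)))"
  proof (rule nn_integral_mono)
   fix x
   have "ennreal (n k x) <= ennreal (e + c * n k x powr p)"
    unfolding c_def by (intro ennreal_leI le_eps_powr e n0 p)
   also have "\<dots> = ennreal e + ennreal c * ennreal (n k x powr p)"
    using e c by (simp add: ennreal_plus ennreal_mult)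
   finally show "ennreal (n k x) * indicator S x <= 1 * (ennreal e * indicator S x + ennreal c * (ennreal (n k x powr p) * indicator S x))"
    by (cases "x \<in> S") auto
  qed
  also have "\<dots> = 1 * ((LBNN x. ennreal e * indicator S x) + (LBNN x. ennreal c * (ennreal (n k x powr p) * indicator S x)))"
   by (rule nn_integral_cmult_add2) measurable
  also have "(LBNN x. ennreal e * indicator S x) = ennreal (e * V)"
   using V V0 e by (subst nn_integral_cmult_indicator) (auto simp: ennreal_mult)
  also have "(LBNN x. ennreal c * (ennreal (n k x powr p) * indicator S x)) = ennreal c * (LBNN x. ennreal (n k x powr p) * indicator S x)"
   by (rule nn_integral_cmult) measurable
  also have "1 * (ennreal (e * V) + ennreal c * (LBNN x. ennreal (n k x powr p) * indicator S x)) <= ennreal (eps / 2) + ennreal c * ennreal (eps / (2 * c))"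
  proof -
   have "e * V <= eps / 2" using eps V0 by (simp add: e_def field_simps)
   then show ?thesis using elim by (simp add: add_mono ennreal_leI mult_left_mono less_imp_le)
  qed
  also have "\<dots> = ennreal (eps / 2 + c * (eps / (2 * c)))" using eps c by (subst ennreal_mult[symmetric]) (auto simp flip: ennreal_plus)
  also have "\<dots> = ennreal eps" using c by (simp add: field_simps)
  finally show ?case using a' eps by (auto intro: le_less_trans)
 qed
qed

lemma Lp_imp_L1_finite:
 fixes h :: "'a::euclidean_space => 'b::euclidean_space"
 assumes [measurable]: "h \<in> borel_measurable borel" "S \<in> sets borel" and S: "emeasure lborel S < \<infinity>" and p: "1 <= p"
  and fin: "(LBNN x. ennreal (norm (h x) powr p) * indicator S x) < \<infinity>"
 shows "(LBNN x. ennreal (norm (h x)) * indicator S x) < \<infinity>"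
proof -
 have "(LBNN x. ennreal (norm (h x)) * indicator S x) <= (LBNN x. 1 * (indicator S x + (ennreal (norm (h x) powr p) * indicator S x)))"
 proof (rule nn_integral_mono)
  fix x
  have "ennreal (norm (h x)) <= ennreal (1 + norm (h x) powr p)"
   using le_eps_powr[of 1 "norm (h x)" p] p by (intro ennreal_leI) auto
  then show "ennreal (norm (h x)) * indicator S x <= 1 * (indicator S x + (ennreal (norm (h x) powr p) * indicator S x))"
   by (cases "x \<in> S") (auto simp: ennreal_plus)
 qed
 also have "\<dots> = 1 * ((LBNN x. indicator S x) + (LBNN x. ennreal (norm (h x) powr p) * indicator S x))"
  by (rule nn_integral_cmult_add2) measurable
 also have "\<dots> < \<infinity>" using S fin by simp
 finally show ?thesis .
qed

lemma continuous_bounded_on_cball: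
 fixes H :: "'a::euclidean_space => 'b::real_normed_vector"
 assumes "continuous_on UNIV H"
 obtains B where "B > 0" "\<And>x. x \<in> cball x0 r ==> norm (H x) <= B"
proof -
 have "compact (H ` cball x0 r)"
  by (intro compact_continuous_image continuous_on_subset[OF assms]) auto
 then have "bounded (H ` cball x0 r)" by (rule compact_imp_bounded)
 then obtain B where B: "\<forall>y\<in>H ` cball x0 r. norm y <= B" unfolding bounded_iff by blast
 show ?thesis
 proof (rule that[of "max B 1"])
  fix x assume "x \<in> cball x0 r"
  then have "norm (H x) <= B" using B by blast
  then show "norm (H x) <= max B 1" by simp
 qed simp
qed

lemma sobC_ibp:
 fixes w \<psi> :: "'a::euclidean_space => real"
 assumes sob: "sobC p S (cball x0 r') a b w g" and p: "1 <= p" and S [measurable]: "S \<in> sets borel" and Sfin: "emeasure lborel S < \<infinity>"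
  and ZS: "cball x0 r' \<subseteq> S" and w0: "\<And>x. x \<notin> cball x0 r' ==> w x = 0" and g0: "\<And>x. x \<notin> cball x0 r' ==> g x = 0"
  and \<psi>: "C1g \<psi> G\<psi>"
 shows "(LBINT x. w x *\<^sub>R G\<psi> x) = - (LBINT x. \<psi> x *\<^sub>R g x)"
proof -
 let ?Z = "cball x0 r'"
 obtain wk Gk where w [measurable]: "w \<in> borel_measurable borel" and g [measurable]: "g \<in> borel_measurable borel"
  and wab: "\<And>x. w x \<in> {a..b}"
  and fin: "(LBNN x. ennreal (norm (g x) powr p) * indicator S x) < \<infinity>"
  and C1: "\<And>k. C1g (wk k) (Gk k)" and wkab: "\<And>k x. wk k x \<in> {a..b}" and wkZ: "\<And>k x. x \<notin> ?Z ==> wk k x = 0"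
  and AE: "AE x in lborel. x \<in> S --> (\<lambda>k. wk k x) \<longlonglongrightarrow> w x"
  and Lp: "(\<lambda>k. LBNN x. ennreal (norm (Gk k x - g x) powr p) * indicator S x) \<longlonglongrightarrow> 0"
  by (rule sobCE[OF sob]) (rule that)
 note [measurable] = C1g_borel[OF C1] C1g_borel[OF \<psi>]
 have Gk0: "Gk k x = 0" if "x \<notin> ?Z" for k x
  by (rule C1g_zero_open[OF C1, of "- ?Z"]) (use wkZ that in auto)
 obtain B1 where B1: "B1 > 0" "\<And>x. x \<in> ?Z ==> norm (G\<psi> x) <= B1"
  by (rule continuous_bounded_on_cball[OF C1g_cont(2)[OF \<psi>]]) (rule that)
 obtain B2 where B2: "B2 > 0" "\<And>x. x \<in> ?Z ==> norm (\<psi> x) <= B2"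
  by (rule continuous_bounded_on_cball[OF C1g_cont(1)[OF \<psi>]]) (rule that)
 define M where "M = max \<bar>a\<bar> \<bar>b\<bar>"
 have M: "\<bar>w x\<bar> <= M" "\<bar>wk k x\<bar> <= M" for x k using wab[of x] wkab[of k x] by (auto simp: M_def abs_le_iff)
 have M0: "M >= 0" by (simp add: M_def)
 have i1: "integrable lborel (\<lambda>x. wk k x *\<^sub>R G\<psi> x)" for k
  by (rule integrable_cont_compact_support[of _ ?Z])
   (use C1g_cont[OF C1] C1g_cont[OF \<psi>] wkZ in \<open>auto intro!: continuous_intros\<close>)
 have i2: "integrable lborel (\<lambda>x. \<psi> x *\<^sub>R Gk k x)" for k
  by (rule integrable_cont_compact_support[of _ ?Z])
   (use C1g_cont[OF C1] C1g_cont[OF \<psi>] Gk0 in \<open>auto intro!: continuous_intros\<close>)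
 have i3: "integrable lborel (\<lambda>x. \<psi> x *\<^sub>R g x)"
 proof (rule integrableI_bounded)
  have "(LBNN x. ennreal (norm (\<psi> x *\<^sub>R g x))) <= (LBNN x. ennreal B2 * (ennreal (norm (g x)) * indicator S x))"
  proof (rule nn_integral_mono)
   fix x
   show "ennreal (norm (\<psi> x *\<^sub>R g x)) <= ennreal B2 * (ennreal (norm (g x)) * indicator S x)"
    using B2(2)[of x] B2(1) ZS g0[of x]
    by (cases "x \<in> ?Z") (auto simp: ennreal_mult[symmetric] subset_iff intro!: ennreal_leI mult_right_mono)
  qed
  also have "\<dots> = ennreal B2 * (LBNN x. ennreal (norm (g x)) * indicator S x)" by (rule nn_integral_cmult) measurable
  also have "\<dots> < \<infinity>" using Lp_imp_L1_finite[OF g S Sfin p fin] by (simp add: ennreal_mult_less_top)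
  finally show "(LBNN x. ennreal (norm (\<psi> x *\<^sub>R g x))) < \<infinity>" .
 qed measurable
 have eq: "(LBINT x. wk k x *\<^sub>R G\<psi> x) = - (LBINT x. \<psi> x *\<^sub>R Gk k x)" for k
 proof -
  have "(LBINT x. wk k x *\<^sub>R G\<psi> x + \<psi> x *\<^sub>R Gk k x) = 0"
  proof (rule integral_gradient_eq_0[OF C1g_mult[OF C1 \<psi>], of "norm x0 + r'"])
   fix x :: 'a assume "norm x0 + r' < norm x"
   then have "x \<notin> ?Z" using norm_triangle_sub[of x x0] by (auto simp: dist_norm norm_minus_commute)
   then show "wk k x * \<psi> x = 0" using wkZ by simp
  qed
  then show ?thesis using i1 i2 by (simp add: add_eq_0_iff)
 qed
 have l1: "(\<lambda>k. LBINT x. wk k x *\<^sub>R G\<psi> x) \<longlonglongrightarrow> (LBINT x. w x *\<^sub>R G\<psi> x)"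
 proof (rule integral_dominated_convergence[where w = "\<lambda>x. M * B1 * indicator ?Z x"])
  show "integrable lborel (\<lambda>x. M * B1 * indicat_real ?Z x)"
   using emeasure_lborel_cball_finite[of x0 r'] by (intro integrable_mult_right) (simp add: less_top)
  show "AE x in lborel. norm (wk k x *\<^sub>R G\<psi> x) <= M * B1 * indicator ?Z x" for k
  proof (rule AE_I2)
   fix x
   show "norm (wk k x *\<^sub>R G\<psi> x) <= M * B1 * indicator ?Z x"
    using M(2)[of k x] B1(2)[of x] wkZ[of x k] M0 by (cases "x \<in> ?Z") (auto intro!: mult_mono)
  qed
  show "AE x in lborel. (\<lambda>k. wk k x *\<^sub>R G\<psi> x) \<longlonglongrightarrow> w x *\<^sub>R G\<psi> x"
   using AE
  proof eventually_elim
   case (elim x)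
   show ?case
   proof (cases "x \<in> ?Z")
    case True
    then show ?thesis using elim ZS by (intro tendsto_intros) auto
   next
    case False
    then show ?thesis using wkZ w0 by simp
   qed
  qed
 qed measurable
 have L1: "(\<lambda>k. LBNN x. ennreal (norm (Gk k x - g x)) * indicator S x) \<longlonglongrightarrow> 0"
  by (rule Lp_tendsto_imp_L1[OF _ S Sfin _ p Lp]) auto
 have l2: "(\<lambda>k. LBINT x. \<psi> x *\<^sub>R Gk k x) \<longlonglongrightarrow> (LBINT x. \<psi> x *\<^sub>R g x)"
 proof -
  have le: "ennreal (norm ((LBINT x. \<psi> x *\<^sub>R Gk k x) - (LBINT x. \<psi> x *\<^sub>R g x))) <= ennreal B2 * (LBNN x. ennreal (norm (Gk k x - g x)) * indicator S x)" for k
  proof -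
   have "ennreal (norm ((LBINT x. \<psi> x *\<^sub>R Gk k x) - (LBINT x. \<psi> x *\<^sub>R g x))) = ennreal (norm (LBINT x. \<psi> x *\<^sub>R Gk k x - \<psi> x *\<^sub>R g x))"
    using i2 i3 by simp
   also have "\<dots> <= (LBNN x. ennreal (norm (\<psi> x *\<^sub>R Gk k x - \<psi> x *\<^sub>R g x)))"
    using i2 i3 by (intro integral_norm_bound_ennreal) auto
   also have "\<dots> <= (LBNN x. ennreal B2 * (ennreal (norm (Gk k x - g x)) * indicator S x))"
   proof (rule nn_integral_mono)
    fix x
    have "\<psi> x *\<^sub>R Gk k x - \<psi> x *\<^sub>R g x = \<psi> x *\<^sub>R (Gk k x - g x)" by (simp add: algebra_simps)
    then show "ennreal (norm (\<psi> x *\<^sub>R Gk k x - \<psi> x *\<^sub>R g x)) <= ennreal B2 * (ennreal (norm (Gk k x - g x)) * indicator S x)"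
     using B2(2)[of x] B2(1) ZS g0[of x] Gk0[of x k]
     by (cases "x \<in> ?Z") (auto simp: ennreal_mult[symmetric] subset_iff intro!: ennreal_leI mult_right_mono)
   qed
   also have "\<dots> = ennreal B2 * (LBNN x. ennreal (norm (Gk k x - g x)) * indicator S x)"
    by (rule nn_integral_cmult) measurable
   finally show ?thesis .
  qed
  have "(\<lambda>k. ennreal B2 * (LBNN x. ennreal (norm (Gk k x - g x)) * indicator S x)) \<longlonglongrightarrow> ennreal B2 * 0"
   by (rule ennreal_tendsto_cmult[OF _ L1]) simp
  then have "(\<lambda>k. ennreal (norm ((LBINT x. \<psi> x *\<^sub>R Gk k x) - (LBINT x. \<psi> x *\<^sub>R g x)))) \<longlonglongrightarrow> 0"
   unfolding mult_zero_right
  proof (rule tendsto_sandwich[OF _ _ tendsto_const, rotated 2])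
   show "\<forall>\<^sub>F k in sequentially. ennreal (norm ((LBINT x. \<psi> x *\<^sub>R Gk k x) - (LBINT x. \<psi> x *\<^sub>R g x)))
     <= ennreal B2 * (LBNN x. ennreal (norm (Gk k x - g x)) * indicator S x)"
    by (intro always_eventually allI le)
  qed simp
  then have "(\<lambda>k. norm ((LBINT x. \<psi> x *\<^sub>R Gk k x) - (LBINT x. \<psi> x *\<^sub>R g x))) \<longlonglongrightarrow> 0"
   by (intro tendsto_ennrealD) auto
  then show ?thesis using LIM_zero_cancel tendsto_norm_zero_iff by blast
 qed
 have "(\<lambda>k. - (LBINT x. \<psi> x *\<^sub>R Gk k x)) \<longlonglongrightarrow> - (LBINT x. \<psi> x *\<^sub>R g x)" using l2 by (rule tendsto_minus)
 then have "(\<lambda>k. LBINT x. wk k x *\<^sub>R G\<psi> x) \<longlonglongrightarrow> - (LBINT x. \<psi> x *\<^sub>R g x)" unfolding eq .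
 then show ?thesis using l1 LIMSEQ_unique by blast
qed

lemma const_over_n_plus_2: "(\<lambda>k::nat. c / (real k + 2)) \<longlonglongrightarrow> 0"
 using LIMSEQ_ignore_initial_segment[OF lim_const_over_n[of c], of 2] by (simp add: add.commute)

definition mollk :: "real => 'a::euclidean_space => real" where
 "mollk e z = molly ((1/e) *\<^sub>R z)"

lemma mollk_smooth: "Ck_fun k (mollk e)"
 using Ck_fun_affine[OF molly_smooth, of k 1 0 "1/e"] by (simp add: mollk_def[abs_def])

lemma mollk_eq_0: "e > 0 ==> norm z >= e ==> mollk e z = 0"
 unfolding mollk_def by (rule molly_eq_0) (simp add: divide_simps)

lemma mollk_C1g: "C1g (mollk e) (cgrad (mollk e))"
 by (rule Ck_fun_imp_C1g[OF mollk_smooth])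

lemma moll_mollk:
 fixes f :: "'a::euclidean_space => 'b::euclidean_space"
 assumes "f \<in> borel_measurable borel" "e > 0"
 shows "moll e f x = (1 / e ^ DIM('a)) *\<^sub>R (LBINT y. mollk e (x - y) *\<^sub>R f y)"
 using moll_alt[OF assms] by (simp add: mollk_def)

lemma moll_C1g:
 fixes w :: "'a::euclidean_space => real"
 assumes w: "w \<in> borel_measurable borel" and M: "\<And>y. \<bar>w y\<bar> <= M" and e: "e > 0"
 shows "C1g (moll e w) (\<lambda>x. (1 / e ^ DIM('a)) *\<^sub>R (LBINT y. w y *\<^sub>R cgrad (mollk e) (x - y)))"
  and "Ck_fun k (moll e w)"
proof -
 have eq: "moll e w = (\<lambda>x. (1 / e ^ DIM('a)) * (LBINT y. mollk e (x - y) * w y))"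
  using moll_mollk[OF w e] by auto
 have z: "mollk e x = 0" if "norm x > e" for x :: 'a by (rule mollk_eq_0[OF e]) (use that in simp)
 show "C1g (moll e w) (\<lambda>x. (1 / e ^ DIM('a)) *\<^sub>R (LBINT y. w y *\<^sub>R cgrad (mollk e) (x - y)))"
  unfolding eq by (rule C1g_cmult[OF C1_conv[OF mollk_C1g z w M]])
 show "Ck_fun k (moll e w)"
  unfolding eq by (rule Ck_fun_mult[OF Ck_fun_const Ck_conv[OF mollk_smooth z w M]])
qed

lemma moll_grad:
 fixes w :: "'a::euclidean_space => real"
 assumes w: "w \<in> borel_measurable borel" and M: "\<And>y. \<bar>w y\<bar> <= M" and e: "e > 0" and g: "g \<in> borel_measurable borel"
  and ibp: "(LBINT y. w y *\<^sub>R (- cgrad (mollk e) (x - y))) = - (LBINT y. mollk e (x - y) *\<^sub>R g y)"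
 shows "cgrad (moll e w) x = moll e g x"
 using C1g_unique[OF moll_C1g(1)[OF w M e], of x] ibp moll_mollk[OF g e, of x] by simp

lemma moll_range:
 fixes w :: "'a::euclidean_space => real"
 assumes [measurable]: "w \<in> borel_measurable borel" and ab: "\<And>y. w y \<in> {a..b}"
 shows "moll e w x \<in> {a..b}"
proof -
 define M where "M = max \<bar>a\<bar> \<bar>b\<bar>"
 have M: "\<bar>w y\<bar> <= M" for y using ab[of y] by (auto simp: M_def abs_le_iff)
 have i: "integrable lborel (\<lambda>z. molly z * w (x - e *\<^sub>R z))"
  by (rule Bochner_Integration.integrable_bound[OF integrable_mult_right[OF molly_integrable, of M]])
   (auto simp: abs_mult molly_nonneg mult.commute[of _ "molly _"] intro!: mult_left_mono order_trans[OF M] AE_I2)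
 have le: "a * molly z <= molly z * w y" "molly z * w y <= b * molly z" for z y
  using mult_left_mono[of a "w y" "molly z"] mult_left_mono[of "w y" b "molly z"] ab[of y] molly_nonneg[of z]
  by (auto simp: mult.commute)
 have "a * 1 <= (LBINT z. molly z * w (x - e *\<^sub>R z))"
  unfolding molly_integral[where 'a='a, symmetric] integral_mult_right_zero[symmetric]
  by (rule integral_mono[OF integrable_mult_right[OF molly_integrable] i]) (rule le)
 moreover have "(LBINT z. molly z * w (x - e *\<^sub>R z)) <= b * 1"
  unfolding molly_integral[where 'a='a, symmetric] integral_mult_right_zero[symmetric]
  by (rule integral_mono[OF i integrable_mult_right[OF molly_integrable]]) (rule le)
 ultimately show ?thesis by (simp add: moll_def)
qed

lemma lebesgue_set_integral_borel:
 fixes f :: "'a::euclidean_space => 'b::{banach, second_countable_topology}"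
 assumes [measurable]: "(\<lambda>x. indicator U x *\<^sub>R f x) \<in> borel_measurable borel"
 shows "(LINT x:U|lebesgue. f x) = (LBINT x. indicator U x *\<^sub>R f x)"
 unfolding set_lebesgue_integral_def by (rule integral_completion) simp

lemma set_integrable_lebesgue_borel:
 fixes f :: "'a::euclidean_space => 'b::{banach, second_countable_topology}"
 assumes "integrable lborel f" "U \<in> sets borel"
 shows "set_integrable lebesgue U f"
proof -
 have i: "integrable lborel (\<lambda>x. indicator U x *\<^sub>R f x)"
  by (rule integrable_mult_indicator) (use assms in auto)
 then show ?thesis unfolding set_integrable_def
  by (subst integrable_completion) (auto dest: borel_measurable_integrable)
qed

lemma set_borel_measurable_lebesgue_borel:
 fixes f :: "'a::euclidean_space => real"
 assumes [measurable]: "f \<in> borel_measurable borel" "U \<in> sets borel"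
 shows "set_borel_measurable lebesgue U f"
 unfolding set_borel_measurable_def by (rule measurable_completion) measurable

lemma weak_grad_on_of_sobC:
 fixes \<phi> :: "'a::euclidean_space => real"
 assumes sob: "sobC p (ball x0 \<rho>) (cball x0 \<rho>') a b \<phi> h" and p: "1 <= p" and \<rho>: "\<rho>' < \<rho>"
  and \<phi>0: "\<And>x. x \<notin> cball x0 \<rho>' ==> \<phi> x = 0" and h0: "\<And>x. x \<notin> cball x0 \<rho>' ==> h x = 0"
 shows "integrable lborel \<phi>" "integrable lborel h" "weak_grad_on (ball x0 \<rho>) \<phi> h"
proof -
 let ?S = "ball x0 \<rho>" and ?Z = "cball x0 \<rho>'"
 have \<phi>b [measurable]: "\<phi> \<in> borel_measurable borel" and hb [measurable]: "h \<in> borel_measurable borel"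
  and \<phi>ab: "\<And>x. \<phi> x \<in> {a..b}"
  and fin: "(LBNN x. ennreal (norm (h x) powr p) * indicator ?S x) < \<infinity>"
  using sob unfolding sobC_def by blast+
 define M where "M = max \<bar>a\<bar> \<bar>b\<bar>"
 have M: "\<bar>\<phi> y\<bar> <= M" for y using \<phi>ab[of y] by (auto simp: M_def abs_le_iff)
 have M0: "M >= 0" by (simp add: M_def)
 have ZS: "?Z \<subseteq> ?S" using \<rho> by auto
 have Sfin: "emeasure lborel ?S < \<infinity>" using emeasure_lborel_ball_finite[of x0 \<rho>] by simp
 show i\<phi>: "integrable lborel \<phi>"
  by (rule integrable_bounded_compact_support[of _ M x0 \<rho>']) (use M \<phi>0 in auto)
 show ih: "integrable lborel h"
 proof (rule integrableI_bounded)
  have "(LBNN x. ennreal (norm (h x))) = (LBNN x. ennreal (norm (h x)) * indicator ?S x)"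
  proof (rule nn_integral_cong)
   fix x
   show "ennreal (norm (h x)) = ennreal (norm (h x)) * indicator ?S x"
    using h0[of x] ZS by (cases "x \<in> ?Z") auto
  qed
  then show "(LBNN x. ennreal (norm (h x))) < \<infinity>"
   using Lp_imp_L1_finite[OF hb _ Sfin p fin] by simp
 qed simp
 show "weak_grad_on ?S \<phi> h"
  unfolding weak_grad_on_def
 proof (intro conjI allI impI ballI)
  fix C assume C: "compact C \<and> C \<subseteq> ?S"
  then have [measurable]: "C \<in> sets borel" by (simp add: compact_imp_closed)
  show "set_integrable lebesgue C \<phi>"
   by (rule set_integrable_lebesgue_borel[OF i\<phi>]) measurable
  fix b :: 'a
  show "set_integrable lebesgue C (\<lambda>x. h x \<bullet> b)"
   by (rule set_integrable_lebesgue_borel[OF integrable_inner_left[OF ih]]) measurable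
 next
  fix \<psi> and b :: 'a assume \<psi>: "test_fun ?S \<psi>"
  then have "Ck_fun (Suc 0) \<psi>" unfolding test_fun_def smooth_fun_def by blast
  then have C1: "C1g \<psi> (cgrad \<psi>)" by (rule Ck_fun_imp_C1g)
  note [measurable] = C1g_borel[OF C1]
  have fd: "frechet_derivative \<psi> (at x) b = cgrad \<psi> x \<bullet> b" for x using C1g_frechet[OF C1] by simp
  obtain B1 where B1: "B1 > 0" "\<And>x. x \<in> ?Z ==> norm (cgrad \<psi> x) <= B1"
   by (rule continuous_bounded_on_cball[OF C1g_cont(2)[OF C1]]) (rule that)
  obtain B2 where B2: "B2 > 0" "\<And>x. x \<in> ?Z ==> norm (\<psi> x) <= B2"
   by (rule continuous_bounded_on_cball[OF C1g_cont(1)[OF C1]]) (rule that)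
  have i1: "integrable lborel (\<lambda>x. \<phi> x *\<^sub>R cgrad \<psi> x)"
  proof (rule integrable_bounded_compact_support[of _ "M * B1" x0 \<rho>'])
   show "norm (\<phi> y *\<^sub>R cgrad \<psi> y) <= M * B1" for y
    using M[of y] B1(2)[of y] B1(1) \<phi>0[of y] M0 by (cases "y \<in> ?Z") (auto intro!: mult_mono)
  qed (use \<phi>0 in auto)
  have i2: "integrable lborel (\<lambda>x. \<psi> x *\<^sub>R h x)"
  proof (rule Bochner_Integration.integrable_bound[OF integrable_scaleR_right[OF ih, of B2]])
   show "AE x in lborel. norm (\<psi> x *\<^sub>R h x) <= norm (B2 *\<^sub>R h x)"
   proof (rule AE_I2)
    fix x show "norm (\<psi> x *\<^sub>R h x) <= norm (B2 *\<^sub>R h x)"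
     using B2(2)[of x] B2(1) h0[of x] by (cases "x \<in> ?Z") (auto intro!: mult_right_mono)
   qed
  qed simp
  have "(LINT x:?S|lebesgue. \<phi> x * frechet_derivative \<psi> (at x) b) = (LBINT x. (\<phi> x *\<^sub>R cgrad \<psi> x) \<bullet> b)"
  proof -
   have "indicator ?S x *\<^sub>R (\<phi> x * (cgrad \<psi> x \<bullet> b)) = (\<phi> x *\<^sub>R cgrad \<psi> x) \<bullet> b" for x
    using \<phi>0[of x] ZS by (cases "x \<in> ?Z") auto
   then show ?thesis unfolding fd by (subst lebesgue_set_integral_borel) (simp_all only:, measurable)
  qed
  also have "\<dots> = (LBINT x. \<phi> x *\<^sub>R cgrad \<psi> x) \<bullet> b" by (rule integral_inner_left) (rule i1)
  also have "\<dots> = - ((LBINT x. \<psi> x *\<^sub>R h x) \<bullet> b)"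
   using sobC_ibp[OF sob p _ Sfin ZS \<phi>0 h0 C1] by simp
  also have "(LBINT x. \<psi> x *\<^sub>R h x) \<bullet> b = (LBINT x. (\<psi> x *\<^sub>R h x) \<bullet> b)"
   by (rule integral_inner_left[symmetric]) (rule i2)
  also have "\<dots> = (LINT x:?S|lebesgue. (h x \<bullet> b) * \<psi> x)"
  proof -
   have "indicator ?S x *\<^sub>R ((h x \<bullet> b) * \<psi> x) = (\<psi> x *\<^sub>R h x) \<bullet> b" for x
    using h0[of x] ZS by (cases "x \<in> ?Z") auto
   then show ?thesis by (subst lebesgue_set_integral_borel) (simp_all only:, measurable)
  qed
  finally show "(LINT x:?S|lebesgue. \<phi> x * frechet_derivative \<psi> (at x) b) = - (LINT x:?S|lebesgue. (h x \<bullet> b) * \<psi> x)" .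
 qed
qed

lemma set_lebesgue_Lp_tendsto_0:
 fixes f :: "nat => 'a::euclidean_space => real"
 assumes [measurable]: "\<And>k. f k \<in> borel_measurable borel" "U \<in> sets borel" and "\<And>k x. 0 <= f k x"
  and lim: "(\<lambda>k. LBNN x. ennreal (f k x)) \<longlonglongrightarrow> 0"
 shows "(\<lambda>k. LINT x:U|lebesgue. f k x) \<longlonglongrightarrow> 0"
proof -
 have "(\<lambda>k. LBINT x. indicator U x *\<^sub>R f k x) \<longlonglongrightarrow> 0"
 proof (rule nn_integral_tendsto_0_imp_integral)
  show "(\<lambda>k. LBNN x. ennreal (indicator U x *\<^sub>R f k x)) \<longlonglongrightarrow> 0"
  proof (rule tendsto_sandwich[OF _ _ tendsto_const lim])
   show "\<forall>\<^sub>F k in sequentially. (LBNN x. ennreal (indicator U x *\<^sub>R f k x)) <= (LBNN x. ennreal (f k x))"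
    by (intro always_eventually allI nn_integral_mono ennreal_leI) (use assms(3) in \<open>auto simp: indicator_def\<close>)
  qed simp
 qed (use assms(3) in auto)
 moreover have "(LINT x:U|lebesgue. f k x) = (LBINT x. indicator U x *\<^sub>R f k x)" for k
  by (rule lebesgue_set_integral_borel) measurable
 ultimately show ?thesis by simp
qed

lemma W1p0_of_sobC:
 fixes \<phi> :: "'a::euclidean_space => real"
 assumes sob: "sobC p (ball x0 \<rho>) (cball x0 \<rho>') a b \<phi> h" and p: "1 <= p" and \<rho>: "\<rho>' < \<rho>"
  and \<phi>0: "\<And>x. x \<notin> cball x0 \<rho>' ==> \<phi> x = 0" and h0: "\<And>x. x \<notin> cball x0 \<rho>' ==> h x = 0"
 shows "W1p0 p (ball x0 \<rho>) \<phi>"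
proof -
 let ?S = "ball x0 \<rho>" and ?Z = "cball x0 \<rho>'"
 have \<phi>b [measurable]: "\<phi> \<in> borel_measurable borel" and hb [measurable]: "h \<in> borel_measurable borel"
  and \<phi>ab: "\<And>x. \<phi> x \<in> {a..b}"
  and fin: "(LBNN x. ennreal (norm (h x) powr p) * indicator ?S x) < \<infinity>"
  using sob unfolding sobC_def by blast+
 define M where "M = max \<bar>a\<bar> \<bar>b\<bar>"
 have M: "\<bar>\<phi> y\<bar> <= M" for y using \<phi>ab[of y] by (auto simp: M_def abs_le_iff)
 have ZS: "?Z \<subseteq> ?S" using \<rho> by auto
 have Sfin: "emeasure lborel ?S < \<infinity>" using emeasure_lborel_ball_finite[of x0 \<rho>] by simp
 have iphi: "integrable lborel (\<lambda>x. \<bar>\<phi> x\<bar> powr p)"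
  by (rule integrable_bounded_compact_support[of _ "M powr p" x0 \<rho>']) (use M \<phi>0 p in \<open>auto intro!: powr_mono2\<close>)
 have finh: "(LBNN x. ennreal (norm (h x) powr p)) < \<infinity>"
 proof -
  have "(LBNN x. ennreal (norm (h x) powr p)) = (LBNN x. ennreal (norm (h x) powr p) * indicator ?S x)"
  proof (rule nn_integral_cong)
   fix x
   show "ennreal (norm (h x) powr p) = ennreal (norm (h x) powr p) * indicator ?S x"
    using h0[of x] ZS by (cases "x \<in> ?Z") auto
  qed
  then show ?thesis using fin by simp
 qed
 have ihp: "integrable lborel (\<lambda>x. norm (h x) powr p)" using finh by (intro integrableI_bounded) auto
 have fin\<phi>: "(LBNN x. ennreal (norm (\<phi> x) powr p)) < \<infinity>"
  using iphi by (simp add: integrable_iff_bounded)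
 define em where "em k = (\<rho> - \<rho>') / (real k + 2)" for k
 have em: "em k > 0" "em k < \<rho> - \<rho>'" for k using \<rho> by (auto simp: em_def divide_simps)
 have em0: "em \<longlonglongrightarrow> 0" unfolding em_def
  by (rule const_over_n_plus_2)
 have grad: "cgrad (moll (em k) \<phi>) x = moll (em k) h x" for k x
 proof (rule moll_grad[OF \<phi>b M em(1) hb])
  show "(LBINT y. \<phi> y *\<^sub>R (- cgrad (mollk (em k)) (x - y))) = - (LBINT y. mollk (em k) (x - y) *\<^sub>R h y)"
   by (rule sobC_ibp[OF sob p _ Sfin ZS \<phi>0 h0 C1g_reflect[OF mollk_C1g]]) auto
 qed
 have mb [measurable]: "moll (em k) \<phi> \<in> borel_measurable borel" "moll (em k) h \<in> borel_measurable borel" for k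
  by (rule moll_borel, fact)+
 show ?thesis
  unfolding W1p0_def
 proof (intro conjI exI[of _ h] exI[of _ "\<lambda>k. moll (em k) \<phi>"] allI impI)
  show "\<phi> x = 0" if "x \<notin> ?S" for x using that ZS \<phi>0 by blast
  show "Lp_on p ?S \<phi>" unfolding Lp_on_def
   by (intro conjI set_integrable_lebesgue_borel set_borel_measurable_lebesgue_borel iphi) auto
  show "Lp_on p ?S (\<lambda>x. norm (h x))" unfolding Lp_on_def
   by (intro conjI set_integrable_lebesgue_borel set_borel_measurable_lebesgue_borel) (use ihp in auto)
  show "weak_grad_on ?S \<phi> h" by (rule weak_grad_on_of_sobC[OF sob p \<rho> \<phi>0 h0])
  show "test_fun ?S (moll (em k) \<phi>)" for k
  proof -
   have "{x. moll (em k) \<phi> x \<noteq> 0} \<subseteq> cball x0 (\<rho>' + em k)"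
   proof
    fix x assume x: "x \<in> {x. moll (em k) \<phi> x \<noteq> 0}"
    show "x \<in> cball x0 (\<rho>' + em k)"
    proof (rule ccontr)
     assume n: "x \<notin> cball x0 (\<rho>' + em k)"
     have "moll (em k) \<phi> x = 0"
     proof (rule moll_supp[OF \<phi>0])
      fix y assume "y \<in> ?Z"
      then show "em k <= dist x y" using n dist_triangle[of x0 x y] by (auto simp: dist_commute)
     qed (use em in auto)
     then show False using x by simp
    qed
   qed
   then have cl: "closure {x. moll (em k) \<phi> x \<noteq> 0} \<subseteq> cball x0 (\<rho>' + em k)"
    by (rule closure_minimal) simp
   moreover have "cball x0 (\<rho>' + em k) \<subseteq> ?S" using em(2)[of k] by auto
   moreover have "compact (closure {x. moll (em k) \<phi> x \<noteq> 0})"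
    using cl by (meson bounded_cball bounded_subset closed_closure compact_eq_bounded_closed)
   ultimately show ?thesis unfolding test_fun_def smooth_fun_def
    using moll_C1g(2)[OF \<phi>b M em(1)] by blast
  qed
  show "(\<lambda>k. LINT x:?S|lebesgue. \<bar>moll (em k) \<phi> x - \<phi> x\<bar> powr p) \<longlonglongrightarrow> 0"
   using moll_Lp_tendsto[OF \<phi>b p fin\<phi> em(1) em0] by (intro set_lebesgue_Lp_tendsto_0) auto
  show "(\<lambda>k. LINT x:?S|lebesgue. norm (cgrad (moll (em k) \<phi>) x - h x) powr p) \<longlonglongrightarrow> 0"
   unfolding grad using moll_Lp_tendsto[OF hb p finh em(1) em0] by (intro set_lebesgue_Lp_tendsto_0) auto
 qed
qed

lemma sobC_of_weak_gradient:
 fixes u :: "'a::euclidean_space => real"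
 assumes u [measurable]: "u \<in> borel_measurable borel" and uab: "\<And>x. u x \<in> {a..b}"
  and g [measurable]: "g \<in> borel_measurable borel" and \<rho>: "\<rho> < \<rho>1" and p: "1 <= p"
  and fin: "(LBNN x. ennreal (norm (g x) powr p) * indicator (ball x0 \<rho>1) x) < \<infinity>"
  and weak: "\<And>\<psi> b. test_fun (ball x0 \<rho>1) \<psi> ==> b \<in> Basis ==>
    (LBINT x. u x * (cgrad \<psi> x \<bullet> b)) = - (LBINT x. (g x \<bullet> b) * \<psi> x)"
 shows "sobC p (ball x0 \<rho>) UNIV a b u g"
proof -
 let ?T = "ball x0 \<rho>1" and ?S = "ball x0 \<rho>"
 define M where "M = max \<bar>a\<bar> \<bar>b\<bar>"
 have M: "\<bar>u y\<bar> <= M" for y using uab[of y] by (auto simp: M_def abs_le_iff)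
 have M0: "M >= 0" by (simp add: M_def)
 define g1 where "g1 x = indicat_real ?T x *\<^sub>R g x" for x
 define u1 where "u1 x = indicat_real ?T x * u x" for x
 have [measurable]: "?T \<in> sets borel" "?S \<in> sets borel" by auto
 have g1b [measurable]: "g1 \<in> borel_measurable borel" unfolding g1_def by measurable
 have u1b [measurable]: "u1 \<in> borel_measurable borel" unfolding u1_def by measurable
 have fin1: "(LBNN x. ennreal (norm (g1 x) powr p)) < \<infinity>"
 proof -
  have "(LBNN x. ennreal (norm (g1 x) powr p)) = (LBNN x. ennreal (norm (g x) powr p) * indicator ?T x)"
   by (rule nn_integral_cong) (auto simp: g1_def indicator_def)
  then show ?thesis using fin by simp
 qed
 have Tfin: "emeasure lborel ?T < \<infinity>" using emeasure_lborel_ball_finite[of x0 \<rho>1] by simp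
 have ig1: "integrable lborel g1"
 proof (rule integrableI_bounded)
  have "(LBNN x. ennreal (norm (g1 x))) = (LBNN x. ennreal (norm (g x)) * indicator ?T x)"
   by (rule nn_integral_cong) (auto simp: g1_def indicator_def)
  then show "(LBNN x. ennreal (norm (g1 x))) < \<infinity>" using Lp_imp_L1_finite[OF g _ Tfin p fin] by simp
 qed simp
 have iu1: "integrable lborel u1"
  by (rule integrable_bounded_compact_support[of _ M x0 \<rho>1]) (use M M0 in \<open>auto simp: u1_def indicator_def\<close>)
 define em where "em k = (\<rho>1 - \<rho>) / (real k + 2)" for k :: nat
 have em: "em k > 0" "em k < \<rho>1 - \<rho>" for k using \<rho> by (auto simp: em_def divide_simps)
 have em0: "em \<longlonglongrightarrow> 0" unfolding em_def
  by (rule const_over_n_plus_2)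
 have grad: "cgrad (moll (em k) u) x = moll (em k) g1 x" if x: "x \<in> ?S" for k x
 proof (rule moll_grad[OF u M em(1) g1b])
  define \<psi> where "\<psi> y = mollk (em k) (x - y)" for y
  have C1: "C1g \<psi> (\<lambda>y. - cgrad (mollk (em k)) (x - y))" unfolding \<psi>_def by (rule C1g_reflect[OF mollk_C1g])
  note [measurable] = C1g_borel[OF C1]
  have \<psi>0: "\<psi> y = 0" if "y \<notin> cball x (em k)" for y
   unfolding \<psi>_def by (rule mollk_eq_0) (use em that in \<open>auto simp: dist_norm\<close>)
  have cb: "cball x (em k) \<subseteq> ?T"
  proof
   fix y assume "y \<in> cball x (em k)"
   then show "y \<in> ?T" using x em(2)[of k] dist_triangle[of x0 y x] by auto
  qed
  have test: "test_fun ?T \<psi>"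
  proof -
   have sm: "smooth_fun \<psi>" unfolding smooth_fun_def
    using Ck_fun_affine[OF mollk_smooth, where c = 1 and a = x and t = "-1"] by (simp add: \<psi>_def[abs_def])
   have cl: "closure {y. \<psi> y \<noteq> 0} \<subseteq> cball x (em k)"
   proof (rule closure_minimal)
    show "{y. \<psi> y \<noteq> 0} \<subseteq> cball x (em k)" using \<psi>0 by blast
   qed simp
   moreover have "compact (closure {y. \<psi> y \<noteq> 0})"
    using cl by (meson bounded_cball bounded_subset closed_closure compact_eq_bounded_closed)
   ultimately show ?thesis unfolding test_fun_def using sm cb by blast
  qed
  have cg: "cgrad \<psi> = (\<lambda>y. - cgrad (mollk (em k)) (x - y))" using C1g_unique[OF C1] by auto
  have G0: "cgrad \<psi> y = 0" if "y \<notin> cball x (em k)" for y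
   unfolding cg by (rule C1g_zero_open[OF C1, of "- cball x (em k)"]) (use \<psi>0 that in auto)
  have cont: "continuous_on UNIV \<psi>" "continuous_on UNIV (cgrad \<psi>)" using C1g_cont[OF C1] by (auto simp: cg)
  obtain B1 where B1: "B1 > 0" "\<And>y. y \<in> cball x (em k) ==> norm (cgrad \<psi> y) <= B1"
   by (rule continuous_bounded_on_cball[OF cont(2)]) (rule that)
  obtain B2 where B2: "B2 > 0" "\<And>y. y \<in> cball x (em k) ==> norm (\<psi> y) <= B2"
   by (rule continuous_bounded_on_cball[OF cont(1)]) (rule that)
  have [measurable]: "cgrad \<psi> \<in> borel_measurable borel" using C1g_borel[OF C1] by (simp add: cg)
  have i1: "integrable lborel (\<lambda>y. u y *\<^sub>R cgrad \<psi> y)"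
  proof (rule integrable_bounded_compact_support[of _ "M * B1" x "em k"])
   show "norm (u y *\<^sub>R cgrad \<psi> y) <= M * B1" for y
    using M[of y] B1(2)[of y] B1(1) G0[of y] M0 by (cases "y \<in> cball x (em k)") (auto intro!: mult_mono)
  qed (use G0 in auto)
  have i2: "integrable lborel (\<lambda>y. \<psi> y *\<^sub>R g1 y)"
  proof (rule Bochner_Integration.integrable_bound[OF integrable_scaleR_right[OF ig1, of B2]])
   show "AE y in lborel. norm (\<psi> y *\<^sub>R g1 y) <= norm (B2 *\<^sub>R g1 y)"
   proof (rule AE_I2)
    fix y show "norm (\<psi> y *\<^sub>R g1 y) <= norm (B2 *\<^sub>R g1 y)"
     using B2(2)[of y] B2(1) \<psi>0[of y] by (cases "y \<in> cball x (em k)") (auto intro!: mult_right_mono)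
   qed
  qed simp
  have "(LBINT y. u y *\<^sub>R cgrad \<psi> y) = - (LBINT y. \<psi> y *\<^sub>R g1 y)"
  proof (rule euclidean_eqI)
   fix b :: 'a assume b: "b \<in> Basis"
   have "(LBINT y. u y *\<^sub>R cgrad \<psi> y) \<bullet> b = (LBINT y. (u y *\<^sub>R cgrad \<psi> y) \<bullet> b)"
    by (rule integral_inner_left[symmetric]) (rule i1)
   also have "\<dots> = (LBINT y. u y * (cgrad \<psi> y \<bullet> b))" by simp
   also have "\<dots> = - (LBINT y. (g y \<bullet> b) * \<psi> y)" by (rule weak[OF test b])
   also have "(LBINT y. (g y \<bullet> b) * \<psi> y) = (LBINT y. (\<psi> y *\<^sub>R g1 y) \<bullet> b)"
   proof (rule Bochner_Integration.integral_cong[OF refl])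
    fix y show "(g y \<bullet> b) * \<psi> y = (\<psi> y *\<^sub>R g1 y) \<bullet> b"
     using \<psi>0[of y] cb by (cases "y \<in> cball x (em k)") (auto simp: g1_def indicator_def)
   qed
   also have "\<dots> = (LBINT y. \<psi> y *\<^sub>R g1 y) \<bullet> b" by (rule integral_inner_left) (rule i2)
   finally show "(LBINT y. u y *\<^sub>R cgrad \<psi> y) \<bullet> b = - (LBINT y. \<psi> y *\<^sub>R g1 y) \<bullet> b" by simp
  qed
  then show "(LBINT y. u y *\<^sub>R (- cgrad (mollk (em k)) (x - y))) = - (LBINT y. mollk (em k) (x - y) *\<^sub>R g1 y)"
   by (simp add: cg \<psi>_def)
 qed
 have mu: "moll (em k) u x = moll (em k) u1 x" if x: "x \<in> ?S" for k x
  unfolding moll_def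
 proof (rule Bochner_Integration.integral_cong[OF refl])
  fix z :: 'a
  show "molly z *\<^sub>R u (x - em k *\<^sub>R z) = molly z *\<^sub>R u1 (x - em k *\<^sub>R z)"
  proof (cases "norm z < 1")
   case True
   have "em k * norm z <= em k * 1" using True em(1)[of k] by (intro mult_left_mono) auto
   then have "dist x (x - em k *\<^sub>R z) <= em k" using em(1)[of k] by (simp add: dist_norm)
   then have "x - em k *\<^sub>R z \<in> ?T" using x em(2)[of k] dist_triangle[of x0 "x - em k *\<^sub>R z" x] by auto
   then show ?thesis by (simp add: u1_def)
  qed (simp add: molly_eq_0)
 qed
 have finu1: "(LBNN x. ennreal (norm (u1 x) powr 1)) < \<infinity>"
  using iu1 by (simp add: integrable_iff_bounded)
 have mb [measurable]: "moll (em k) u1 \<in> borel_measurable borel" "moll (em k) g1 \<in> borel_measurable borel" for k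
  by (rule moll_borel, fact)+
 have "\<exists>r::nat=>nat. strict_mono r \<and> (AE x in lborel. (\<lambda>n. moll (em (r n)) u1 x - u1 x) \<longlonglongrightarrow> 0)"
 proof (rule tendsto_L1_AE_subseq)
  show "integrable lborel (\<lambda>x. moll (em n) u1 x - u1 x)" for n
  proof (rule Bochner_Integration.integrable_diff[OF _ iu1], rule integrableI_bounded)
   show "(LBNN x. ennreal (norm (moll (em n) u1 x))) < \<infinity>"
    using moll_Lp_le[OF u1b, of 1 "em n"] finu1 by (simp add: le_less_trans)
  qed simp
  show "(\<lambda>n. LBINT x. norm (moll (em n) u1 x - u1 x)) \<longlonglongrightarrow> 0"
   using moll_Lp_tendsto[OF u1b _ finu1 em(1) em0] by (intro nn_integral_tendsto_0_imp_integral) auto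
 qed
 then obtain r :: "nat => nat" where r: "strict_mono r" and AE1: "AE x in lborel. (\<lambda>n. moll (em (r n)) u1 x - u1 x) \<longlonglongrightarrow> 0"
  by blast
 show ?thesis
  unfolding sobC_def
 proof (intro conjI exI[of _ "\<lambda>k. moll (em (r k)) u"] exI[of _ "\<lambda>k. cgrad (moll (em (r k)) u)"] allI impI)
  show "(LBNN x. ennreal (norm (g x) powr p) * indicator ?S x) < \<infinity>"
   using fin \<rho> by (elim le_less_trans[rotated]) (auto intro!: nn_integral_mono simp: indicator_def)
  show "C1g (moll (em (r k)) u) (cgrad (moll (em (r k)) u))" for k
   by (rule Ck_fun_imp_C1g[OF moll_C1g(2)[OF u M em(1)]])
  show "moll (em (r k)) u x \<in> {a..b}" for k x by (rule moll_range[OF u uab])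
  show "AE x in lborel. x \<in> ?S --> (\<lambda>k. moll (em (r k)) u x) \<longlonglongrightarrow> u x"
   using AE1
  proof (eventually_elim, intro impI)
   fix x assume l: "(\<lambda>n. moll (em (r n)) u1 x - u1 x) \<longlonglongrightarrow> 0" and x: "x \<in> ?S"
   have "u1 x = u x" using x \<rho> by (auto simp: u1_def indicator_def)
   moreover have "(\<lambda>n. moll (em (r n)) u1 x) \<longlonglongrightarrow> u1 x" using l by (rule LIM_zero_cancel)
   ultimately show "(\<lambda>k. moll (em (r k)) u x) \<longlonglongrightarrow> u x" using mu[OF x] by simp
  qed
  have "(\<lambda>k. LBNN x. ennreal (norm (moll (em k) g1 x - g1 x) powr p)) \<longlonglongrightarrow> 0"
   by (rule moll_Lp_tendsto[OF g1b p fin1 em(1) em0])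
  then have l: "(\<lambda>k. LBNN x. ennreal (norm (moll (em (r k)) g1 x - g1 x) powr p)) \<longlonglongrightarrow> 0"
   using LIMSEQ_subseq_LIMSEQ[OF _ r] by (force simp: o_def)
  show "(\<lambda>k. LBNN x. ennreal (norm (cgrad (moll (em (r k)) u) x - g x) powr p) * indicator ?S x) \<longlonglongrightarrow> 0"
  proof (rule tendsto_sandwich[OF _ _ tendsto_const l])
   show "\<forall>\<^sub>F k in sequentially. (LBNN x. ennreal (norm (cgrad (moll (em (r k)) u) x - g x) powr p) * indicator ?S x)
     <= (LBNN x. ennreal (norm (moll (em (r k)) g1 x - g1 x) powr p))"
   proof (intro always_eventually allI nn_integral_mono)
    fix k x
    show "ennreal (norm (cgrad (moll (em (r k)) u) x - g x) powr p) * indicator ?S x <= ennreal (norm (moll (em (r k)) g1 x - g1 x) powr p)"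
    proof (cases "x \<in> ?S")
     case True
     then have "g1 x = g x" using \<rho> by (auto simp: g1_def indicator_def)
     then show ?thesis using grad[OF True] True by simp
    qed simp
   qed
  qed simp
 qed (use uab in auto)
qed

subsection \<open>Integrals of power kernels\<close>

lemma dyadic_scale:
 fixes x :: real assumes "1 <= x"
 obtains j :: nat where "2 ^ j <= x" "x < 2 ^ Suc j"
proof -
 define n where "n = (LEAST n. x < 2 ^ n)"
 obtain n0 :: nat where "x < 2 ^ n0" using real_arch_pow[of 2 x] by auto
 then have n: "x < 2 ^ n" unfolding n_def by (rule LeastI)
 then have "n \<noteq> 0" using assms by (intro notI) simp
 then obtain j where j: "n = Suc j" using not0_implies_Suc by blast
 have "\<not> x < 2 ^ j" unfolding n_def using j n_def not_less_Least[of j "\<lambda>n. x < 2 ^ n"] by auto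
 then show ?thesis using that[of j] n j by auto
qed

lemma ennreal_term_le_suminf: "h j <= (\<Sum>i. h i :: ennreal)"
 using sum_le_suminf[of h "{j}"] by simp

lemma nn_integral_le_geometric:
 fixes f :: "'a::euclidean_space => ennreal"
 assumes le: "\<And>z. \<exists>j. f z <= ennreal (c * a ^ j) * indicator (cball 0 (b * t ^ j)) z"
  and pos: "0 <= c" "0 <= a" "0 <= b" "0 <= t" and r: "a * t ^ DIM('a) < 1"
 shows "(LBNN z. f z) < \<infinity>"
proof -
 let ?h = "\<lambda>j z. ennreal (c * a ^ j) * indicator (cball (0::'a) (b * t ^ j)) z"
 have [measurable]: "cball (0::'a) u \<in> sets borel" for u by simp
 have h: "integral\<^sup>N lborel (?h j) = ennreal (c * unit_ball_vol (real DIM('a)) * b ^ DIM('a) * (a * t ^ DIM('a)) ^ j)" for j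
 proof -
  have "integral\<^sup>N lborel (?h j) = ennreal (c * a ^ j) * emeasure lborel (cball (0::'a) (b * t ^ j))"
   by (rule nn_integral_cmult_indicator) simp
  also have "\<dots> = ennreal (c * a ^ j) * ennreal (unit_ball_vol (real DIM('a)) * (b * t ^ j) ^ DIM('a))"
   using pos by (subst emeasure_cball) auto
  also have "\<dots> = ennreal (c * a ^ j * (unit_ball_vol (real DIM('a)) * (b * t ^ j) ^ DIM('a)))"
   using pos by (intro ennreal_mult[symmetric]) auto
  also have "c * a ^ j * (unit_ball_vol (real DIM('a)) * (b * t ^ j) ^ DIM('a)) = c * unit_ball_vol (real DIM('a)) * b ^ DIM('a) * (a * t ^ DIM('a)) ^ j"
   by (simp add: power_mult_distrib power_mult[symmetric] mult_ac)
  finally show ?thesis .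
 qed
 have "(LBNN z. f z) <= (LBNN z. (\<Sum>j. ?h j z))"
 proof (rule nn_integral_mono)
  fix z
  obtain j where "f z <= ?h j z" using le by blast
  also have "\<dots> <= (\<Sum>j. ?h j z)" by (rule ennreal_term_le_suminf)
  finally show "f z <= (\<Sum>j. ?h j z)" .
 qed
 also have "\<dots> = (\<Sum>j. integral\<^sup>N lborel (?h j))" by (rule nn_integral_suminf) measurable
 also have "\<dots> = (\<Sum>j. ennreal (c * unit_ball_vol (real DIM('a)) * b ^ DIM('a) * (a * t ^ DIM('a)) ^ j))" by (simp only: h)
 also have "\<dots> = ennreal (\<Sum>j. c * unit_ball_vol (real DIM('a)) * b ^ DIM('a) * (a * t ^ DIM('a)) ^ j)"
  using pos r by (intro suminf_ennreal2 summable_mult summable_geometric) auto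
 finally show ?thesis by (rule le_less_trans) simp
qed

lemma nn_integral_kernel_near_pos:
 assumes "0 < \<beta>" "\<beta> < real DIM('a::euclidean_space)"
 shows "(LBNN z. ennreal (norm (z::'a) powr (-\<beta>)) * indicator (cball 0 1) z) < \<infinity>"
proof (rule nn_integral_le_geometric[where c = "2 powr \<beta>" and a = "2 powr \<beta>" and b = 1 and t = "1/2"])
 fix z :: 'a
 show "\<exists>j. ennreal (norm z powr (-\<beta>)) * indicator (cball 0 1) z <= ennreal (2 powr \<beta> * (2 powr \<beta>) ^ j) * indicator (cball 0 (1 * (1/2) ^ j)) z"
 proof (cases "z = 0 \<or> z \<notin> cball 0 1")
  case False
  then have z: "norm z > 0" "norm z <= 1" by auto
  obtain j where j: "2 ^ j <= 1 / norm z" "1 / norm z < 2 ^ Suc j"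
   using dyadic_scale[of "1 / norm z"] z by auto
  have "norm z powr (-\<beta>) = (1 / norm z) powr \<beta>" using z by (simp add: powr_minus powr_divide field_simps)
  also have "\<dots> <= (2 ^ Suc j) powr \<beta>" using j z assms by (intro powr_mono2) auto
  also have "\<dots> = 2 powr \<beta> * (2 powr \<beta>) ^ j"
   by (simp add: powr_mult powr_power powr_realpow[symmetric] powr_powr mult.commute)
  finally have "norm z powr (-\<beta>) <= 2 powr \<beta> * (2 powr \<beta>) ^ j" .
  moreover have "z \<in> cball 0 (1 * (1/2) ^ j)" using j(1) z by (simp add: power_divide field_simps)
  ultimately show ?thesis using False by (intro exI[of _ j]) (auto intro!: ennreal_leI)
 qed auto
 have "2 powr \<beta> * (1/2) ^ DIM('a) = 2 powr (\<beta> - real DIM('a))"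
  by (simp add: powr_diff powr_realpow power_divide)
 also have "\<dots> < 1" using powr_less_mono[of "\<beta> - real DIM('a)" 0 2] assms by simp
 finally show "2 powr \<beta> * (1/2) ^ DIM('a) < 1" .
qed auto

lemma nn_integral_kernel_near:
 assumes "\<beta> < real DIM('a::euclidean_space)"
 shows "(LBNN z. ennreal (norm (z::'a) powr (-\<beta>)) * indicator (cball 0 1) z) < \<infinity>"
proof -
 define \<gamma> where "\<gamma> = max \<beta> (1/2)"
 have "1 <= real DIM('a)" using DIM_positive[where 'a='a] by linarith
 then have "1/2 < real DIM('a)" by linarith
 then have "0 < \<gamma>" "\<gamma> < real DIM('a)" using assms by (auto simp: \<gamma>_def)
 then have "(LBNN z. ennreal (norm (z::'a) powr (-\<gamma>)) * indicator (cball 0 1) z) < \<infinity>"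
  by (rule nn_integral_kernel_near_pos)
 moreover have "(LBNN z. ennreal (norm (z::'a) powr (-\<beta>)) * indicator (cball 0 1) z)
   <= (LBNN z. ennreal (norm (z::'a) powr (-\<gamma>)) * indicator (cball 0 1) z)"
 proof (rule nn_integral_mono)
  fix z :: 'a
  show "ennreal (norm z powr (-\<beta>)) * indicator (cball 0 1) z <= ennreal (norm z powr (-\<gamma>)) * indicator (cball 0 1) z"
   by (cases "z \<in> cball 0 1") (auto intro!: ennreal_leI powr_mono' simp: \<gamma>_def)
 qed
 ultimately show ?thesis by (rule le_less_trans[rotated])
qed

lemma nn_integral_kernel_far:
 assumes "0 < a"
 shows "(LBNN z. ennreal (norm (z::'a::euclidean_space) powr (-(real DIM('a) + a))) * indicator (- ball 0 1) z) < \<infinity>"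
proof (rule nn_integral_le_geometric[where c = 1 and a = "2 powr (-(real DIM('a) + a))" and b = 2 and t = 2])
 let ?q = "-(real DIM('a) + a)"
 fix z :: 'a
 show "\<exists>j. ennreal (norm z powr ?q) * indicator (- ball 0 1) z <= ennreal (1 * (2 powr ?q) ^ j) * indicator (cball 0 (2 * 2 ^ j)) z"
 proof (cases "z \<in> ball 0 1")
  case False
  then have z: "norm z >= 1" by auto
  obtain j where j: "2 ^ j <= norm z" "norm z < 2 ^ Suc j" using dyadic_scale[OF z] by blast
  have "norm z powr ?q <= (2 ^ j) powr ?q" using j z assms by (intro powr_mono2') auto
  also have "\<dots> = (2 powr ?q) ^ j"
   by (simp add: powr_power powr_realpow[symmetric] powr_powr mult.commute)
  finally show ?thesis using False j by (intro exI[of _ j]) (auto intro!: ennreal_leI)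
 qed auto
 have "2 powr ?q * 2 ^ DIM('a) = 2 powr (-a)"
  by (simp add: powr_realpow[symmetric] powr_add[symmetric])
 also have "\<dots> < 1" using powr_less_mono[of "- a" 0 2] assms by simp
 finally show "2 powr ?q * 2 ^ DIM('a) < 1" .
qed auto

lemma nonlocal_kernel_integral:
 assumes "1 < p" "0 < s" "s < 1"
 obtains C where "C > 0" "\<And>L. L > 0 ==>
  (LBNN z. ennreal (min 1 (L * norm (z::'a::euclidean_space)) powr p * norm z powr (-(real DIM('a) + p * s)))) <= ennreal (C * L powr (p * s))"
proof -
 let ?q = "-(real DIM('a) + p * s)"
 let ?h = "\<lambda>z::'a. ennreal (min 1 (norm z) powr p * norm z powr ?q)"
 have ps: "0 < p * s" "p * s < p" using assms by auto
 have [measurable]: "- ball (0::'a) 1 \<in> sets borel" "cball (0::'a) 1 \<in> sets borel" by auto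
 have "integral\<^sup>N lborel ?h <= (LBNN z. 1 * (ennreal (norm (z::'a) powr (-(real DIM('a) + p * s - p))) * indicator (cball 0 1) z + ennreal (norm z powr ?q) * indicator (- ball 0 1) z))"
 proof (rule nn_integral_mono)
  fix z :: 'a
  show "?h z <= 1 * (ennreal (norm z powr (-(real DIM('a) + p * s - p))) * indicator (cball 0 1) z + ennreal (norm z powr ?q) * indicator (- ball 0 1) z)"
   using ps by (cases "norm z < 1") (auto simp: min_def powr_add[symmetric] algebra_simps)
 qed
 also have "\<dots> = 1 * ((LBNN z. ennreal (norm (z::'a) powr (-(real DIM('a) + p * s - p))) * indicator (cball 0 1) z) + (LBNN z. ennreal (norm (z::'a) powr ?q) * indicator (- ball 0 1) z))"
  by (rule nn_integral_cmult_add2) measurable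
 also have "\<dots> < \<infinity>" using nn_integral_kernel_near[of "real DIM('a) + p * s - p", where 'a='a] nn_integral_kernel_far[OF ps(1), where 'a='a] ps by simp
 finally obtain C0 where C0: "integral\<^sup>N lborel ?h = ennreal C0" "C0 >= 0" by (cases "integral\<^sup>N lborel ?h") auto
 show ?thesis
 proof (rule that[of "C0 + 1"])
  fix L :: real assume L: "L > 0"
  have "(LBNN z. ennreal (min 1 (L * norm (z::'a)) powr p * norm z powr ?q))
   = ennreal (\<bar>1/L\<bar> ^ DIM('a)) * (LBNN z. ennreal (min 1 (L * norm (0 + (1/L) *\<^sub>R (z::'a))) powr p * norm (0 + (1/L) *\<^sub>R z) powr ?q))"
   using L by (intro nn_integral_lborel_affine) auto
  also have "(LBNN z. ennreal (min 1 (L * norm (0 + (1/L) *\<^sub>R (z::'a))) powr p * norm (0 + (1/L) *\<^sub>R z) powr ?q))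
   = (LBNN z. ennreal (L powr (- ?q)) * ?h z)"
  proof (rule nn_integral_cong)
   fix z :: 'a
   have "norm (0 + (1/L) *\<^sub>R z) powr q = L powr (- q) * norm z powr q" for q
    using L by (simp add: powr_divide powr_minus field_simps)
   from this[of ?q] show "ennreal (min 1 (L * norm (0 + (1/L) *\<^sub>R z)) powr p * norm (0 + (1/L) *\<^sub>R z) powr ?q) = ennreal (L powr (- ?q)) * ?h z"
    using L by (simp add: ennreal_mult[symmetric] mult_ac)
  qed
  also have "\<dots> = ennreal (L powr (- ?q)) * integral\<^sup>N lborel ?h" by (rule nn_integral_cmult) measurable
  also have "\<dots> = ennreal (L powr (- ?q)) * ennreal C0" by (simp only: C0)
  also have "ennreal (\<bar>1/L\<bar> ^ DIM('a)) * (ennreal (L powr (- ?q)) * ennreal C0) = ennreal ((1/L) ^ DIM('a) * (L powr (- ?q) * C0))"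
   using L C0 by (simp add: ennreal_mult)
  also have "(1/L) ^ DIM('a) * (L powr (- ?q) * C0) = C0 * L powr (p * s)"
   using L by (simp add: powr_add powr_realpow power_divide)
  also have "ennreal (C0 * L powr (p * s)) <= ennreal ((C0 + 1) * L powr (p * s))"
   by (intro ennreal_leI mult_right_mono) auto
  finally show "(LBNN z. ennreal (min 1 (L * norm (z::'a)) powr p * norm z powr ?q)) <= ennreal ((C0 + 1) * L powr (p * s))" .
 qed (use C0 in auto)
qed

lemma riesz_kernel_integral:
 assumes "\<beta> < real DIM('a::euclidean_space)"
 obtains C where "C > 0" "\<And>T. T > 0 ==>
  (LBNN z. ennreal (norm (z::'a) powr (-\<beta>)) * indicator (cball 0 T) z) <= ennreal (C * T powr (real DIM('a) - \<beta>))"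
proof -
 let ?h = "\<lambda>z::'a. ennreal (norm z powr (-\<beta>)) * indicator (cball 0 1) z"
 have [measurable]: "cball (0::'a) u \<in> sets borel" for u by simp
 obtain C0 where C0: "integral\<^sup>N lborel ?h = ennreal C0" "C0 >= 0"
  using nn_integral_kernel_near[OF assms] by (cases "integral\<^sup>N lborel ?h") auto
 show ?thesis
 proof (rule that[of "C0 + 1"])
  fix T :: real assume T: "T > 0"
  have "(LBNN z. ennreal (norm (z::'a) powr (-\<beta>)) * indicator (cball 0 T) z)
   = ennreal (\<bar>T\<bar> ^ DIM('a)) * (LBNN z. ennreal (norm (0 + T *\<^sub>R (z::'a)) powr (-\<beta>)) * indicator (cball 0 T) (0 + T *\<^sub>R z))"
   by (rule nn_integral_lborel_affine, measurable) (use T in simp)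
  also have "(LBNN z. ennreal (norm (0 + T *\<^sub>R (z::'a)) powr (-\<beta>)) * indicator (cball 0 T) (0 + T *\<^sub>R z))
   = (LBNN z. ennreal (T powr (-\<beta>)) * ?h z)"
   using T by (intro nn_integral_cong) (auto simp: powr_mult ennreal_mult indicator_def mult_le_cancel_left2)
  also have "\<dots> = ennreal (T powr (-\<beta>)) * ennreal C0" by (subst nn_integral_cmult) (auto simp: C0)
  also have "ennreal (\<bar>T\<bar> ^ DIM('a)) * (ennreal (T powr (-\<beta>)) * ennreal C0) = ennreal (T ^ DIM('a) * (T powr (-\<beta>) * C0))"
   using T C0 by (simp add: ennreal_mult)
  also have "T ^ DIM('a) * (T powr (-\<beta>) * C0) = C0 * T powr (real DIM('a) - \<beta>)"
   using T by (simp add: powr_diff powr_minus powr_realpow field_simps)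
  also have "ennreal (C0 * T powr (real DIM('a) - \<beta>)) <= ennreal ((C0 + 1) * T powr (real DIM('a) - \<beta>))"
   by (intro ennreal_leI mult_right_mono) auto
  finally show "(LBNN z. ennreal (norm (z::'a) powr (-\<beta>)) * indicator (cball 0 T) z) <= ennreal ((C0 + 1) * T powr (real DIM('a) - \<beta>))" .
 qed (use C0 in auto)
qed

subsection \<open>Sobolev and Poincare inequalities\<close>

lemma C1g_segment_bound:
 assumes "C1g f G" and T: "T >= 0"
 shows "ennreal \<bar>f (x + T *\<^sub>R z) - f x\<bar> <= (LBNN t. ennreal (norm (G (x + t *\<^sub>R z)) * norm z) * indicator {0..T} t)"
proof -
 have cont: "continuous_on {0..T} (\<lambda>t. G (x + t *\<^sub>R z) \<bullet> z)"
  by (intro continuous_intros continuous_on_compose2[OF C1g_cont(2)[OF assms(1)]]) auto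
 have D: "((\<lambda>t. f (x + t *\<^sub>R z)) has_vector_derivative G (x + t *\<^sub>R z) \<bullet> z) (at t within {0..T})" for t
 proof -
  have "((\<lambda>t. x + t *\<^sub>R z) has_derivative (\<lambda>s. s *\<^sub>R z)) (at t within {0..T})"
   by (auto intro!: derivative_eq_intros)
  from has_derivative_compose[OF this C1g_D[OF assms(1)]]
  show ?thesis by (simp add: has_vector_derivative_def)
 qed
 have "(LBINT t. indicator {0..T} t *\<^sub>R (G (x + t *\<^sub>R z) \<bullet> z)) = f (x + T *\<^sub>R z) - f (x + 0 *\<^sub>R z)"
  by (rule integral_FTC_atLeastAtMost[OF T D cont])
 then have "ennreal \<bar>f (x + T *\<^sub>R z) - f x\<bar> = ennreal (norm (LBINT t. indicator {0..T} t *\<^sub>R (G (x + t *\<^sub>R z) \<bullet> z)))" by simp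
 also have "\<dots> <= (LBNN t. ennreal (norm (indicator {0..T} t *\<^sub>R (G (x + t *\<^sub>R z) \<bullet> z))))"
  using borel_integrable_compact[OF _ cont] by (intro integral_norm_bound_ennreal) auto
 also have "\<dots> <= (LBNN t. ennreal (norm (G (x + t *\<^sub>R z)) * norm z) * indicator {0..T} t)"
  by (intro nn_integral_mono) (auto simp: indicator_def intro!: ennreal_leI Cauchy_Schwarz_ineq2)
 finally show ?thesis .
qed

lemma C1g_riesz_bound:
 fixes f :: "'a::euclidean_space => real"
 assumes f: "C1g f G" and supp: "\<And>x. x \<notin> ball x0 \<rho> ==> f x = 0" and \<rho>: "\<rho> > 0"
 shows "ennreal (unit_ball_vol (real DIM('a)) * (2 ^ DIM('a) - 1) * \<bar>f x\<bar>)
  <= ennreal (2 ^ DIM('a)) * (LBNN y. ennreal (norm (G y) * norm (y - x) powr (1 - real DIM('a))) * indicator (cball 0 (4 * \<rho>)) (y - x))"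
proof (cases "x \<in> ball x0 \<rho>")
 case False
 then show ?thesis using supp by simp
next
 case True
 have [measurable]: "G \<in> borel_measurable borel" using C1g_borel[OF f] by simp
 define A where "A = cball (0::'a) 2 - ball 0 1"
 have [measurable]: "A \<in> sets borel" "cball (0::'a) (4 * \<rho>) \<in> sets borel" by (simp_all add: A_def)
 let ?N = "DIM('a)"
 have eA: "emeasure lborel A = ennreal (unit_ball_vol (real ?N) * (2 ^ ?N - 1))"
 proof -
  have "emeasure lborel A = emeasure lborel (cball (0::'a) 2) - emeasure lborel (ball (0::'a) 1)"
   unfolding A_def using emeasure_lborel_ball_finite[of "0::'a" 1] by (intro emeasure_Diff) auto
  also have "\<dots> = ennreal (unit_ball_vol (real ?N) * 2 ^ ?N) - ennreal (unit_ball_vol (real ?N))"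
   by (simp add: emeasure_cball emeasure_ball)
  also have "\<dots> = ennreal (unit_ball_vol (real ?N) * 2 ^ ?N - unit_ball_vol (real ?N))"
   by (rule ennreal_minus) simp
  finally show ?thesis by (simp add: algebra_simps)
 qed
 let ?I = "\<lambda>t. indicator {0..2*\<rho>} t :: ennreal"
 have bd: "ennreal \<bar>f x\<bar> * indicator A z <= (LBNN t. indicator A z * (ennreal (2 * norm (G (x + t *\<^sub>R z))) * ?I t))" for z
 proof (cases "z \<in> A")
  case True': True
  then have z: "1 <= norm z" "norm z <= 2" by (auto simp: A_def)
  have "x + (2*\<rho>) *\<^sub>R z \<notin> ball x0 \<rho>"
  proof
   assume "x + (2*\<rho>) *\<^sub>R z \<in> ball x0 \<rho>"
   then have "dist x (x + (2*\<rho>) *\<^sub>R z) < 2 * \<rho>" using True dist_triangle[of x "x + (2*\<rho>) *\<^sub>R z" x0] by (simp add: dist_commute)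
   moreover have "dist x (x + (2*\<rho>) *\<^sub>R z) = 2 * \<rho> * norm z" using \<rho> by (simp add: dist_norm)
   moreover have "2 * \<rho> * 1 <= 2 * \<rho> * norm z" using \<rho> z by (intro mult_left_mono) auto
   ultimately show False by linarith
  qed
  then have "ennreal \<bar>f x\<bar> = ennreal \<bar>f (x + (2*\<rho>) *\<^sub>R z) - f x\<bar>" using supp by simp
  also have "\<dots> <= (LBNN t. ennreal (norm (G (x + t *\<^sub>R z)) * norm z) * ?I t)"
   using \<rho> by (intro C1g_segment_bound[OF f]) auto
  also have "\<dots> <= (LBNN t. ennreal (2 * norm (G (x + t *\<^sub>R z))) * ?I t)"
   using z by (intro nn_integral_mono mult_right_mono ennreal_leI) (auto simp: mult.commute intro!: mult_right_mono)
  finally show ?thesis using True' by simp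
 qed simp
 have "ennreal (unit_ball_vol (real ?N) * (2 ^ ?N - 1) * \<bar>f x\<bar>) = ennreal \<bar>f x\<bar> * emeasure lborel A"
  by (simp add: eA ennreal_mult mult_ac)
 also have "\<dots> = (LBNN z. ennreal \<bar>f x\<bar> * indicator A z)" by (rule nn_integral_cmult_indicator[symmetric]) simp
 also have "\<dots> <= (LBNN z. LBNN t. indicator A z * (ennreal (2 * norm (G (x + t *\<^sub>R z))) * ?I t))"
  by (intro nn_integral_mono bd)
 also have "\<dots> = (LBNN t. LBNN z. indicator A z * (ennreal (2 * norm (G (x + t *\<^sub>R z))) * ?I t))"
  by (rule lborel_pair.Fubini') measurable
 also have "\<dots> = (LBNN t. LBNN y. ennreal (1 / t ^ ?N) * (indicator A ((1/t) *\<^sub>R (y - x)) * (ennreal (2 * norm (G y)) * ?I t)))"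
 proof (rule nn_integral_cong_AE)
  have "AE t in lborel. t \<noteq> (0::real)" by (rule AE_lborel_singleton)
  then show "AE t in lborel. (LBNN z. indicator A z * (ennreal (2 * norm (G (x + t *\<^sub>R z))) * ?I t))
   = (LBNN y. ennreal (1 / t ^ ?N) * (indicator A ((1/t) *\<^sub>R (y - x)) * (ennreal (2 * norm (G y)) * ?I t)))"
  proof eventually_elim
   case (elim t)
   show ?case
   proof (cases "t \<in> {0..2*\<rho>}")
    case True
    then have t: "t > 0" using elim by auto
    have "(LBNN y. ennreal (1 / t ^ ?N) * (indicator A ((1/t) *\<^sub>R (y - x)) * (ennreal (2 * norm (G y)) * ?I t)))
     = ennreal (1 / t ^ ?N) * (LBNN y. (indicator A ((1/t) *\<^sub>R (y - x)) * (ennreal (2 * norm (G y)) * ?I t)))"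
     by (rule nn_integral_cmult) measurable
    also have "(LBNN y. (indicator A ((1/t) *\<^sub>R (y - x)) * (ennreal (2 * norm (G y)) * ?I t)))
     = ennreal (\<bar>t\<bar> ^ ?N) * (LBNN z. (indicator A ((1/t) *\<^sub>R (x + t *\<^sub>R z - x)) * (ennreal (2 * norm (G (x + t *\<^sub>R z))) * ?I t)))"
     using t by (intro nn_integral_lborel_affine) auto
    also have "ennreal (1 / t ^ ?N) * (ennreal (\<bar>t\<bar> ^ ?N) * (LBNN z. (indicator A ((1/t) *\<^sub>R (x + t *\<^sub>R z - x)) * (ennreal (2 * norm (G (x + t *\<^sub>R z))) * ?I t))))
     = (LBNN z. indicator A z * (ennreal (2 * norm (G (x + t *\<^sub>R z))) * ?I t))"
     using t by (simp add: mult.assoc[symmetric] ennreal_mult[symmetric])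
    finally show ?thesis ..
   qed simp
  qed
 qed
 also have "\<dots> = (LBNN y. LBNN t. ennreal (1 / t ^ ?N) * (indicator A ((1/t) *\<^sub>R (y - x)) * (ennreal (2 * norm (G y)) * ?I t)))"
  by (rule lborel_pair.Fubini') measurable
 also have "\<dots> <= (LBNN y. ennreal (2 ^ ?N) * (ennreal (norm (G y) * norm (y - x) powr (1 - real ?N)) * indicator (cball 0 (4 * \<rho>)) (y - x)))"
 proof (rule nn_integral_mono)
  fix y
  define D where "D = norm (y - x)"
  have D0: "D >= 0" by (simp add: D_def)
  define c where "c = (if D = 0 \<or> D > 4 * \<rho> then 0 else (2 / D) ^ ?N * (2 * norm (G y)))"
  have c0: "c >= 0" using D0 by (simp add: c_def)
  have "(LBNN t. ennreal (1 / t ^ ?N) * (indicator A ((1/t) *\<^sub>R (y - x)) * (ennreal (2 * norm (G y)) * ?I t)))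
   <= (LBNN t. ennreal c * indicator {D/2..D} t)"
  proof (rule nn_integral_mono)
   fix t :: real
   show "ennreal (1 / t ^ ?N) * (indicator A ((1/t) *\<^sub>R (y - x)) * (ennreal (2 * norm (G y)) * ?I t)) <= ennreal c * indicator {D/2..D} t"
   proof (cases "(1/t) *\<^sub>R (y - x) \<in> A \<and> t \<in> {0..2*\<rho>}")
    case True
    then have "1 <= norm ((1/t) *\<^sub>R (y - x))" "norm ((1/t) *\<^sub>R (y - x)) <= 2" "0 <= t" "t <= 2 * \<rho>" by (auto simp: A_def)
    moreover then have t: "t > 0" by (cases "t = 0") auto
    ultimately have "t <= D" "D <= 2 * t" by (auto simp: D_def divide_simps)
    then have "D \<noteq> 0" "\<not> D > 4 * \<rho>" "D > 0" "t \<in> {D/2..D}" using t \<open>t <= 2 * \<rho>\<close> by auto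
    moreover have "1 / t ^ ?N <= (2 / D) ^ ?N"
    proof -
     have "(1 / t) ^ ?N <= (2 / D) ^ ?N" using t \<open>D <= 2 * t\<close> \<open>D > 0\<close> by (intro power_mono) (auto simp: field_simps)
     then show ?thesis by (simp add: power_divide)
    qed
    moreover have "1 / t ^ ?N * (2 * norm (G y)) <= (2 / D) ^ ?N * (2 * norm (G y))"
     using calculation by (intro mult_right_mono) auto
    ultimately show ?thesis using True t
     by (auto simp: c_def ennreal_mult[symmetric] intro!: ennreal_leI)
   qed auto
  qed
  also have "\<dots> = ennreal c * emeasure lborel {D/2..D}" by (rule nn_integral_cmult_indicator) simp
  also have "\<dots> = ennreal (c * (D/2))" using D0 c0 by (simp add: ennreal_mult[symmetric])
  also have "c * (D/2) <= 2 ^ ?N * (norm (G y) * D powr (1 - real ?N)) * (if D <= 4 * \<rho> then 1 else 0)"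
  proof (cases "D = 0 \<or> D > 4 * \<rho>")
   case False
   then have D: "D > 0" using D0 by auto
   then have "D powr (1 - real ?N) = D / D ^ ?N" by (simp add: powr_diff powr_realpow)
   then have "c * (D/2) = 2 ^ ?N * (norm (G y) * D powr (1 - real ?N))"
    using False D by (simp add: c_def power_divide)
   then show ?thesis using False by simp
  qed (auto simp: c_def)
  also have "ennreal (2 ^ ?N * (norm (G y) * D powr (1 - real ?N)) * (if D <= 4 * \<rho> then 1 else 0))
   = ennreal (2 ^ ?N) * (ennreal (norm (G y) * norm (y - x) powr (1 - real ?N)) * indicator (cball 0 (4 * \<rho>)) (y - x))"
   by (auto simp: D_def ennreal_mult indicator_def)
  finally show "(LBNN t. ennreal (1 / t ^ ?N) * (indicator A ((1/t) *\<^sub>R (y - x)) * (ennreal (2 * norm (G y)) * ?I t)))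
   <= ennreal (2 ^ ?N) * (ennreal (norm (G y) * norm (y - x) powr (1 - real ?N)) * indicator (cball 0 (4 * \<rho>)) (y - x))"
   using ennreal_leI by blast
 qed
 also have "\<dots> = ennreal (2 ^ ?N) * (LBNN y. ennreal (norm (G y) * norm (y - x) powr (1 - real ?N)) * indicator (cball 0 (4 * \<rho>)) (y - x))"
  by (rule nn_integral_cmult) measurable
 finally show ?thesis .
qed

lemma weighted_amgm3:
 fixes x y z :: real
 assumes "0 <= x" "0 <= y" "0 <= z" and t: "0 < a" "0 < b" "0 < c" "a + b + c = 1"
 shows "x powr a * y powr b * z powr c <= a * x + b * y + c * z"
proof (cases "x = 0 \<or> y = 0 \<or> z = 0")
 case True
 then show ?thesis using assms by auto
next
 case False
 then have pos: "x > 0" "y > 0" "z > 0" using assms by auto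
 define \<sigma> where "\<sigma> = b + c"
 have \<sigma>: "\<sigma> > 0" "a + \<sigma> = 1" using t by (auto simp: \<sigma>_def)
 define w where "w = y powr (b / \<sigma>) * z powr (c / \<sigma>)"
 have w: "w > 0" using pos by (simp add: w_def)
 have "b / \<sigma> + c / \<sigma> = 1" using \<sigma> by (simp add: \<sigma>_def add_divide_distrib[symmetric])
 then have "w <= b / \<sigma> * y + c / \<sigma> * z" unfolding w_def
  using pos t \<sigma> by (intro Youngs_inequality_0) auto
 then have "\<sigma> * w <= \<sigma> * (b / \<sigma> * y + c / \<sigma> * z)" using \<sigma> by (intro mult_left_mono) auto
 then have ws: "\<sigma> * w <= b * y + c * z" using \<sigma> by (simp add: distrib_left)
 have "w powr \<sigma> = y powr b * z powr c" using \<sigma> pos by (simp add: w_def powr_mult powr_powr)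
 then have "x powr a * y powr b * z powr c = x powr a * w powr \<sigma>" by simp
 also have "\<dots> <= a * x + \<sigma> * w" using pos t \<sigma> w by (intro Youngs_inequality_0) auto
 finally show ?thesis using ws by linarith
qed

lemma young_convolution_bound:
 fixes G :: "'a::euclidean_space => 'b::euclidean_space" and k :: "'a => real"
 assumes [measurable]: "G \<in> borel_measurable borel" "k \<in> borel_measurable borel" and k0: "\<And>z. 0 <= k z"
  and p: "1 < p" "p < Q" and m: "1 / m = 1 - 1 / p + 1 / Q" and A: "0 < A" "(LBNN y. ennreal (k (y - x) powr m)) <= ennreal A"
  and D: "integrable lborel (\<lambda>y. norm (G y) powr p)" and X: "(LBNN y. ennreal (k (y - x) powr m * norm (G y) powr p)) = ennreal X" "0 <= X"
 shows "(LBNN y. ennreal (norm (G y) * k (y - x))) <= ennreal (X powr (1/Q) * A powr (1 - 1/p) * (LBINT y. norm (G y) powr p) powr (1/p - 1/Q))"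
proof -
 have "1 / p < 1" "1 / Q > 0" using p by auto
 then have "1 / m > 0" unfolding m by linarith
 then have m0: "m > 0" by simp
 define d where "d = (LBINT y. norm (G y) powr p)"
 have dn: "(LBNN y. ennreal (norm (G y) powr p)) = ennreal d"
  unfolding d_def using D by (intro nn_integral_eq_integral) auto
 have d0: "d >= 0" unfolding d_def by (intro integral_nonneg_AE) auto
 show ?thesis
 proof (cases "X = 0")
  case True
  then have "AE y in lborel. ennreal (k (y - x) powr m * norm (G y) powr p) = 0"
   using X(1) by (intro nn_integral_0_iff_AE[THEN iffD1]) auto
  then have "AE y in lborel. ennreal (norm (G y) * k (y - x)) = 0"
  proof eventually_elim
   case (elim y)
   then have "k (y - x) powr m * norm (G y) powr p = 0"
    by (metis ennreal_eq_0_iff mult_nonneg_nonneg order_antisym powr_ge_zero)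
   then show ?case by auto
  qed
  then have "(LBNN y. ennreal (norm (G y) * k (y - x))) = 0"
   by (subst nn_integral_0_iff_AE) auto
  then show ?thesis by simp
 next
  case False
  then have X0: "X > 0" using X by simp
  have "d \<noteq> 0"
  proof
   assume "d = 0"
   then have "AE y in lborel. ennreal (norm (G y) powr p) = 0" using dn by (intro nn_integral_0_iff_AE[THEN iffD1]) auto
   then have "AE y in lborel. ennreal (k (y - x) powr m * norm (G y) powr p) = 0" by eventually_elim auto
   then have "(LBNN y. ennreal (k (y - x) powr m * norm (G y) powr p)) = 0" by (subst nn_integral_0_iff_AE) auto
   then show False using X X0 by simp
  qed
  then have dp: "d > 0" using d0 by simp
  define a b c where "a = 1 / Q" and "b = 1 - 1 / p" and "c = 1 / p - 1 / Q"
  have abc: "a > 0" "b > 0" "c > 0" using p by (auto simp: a_def b_def c_def divide_simps)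
  have abc4: "a + b + c = 1" by (simp add: a_def b_def c_def)
  define W where "W = X powr a * A powr b * d powr c"
  have W0: "W > 0" using X0 A dp by (simp add: W_def)
  have "(LBNN y. ennreal (norm (G y) * k (y - x)))
   <= (LBNN y. ennreal W * (ennreal (a / X) * ennreal (k (y - x) powr m * norm (G y) powr p)
      + (ennreal (b / A) * ennreal (k (y - x) powr m) + ennreal (c / d) * ennreal (norm (G y) powr p))))"
  proof (rule nn_integral_mono)
   fix y
   define K g where "K = k (y - x) powr m" and "g = norm (G y) powr p"
   have Kg: "K >= 0" "g >= 0" by (auto simp: K_def g_def)
   have e1: "k (y - x) = K powr (a + b)"
   proof -
    have "m * (a + b) = 1" using m m0 by (simp add: a_def b_def field_simps)
    then show ?thesis using k0[of "y - x"] by (simp add: K_def powr_powr)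
   qed
   have e2: "norm (G y) = g powr (a + c)"
   proof -
    have "p * (a + c) = 1" using p by (simp add: a_def c_def)
    then show ?thesis by (simp add: g_def powr_powr)
   qed
   have "norm (G y) * k (y - x) = (K * g) powr a * K powr b * g powr c"
    unfolding e1 e2 using Kg by (simp add: powr_add powr_mult)
   also have "\<dots> = W * ((K * g / X) powr a * (K / A) powr b * (g / d) powr c)"
    using X0 A dp Kg by (simp add: W_def powr_divide)
   also have "\<dots> <= W * (a * (K * g / X) + b * (K / A) + c * (g / d))"
    using X0 A dp Kg W0 abc abc4 by (intro mult_left_mono weighted_amgm3) auto
   also have "\<dots> = W * (a / X * (K * g) + (b / A * K + c / d * g))" by (simp add: field_simps)
   finally have "ennreal (norm (G y) * k (y - x)) <= ennreal (W * (a / X * (K * g) + (b / A * K + c / d * g)))" by (rule ennreal_leI)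
   also have "\<dots> = ennreal W * (ennreal (a / X) * ennreal (K * g) + (ennreal (b / A) * ennreal K + ennreal (c / d) * ennreal g))"
   proof -
    have n: "0 <= a / X" "0 <= b / A" "0 <= c / d" "0 <= K * g" "0 <= W" using X0 A dp Kg W0 abc by auto
    show ?thesis using n Kg by (simp only: ennreal_mult ennreal_plus mult_nonneg_nonneg add_nonneg_nonneg)
   qed
   finally show "ennreal (norm (G y) * k (y - x)) <= ennreal W * (ennreal (a / X) * ennreal (k (y - x) powr m * norm (G y) powr p)
      + (ennreal (b / A) * ennreal (k (y - x) powr m) + ennreal (c / d) * ennreal (norm (G y) powr p)))"
    by (simp only: K_def g_def)
  qed
  also have "\<dots> = ennreal W * ((LBNN y. ennreal (a / X) * ennreal (k (y - x) powr m * norm (G y) powr p))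
    + ((LBNN y. ennreal (b / A) * ennreal (k (y - x) powr m)) + (LBNN y. ennreal (c / d) * ennreal (norm (G y) powr p))))"
   by (rule nn_integral_cmult_add3) measurable
  also have "\<dots> = ennreal W * (ennreal (a / X) * ennreal X + (ennreal (b / A) * (LBNN y. ennreal (k (y - x) powr m)) + ennreal (c / d) * ennreal d))"
   by (subst nn_integral_cmult, measurable, subst nn_integral_cmult, measurable, subst nn_integral_cmult, measurable) (simp add: X dn)
  also have "\<dots> <= ennreal W * (ennreal (a / X) * ennreal X + (ennreal (b / A) * ennreal A + ennreal (c / d) * ennreal d))"
   by (intro mult_left_mono add_mono order_refl A) auto
  also have "\<dots> = ennreal W * ennreal (a + b + c)"
   using X0 A dp abc by (simp add: ennreal_mult[symmetric] ennreal_plus[symmetric] add.assoc del: ennreal_plus)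
  finally show ?thesis using abc4 by (simp add: W_def a_def b_def c_def d_def)
 qed
qed

lemma sobolev_C1:
 fixes p \<kappa> :: real
 assumes p: "1 < p" and \<kappa>: "1 < \<kappa>" and sub: "real DIM('a::euclidean_space) * (1 - 1 / \<kappa>) < p" and N2: "2 <= DIM('a)"
 obtains S where "S > 0" "\<And>(x0::'a) \<rho> f G. \<rho> > 0 ==> C1g f G ==> (\<And>x. x \<notin> ball x0 \<rho> ==> f x = 0) ==>
   (LBINT x. \<bar>f x\<bar> powr (\<kappa> * p)) powr (1 / \<kappa>) <= S * \<rho> powr (p - real DIM('a) * (1 - 1 / \<kappa>)) * (LBINT x. norm (G x) powr p)"
proof -
 let ?N = "real DIM('a)"
 define Q where "Q = \<kappa> * p"
 have "Q > p" using p \<kappa> by (simp add: Q_def)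
 then have Q: "Q > p" "Q > 1" using p by auto
 define im where "im = 1 - 1 / p + 1 / Q"
 have im: "im > 0" using p Q unfolding im_def by (simp add: add_pos_pos)
 define m where "m = 1 / im"
 have m0: "m > 0" using im by (simp add: m_def)
 have mi: "1 / m = 1 - 1 / p + 1 / Q" by (simp add: m_def im_def)
 have N0: "?N >= 2" using N2 by linarith
 have sub2: "(?N - 1) * m < ?N"
 proof -
  have "(1 - 1 / \<kappa>) / p < 1 / ?N" using sub p N0 by (simp add: field_simps)
  moreover have "im = 1 - (1 - 1 / \<kappa>) / p" using p \<kappa> by (simp add: im_def Q_def field_simps)
  ultimately have "im > 1 - 1 / ?N" by linarith
  then have "(?N - 1) < ?N * im" using N0 by (simp add: field_simps)
  then show ?thesis using im by (simp add: m_def field_simps)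
 qed
 obtain C where C: "C > 0" "\<And>T. T > 0 ==> (LBNN z. ennreal (norm (z::'a) powr (-((?N - 1) * m))) * indicator (cball 0 T) z) <= ennreal (C * T powr (?N - (?N - 1) * m))"
  using riesz_kernel_integral[OF sub2] by blast
 define v where "v = unit_ball_vol ?N * (2 ^ DIM('a) - 1)"
 have "(2::real) ^ DIM('a) > 1" using N2 by (intro one_less_power) auto
 then have v: "v > 0" unfolding v_def by (intro mult_pos_pos) auto
 define R where "R = 2 ^ DIM('a) / v"
 have R0: "R > 0" using v by (simp add: R_def)
 define e where "e = ?N - (?N - 1) * m"
 define S where "S = R powr p * (C * 4 powr e) powr (p / m)"
 have S0: "S > 0" using R0 C by (simp add: S_def)
 show ?thesis
 proof (rule that[OF S0])
  fix x0 :: 'a and \<rho> f G assume \<rho>: "\<rho> > (0::real)" and f: "C1g f G" and supp: "\<And>x. x \<notin> ball x0 \<rho> ==> f x = 0"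
  note [measurable] = C1g_borel[OF f]
  have G0: "G x = 0" if "x \<notin> cball x0 \<rho>" for x
   by (rule C1g_zero_open[OF f, of "- cball x0 \<rho>"]) (use supp that in auto)
  have contG: "continuous_on UNIV (\<lambda>x. norm (G x) powr p)"
   using C1g_cont(2)[OF f] p by (intro continuous_on_powr' continuous_intros) auto
  have D: "integrable lborel (\<lambda>x. norm (G x) powr p)"
   by (rule integrable_cont_compact_support[OF contG, of "cball x0 \<rho>"]) (use G0 in auto)
  define d where "d = (LBINT x. norm (G x) powr p)"
  have d0: "d >= 0" unfolding d_def by (intro integral_nonneg_AE) auto
  have dn: "(LBNN y. ennreal (norm (G y) powr p)) = ennreal d"
   unfolding d_def using D by (intro nn_integral_eq_integral) auto
  define T where "T = 4 * \<rho>"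
  have T: "T > 0" using \<rho> by (simp add: T_def)
  define k where "k z = norm (z::'a) powr (1 - ?N) * indicator (cball 0 T) z" for z
  have [measurable]: "cball (0::'a) T \<in> sets borel" by simp
  have [measurable]: "k \<in> borel_measurable borel" unfolding k_def by measurable
  have k0: "k z >= 0" for z by (simp add: k_def)
  define A where "A = C * T powr e"
  have A0: "A > 0" using C T by (simp add: A_def)
  have kA: "(LBNN z. ennreal (k z powr m)) <= ennreal A"
  proof -
   have "k z powr m = norm z powr (-((?N - 1) * m)) * indicator (cball 0 T) z" for z
    using m0 by (cases "z \<in> cball 0 T") (auto simp: k_def powr_powr algebra_simps)
   then have "(LBNN z. ennreal (k z powr m)) = (LBNN z. ennreal (norm (z::'a) powr (-((?N - 1) * m))) * indicator (cball 0 T) z)"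
    by (intro nn_integral_cong) (auto simp: indicator_def)
   then show ?thesis using C(2)[OF T] by (simp add: A_def e_def)
  qed
  have kAx: "(LBNN y. ennreal (k (y - x) powr m)) <= ennreal A" for x
   using nn_integral_lborel_affine[of "\<lambda>y. ennreal (k y powr m)" 1 "- x"] kA by simp
  have kAy: "(LBNN x. ennreal (k (y - x) powr m)) <= ennreal A" for y
   using nn_integral_lborel_affine[of "\<lambda>y. ennreal (k y powr m)" "-1" y] kA by simp
  define Xn where "Xn x = (LBNN y. ennreal (k (y - x) powr m * norm (G y) powr p))" for x
  have XnD: "(LBNN x. Xn x) <= ennreal (A * d)"
  proof -
   have "(LBNN x. Xn x) = (LBNN y. LBNN x. ennreal (k (y - x) powr m * norm (G y) powr p))"
    unfolding Xn_def by (rule lborel_pair.Fubini') measurable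
   also have "\<dots> <= (LBNN y. ennreal A * ennreal (norm (G y) powr p))"
   proof (rule nn_integral_mono)
    fix y
    have "(LBNN x. ennreal (k (y - x) powr m * norm (G y) powr p)) = (LBNN x. ennreal (k (y - x) powr m) * ennreal (norm (G y) powr p))"
     by (simp add: ennreal_mult)
    also have "\<dots> = (LBNN x. ennreal (k (y - x) powr m)) * ennreal (norm (G y) powr p)"
     by (rule nn_integral_multc) measurable
    also have "\<dots> <= ennreal A * ennreal (norm (G y) powr p)" by (intro mult_right_mono kAy) auto
    finally show "(LBNN x. ennreal (k (y - x) powr m * norm (G y) powr p)) <= ennreal A * ennreal (norm (G y) powr p)" .
   qed
   also have "\<dots> = ennreal A * ennreal d" by (subst nn_integral_cmult) (auto simp: dn)
   finally show ?thesis using A0 d0 by (simp add: ennreal_mult)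
  qed
  define E where "E = R powr Q * (A powr (1 - 1/p) * d powr (1/p - 1/Q)) powr Q"
  have E0: "E >= 0" by (simp add: E_def)
  have pt: "ennreal (\<bar>f x\<bar> powr Q) <= ennreal E * Xn x" for x
  proof -
   obtain B where B: "B > 0" "\<And>y. y \<in> cball x0 \<rho> ==> norm (G y) <= B"
    by (rule continuous_bounded_on_cball[OF C1g_cont(2)[OF f]]) (rule that)
   have "Xn x <= (LBNN y. ennreal (B powr p) * ennreal (k (y - x) powr m))"
    unfolding Xn_def
   proof (rule nn_integral_mono)
    fix y
    have "norm (G y) powr p <= B powr p" using B(2)[of y] G0[of y] p by (cases "y \<in> cball x0 \<rho>") (auto intro!: powr_mono2)
    then show "ennreal (k (y - x) powr m * norm (G y) powr p) <= ennreal (B powr p) * ennreal (k (y - x) powr m)"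
     by (simp add: ennreal_mult[symmetric] mult.commute ennreal_leI mult_right_mono)
   qed
   also have "\<dots> = ennreal (B powr p) * (LBNN y. ennreal (k (y - x) powr m))" by (rule nn_integral_cmult) measurable
   also have "\<dots> <= ennreal (B powr p) * ennreal A" by (intro mult_left_mono kAx) auto
   finally have "Xn x < \<infinity>" by (rule le_less_trans) (simp add: ennreal_mult[symmetric] A0 less_imp_le)
   then obtain X where X: "Xn x = ennreal X" "X >= 0" by (cases "Xn x") auto
   have "ennreal (v * \<bar>f x\<bar>) <= ennreal (2 ^ DIM('a)) * (LBNN y. ennreal (norm (G y) * norm (y - x) powr (1 - ?N)) * indicator (cball 0 (4 * \<rho>)) (y - x))"
    unfolding v_def by (rule C1g_riesz_bound[OF f _ \<rho>]) (rule supp)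
   also have "(LBNN y. ennreal (norm (G y) * norm (y - x) powr (1 - ?N)) * indicator (cball 0 (4 * \<rho>)) (y - x))
     = (LBNN y. ennreal (norm (G y) * k (y - x)))"
    by (intro nn_integral_cong) (auto simp: k_def T_def indicator_def)
   also have "\<dots> <= ennreal (X powr (1/Q) * A powr (1 - 1/p) * d powr (1/p - 1/Q))"
    unfolding d_def using p Q mi A0 kAx D X unfolding Xn_def
    by (intro young_convolution_bound[where m = m] k0) auto
   finally have "ennreal (v * \<bar>f x\<bar>) <= ennreal (2 ^ DIM('a)) * ennreal (X powr (1/Q) * A powr (1 - 1/p) * d powr (1/p - 1/Q))"
    by (simp add: mult_left_mono)
   then have "v * \<bar>f x\<bar> <= 2 ^ DIM('a) * (X powr (1/Q) * A powr (1 - 1/p) * d powr (1/p - 1/Q))"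
    using v by (simp add: ennreal_mult[symmetric] ennreal_le_iff)
   then have "\<bar>f x\<bar> <= R * (X powr (1/Q) * (A powr (1 - 1/p) * d powr (1/p - 1/Q)))"
    using v by (simp add: R_def field_simps)
   then have "\<bar>f x\<bar> powr Q <= (R * (X powr (1/Q) * (A powr (1 - 1/p) * d powr (1/p - 1/Q)))) powr Q"
    using Q by (intro powr_mono2) auto
   also have "\<dots> = E * X" using Q X R0 by (simp add: E_def powr_mult powr_powr mult_ac)
   finally show ?thesis using X E0 by (simp add: ennreal_mult[symmetric] ennreal_leI)
  qed
  have [measurable]: "Xn \<in> borel_measurable borel" unfolding Xn_def[abs_def] by measurable
  have "(LBNN x. ennreal (\<bar>f x\<bar> powr Q)) <= (LBNN x. ennreal E * Xn x)" by (intro nn_integral_mono pt)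
  also have "\<dots> = ennreal E * (LBNN x. Xn x)" by (rule nn_integral_cmult) measurable
  also have "\<dots> <= ennreal E * ennreal (A * d)" by (intro mult_left_mono XnD) auto
  also have "\<dots> = ennreal (E * (A * d))" using E0 A0 d0 by (simp add: ennreal_mult)
  finally have "(LBINT x. \<bar>f x\<bar> powr Q) <= E * (A * d)"
   using E0 A0 d0 by (subst integral_eq_nn_integral) (auto intro!: enn2real_leI)
  then have "(LBINT x. \<bar>f x\<bar> powr Q) powr (1/\<kappa>) <= (E * (A * d)) powr (1/\<kappa>)"
   using \<kappa> by (intro powr_mono2) (auto intro!: integral_nonneg_AE)
  also have "\<dots> = R powr p * A powr (p / m) * d"
  proof -
   have q1: "Q * (1 - 1/p) * (1/\<kappa>) + 1/\<kappa> = p / m"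
   proof -
    have "p / m = p * (1 / m)" by simp
    also have "\<dots> = p * (1 - 1/p + 1/Q)" by (simp only: mi)
    finally have "p / m = p * (1 - 1/p + 1/Q)" .
    then show ?thesis using p \<kappa> by (simp add: Q_def field_simps)
   qed
   have q2: "Q * (1/p - 1/Q) * (1/\<kappa>) + 1/\<kappa> = 1" using p \<kappa> by (simp add: Q_def field_simps)
   have split: "(R powr Q * (A powr \<alpha> * d powr \<beta>) powr Q * (A * d)) powr t
     = R powr (Q * t) * A powr (Q * \<alpha> * t + t) * d powr (Q * \<beta> * t + t)" for \<alpha> \<beta> t
    using A0 d0 R0 by (simp add: powr_mult powr_powr powr_add mult.commute mult.left_commute)
   have "(E * (A * d)) powr (1/\<kappa>) = R powr (Q * (1/\<kappa>)) * A powr (Q * (1 - 1/p) * (1/\<kappa>) + 1/\<kappa>) * d powr (Q * (1/p - 1/Q) * (1/\<kappa>) + 1/\<kappa>)"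
    unfolding E_def by (rule split)
   also have "\<dots> = R powr p * A powr (p / m) * d" unfolding q1 q2 using d0 \<kappa> by (simp add: Q_def)
   finally show ?thesis .
  qed
  also have "A powr (p / m) = (C * 4 powr e) powr (p / m) * \<rho> powr (p - ?N * (1 - 1 / \<kappa>))"
  proof -
   have "e * (p / m) = p - ?N * (1 - 1 / \<kappa>)"
   proof -
    have "e * (p / m) = p * (?N * (1 / m) - (?N - 1))" using m0 by (simp add: e_def field_simps)
    also have "\<dots> = p - ?N * (1 - 1 / \<kappa>)" unfolding mi using p \<kappa> by (simp add: Q_def field_simps)
    finally show ?thesis .
   qed
   moreover have "A = (C * 4 powr e) * \<rho> powr e" using \<rho> by (simp add: A_def T_def powr_mult)
   ultimately show ?thesis using C \<rho> by (simp add: powr_mult powr_powr)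
  qed
  finally show "(LBINT x. \<bar>f x\<bar> powr (\<kappa> * p)) powr (1 / \<kappa>) <= S * \<rho> powr (p - ?N * (1 - 1 / \<kappa>)) * (LBINT x. norm (G x) powr p)"
   by (simp add: Q_def S_def d_def mult_ac)
 qed
qed

lemma poincare_C1:
 fixes w :: "'a::euclidean_space => real"
 assumes w: "C1g w G" and \<rho>: "\<rho> > 0"
 shows "(LBNN x. LBNN y. ennreal \<bar>w x - w y\<bar> * indicator (ball x0 \<rho>) x * indicator (ball x0 \<rho>) y)
  <= ennreal (2 * \<rho> * 2 ^ DIM('a)) * emeasure lborel (ball x0 \<rho>) * (LBNN x. ennreal (norm (G x)) * indicator (ball x0 \<rho>) x)"
proof -
 let ?B = "ball x0 \<rho>" and ?N = "DIM('a)"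
 note [measurable] = C1g_borel[OF w]
 have [measurable]: "?B \<in> sets borel" by simp
 let ?i = "\<lambda>x. indicator ?B x :: ennreal"
 let ?J = "(LBNN x. ennreal (norm (G x)) * ?i x)"
 have conv: "(1 - t) *\<^sub>R x + t *\<^sub>R y \<in> ?B" if "x \<in> ?B" "y \<in> ?B" "0 <= t" "t <= 1" for x y t
  using convexD_alt[OF convex_ball[of x0 \<rho>]] that by blast
 have aff: "(LBNN y. ennreal (norm (G (a + t *\<^sub>R y))) * ?i (a + t *\<^sub>R y)) <= ennreal (2 ^ ?N) * ?J" if t: "t >= 1/2" for a :: 'a and t
 proof -
  have "?J = ennreal (\<bar>t\<bar> ^ ?N) * (LBNN y. ennreal (norm (G (a + t *\<^sub>R y))) * ?i (a + t *\<^sub>R y))"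
   by (rule nn_integral_lborel_affine, measurable) (use t in auto)
  then have "ennreal (2 ^ ?N) * ?J = ennreal (2 ^ ?N * t ^ ?N) * (LBNN y. ennreal (norm (G (a + t *\<^sub>R y))) * ?i (a + t *\<^sub>R y))"
   using t by (simp add: ennreal_mult mult.assoc)
  moreover have "2 ^ ?N * t ^ ?N >= 1" using t one_le_power[of "2 * t" ?N] by (simp add: power_mult_distrib)
  ultimately show ?thesis
   using mult_right_mono[of 1 "ennreal (2 ^ ?N * t ^ ?N)" "LBNN y. ennreal (norm (G (a + t *\<^sub>R y))) * ?i (a + t *\<^sub>R y)"] by simp
 qed
 have H: "(LBNN x. LBNN y. ennreal (norm (G ((1 - t) *\<^sub>R x + t *\<^sub>R y))) * ?i x * ?i y) <= emeasure lborel ?B * (ennreal (2 ^ ?N) * ?J)"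
  if t: "0 <= t" "t <= 1" for t
 proof -
  have H1: "(LBNN x. LBNN y. ennreal (norm (G ((1 - t) *\<^sub>R x + t *\<^sub>R y))) * ?i x * ?i y) <= emeasure lborel ?B * (ennreal (2 ^ ?N) * ?J)"
   if t: "1/2 <= t" "t <= 1" for t
  proof -
   have "(LBNN x. LBNN y. ennreal (norm (G ((1 - t) *\<^sub>R x + t *\<^sub>R y))) * ?i x * ?i y) <= (LBNN x. ?i x * (ennreal (2 ^ ?N) * ?J))"
   proof (rule nn_integral_mono)
    fix x
    show "(LBNN y. ennreal (norm (G ((1 - t) *\<^sub>R x + t *\<^sub>R y))) * ?i x * ?i y) <= ?i x * (ennreal (2 ^ ?N) * ?J)"
    proof (cases "x \<in> ?B")
     case True
     have "(LBNN y. ennreal (norm (G ((1 - t) *\<^sub>R x + t *\<^sub>R y))) * ?i x * ?i y) <= (LBNN y. ennreal (norm (G ((1 - t) *\<^sub>R x + t *\<^sub>R y))) * ?i ((1 - t) *\<^sub>R x + t *\<^sub>R y))"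
     proof (rule nn_integral_mono)
      fix y
      show "ennreal (norm (G ((1 - t) *\<^sub>R x + t *\<^sub>R y))) * ?i x * ?i y <= ennreal (norm (G ((1 - t) *\<^sub>R x + t *\<^sub>R y))) * ?i ((1 - t) *\<^sub>R x + t *\<^sub>R y)"
       using conv[OF True, of y t] t True by (cases "y \<in> ?B") auto
     qed
     also have "\<dots> <= ennreal (2 ^ ?N) * ?J" by (rule aff[OF t(1)])
     finally show ?thesis using True by simp
    qed simp
   qed
   also have "\<dots> = (LBNN x. ?i x) * (ennreal (2 ^ ?N) * ?J)" by (rule nn_integral_multc) measurable
   finally show ?thesis by simp
  qed
  show ?thesis
  proof (cases "1/2 <= t")
   case True
   then show ?thesis using H1 t by blast
  next
   case False
   have "(LBNN x. LBNN y. ennreal (norm (G ((1 - t) *\<^sub>R x + t *\<^sub>R y))) * ?i x * ?i y) = (LBNN y. LBNN x. ennreal (norm (G ((1 - t) *\<^sub>R x + t *\<^sub>R y))) * ?i x * ?i y)"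
    by (rule lborel_pair.Fubini') measurable
   also have "\<dots> = (LBNN x. LBNN y. ennreal (norm (G ((1 - (1 - t)) *\<^sub>R x + (1 - t) *\<^sub>R y))) * ?i x * ?i y)"
    by (simp add: add.commute mult_ac)
   also have "\<dots> <= emeasure lborel ?B * (ennreal (2 ^ ?N) * ?J)" using H1[of "1 - t"] False t by simp
   finally show ?thesis .
  qed
 qed
 let ?I = "\<lambda>t::real. indicator {0..1} t :: ennreal"
 have "(LBNN x. LBNN y. ennreal \<bar>w x - w y\<bar> * ?i x * ?i y)
   <= (LBNN x. LBNN y. LBNN t. ennreal (2 * \<rho>) * (ennreal (norm (G ((1 - t) *\<^sub>R x + t *\<^sub>R y))) * ?i x * ?i y * ?I t))"
 proof (intro nn_integral_mono)
  fix x y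
  show "ennreal \<bar>w x - w y\<bar> * ?i x * ?i y <= (LBNN t. ennreal (2 * \<rho>) * (ennreal (norm (G ((1 - t) *\<^sub>R x + t *\<^sub>R y))) * ?i x * ?i y * ?I t))"
  proof (cases "x \<in> ?B \<and> y \<in> ?B")
   case True
   then have n: "norm (y - x) <= 2 * \<rho>" using dist_triangle[of x y x0] by (auto simp: dist_norm norm_minus_commute dist_commute)
   have "ennreal \<bar>w x - w y\<bar> = ennreal \<bar>w (x + 1 *\<^sub>R (y - x)) - w x\<bar>" by (simp add: abs_minus_commute)
   also have "\<dots> <= (LBNN t. ennreal (norm (G (x + t *\<^sub>R (y - x))) * norm (y - x)) * ?I t)"
    by (rule C1g_segment_bound[OF w]) simp
   also have "\<dots> <= (LBNN t. ennreal (2 * \<rho>) * (ennreal (norm (G ((1 - t) *\<^sub>R x + t *\<^sub>R y))) * ?i x * ?i y * ?I t))"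
   proof (rule nn_integral_mono)
    fix t :: real
    have e: "x + t *\<^sub>R (y - x) = (1 - t) *\<^sub>R x + t *\<^sub>R y" by (simp add: algebra_simps)
    have "ennreal (norm (G (x + t *\<^sub>R (y - x))) * norm (y - x)) <= ennreal (2 * \<rho>) * ennreal (norm (G ((1 - t) *\<^sub>R x + t *\<^sub>R y)))"
     unfolding e using n \<rho> by (simp add: ennreal_mult[symmetric] mult.commute ennreal_leI mult_right_mono)
    then show "ennreal (norm (G (x + t *\<^sub>R (y - x))) * norm (y - x)) * ?I t <= ennreal (2 * \<rho>) * (ennreal (norm (G ((1 - t) *\<^sub>R x + t *\<^sub>R y))) * ?i x * ?i y * ?I t)"
     using True by (cases "t \<in> {0..1}") auto
   qed
   finally show ?thesis using True by simp
  qed auto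
 qed
 also have "\<dots> = (LBNN x. LBNN t. LBNN y. ennreal (2 * \<rho>) * (ennreal (norm (G ((1 - t) *\<^sub>R x + t *\<^sub>R y))) * ?i x * ?i y * ?I t))"
  by (intro nn_integral_cong lborel_pair.Fubini') measurable
 also have "\<dots> = (LBNN t. LBNN x. LBNN y. ennreal (2 * \<rho>) * (ennreal (norm (G ((1 - t) *\<^sub>R x + t *\<^sub>R y))) * ?i x * ?i y * ?I t))"
  by (rule lborel_pair.Fubini') measurable
 also have "\<dots> <= (LBNN t. ennreal (2 * \<rho>) * (emeasure lborel ?B * (ennreal (2 ^ ?N) * ?J)) * ?I t)"
 proof (rule nn_integral_mono)
  fix t :: real
  show "(LBNN x. LBNN y. ennreal (2 * \<rho>) * (ennreal (norm (G ((1 - t) *\<^sub>R x + t *\<^sub>R y))) * ?i x * ?i y * ?I t))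
    <= ennreal (2 * \<rho>) * (emeasure lborel ?B * (ennreal (2 ^ ?N) * ?J)) * ?I t"
  proof (cases "t \<in> {0..1}")
   case True
   have "(LBNN x. LBNN y. ennreal (2 * \<rho>) * (ennreal (norm (G ((1 - t) *\<^sub>R x + t *\<^sub>R y))) * ?i x * ?i y * ?I t))
    = (LBNN x. ennreal (2 * \<rho>) * (LBNN y. ennreal (norm (G ((1 - t) *\<^sub>R x + t *\<^sub>R y))) * ?i x * ?i y))"
    using True by (intro nn_integral_cong) (simp, rule nn_integral_cmult, measurable)
   also have "\<dots> = ennreal (2 * \<rho>) * (LBNN x. LBNN y. ennreal (norm (G ((1 - t) *\<^sub>R x + t *\<^sub>R y))) * ?i x * ?i y)"
    by (rule nn_integral_cmult) measurable
   also have "\<dots> <= ennreal (2 * \<rho>) * (emeasure lborel ?B * (ennreal (2 ^ ?N) * ?J))"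
    using True by (intro mult_left_mono H) auto
   finally show ?thesis using True by simp
  qed simp
 qed
 also have "\<dots> = ennreal (2 * \<rho>) * (emeasure lborel ?B * (ennreal (2 ^ ?N) * ?J))"
  by (subst nn_integral_cmult_indicator) auto
 also have "\<dots> = ennreal (2 * \<rho> * 2 ^ ?N) * emeasure lborel ?B * ?J"
  using \<rho> by (simp add: ennreal_mult mult_ac)
 finally show ?thesis .
qed

subsection \<open>Algebraic inequalities\<close>

lemma young_powr:
 fixes X Y e p :: real
 assumes "0 <= X" "0 <= Y" "0 < e" "1 < p"
 shows "X powr (p - 1) * Y <= e * X powr p + e powr (1 - p) * Y powr p"
proof (cases "Y <= e * X")
 case True
 have "X powr (p - 1) * Y <= X powr (p - 1) * (e * X)" using True by (intro mult_left_mono) auto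
 also have "\<dots> = e * X powr p" using assms by (cases "X = 0") (auto simp: powr_diff)
 finally show ?thesis by (simp add: add_increasing2)
next
 case False
 then have Y: "Y > 0" using assms by (smt (verit) mult_nonneg_nonneg)
 have "X <= Y / e" using False assms by (simp add: field_simps)
 then have "X powr (p - 1) * Y <= (Y / e) powr (p - 1) * Y" using assms by (intro mult_right_mono powr_mono2) auto
 also have "\<dots> = e powr (1 - p) * Y powr p"
  using assms Y by (simp add: powr_divide powr_diff field_simps)
 finally show ?thesis using assms by (simp add: add_increasing)
qed

lemma ppow_nonneg_eq: "0 <= t ==> 1 < p ==> ppow p t = t powr (p - 1)"
 by (cases "t = 0") (auto simp: ppow_def powr_diff power2_eq_square powr_realpow[symmetric])

lemma ppow_minus: "ppow p (- t) = - ppow p t"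
 by (simp add: ppow_def)

lemma ppow_le: "t <= m ==> 0 <= m ==> 1 < p ==> ppow p t <= m powr (p - 1)"
proof (cases "t >= 0")
 case True
 assume "t <= m" "0 <= m" "1 < p"
 then show ?thesis using True by (simp add: ppow_nonneg_eq powr_mono2)
next
 case False
 assume "t <= m" "0 <= m" "1 < p"
 have "ppow p t <= 0" using False by (simp add: ppow_def mult_nonneg_nonpos)
 then show ?thesis using powr_ge_zero[of m "p - 1"] by linarith
qed

lemma powr_add_le: "0 <= a ==> 0 <= b ==> 0 <= t ==> (a + b :: real) powr t <= 2 powr t * (a powr t + b powr t)"
proof -
 assume ab: "0 <= a" "0 <= b" "0 <= t"
 have "(a + b) powr t <= (2 * max a b) powr t" using ab by (intro powr_mono2) auto
 also have "\<dots> = 2 powr t * max a b powr t" using ab by (simp add: powr_mult)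
 also have "\<dots> <= 2 powr t * (a powr t + b powr t)"
  by (intro mult_left_mono) (auto simp: max_def)
 finally show ?thesis .
qed

definition nl_const :: "real => real => real" where
 "nl_const p \<delta> = p * (p * (1 + \<delta>) / \<delta>) powr (p - 1)"

lemma nonlocal_scalar:
 fixes p \<delta> e \<xi> \<tau> :: real
 assumes p: "1 < p" and \<delta>: "0 < \<delta>" and e: "0 <= e" "e <= 1" and \<xi>: "0 <= \<xi>" "0 <= \<tau>"
 shows "e powr (p - 1) * (\<xi> powr p - (1 + \<delta> * e) * \<tau> powr p) <= nl_const p \<delta> * \<bar>\<xi> - \<tau>\<bar> powr p"
proof -
 have nl: "0 <= nl_const p \<delta> * \<bar>\<xi> - \<tau>\<bar> powr p" using p by (simp add: nl_const_def)
 have neg: ?thesis if "\<xi> powr p <= (1 + \<delta> * e) * \<tau> powr p"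
 proof -
  have "e powr (p - 1) * (\<xi> powr p - (1 + \<delta> * e) * \<tau> powr p) <= 0" using that by (intro mult_nonneg_nonpos) auto
  then show ?thesis using nl by linarith
 qed
 define c where "c = \<delta> / (p * (1 + \<delta>))"
 have c: "0 < c" "p * c = \<delta> / (1 + \<delta>)" using p \<delta> by (auto simp: c_def)
 have pc1: "p * c <= 1" using \<delta> by (simp add: c(2))
 show ?thesis
 proof (cases "\<xi> <= \<tau>")
  case True
  have "\<xi> powr p <= \<tau> powr p" using True \<xi> p by (intro powr_mono2) auto
  also have "\<dots> <= (1 + \<delta> * e) * \<tau> powr p" using \<delta> e by (simp add: algebra_simps)
  finally show ?thesis by (rule neg)
 next
  case False
  then have x: "\<xi> > \<tau>" "\<xi> > 0" using \<xi> by auto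
  show ?thesis
  proof (cases "c * e * \<xi> <= \<xi> - \<tau>")
   case True
   have "\<xi> powr p - (1 + \<delta> * e) * \<tau> powr p <= \<xi> powr p - \<tau> powr p" using \<delta> e by (simp add: algebra_simps)
   also have "\<dots> <= p * \<xi> powr (p - 1) * (\<xi> - \<tau>)"
    using powr_tangent[of p \<tau> \<xi>] p \<xi> x by (simp add: algebra_simps)
   finally have "e powr (p - 1) * (\<xi> powr p - (1 + \<delta> * e) * \<tau> powr p) <= e powr (p - 1) * (p * \<xi> powr (p - 1) * (\<xi> - \<tau>))"
    by (intro mult_left_mono) auto
   also have "\<dots> = p * ((e * \<xi>) powr (p - 1) * (\<xi> - \<tau>))" using e x by (simp add: powr_mult)
   also have "\<dots> <= p * (((\<xi> - \<tau>) / c) powr (p - 1) * (\<xi> - \<tau>))"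
    using True c e x p by (intro mult_left_mono mult_right_mono powr_mono2) (auto simp: field_simps)
   also have "\<dots> = nl_const p \<delta> * \<bar>\<xi> - \<tau>\<bar> powr p"
   proof -
    have "1 / c = p * (1 + \<delta>) / \<delta>" by (simp add: c_def)
    moreover have "((\<xi> - \<tau>) / c) powr (p - 1) * (\<xi> - \<tau>) = (1 / c) powr (p - 1) * (\<xi> - \<tau>) powr p"
     using x c by (simp add: powr_divide powr_diff)
    ultimately show ?thesis using x by (simp add: nl_const_def)
   qed
   finally show ?thesis .
  next
   case F: False
   have ce: "0 <= 1 - c * e"
   proof -
    have "c <= 1" using pc1 p c mult_right_mono[of 1 p c] by simp
    then show ?thesis using e c mult_mono[of c 1 e 1] by simp
   qed
   have "(1 - p * c * e) * \<xi> powr p <= (1 - c * e) powr p * \<xi> powr p"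
    using powr_tangent[of p "1 - c * e" 1] p ce by (intro mult_right_mono) (auto simp: algebra_simps)
   also have "\<dots> = ((1 - c * e) * \<xi>) powr p" using ce x by (simp add: powr_mult)
   also have "\<dots> <= \<tau> powr p" using F ce x p by (intro powr_mono2) (auto simp: algebra_simps)
   finally have t: "(1 - p * c * e) * \<xi> powr p <= \<tau> powr p" .
   have "1 <= (1 + \<delta> * e) * (1 - p * c * e)"
   proof -
    have "\<delta> = p * c * (1 + \<delta>)" using \<delta> by (simp add: c(2))
    then have "(1 + \<delta> * e) * (1 - p * c * e) - 1 = p * c * \<delta> * (e * (1 - e))" by algebra
    moreover have "0 <= p * c * \<delta> * (e * (1 - e))" using p c \<delta> e by (intro mult_nonneg_nonneg) auto
    ultimately show ?thesis by linarith
   qed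
   then have "1 * \<xi> powr p <= (1 + \<delta> * e) * (1 - p * c * e) * \<xi> powr p" by (intro mult_right_mono) auto
   also have "\<dots> <= (1 + \<delta> * e) * \<tau> powr p" using t \<delta> e by (simp add: mult.assoc mult_left_mono)
   finally show ?thesis by (intro neg) simp
  qed
 qed
qed

lemma nonlocal_ineq_ordered:
 fixes p \<delta> q a b \<xi> \<tau> :: real
 assumes p: "1 < p" and \<delta>: "0 < \<delta>" "1 + \<delta> <= q" and ab: "0 < b" "b <= a" and \<xi>: "0 <= \<xi>" "0 <= \<tau>"
 shows "ppow p (a - b) * (\<xi> powr p * a powr (1 - q) - \<tau> powr p * b powr (1 - q)) <= nl_const p \<delta> * a powr (p - q) * \<bar>\<xi> - \<tau>\<bar> powr p"
proof -
 define t where "t = b / a"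
 have a: "a > 0" using ab by linarith
 have t: "0 < t" "t <= 1" using ab a by (auto simp: t_def)
 have "1 + \<delta> * (1 - t) <= t powr (-\<delta>)"
 proof -
  have "1 + \<delta> * (1 - t) <= 1 - \<delta> * ln t" using ln_le_minus_one[of t] t \<delta> mult_left_mono[of "ln t" "t - 1" \<delta>] by (simp add: algebra_simps)
  also have "\<dots> <= exp (- \<delta> * ln t)" using exp_ge_add_one_self[of "- \<delta> * ln t"] by simp
  finally show ?thesis using t by (simp add: powr_def)
 qed
 also have "\<dots> <= t powr (1 - q)" using t \<delta> by (intro powr_mono') auto
 finally have tq: "1 + \<delta> * (1 - t) <= t powr (1 - q)" .
 have bq: "b powr (1 - q) = a powr (1 - q) * t powr (1 - q)" using a t by (simp add: t_def powr_mult[symmetric])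
 have "ppow p (a - b) = (a * (1 - t)) powr (p - 1)" using ab a p by (simp add: ppow_nonneg_eq t_def algebra_simps)
 also have "\<dots> = a powr (p - 1) * (1 - t) powr (p - 1)" using a t by (simp add: powr_mult)
 finally have pp: "ppow p (a - b) = a powr (p - 1) * (1 - t) powr (p - 1)" .
 have "\<xi> powr p * a powr (1 - q) - \<tau> powr p * b powr (1 - q) <= a powr (1 - q) * (\<xi> powr p - (1 + \<delta> * (1 - t)) * \<tau> powr p)"
  unfolding bq using mult_right_mono[OF tq, of "\<tau> powr p * a powr (1 - q)"] by (simp add: algebra_simps)
 then have "ppow p (a - b) * (\<xi> powr p * a powr (1 - q) - \<tau> powr p * b powr (1 - q))
   <= (a powr (p - 1) * (1 - t) powr (p - 1)) * (a powr (1 - q) * (\<xi> powr p - (1 + \<delta> * (1 - t)) * \<tau> powr p))"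
  unfolding pp by (intro mult_left_mono) auto
 also have "\<dots> = (a powr (p - 1) * a powr (1 - q)) * ((1 - t) powr (p - 1) * (\<xi> powr p - (1 + \<delta> * (1 - t)) * \<tau> powr p))"
  by (simp add: mult_ac)
 also have "a powr (p - 1) * a powr (1 - q) = a powr (p - q)" by (simp add: powr_add[symmetric])
 also have "a powr (p - q) * ((1 - t) powr (p - 1) * (\<xi> powr p - (1 + \<delta> * (1 - t)) * \<tau> powr p)) <= a powr (p - q) * (nl_const p \<delta> * \<bar>\<xi> - \<tau>\<bar> powr p)"
  using t by (intro mult_left_mono nonlocal_scalar p \<delta> \<xi>) auto
 finally show ?thesis by (simp add: mult_ac)
qed

lemma nonlocal_ineq:
 fixes p \<delta> q a b \<xi> \<tau> :: real
 assumes p: "1 < p" and \<delta>: "0 < \<delta>" "1 + \<delta> <= q" and ab: "0 < a" "0 < b" and \<xi>: "0 <= \<xi>" "0 <= \<tau>"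
 shows "ppow p (a - b) * (\<xi> powr p * a powr (1 - q) - \<tau> powr p * b powr (1 - q)) <= nl_const p \<delta> * (a powr (p - q) + b powr (p - q)) * \<bar>\<xi> - \<tau>\<bar> powr p"
proof -
 have n: "0 <= nl_const p \<delta>" using p by (simp add: nl_const_def)
 show ?thesis
 proof (cases "b <= a")
  case True
  have "nl_const p \<delta> * a powr (p - q) * \<bar>\<xi> - \<tau>\<bar> powr p <= nl_const p \<delta> * (a powr (p - q) + b powr (p - q)) * \<bar>\<xi> - \<tau>\<bar> powr p"
   using n by (intro mult_right_mono mult_left_mono) auto
  then show ?thesis using nonlocal_ineq_ordered[OF p \<delta> ab(2) True \<xi>] by linarith
 next
  case False
  have e: "ppow p (b - a) = - ppow p (a - b)" using ppow_minus[of p "a - b"] by simp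
  have "nl_const p \<delta> * b powr (p - q) * \<bar>\<tau> - \<xi>\<bar> powr p <= nl_const p \<delta> * (a powr (p - q) + b powr (p - q)) * \<bar>\<xi> - \<tau>\<bar> powr p"
   unfolding abs_minus_commute[of \<tau> \<xi>] using n by (intro mult_right_mono mult_left_mono) auto
  moreover have "ppow p (b - a) * (\<tau> powr p * b powr (1 - q) - \<xi> powr p * a powr (1 - q)) <= nl_const p \<delta> * b powr (p - q) * \<bar>\<tau> - \<xi>\<bar> powr p"
   by (rule nonlocal_ineq_ordered[OF p \<delta> ab(1) _ \<xi>(2,1)]) (use False in simp)
  ultimately show ?thesis unfolding e by (simp add: algebra_simps)
 qed
qed

subsection \<open>Cutoff functions\<close>

lemma pos_powr_deriv:
 assumes p: "1 < (p::real)"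
 shows "((\<lambda>t. max 0 t powr p) has_real_derivative p * max 0 t powr (p - 1)) (at t)"
proof (cases t "0::real" rule: linorder_cases)
 case less
 have "((\<lambda>t. 0) has_real_derivative 0) (at t)" by simp
 then have "((\<lambda>t. max 0 t powr p) has_real_derivative 0) (at t)"
  by (rule DERIV_cong_ev[THEN iffD1, rotated -1])
   (use less in \<open>auto intro!: eventually_nhds_in_open[of "{..<0}", THEN eventually_mono]\<close>)
 then show ?thesis using less by simp
next
 case equal
 have "((\<lambda>h::real. (max 0 h powr p - 0) / h) \<longlongrightarrow> 0) (at 0)"
 proof (rule Lim_null_comparison)
  show "\<forall>\<^sub>F h in at 0. norm ((max 0 h powr p - 0) / h) <= \<bar>h\<bar> powr (p - 1)"
  proof (rule eventually_mono[OF eventually_neq_at_within[of 0]])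
   fix h :: real assume "h \<noteq> 0"
   then show "norm ((max 0 h powr p - 0) / h) <= \<bar>h\<bar> powr (p - 1)"
   proof (cases "h > 0")
    case True
    then show ?thesis by (simp add: powr_diff)
   next
    case False
    then have "max 0 h = 0" by simp
    then show ?thesis by simp
   qed
  qed
  have "((\<lambda>h::real. \<bar>h\<bar> powr (p - 1)) \<longlongrightarrow> \<bar>0\<bar> powr (p - 1)) (at 0)"
   using p by (intro tendsto_powr' tendsto_intros) auto
  then show "((\<lambda>h::real. \<bar>h\<bar> powr (p - 1)) \<longlongrightarrow> 0) (at 0)" by simp
 qed
 then show ?thesis using equal by (simp add: has_field_derivative_iff)
next
 case greater
 have "((\<lambda>t. t powr p) has_real_derivative p * t powr (p - 1)) (at t)"
  using has_real_derivative_powr[OF greater, of p] by simp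
 then have "((\<lambda>t. max 0 t powr p) has_real_derivative p * t powr (p - 1)) (at t)"
  by (rule DERIV_cong_ev[THEN iffD1, rotated -1])
   (use greater in \<open>auto simp: max_def intro!: eventually_nhds_in_open[of "{0<..}", THEN eventually_mono]\<close>)
 then show ?thesis using greater by simp
qed

lemma pos_powr_deriv_cont: "1 < p ==> continuous_on UNIV (\<lambda>t::real. p * max 0 t powr (p - 1))"
 by (intro continuous_intros continuous_on_powr') auto

lemma smooth_step:
 obtains \<sigma> \<sigma>' :: "real => real" where "\<And>t. (\<sigma> has_real_derivative \<sigma>' t) (at t)" "continuous_on UNIV \<sigma>'"
  "\<And>t. t <= 0 ==> \<sigma> t = 0" "\<And>t. t >= 1 ==> \<sigma> t = 1" "\<And>t. 0 <= \<sigma> t" "\<And>t. \<sigma> t <= 1" "\<And>t. \<bar>\<sigma>' t\<bar> <= 2"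
  "\<And>t. t < 0 ==> \<sigma>' t = 0"
proof -
 define q where "q t = max 0 t powr 2" for t :: real
 define q' where "q' t = 2 * max 0 t powr (2 - 1)" for t :: real
 have qd: "(q has_real_derivative q' t) (at t)" for t unfolding q_def q'_def by (rule pos_powr_deriv) simp
 have q'c: "continuous_on UNIV q'" unfolding q'_def by (rule pos_powr_deriv_cont) simp
 have qe: "q t = (max 0 t)\<^sup>2" "q' t = 2 * max 0 t" for t by (auto simp: q_def q'_def powr_numeral)
 have d: "q t + q (1 - t) >= 1/2" for t
 proof (cases "0 <= t \<and> t <= 1")
  case True
  have "t\<^sup>2 + (1 - t)\<^sup>2 - 1/2 = 2 * (t - 1/2)\<^sup>2" by (simp add: power2_eq_square algebra_simps)
  moreover have "0 <= 2 * (t - 1/2)\<^sup>2" by simp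
  ultimately have "1/2 <= t\<^sup>2 + (1 - t)\<^sup>2" by linarith
  then show ?thesis using True by (simp add: qe)
 next
  case False
  then have "1 <= max 0 t \<or> 1 <= max 0 (1 - t)" by auto
  then have "1 <= q t \<or> 1 <= q (1 - t)" unfolding qe by (auto simp: one_le_power)
  moreover have "0 <= q t" "0 <= q (1 - t)" by (auto simp: qe)
  ultimately show ?thesis by linarith
 qed
 define \<sigma> where "\<sigma> t = q t / (q t + q (1 - t))" for t
 define \<sigma>' where "\<sigma>' t = (q' t * q (1 - t) + q t * q' (1 - t)) / (q t + q (1 - t))\<^sup>2" for t
 have dn: "q t + q (1 - t) > 0" for t using d[of t] by linarith
 have qd1: "((\<lambda>t. q (1 - t)) has_real_derivative - q' (1 - t)) (at t)" for t
 proof -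
  have "((\<lambda>t::real. 1 - t) has_real_derivative -1) (at t)" by (auto intro!: derivative_eq_intros)
  from DERIV_chain2[OF qd this] show ?thesis by simp
 qed
 have sd: "(\<sigma> has_real_derivative \<sigma>' t) (at t)" for t
 proof -
  have "((\<lambda>t. q t / (q t + q (1 - t))) has_real_derivative
   (q' t * (q t + q (1 - t)) - q t * (q' t + - q' (1 - t))) / ((q t + q (1 - t)) * (q t + q (1 - t)))) (at t)"
   by (rule DERIV_divide[OF qd DERIV_add[OF qd qd1]]) (use dn[of t] in auto)
  then show ?thesis unfolding \<sigma>_def \<sigma>'_def by (simp add: power2_eq_square algebra_simps)
 qed
 have qc: "continuous_on UNIV q" using qd by (meson DERIV_isCont continuous_at_imp_continuous_on)
 have sc: "continuous_on UNIV \<sigma>'" unfolding \<sigma>'_def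
  by (intro continuous_intros continuous_on_compose2[OF qc] continuous_on_compose2[OF q'c]) (use dn in \<open>auto simp: less_imp_neq[symmetric]\<close>)
 have s2: "\<bar>\<sigma>' t\<bar> <= 2" for t
 proof (cases "0 <= t \<and> t <= 1")
  case True
  have "q' t * q (1 - t) + q t * q' (1 - t) = 2 * (t * (1 - t))" using True by (simp add: qe power2_eq_square algebra_simps)
  moreover have "t * (1 - t) <= 1/4"
  proof -
   have "1/4 - t * (1 - t) = (t - 1/2)\<^sup>2" by (simp add: power2_eq_square algebra_simps)
   then show ?thesis using zero_le_power2[of "t - 1/2"] by linarith
  qed
  moreover have "0 <= t * (1 - t)" using True by simp
  moreover have "(1/2)\<^sup>2 <= (q t + q (1 - t))\<^sup>2" using d[of t] by (intro power_mono) auto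
  ultimately show ?thesis unfolding \<sigma>'_def using dn[of t] by (simp add: divide_le_eq power2_eq_square abs_of_nonneg)
 next
  case False
  then have "\<sigma>' t = 0" by (auto simp: \<sigma>'_def qe)
  then show ?thesis by simp
 qed
 show ?thesis
 proof (rule that[of \<sigma> \<sigma>'])
  show "\<sigma> t = 0" if "t <= 0" for t using that by (simp add: \<sigma>_def qe)
  show "\<sigma> t = 1" if "t >= 1" for t using that dn[of t] by (simp add: \<sigma>_def qe)
  show "0 <= \<sigma> t" "\<sigma> t <= 1" for t using dn[of t] by (auto simp: \<sigma>_def qe divide_le_eq)
  show "\<sigma>' t = 0" if "t < 0" for t using that by (simp add: \<sigma>'_def qe)
 qed (use sd sc s2 in auto)
qed

lemma cutoff:
 fixes x0 :: "'a::euclidean_space"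
 assumes \<rho>: "0 < \<rho>'" "\<rho>' < \<rho>"
 obtains \<eta> G where "C1g \<eta> G" "\<And>x. 0 <= \<eta> x" "\<And>x. \<eta> x <= 1" "\<And>x. x \<in> ball x0 \<rho>' ==> \<eta> x = 1"
  "\<And>x. x \<notin> cball x0 ((\<rho>' + \<rho>) / 2) ==> \<eta> x = 0" "\<And>x. x \<notin> cball x0 ((\<rho>' + \<rho>) / 2) ==> G x = 0"
  "\<And>x. norm (G x) <= 8 / (\<rho> - \<rho>')" "\<And>x y. \<bar>\<eta> x - \<eta> y\<bar> <= min 1 (8 / (\<rho> - \<rho>') * dist x y)"
proof -
 obtain \<sigma> \<sigma>' :: "real => real" where s: "\<And>t. (\<sigma> has_real_derivative \<sigma>' t) (at t)" "continuous_on UNIV \<sigma>'"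
  "\<And>t. t <= 0 ==> \<sigma> t = 0" "\<And>t. t >= 1 ==> \<sigma> t = 1" "\<And>t. 0 <= \<sigma> t" "\<And>t. \<sigma> t <= 1" "\<And>t. \<bar>\<sigma>' t\<bar> <= 2" "\<And>t. t < 0 ==> \<sigma>' t = 0"
  by (rule smooth_step) (rule that)
 define b where "b = (\<rho>' + \<rho>) / 2"
 have b: "\<rho>' < b" "0 < b" "b - \<rho>' = (\<rho> - \<rho>') / 2" using \<rho> by (auto simp: b_def field_simps)
 define w where "w = b\<^sup>2 - \<rho>'\<^sup>2"
 have wf: "w = (b - \<rho>') * (b + \<rho>')" by (simp add: w_def power2_eq_square algebra_simps)
 have w0: "w > 0" unfolding wf using b \<rho> by (intro mult_pos_pos) auto
 define h where "h x = (b\<^sup>2 - (norm (x - x0))\<^sup>2) / w" for x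
 define H where "H x = (- 2 / w) *\<^sub>R (x - x0)" for x
 have hC: "C1g h H"
  unfolding C1g_def
 proof (intro conjI allI)
  fix x
  have "((\<lambda>x. (b\<^sup>2 - (x - x0) \<bullet> (x - x0)) / w) has_derivative (\<lambda>k. H x \<bullet> k)) (at x)"
   unfolding H_def using w0 by (auto intro!: derivative_eq_intros simp: inner_commute algebra_simps divide_simps)
  then show "(h has_derivative (\<lambda>k. H x \<bullet> k)) (at x)" by (simp add: h_def[abs_def] dot_square_norm)
  show "continuous_on UNIV H" unfolding H_def by (intro continuous_intros)
 qed
 define \<eta> where "\<eta> x = \<sigma> (h x)" for x
 define G where "G x = \<sigma>' (h x) *\<^sub>R H x" for x
 have C: "C1g \<eta> G" unfolding \<eta>_def[abs_def] G_def[abs_def] by (rule C1g_compose[OF hC s(1) s(2)]) simp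
 have out: "h x < 0" if "x \<notin> cball x0 b" for x
 proof -
  have "b < norm (x - x0)" using that by (simp add: dist_norm norm_minus_commute)
  then have "b\<^sup>2 < (norm (x - x0))\<^sup>2" using b by (intro power_strict_mono) auto
  then show ?thesis using w0 by (simp add: h_def divide_neg_pos)
 qed
 have G0: "G x = 0" if "x \<notin> cball x0 b" for x using s(8)[OF out[OF that]] by (simp add: G_def)
 have Gn: "norm (G x) <= 8 / (\<rho> - \<rho>')" for x
 proof (cases "x \<in> cball x0 b")
  case True
  then have "norm (x - x0) <= b" by (simp add: dist_norm norm_minus_commute)
  then have "norm (H x) <= 2 / w * b" using w0 by (simp add: H_def divide_simps)
  also have "\<dots> <= 2 / (b - \<rho>')" unfolding wf using b \<rho> by (simp add: divide_simps)
  finally have "norm (H x) <= 2 / (b - \<rho>')" .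
  then have "\<bar>\<sigma>' (h x)\<bar> * norm (H x) <= 2 * (2 / (b - \<rho>'))" using s(7) by (intro mult_mono) auto
  then show ?thesis by (simp add: G_def b(3))
 next
  case False
  then show ?thesis using G0 \<rho> by simp
 qed
 have lip: "\<bar>\<eta> x - \<eta> y\<bar> <= 8 / (\<rho> - \<rho>') * dist x y" for x y
 proof -
  obtain t where "0 < t" "t < 1" "\<eta> (y + (x - y)) - \<eta> y = G (y + t *\<^sub>R (x - y)) \<bullet> (x - y)" using mvt_grad[OF C] by metis
  then have "\<bar>\<eta> x - \<eta> y\<bar> <= norm (G (y + t *\<^sub>R (x - y))) * norm (x - y)" using Cauchy_Schwarz_ineq2[of "G (y + t *\<^sub>R (x - y))" "x - y"] by simp
  also have "\<dots> <= 8 / (\<rho> - \<rho>') * norm (x - y)" by (intro mult_right_mono Gn) auto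
  finally show ?thesis by (simp add: dist_norm)
 qed
 show ?thesis
 proof (rule that[of \<eta> G])
  show "0 <= \<eta> x" "\<eta> x <= 1" for x by (auto simp: \<eta>_def s)
  show "\<eta> x = 1" if "x \<in> ball x0 \<rho>'" for x
  proof -
   have "norm (x - x0) < \<rho>'" using that by (simp add: dist_norm norm_minus_commute)
   then have "(norm (x - x0))\<^sup>2 <= \<rho>'\<^sup>2" by (intro power_mono) auto
   then have "h x >= 1" using w0 by (simp add: h_def w_def)
   then show ?thesis by (simp add: \<eta>_def s)
  qed
  show "\<eta> x = 0" "G x = 0" if "x \<notin> cball x0 ((\<rho>' + \<rho>) / 2)" for x
   using out[of x] G0[of x] that s(3)[of "h x"] by (auto simp: \<eta>_def b_def)
  show "\<bar>\<eta> x - \<eta> y\<bar> <= min 1 (8 / (\<rho> - \<rho>') * dist x y)" for x y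
   using lip[of x y] s(5,6)[of "h x"] s(5,6)[of "h y"] by (auto simp: \<eta>_def abs_le_iff)
 qed (use C Gn in auto)
qed

subsection \<open>Measurability\<close>

lemma caratheodory_measurable:
 fixes B :: "'a::euclidean_space => real => 'a => 'a"
 assumes B: "\<And>v \<zeta>. set_borel_measurable lebesgue \<Omega> (\<lambda>x. B x v \<zeta>)"
  and cont: "\<And>x. x \<in> \<Omega> ==> continuous_on UNIV (\<lambda>(v, \<zeta>). B x v \<zeta>)"
  and S: "S \<subseteq> \<Omega>" "S \<in> sets lebesgue"
  and U: "U \<in> borel_measurable lebesgue" and G: "G \<in> borel_measurable lebesgue"
 shows "(\<lambda>x. indicator S x *\<^sub>R B x (U x) (G x)) \<in> borel_measurable lebesgue"
proof -
 have BS: "(\<lambda>x. indicator S x *\<^sub>R B x v \<zeta>) \<in> borel_measurable lebesgue" for v \<zeta>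
 proof -
  have "(\<lambda>x. indicator S x *\<^sub>R (indicator \<Omega> x *\<^sub>R B x v \<zeta>)) \<in> borel_measurable lebesgue"
   by (rule borel_measurable_scaleR[OF borel_measurable_indicator[OF S(2)] B[of v \<zeta>, unfolded set_borel_measurable_def]])
  moreover have "indicator S x *\<^sub>R (indicator \<Omega> x *\<^sub>R B x v \<zeta>) = indicator S x *\<^sub>R B x v \<zeta>" for x
   using S(1) by (auto simp: indicator_def)
  ultimately show ?thesis by (simp only:)
 qed
 have "(\<lambda>x. (U x, G x)) \<in> borel_measurable lebesgue" using U G by (rule borel_measurable_Pair)
 then have "\<exists>F. (\<forall>i. simple_function lebesgue (F i)) \<and> (\<forall>x\<in>space lebesgue. (\<lambda>i. F i x) \<longlonglongrightarrow> (U x, G x)) \<and>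
   (\<forall>i. \<forall>x\<in>space lebesgue. dist (F i x) (0, 0) <= 2 * dist (U x, G x) (0, 0))"
  by (rule borel_measurable_implies_sequence_metric)
 then obtain F where F0: "\<forall>i. simple_function lebesgue (F i)" "\<forall>x\<in>space lebesgue. (\<lambda>i. F i x) \<longlonglongrightarrow> (U x, G x)"
  by blast
 have F: "simple_function lebesgue (F i)" "(\<lambda>i. F i x) \<longlonglongrightarrow> (U x, G x)" for i x using F0 by auto
 show ?thesis
 proof (rule borel_measurable_LIMSEQ_metric)
  fix i
  let ?Y = "F i ` space lebesgue"
  have fin: "finite ?Y" using F(1)[of i] by (simp add: simple_function_def)
  have pre: "F i -` {y} \<in> sets lebesgue" if "y \<in> ?Y" for y using F(1)[of i] that by (auto simp: simple_function_def)
  have "(\<lambda>x. \<Sum>y\<in>?Y. indicator (F i -` {y}) x *\<^sub>R (indicator S x *\<^sub>R B x (fst y) (snd y))) \<in> borel_measurable lebesgue"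
   by (intro borel_measurable_sum borel_measurable_scaleR borel_measurable_indicator pre BS)
  moreover have "(\<Sum>y\<in>?Y. indicator (F i -` {y}) x *\<^sub>R (indicator S x *\<^sub>R B x (fst y) (snd y))) = indicator S x *\<^sub>R B x (fst (F i x)) (snd (F i x))" for x
  proof -
   have "(\<Sum>y\<in>?Y. indicator (F i -` {y}) x *\<^sub>R (indicator S x *\<^sub>R B x (fst y) (snd y)))
    = (\<Sum>y\<in>?Y. if y = F i x then indicator S x *\<^sub>R B x (fst y) (snd y) else 0)"
    by (intro sum.cong) (auto simp: indicator_def)
   then show ?thesis using fin by (simp add: sum.delta)
  qed
  ultimately show "(\<lambda>x. indicator S x *\<^sub>R B x (fst (F i x)) (snd (F i x))) \<in> borel_measurable lebesgue" by (simp only:)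
 next
  fix x
  show "(\<lambda>i. indicator S x *\<^sub>R B x (fst (F i x)) (snd (F i x))) \<longlonglongrightarrow> indicator S x *\<^sub>R B x (U x) (G x)"
  proof (cases "x \<in> S")
   case True
   then have c: "continuous_on UNIV (\<lambda>(v, \<zeta>). B x v \<zeta>)" using cont S by blast
   have "(\<lambda>i. (\<lambda>(v, \<zeta>). B x v \<zeta>) (F i x)) \<longlonglongrightarrow> (\<lambda>(v, \<zeta>). B x v \<zeta>) (U x, G x)"
    by (rule continuous_on_tendsto_compose[OF c F(2)]) auto
   then show ?thesis using True by (simp add: case_prod_beta)
  qed simp
 qed
qed

lemma AE_lebesgue_pair:
 fixes P Q :: "'a::euclidean_space => bool"
 assumes P: "AE x in lebesgue. P x"
 shows "AE z in (lebesgue :: ('a \<times> 'a) measure). P (fst z) \<and> P (snd z)"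
proof -
 have "AE x in lborel. P x" using P by (simp add: AE_completion_iff)
 then obtain N where N: "{x. \<not> P x} \<subseteq> N" "N \<in> null_sets lborel" using AE_E2 by (auto elim!: AE_E simp: null_sets_def)
 have n1: "N \<times> UNIV \<in> null_sets (lborel \<Otimes>\<^sub>M lborel :: ('a \<times> 'a) measure)"
  by (rule lborel.times_in_null_sets1[OF N(2)]) simp
 have n2: "UNIV \<times> N \<in> null_sets (lborel \<Otimes>\<^sub>M lborel :: ('a \<times> 'a) measure)"
  by (rule lborel.times_in_null_sets2[OF _ N(2)]) simp
 have "N \<times> UNIV \<union> UNIV \<times> N \<in> null_sets (lborel :: ('a \<times> 'a) measure)"
  using n1 n2 by (simp add: lborel_prod null_sets.Un)
 then have "AE z in (lborel :: ('a \<times> 'a) measure). z \<notin> N \<times> UNIV \<union> UNIV \<times> N" by (rule AE_not_in)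
 then have "AE z in (lborel :: ('a \<times> 'a) measure). P (fst z) \<and> P (snd z)"
  by eventually_elim (use N(1) in \<open>auto simp: subset_iff\<close>)
 then show ?thesis by (rule AE_completion)
qed

subsection \<open>Moser iteration and the lemma of Bombieri and Giusti\<close>

lemma one_le_mult_real: "1 <= a ==> 1 <= b ==> 1 <= a * (b::real)"
 using mult_mono[of 1 a 1 b] by simp

lemma power_powr_swap: "0 < x ==> (x ^ n) powr a = (x powr a) ^ (n::nat)" for x :: real
 by (simp add: powr_realpow[symmetric] powr_powr powr_power mult.commute)

lemma absorb_iteration:
 fixes \<mu> :: real
 assumes \<mu>: "0 < \<mu>"
 shows "\<exists>K>0. \<forall>\<phi> a b A B. a < b --> 0 <= A --> (\<forall>\<sigma>. a <= \<sigma> --> \<sigma> <= b --> \<phi> \<sigma> <= B) -->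
   (\<forall>\<sigma>' \<sigma>. a <= \<sigma>' --> \<sigma>' < \<sigma> --> \<sigma> <= b --> \<phi> \<sigma>' <= 3/4 * \<phi> \<sigma> + A * (\<sigma> - \<sigma>') powr (-\<mu>)) -->
   \<phi> a <= K * A * (b - a) powr (-\<mu>)"
proof -
 define \<tau> where "\<tau> = (7/8::real) powr (1/\<mu>)"
 have \<tau>: "0 < \<tau>" "\<tau> < 1" using \<mu> powr_less_mono2[of "1/\<mu>" "7/8" 1] by (auto simp: \<tau>_def)
 have \<tau>\<mu>: "\<tau> powr (-\<mu>) = 8/7" using \<mu> by (simp add: \<tau>_def powr_powr powr_minus)
 define K where "K = 7 * (1 - \<tau>) powr (-\<mu>)"
 have K: "K > 0" using \<tau> by (simp add: K_def)
 show ?thesis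
 proof (intro exI[of _ K] conjI K allI impI)
  fix \<phi> :: "real => real" and a b A B :: real
  assume ab: "a < b" and A: "0 <= A" and B0: "\<forall>\<sigma>. a <= \<sigma> --> \<sigma> <= b --> \<phi> \<sigma> <= B"
   and step0: "\<forall>\<sigma>' \<sigma>. a <= \<sigma>' --> \<sigma>' < \<sigma> --> \<sigma> <= b --> \<phi> \<sigma>' <= 3/4 * \<phi> \<sigma> + A * (\<sigma> - \<sigma>') powr (-\<mu>)"
  have B: "\<phi> \<sigma> <= B" if "a <= \<sigma>" "\<sigma> <= b" for \<sigma> using B0 that by blast
  have step: "\<phi> \<sigma>' <= 3/4 * \<phi> \<sigma> + A * (\<sigma> - \<sigma>') powr (-\<mu>)" if "a <= \<sigma>'" "\<sigma>' < \<sigma>" "\<sigma> <= b" for \<sigma>' \<sigma>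
   using step0 that by blast
  define D where "D = A * ((b - a) * (1 - \<tau>)) powr (-\<mu>)"
  have D: "D >= 0" using A by (simp add: D_def)
  define \<sigma> where "\<sigma> j = b - (b - a) * \<tau> ^ j" for j :: nat
  have s: "\<phi> (\<sigma> j) <= 3/4 * \<phi> (\<sigma> (Suc j)) + D * (8/7) ^ j" for j
  proof -
   have le: "\<tau> ^ j <= 1" "0 < \<tau> ^ j" "\<tau> ^ Suc j < \<tau> ^ j" using \<tau> by (auto simp: power_le_one)
   have "(b - a) * \<tau> ^ j <= (b - a) * 1" using le ab by (intro mult_left_mono) auto
   moreover have "(b - a) * \<tau> ^ Suc j < (b - a) * \<tau> ^ j" using le ab by (intro mult_strict_left_mono) auto
   moreover have "0 < (b - a) * \<tau> ^ Suc j" using \<tau> ab by auto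
   ultimately have "\<phi> (\<sigma> j) <= 3/4 * \<phi> (\<sigma> (Suc j)) + A * (\<sigma> (Suc j) - \<sigma> j) powr (-\<mu>)"
    by (intro step) (auto simp: \<sigma>_def)
   also have "\<sigma> (Suc j) - \<sigma> j = ((b - a) * (1 - \<tau>)) * \<tau> ^ j" by (simp add: \<sigma>_def algebra_simps)
   also have "\<dots> powr (-\<mu>) = ((b - a) * (1 - \<tau>)) powr (-\<mu>) * (\<tau> powr (-\<mu>)) ^ j"
    using \<tau> ab by (simp add: powr_mult powr_power powr_realpow[symmetric] powr_powr mult.commute)
   finally show ?thesis by (simp add: D_def \<tau>\<mu> mult.assoc)
  qed
  have n: "\<phi> (\<sigma> 0) <= (3/4) ^ n * \<phi> (\<sigma> n) + D * (\<Sum>j<n. (6/7) ^ j)" for n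
  proof (induction n)
   case 0
   then show ?case by simp
  next
   case (Suc n)
   have "(3/4) ^ n * \<phi> (\<sigma> n) <= (3/4) ^ n * (3/4 * \<phi> (\<sigma> (Suc n)) + D * (8/7) ^ n)"
    by (intro mult_left_mono s) auto
   also have "\<dots> = (3/4) ^ Suc n * \<phi> (\<sigma> (Suc n)) + D * (6/7) ^ n"
    by (simp add: algebra_simps power_mult_distrib[symmetric])
   finally show ?case using Suc by (simp add: algebra_simps)
  qed
  have geo: "(\<Sum>j<n. (6/7::real) ^ j) <= 7" for n
   using sum_le_suminf[of "\<lambda>j. (6/7::real) ^ j" "{..<n}"] by (simp add: suminf_geometric summable_geometric)
  have "\<phi> a <= (3/4) ^ n * B + D * 7" for n
  proof -
   have "(b - a) * \<tau> ^ n <= (b - a) * 1" using \<tau> ab by (intro mult_left_mono) (auto simp: power_le_one)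
   moreover have "0 <= (b - a) * \<tau> ^ n" using \<tau> ab by auto
   ultimately have "\<phi> (\<sigma> n) <= B" by (intro B) (auto simp: \<sigma>_def)
   then have "(3/4) ^ n * \<phi> (\<sigma> n) + D * (\<Sum>j<n. (6/7) ^ j) <= (3/4) ^ n * B + D * 7"
    using D geo by (intro add_mono mult_left_mono) auto
   then show ?thesis using n[of n] by (simp add: \<sigma>_def)
  qed
  moreover have "(\<lambda>n. (3/4) ^ n * B + D * 7) \<longlonglongrightarrow> 0 * B + D * 7"
   by (intro tendsto_intros LIMSEQ_power_zero) auto
  ultimately have "\<phi> a <= 0 * B + D * 7" by (intro LIMSEQ_le_const) auto
  also have "\<dots> = K * A * (b - a) powr (-\<mu>)" using ab \<tau> by (simp add: D_def K_def powr_mult)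
  finally show "\<phi> a <= K * A * (b - a) powr (-\<mu>)" .
 qed
qed

definition moser_exp :: "real => real" where
 "moser_exp \<kappa> = 1 / (1 - 1/\<kappa>)\<^sup>2"

definition moser_const :: "real => real => real => real" where
 "moser_const \<kappa> p C0 = (C0 * 4 powr p * (2 * \<kappa>) powr p) powr moser_exp \<kappa>"

locale moser =
 fixes M :: "'b measure" and U :: "real => 'b set" and f :: "'b => real" and c1 c2 V \<kappa> p C0 :: real and P :: "real => bool"
 assumes f_meas [measurable]: "f \<in> borel_measurable M" and f_bd: "\<And>x. c1 <= f x" "\<And>x. f x <= c2" and c1: "0 < c1"
  and U_sets [measurable]: "\<And>\<sigma>. U \<sigma> \<in> sets M" and U_mono: "\<And>\<sigma>' \<sigma>. \<sigma>' <= \<sigma> ==> U \<sigma>' \<subseteq> U \<sigma>"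
  and U_fin: "emeasure M (U (3/2)) \<noteq> \<infinity>" and U_V: "measure M (U (3/2)) <= V" and U_pos: "0 < measure M (U 1)"
  and \<kappa>: "1 < \<kappa>" and p: "0 < p" and C0: "1 <= C0"
  and rev: "\<And>\<alpha> \<sigma>' \<sigma>. 0 < \<alpha> ==> P \<alpha> ==> 1 <= \<sigma>' ==> \<sigma>' < \<sigma> ==> \<sigma> <= 3/2 ==>
    (\<integral>x. f x powr (\<alpha> * \<kappa>) * indicator (U \<sigma>') x \<partial>M) powr (1/\<kappa>)
     <= C0 * (1 + \<alpha>) powr p * (\<sigma> - \<sigma>') powr (-p) * (\<integral>x. f x powr \<alpha> * indicator (U \<sigma>) x \<partial>M)"
begin

definition I :: "real => real => real" where
 "I \<alpha> \<sigma> = (\<integral>x. f x powr \<alpha> * indicator (U \<sigma>) x \<partial>M)"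

lemma f_pos: "0 < f x"
 using f_bd(1)[of x] c1 by linarith

lemma integrable_f:
 assumes "\<sigma> <= 3/2" "0 <= \<alpha>"
 shows "integrable M (\<lambda>x. f x powr \<alpha> * indicator (U \<sigma>) x)"
proof (rule Bochner_Integration.integrable_bound)
 show "integrable M (\<lambda>x. c2 powr \<alpha> * indicat_real (U (3/2)) x)"
  using U_fin by (intro integrable_mult_right) (simp add: top.not_eq_extremum)
 show "AE x in M. norm (f x powr \<alpha> * indicator (U \<sigma>) x) <= norm (c2 powr \<alpha> * indicat_real (U (3/2)) x)"
 proof (rule AE_I2)
  fix x
  have "f x powr \<alpha> <= c2 powr \<alpha>" using f_bd(2)[of x] f_pos[of x] assms by (intro powr_mono2) auto
  then show "norm (f x powr \<alpha> * indicator (U \<sigma>) x) <= norm (c2 powr \<alpha> * indicat_real (U (3/2)) x)"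
   using U_mono[OF assms(1)] by (auto simp: indicator_def)
 qed
qed measurable

lemma I_nonneg: "0 <= I \<alpha> \<sigma>"
 unfolding I_def by (intro integral_nonneg_AE) auto

lemma I_mono: "\<sigma>' <= \<sigma> ==> \<sigma> <= 3/2 ==> 0 <= \<alpha> ==> I \<alpha> \<sigma>' <= I \<alpha> \<sigma>"
 unfolding I_def using U_mono[of \<sigma>' \<sigma>] by (intro integral_mono integrable_f) (auto simp: indicator_def)

lemma I_pos: "1 <= \<sigma> ==> \<sigma> <= 3/2 ==> 0 <= \<alpha> ==> 0 < I \<alpha> \<sigma>"
proof -
 assume s: "1 <= \<sigma>" "\<sigma> <= 3/2" "0 <= \<alpha>"
 have fin: "emeasure M (U 1) \<noteq> \<infinity>" using U_fin emeasure_mono[OF U_mono[of 1 "3/2"], of M] by (auto simp: top_unique)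
 have "0 < c1 powr \<alpha> * measure M (U 1)" using c1 U_pos by simp
 also have "\<dots> = (\<integral>x. c1 powr \<alpha> * indicat_real (U 1) x \<partial>M)" by simp
 also have "\<dots> <= I \<alpha> \<sigma>" unfolding I_def
 proof (rule integral_mono)
  show "integrable M (\<lambda>x. c1 powr \<alpha> * indicat_real (U 1) x)"
   using fin by (intro integrable_mult_right) (simp add: top.not_eq_extremum)
  fix x
  have "c1 powr \<alpha> <= f x powr \<alpha>" using f_bd(1)[of x] c1 s by (intro powr_mono2) auto
  then show "c1 powr \<alpha> * indicat_real (U 1) x <= f x powr \<alpha> * indicator (U \<sigma>) x"
   using U_mono[OF s(1)] by (auto simp: indicator_def)
 qed (rule integrable_f[OF s(2,3)])
 finally show ?thesis .
qed

lemma rev_I: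
 assumes "0 < \<alpha>" "P \<alpha>" "1 <= \<sigma>'" "\<sigma>' < \<sigma>" "\<sigma> <= 3/2"
 shows "I (\<alpha> * \<kappa>) \<sigma>' powr (1/\<kappa>) <= C0 * (1 + \<alpha>) powr p * (\<sigma> - \<sigma>') powr (-p) * I \<alpha> \<sigma>"
 using rev[OF assms] by (simp add: I_def)

abbreviation Bex :: real where "Bex \<equiv> moser_exp \<kappa>"
abbreviation Cm :: real where "Cm \<equiv> moser_const \<kappa> p C0"
lemmas Bex_def = moser_exp_def
lemmas Cm_def = moser_const_def

lemma Bex_pos: "0 < Bex"
 using \<kappa> by (auto simp: Bex_def)

lemma moser_step:
 assumes \<gamma>: "0 < \<gamma>" "\<gamma> <= 1" and J: "\<And>j. j < J ==> P (\<gamma> * \<kappa> ^ j)" and s: "1 <= \<sigma>'" "\<sigma>' < \<sigma>" "\<sigma> <= 3/2"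
 shows "I (\<gamma> * \<kappa> ^ J) \<sigma>' powr (1 / (\<gamma> * \<kappa> ^ J)) <= (Cm * (\<sigma> - \<sigma>') powr (- (p * Bex))) powr (1/\<gamma>) * I \<gamma> \<sigma> powr (1/\<gamma>)"
proof -
 define \<delta> where "\<delta> = \<sigma> - \<sigma>'"
 have \<delta>: "0 < \<delta>" "\<delta> <= 1" using s by (auto simp: \<delta>_def)
 define \<sigma>j where "\<sigma>j j = \<sigma>' + \<delta> * (1/2) ^ j" for j :: nat
 define E where "E = C0 * 4 powr p * (2 * \<kappa>) powr p * \<delta> powr (-p)"
 have \<delta>p: "1 <= \<delta> powr (-p)" using \<delta> p powr_mono2'[of "-p" \<delta> 1] by simp
 have E1: "1 <= E"
 proof -
  have "1 <= (4::real) powr p" "1 <= (2 * \<kappa>) powr p" using p \<kappa> by (auto intro!: ge_one_powr_ge_zero)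
  then show ?thesis unfolding E_def by (intro one_le_mult_real C0 \<delta>p)
 qed
 define m where "m j = I (\<gamma> * \<kappa> ^ j) (\<sigma>j j) powr (1 / (\<gamma> * \<kappa> ^ j))" for j
 have kj: "0 < \<gamma> * \<kappa> ^ j" "1 <= \<kappa> ^ j" for j using \<gamma> \<kappa> by (auto simp: one_le_power)
 have step: "m (Suc j) <= E powr (real (Suc j) / (\<gamma> * \<kappa> ^ j)) * m j" if "j < J" for j
 proof -
  have h: "0 < (1/2::real) ^ j" "(1/2::real) ^ j <= 1" by (auto simp: power_le_one)
  have sj: "1 <= \<sigma>j (Suc j)" "\<sigma>j (Suc j) < \<sigma>j j" "\<sigma>j j <= 3/2" "\<sigma>j j - \<sigma>j (Suc j) = \<delta> * (1/2) ^ Suc j"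
  proof -
   have "\<delta> * (1/2) ^ j <= \<delta> * 1" using \<delta> h by (intro mult_left_mono) auto
   then show "\<sigma>j j <= 3/2" using s \<delta>_def unfolding \<sigma>j_def by linarith
   have hs: "0 < \<delta> * (1/2) ^ Suc j" "\<delta> * (1/2) ^ j = 2 * (\<delta> * (1/2) ^ Suc j)" using \<delta> by auto
   show "1 <= \<sigma>j (Suc j)" using s hs unfolding \<sigma>j_def by linarith
   show "\<sigma>j (Suc j) < \<sigma>j j" using hs unfolding \<sigma>j_def by linarith
   show "\<sigma>j j - \<sigma>j (Suc j) = \<delta> * (1/2) ^ Suc j" by (simp add: \<sigma>j_def)
  qed
  let ?a = "\<gamma> * \<kappa> ^ j"
  have "I (?a * \<kappa>) (\<sigma>j (Suc j)) powr (1/\<kappa>) <= C0 * (1 + ?a) powr p * (\<sigma>j j - \<sigma>j (Suc j)) powr (-p) * I ?a (\<sigma>j j)"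
   by (rule rev_I[OF kj(1) J[OF that] sj(1-3)])
  also have "\<dots> <= E ^ Suc j * I ?a (\<sigma>j j)"
  proof (rule mult_right_mono[OF _ I_nonneg])
   have "?a <= \<kappa> ^ j" using \<gamma> kj(2)[of j] mult_right_mono[of \<gamma> 1 "\<kappa> ^ j"] by simp
   then have "1 + ?a <= 2 * \<kappa> ^ j" using kj(2)[of j] by linarith
   then have "(1 + ?a) powr p <= (2 * \<kappa> ^ j) powr p" using kj(1)[of j] p by (intro powr_mono2) auto
   also have "\<dots> <= ((2 * \<kappa>) ^ Suc j) powr p"
   proof -
    have "2 * \<kappa> ^ j <= 2 ^ Suc j * \<kappa> ^ Suc j" using \<kappa> kj(2)[of j]
     by (intro mult_mono power_increasing) (auto simp: self_le_power)
    then have "2 * \<kappa> ^ j <= (2 * \<kappa>) ^ Suc j" by (simp only: power_mult_distrib)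
    then show ?thesis using p \<kappa> by (intro powr_mono2) auto
   qed
   also have "\<dots> = ((2 * \<kappa>) powr p) ^ Suc j" using \<kappa> by (intro power_powr_swap) simp
   finally have a: "(1 + ?a) powr p <= ((2 * \<kappa>) powr p) ^ Suc j" .
   have "(\<sigma>j j - \<sigma>j (Suc j)) powr (-p) = \<delta> powr (-p) * (2 powr p) ^ Suc j"
   proof -
    have "((1/2) ^ Suc j) powr (-p) = (2 powr p) ^ Suc j"
     by (simp add: powr_minus powr_power powr_realpow[symmetric] powr_powr powr_divide mult.commute field_simps del: power_Suc)
    then show ?thesis unfolding sj(4) using \<delta> by (simp add: powr_mult del: power_Suc)
   qed
   also have "\<dots> <= (\<delta> powr (-p)) ^ Suc j * (4 powr p) ^ Suc j"
    using \<delta>p p by (intro mult_mono power_mono powr_mono2) (auto intro: self_le_power simp del: power_Suc)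
   finally have b: "(\<sigma>j j - \<sigma>j (Suc j)) powr (-p) <= (\<delta> powr (-p)) ^ Suc j * (4 powr p) ^ Suc j" .
   have c: "C0 <= C0 ^ Suc j" using C0 by (intro self_le_power) auto
   have "C0 * (1 + ?a) powr p * (\<sigma>j j - \<sigma>j (Suc j)) powr (-p) <= C0 ^ Suc j * ((2 * \<kappa>) powr p) ^ Suc j * ((\<delta> powr (-p)) ^ Suc j * (4 powr p) ^ Suc j)"
    using a b c C0 by (intro mult_mono) (auto simp del: power_Suc)
   also have "\<dots> = E ^ Suc j" by (simp add: E_def power_mult_distrib mult_ac del: power_Suc)
   finally show "C0 * (1 + ?a) powr p * (\<sigma>j j - \<sigma>j (Suc j)) powr (-p) <= E ^ Suc j" .
  qed
  finally have le: "I (?a * \<kappa>) (\<sigma>j (Suc j)) powr (1/\<kappa>) <= E ^ Suc j * I ?a (\<sigma>j j)" .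
  have "(I (?a * \<kappa>) (\<sigma>j (Suc j)) powr (1/\<kappa>)) powr (1/?a) <= (E ^ Suc j * I ?a (\<sigma>j j)) powr (1/?a)"
   using le kj(1)[of j] by (intro powr_mono2) auto
  then have "I (?a * \<kappa>) (\<sigma>j (Suc j)) powr (1/\<kappa> * (1/?a)) <= (E ^ Suc j) powr (1/?a) * I ?a (\<sigma>j j) powr (1/?a)"
   using E1 I_nonneg by (simp add: powr_powr powr_mult del: power_Suc)
  moreover have "(E ^ Suc j) powr (1/?a) = E powr (real (Suc j) / ?a)"
   using E1 by (simp add: powr_realpow[symmetric] powr_powr del: power_Suc of_nat_Suc)
  moreover have "1/\<kappa> * (1/?a) = 1 / (\<gamma> * \<kappa> ^ Suc j)" by simp
  ultimately show ?thesis by (simp add: m_def mult.assoc power_Suc2[symmetric] del: power_Suc of_nat_Suc) (simp add: mult_ac)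
 qed
 have ind: "n <= J ==> m n <= E powr ((\<Sum>j<n. real (Suc j) * (1/\<kappa>) ^ j) / \<gamma>) * m 0" for n
 proof (induction n)
  case 0
  then show ?case using E1 by simp
 next
  case (Suc n)
  have "m (Suc n) <= E powr (real (Suc n) / (\<gamma> * \<kappa> ^ n)) * m n" using Suc.prems by (intro step) auto
  also have "\<dots> <= E powr (real (Suc n) / (\<gamma> * \<kappa> ^ n)) * (E powr ((\<Sum>j<n. real (Suc j) * (1/\<kappa>) ^ j) / \<gamma>) * m 0)"
   using Suc by (intro mult_left_mono) auto
  also have "\<dots> = E powr (real (Suc n) / (\<gamma> * \<kappa> ^ n) + (\<Sum>j<n. real (Suc j) * (1/\<kappa>) ^ j) / \<gamma>) * m 0"
   by (simp add: powr_add)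
  also have "real (Suc n) / (\<gamma> * \<kappa> ^ n) + (\<Sum>j<n. real (Suc j) * (1/\<kappa>) ^ j) / \<gamma> = (\<Sum>j<Suc n. real (Suc j) * (1/\<kappa>) ^ j) / \<gamma>"
   using \<gamma> \<kappa> by (simp add: add_divide_distrib power_divide del: of_nat_Suc)
  finally show ?case .
 qed
 have "(\<lambda>n. real (Suc n) * (1/\<kappa>) ^ n) sums (1 / (1 - 1/\<kappa>)\<^sup>2)"
  using \<kappa> by (intro geometric_deriv_sums) auto
 then have "(\<Sum>j<J. real (Suc j) * (1/\<kappa>) ^ j) <= Bex"
  unfolding Bex_def using sum_le_suminf[of "\<lambda>n. real (Suc n) * (1/\<kappa>) ^ n" "{..<J}"] \<kappa> by (auto simp: sums_iff)
 then have "E powr ((\<Sum>j<J. real (Suc j) * (1/\<kappa>) ^ j) / \<gamma>) <= E powr (Bex / \<gamma>)"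
  using E1 \<gamma> by (intro powr_mono divide_right_mono) auto
 then have "m J <= E powr (Bex / \<gamma>) * m 0"
  using ind[of J] mult_right_mono[of "E powr ((\<Sum>j<J. real (Suc j) * (1/\<kappa>) ^ j) / \<gamma>)" "E powr (Bex / \<gamma>)" "m 0"] by (simp add: m_def)
 moreover have "E powr (Bex / \<gamma>) = (Cm * \<delta> powr (- (p * Bex))) powr (1/\<gamma>)"
 proof -
  have "E powr Bex = Cm * \<delta> powr (- (p * Bex))" using C0 \<kappa> \<delta> by (simp add: E_def Cm_def powr_mult powr_powr)
  moreover have "E powr (Bex / \<gamma>) = (E powr Bex) powr (1/\<gamma>)" by (simp add: powr_powr)
  ultimately show ?thesis by simp
 qed
 moreover have "m 0 = I \<gamma> \<sigma> powr (1/\<gamma>)" by (simp add: m_def \<sigma>j_def \<delta>_def)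
 moreover have "I (\<gamma> * \<kappa> ^ J) \<sigma>' powr (1 / (\<gamma> * \<kappa> ^ J)) <= m J"
  unfolding m_def
 proof (intro powr_mono2 I_mono I_nonneg)
  show "\<sigma>' <= \<sigma>j J" using \<delta> by (simp add: \<sigma>j_def)
  have "\<delta> * (1/2) ^ J <= \<delta> * 1" using \<delta> by (intro mult_left_mono) (auto simp: power_le_one)
  then show "\<sigma>j J <= 3/2" using s \<delta>_def unfolding \<sigma>j_def by linarith
 qed (use kj(1)[of J] in auto)
 ultimately show ?thesis by (simp add: \<delta>_def)
qed

lemma Cm_ge_1: "1 <= Cm"
proof -
 have "1 <= (4::real) powr p" "1 <= (2 * \<kappa>) powr p" using p \<kappa> by (auto intro!: ge_one_powr_ge_zero)
 then have "1 <= C0 * 4 powr p * (2 * \<kappa>) powr p" by (intro one_le_mult_real C0)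
 then show ?thesis unfolding Cm_def using Bex_pos by (intro ge_one_powr_ge_zero) auto
qed

lemma V_nonneg: "0 <= V"
 using U_V measure_nonneg[of M "U (3/2)"] by linarith

lemma measure_U_le: "\<sigma> <= 3/2 ==> measure M (U \<sigma>) <= V"
proof -
 assume "\<sigma> <= 3/2"
 moreover have "U (3/2) \<in> fmeasurable M" using U_fin by (intro fmeasurableI) (auto simp: top.not_eq_extremum)
 ultimately have "measure M (U \<sigma>) <= measure M (U (3/2))" by (intro measure_mono_fmeasurable U_mono U_sets)
 then show ?thesis using U_V by linarith
qed

definition \<psi> :: "real => real => real" where
 "\<psi> Q \<sigma> = ln (I Q \<sigma>) / Q"

lemma I_exp_psi: "1 <= \<sigma> ==> \<sigma> <= 3/2 ==> 0 < Q ==> I Q \<sigma> = exp (Q * \<psi> Q \<sigma>)"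
 using I_pos[of \<sigma> Q] by (simp add: \<psi>_def)

text \<open>Splitting at the level \<open>\<psi>/2\<close>: below it \<open>f\<close> is small, above it the set is small.\<close>

lemma small_power_bound:
 assumes s: "1 <= \<sigma>" "\<sigma> <= 3/2" and Q: "0 < Q" "0 < \<gamma>" "2 * \<gamma> <= Q" and \<psi>0: "0 < \<psi> Q \<sigma>"
  and T: "0 < T" "2 * T <= \<psi> Q \<sigma>" and tail: "\<And>l. 0 < l ==> measure M {x \<in> U (3/2). l < ln (f x)} <= T / l"
  and \<gamma>: "\<gamma> * \<psi> Q \<sigma> <= ln (\<psi> Q \<sigma> / (2 * T))"
 shows "I \<gamma> \<sigma> <= (V + 2) * exp (\<gamma> * \<psi> Q \<sigma> / 2)"
proof -
 let ?p = "\<psi> Q \<sigma>"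
 define E where "E = {x \<in> U (3/2). ?p / 2 < ln (f x)}"
 have UM: "U (3/2) \<subseteq> space M" using sets.sets_into_space[OF U_sets] .
 have "{x \<in> space M. x \<in> U (3/2) \<and> ?p / 2 < ln (f x)} \<in> sets M" by measurable
 moreover have "E = {x \<in> space M. x \<in> U (3/2) \<and> ?p / 2 < ln (f x)}" using UM unfolding E_def by blast
 ultimately have [measurable]: "E \<in> sets M" by simp
 have Efin: "emeasure M E \<noteq> \<infinity>"
 proof -
  have "emeasure M E <= emeasure M (U (3/2))" by (rule emeasure_mono) (auto simp: E_def)
  then show ?thesis using U_fin by (auto simp: top_unique)
 qed
 define e where "e = 2 * T / ?p"
 have e: "0 < e" "e <= 1" using T \<psi>0 by (auto simp: e_def)
 have mE: "measure M E <= e" using tail[of "?p / 2"] \<psi>0 by (simp add: E_def e_def mult.commute)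
 define t where "t = e powr (-(1/2))"
 have t: "1 <= t" using e powr_mono2'[of "-(1/2)" e 1] by (simp add: t_def)
 have te1: "1 / t = e powr (1/2)" unfolding t_def powr_minus_divide by simp
 have "t * e = e powr (-(1/2)) * e powr 1" using e by (simp add: t_def)
 also have "\<dots> = e powr (1/2)" unfolding powr_add[symmetric] by simp
 finally have te2: "t * e = e powr (1/2)" .
 have pt: "f x powr \<gamma> * indicator (U \<sigma>) x <= exp (\<gamma> * ?p / 2) * indicat_real (U \<sigma>) x
   + exp (\<gamma> * ?p) * ((1 / t) * (exp (- Q * ?p) * (f x powr Q * indicator (U \<sigma>) x)) + t * indicat_real E x)" for x
 proof (cases "x \<in> U \<sigma>")
  case True
  show ?thesis
  proof (cases "x \<in> E")
   case xE: True
   define y where "y = f x * exp (- ?p)"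
   have y: "y > 0" using f_pos by (simp add: y_def)
   have "y powr \<gamma> <= (1 / t) * y powr Q + t"
   proof (cases "y powr \<gamma> <= t")
    case True
    then show ?thesis using t by (simp add: add_increasing)
   next
    case False
    then have "y powr \<gamma> > 1" using t by linarith
    have "y > 1"
    proof (rule ccontr)
     assume "\<not> y > 1"
     then have "y powr \<gamma> <= 1" using y Q(2) by (intro powr_le1) auto
     then show False using \<open>y powr \<gamma> > 1\<close> by linarith
    qed
    then have "y powr (2 * \<gamma>) <= y powr Q" using Q by (intro powr_mono) auto
    moreover have "y powr (2 * \<gamma>) = y powr \<gamma> * y powr \<gamma>" by (simp add: powr_add[symmetric])
    moreover have "t * y powr \<gamma> <= y powr \<gamma> * y powr \<gamma>" using False by (intro mult_right_mono) auto
    ultimately have "t * y powr \<gamma> <= y powr Q" by linarith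
    then have "y powr \<gamma> <= (1 / t) * y powr Q" using t by (simp add: field_simps)
    then show ?thesis using t by linarith
   qed
   moreover have yp: "y powr a = f x powr a * exp (- (a * ?p))" for a
    using f_pos[of x] by (simp add: y_def powr_mult exp_powr_real mult.commute del: exp_minus)
   have "f x powr \<gamma> = exp (\<gamma> * ?p) * y powr \<gamma>" unfolding yp by (simp add: exp_minus)
   moreover have "y powr Q = exp (- Q * ?p) * f x powr Q" unfolding yp by simp
   ultimately have "f x powr \<gamma> <= exp (\<gamma> * ?p) * ((1 / t) * (exp (- Q * ?p) * f x powr Q) + t)" by simp
   then show ?thesis using True xE by (simp add: add_increasing)
  next
   case False
   then have "ln (f x) <= ?p / 2" using True U_mono[OF s(2)] by (auto simp: E_def)
   then have "\<gamma> * ln (f x) <= \<gamma> * (?p / 2)" using Q by (intro mult_left_mono) auto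
   then have "f x powr \<gamma> <= exp (\<gamma> * ?p / 2)" using f_pos[of x] by (simp add: powr_def)
   moreover have "0 <= exp (\<gamma> * ?p) * ((1 / t) * (exp (- Q * ?p) * f x powr Q))" using t by auto
   ultimately show ?thesis using True False by simp
  qed
 next
  case False
  then show ?thesis using t by simp
 qed
 have iU: "integrable M (indicat_real (U \<sigma>))"
 proof -
  have "f x powr 0 = 1" for x using f_pos[of x] by simp
  then show ?thesis using integrable_f[OF s(2), of 0] by simp
 qed
 have iE: "integrable M (indicat_real E)" using Efin by (simp add: top.not_eq_extremum)
 have iQ: "integrable M (\<lambda>x. f x powr Q * indicator (U \<sigma>) x)" using integrable_f[OF s(2)] Q by simp
 have i2: "integrable M (\<lambda>x. exp (\<gamma> * ?p) * ((1 / t) * (exp (- Q * ?p) * (f x powr Q * indicator (U \<sigma>) x)) + t * indicat_real E x))"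
  by (intro integrable_mult_right Bochner_Integration.integrable_add iQ iE)
 have "I \<gamma> \<sigma> <= (\<integral>x. exp (\<gamma> * ?p / 2) * indicat_real (U \<sigma>) x
   + exp (\<gamma> * ?p) * ((1 / t) * (exp (- Q * ?p) * (f x powr Q * indicator (U \<sigma>) x)) + t * indicat_real E x) \<partial>M)"
  unfolding I_def using Q by (intro integral_mono integrable_f s pt Bochner_Integration.integrable_add integrable_mult_right iU i2) auto
 also have "\<dots> = exp (\<gamma> * ?p / 2) * measure M (U \<sigma>) + exp (\<gamma> * ?p) * ((1 / t) * (exp (- Q * ?p) * I Q \<sigma>) + t * measure M E)"
  unfolding I_def using iU iE iQ by (simp add: Bochner_Integration.integral_add)
 also have "\<dots> <= exp (\<gamma> * ?p / 2) * V + exp (\<gamma> * ?p) * ((1 / t) * 1 + t * e)"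
 proof -
  have "exp (- Q * ?p) * I Q \<sigma> = 1" using I_exp_psi[OF s Q(1)] by (simp add: exp_add[symmetric])
  then show ?thesis using mE t measure_U_le[OF s(2)] by (intro add_mono mult_left_mono) auto
 qed
 also have "\<dots> = exp (\<gamma> * ?p / 2) * V + 2 * (exp (\<gamma> * ?p) * e powr (1/2))" unfolding te1 te2 by simp
 also have "\<dots> <= exp (\<gamma> * ?p / 2) * V + 2 * exp (\<gamma> * ?p / 2)"
 proof -
  have "ln e = - ln (?p / (2 * T))" using T \<psi>0 by (simp add: e_def ln_div)
  then have "ln e <= - (\<gamma> * ?p)" using \<gamma> by simp
  then have "exp (\<gamma> * ?p) * e powr (1/2) <= exp (\<gamma> * ?p / 2)"
   using e by (simp add: powr_def exp_add[symmetric])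
  then show ?thesis by simp
 qed
 finally show ?thesis by (simp add: algebra_simps)
qed

lemma bombieri_giusti_step:
 assumes Q: "0 < Q" "\<And>\<alpha>. 0 < \<alpha> ==> \<alpha> <= Q / \<kappa> ==> P \<alpha>" and T: "0 < T"
  and \<gamma>0: "\<gamma>0 = Q / \<kappa> ^ J0" "\<gamma>0 <= 1" "2 * \<gamma>0 <= Q"
  and tail: "\<And>l. 0 < l ==> measure M {x \<in> U (3/2). l < ln (f x)} <= T / l"
  and s: "1 <= \<sigma>'" "\<sigma>' < \<sigma>" "\<sigma> <= 3/2"
 shows "max 0 (\<psi> Q \<sigma>') <= 3/4 * max 0 (\<psi> Q \<sigma>)
   + (2 * T + 2 / (T * \<gamma>0\<^sup>2) + 2 * T * (Cm * (V + 2)) powr (4 * \<kappa>)) * (\<sigma> - \<sigma>') powr (- (p * Bex * (4 * \<kappa>)))"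
proof -
 let ?p = "\<psi> Q \<sigma>"
 define \<delta> where "\<delta> = \<sigma> - \<sigma>'"
 have \<delta>: "0 < \<delta>" "\<delta> <= 1" using s by (auto simp: \<delta>_def)
 define \<mu> where "\<mu> = p * Bex * (4 * \<kappa>)"
 have \<mu>: "\<mu> > 0" using p Bex_pos \<kappa> by (simp add: \<mu>_def)
 have \<delta>\<mu>: "1 <= \<delta> powr (-\<mu>)" using \<delta> \<mu> powr_mono2'[of "-\<mu>" \<delta> 1] by simp
 have g0: "\<gamma>0 > 0" using \<gamma>0 Q \<kappa> by simp
 define A0 where "A0 = 2 * T + 2 / (T * \<gamma>0\<^sup>2)"
 define X where "X = Cm * (V + 2) * \<delta> powr (- (p * Bex))"
 have X1: "1 <= X"
 proof -
  have "1 <= \<delta> powr (- (p * Bex))" using \<delta> p Bex_pos powr_mono2'[of "- (p * Bex)" \<delta> 1] by simp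
  moreover have "1 <= V + 2" using V_nonneg by simp
  ultimately show ?thesis unfolding X_def by (intro one_le_mult_real Cm_ge_1)
 qed
 have XA: "X powr (4 * \<kappa>) = (Cm * (V + 2)) powr (4 * \<kappa>) * \<delta> powr (-\<mu>)"
  using Cm_ge_1 V_nonneg \<delta> by (simp add: X_def powr_mult powr_powr \<mu>_def)
 define W where "W = (A0 + 2 * T * (Cm * (V + 2)) powr (4 * \<kappa>)) * \<delta> powr (-\<mu>)"
 have A0n: "0 <= A0" using T g0 by (simp add: A0_def)
 have W1: "A0 <= W" "2 * T * X powr (4 * \<kappa>) <= W"
 proof -
  have "A0 * 1 <= A0 * \<delta> powr (-\<mu>)" using A0n \<delta>\<mu> by (intro mult_left_mono) auto
  then show "A0 <= W" using T by (simp add: W_def algebra_simps add_increasing2)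
  show "2 * T * X powr (4 * \<kappa>) <= W" unfolding XA W_def using A0n by (simp add: algebra_simps)
 qed
 have W0: "0 <= W" using W1 A0n by linarith
 have mono: "\<psi> Q \<sigma>' <= ?p"
  unfolding \<psi>_def using I_mono[of \<sigma>' \<sigma> Q] I_pos[of \<sigma>' Q] s Q by (intro divide_right_mono) auto
 have "max 0 (\<psi> Q \<sigma>') <= 3/4 * max 0 ?p + W"
 proof (cases "?p <= W")
  case True
  then show ?thesis using mono W0 by auto
 next
  case False
  then have pW: "?p > A0" "?p > 2 * T * X powr (4 * \<kappa>)" using W1 by auto
  then have p0: "?p > 0" "?p >= 2 * T" "?p >= 2 / (T * \<gamma>0\<^sup>2)"
  proof -
   have "0 <= 2 / (T * \<gamma>0\<^sup>2)" using T by simp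
   then show "?p > 0" "?p >= 2 * T" "?p >= 2 / (T * \<gamma>0\<^sup>2)" using pW(1) T unfolding A0_def by linarith+
  qed
  define Lg where "Lg = ln (?p / (2 * T))"
  have "X powr (4 * \<kappa>) < ?p / (2 * T)" using pW T by (simp add: field_simps)
  moreover have Xk: "1 <= X powr (4 * \<kappa>)" using X1 \<kappa> by (intro ge_one_powr_ge_zero) auto
  ultimately have "ln (X powr (4 * \<kappa>)) < Lg" unfolding Lg_def by (subst ln_less_cancel_iff) auto
  then have LgX: "4 * \<kappa> * ln X < Lg" using X1 by (simp add: ln_powr)
  have lnX: "0 <= ln X" using X1 by simp
  have "0 <= 4 * \<kappa> * ln X" using lnX \<kappa> by simp
  then have Lg0: "0 < Lg" using LgX by linarith
  define g where "g = Lg / ?p"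
  have g: "0 < g" using Lg0 p0 by (simp add: g_def)
  have "g <= \<gamma>0"
  proof -
   define y where "y = ?p / (2 * T)"
   have y: "y > 0" using p0 T by (simp add: y_def)
   have "ln y = 2 * ln (sqrt y)" using y by (simp add: ln_sqrt)
   also have "\<dots> <= 2 * sqrt y" using y ln_le_minus_one[of "sqrt y"] by simp
   finally have "Lg <= 2 * sqrt y" by (simp add: Lg_def y_def)
   also have "2 * sqrt y <= \<gamma>0 * ?p"
   proof (rule power2_le_imp_le)
    have "4 * y <= \<gamma>0\<^sup>2 * ?p\<^sup>2"
    proof -
     have "2 / T <= \<gamma>0\<^sup>2 * ?p" using p0(3) T g0 by (simp add: field_simps)
     then have "2 / T * ?p <= \<gamma>0\<^sup>2 * ?p * ?p" using p0 by (intro mult_right_mono) auto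
     then show ?thesis using T by (simp add: y_def power2_eq_square mult.assoc)
    qed
    then show "(2 * sqrt y)\<^sup>2 <= (\<gamma>0 * ?p)\<^sup>2" using y by (simp add: power_mult_distrib)
   qed (use g0 p0 in auto)
   finally show ?thesis using p0 by (simp add: g_def field_simps)
  qed
  obtain J where J: "Q / \<kappa> ^ J <= g" "g < Q / \<kappa> ^ J * \<kappa>" "J >= J0"
  proof -
   define J where "J = (LEAST n. Q / \<kappa> ^ n <= g)"
   obtain n0 where "Q / g < \<kappa> ^ n0" using real_arch_pow[OF \<kappa>] by blast
   then have "Q / \<kappa> ^ n0 <= g" using g \<kappa> by (simp add: field_simps less_imp_le)
   then have J1: "Q / \<kappa> ^ J <= g" unfolding J_def by (rule LeastI)
   have J2: "\<not> Q / \<kappa> ^ n <= g" if "n < J" for n using that not_less_Least unfolding J_def by blast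
   show ?thesis
   proof (cases "J >= J0 \<and> J \<noteq> 0")
    case True
    then have "\<not> Q / \<kappa> ^ (J - 1) <= g" by (intro J2) auto
    moreover have "Q / \<kappa> ^ (J - 1) = Q / \<kappa> ^ J * \<kappa>" using True \<kappa> by (cases J) auto
    ultimately show ?thesis using that[of J] J1 True by auto
   next
    case False
    then have "\<kappa> ^ J <= \<kappa> ^ J0" using \<kappa> by (intro power_increasing) auto
    then have "\<gamma>0 <= Q / \<kappa> ^ J" unfolding \<gamma>0(1) using Q \<kappa> by (intro divide_left_mono) auto
    then have eq: "g = \<gamma>0" using J1 \<open>g <= \<gamma>0\<close> by linarith
    have "g * 1 < g * \<kappa>" using g \<kappa> by (intro mult_strict_left_mono) auto
    then show ?thesis using that[of J0] eq \<gamma>0(1) by simp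
   qed
  qed
  define \<gamma> where "\<gamma> = Q / \<kappa> ^ J"
  have \<gamma>: "0 < \<gamma>" using Q \<kappa> by (simp add: \<gamma>_def)
  have "\<gamma> <= \<gamma>0" using J(1) \<open>g <= \<gamma>0\<close> by (simp add: \<gamma>_def)
  then have \<gamma>1: "\<gamma> <= 1" "2 * \<gamma> <= Q" using \<gamma>0 by auto
  have gJ: "\<gamma> * \<kappa> ^ J = Q" using \<kappa> by (simp add: \<gamma>_def)
  have small: "I \<gamma> \<sigma> <= (V + 2) * exp (\<gamma> * ?p / 2)"
  proof (rule small_power_bound[OF _ s(3) Q(1) \<gamma> \<gamma>1(2) p0(1) T p0(2) tail])
   have "\<gamma> * ?p <= g * ?p" using J(1) p0 by (intro mult_right_mono) (auto simp: \<gamma>_def)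
   then show "\<gamma> * ?p <= ln (?p / (2 * T))" using p0 by (simp add: g_def Lg_def)
  qed (use s in auto)
  have "I Q \<sigma>' powr (1/Q) <= (Cm * \<delta> powr (- (p * Bex))) powr (1/\<gamma>) * I \<gamma> \<sigma> powr (1/\<gamma>)"
  proof -
   have "P (\<gamma> * \<kappa> ^ j)" if "j < J" for j
   proof (rule Q(2))
    show "0 < \<gamma> * \<kappa> ^ j" using \<gamma> \<kappa> by simp
    have "\<kappa> ^ Suc j <= \<kappa> ^ J" using that \<kappa> by (intro power_increasing) auto
    then have "\<gamma> * \<kappa> ^ Suc j <= Q" using gJ mult_left_mono[of "\<kappa> ^ Suc j" "\<kappa> ^ J" \<gamma>] \<gamma> by simp
    then show "\<gamma> * \<kappa> ^ j <= Q / \<kappa>" using \<kappa> by (simp add: field_simps)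
   qed
   then have "I (\<gamma> * \<kappa> ^ J) \<sigma>' powr (1 / (\<gamma> * \<kappa> ^ J)) <= (Cm * (\<sigma> - \<sigma>') powr (- (p * Bex))) powr (1/\<gamma>) * I \<gamma> \<sigma> powr (1/\<gamma>)"
    by (rule moser_step[OF \<gamma> \<gamma>1(1) _ s])
   then show ?thesis by (simp only: gJ \<delta>_def)
  qed
  also have "\<dots> <= (Cm * \<delta> powr (- (p * Bex))) powr (1/\<gamma>) * ((V + 2) * exp (\<gamma> * ?p / 2)) powr (1/\<gamma>)"
   using small \<gamma> I_nonneg by (intro mult_left_mono powr_mono2) auto
  also have "\<dots> = X powr (1/\<gamma>) * exp (?p / 2)"
   using Cm_ge_1 V_nonneg \<gamma> by (simp add: X_def powr_mult exp_powr_real mult_ac)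
  finally have "ln (I Q \<sigma>' powr (1/Q)) <= ln (X powr (1/\<gamma>) * exp (?p / 2))"
   using I_pos[of \<sigma>' Q] s Q X1 by (subst ln_le_cancel_iff) auto
  then have "\<psi> Q \<sigma>' <= ln X / \<gamma> + ?p / 2"
   using I_pos[of \<sigma>' Q] s Q X1 by (simp add: \<psi>_def ln_mult ln_powr)
  also have "ln X / \<gamma> <= ?p / 4"
  proof -
   have "1 / \<gamma> <= \<kappa> / g" using J(2) g \<gamma> \<kappa> by (simp add: \<gamma>_def[symmetric] field_simps)
   then have "ln X * (1 / \<gamma>) <= ln X * (\<kappa> / g)" using lnX by (intro mult_left_mono) auto
   also have "\<dots> = (4 * \<kappa> * ln X) * (?p / (4 * Lg))" using p0 Lg0 by (simp add: g_def)
   also have "\<dots> <= Lg * (?p / (4 * Lg))" using LgX p0 Lg0 by (intro mult_right_mono) auto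
   also have "\<dots> = ?p / 4" using Lg0 by simp
   finally show ?thesis by simp
  qed
  finally show ?thesis using p0 W0 by auto
 qed
 then show ?thesis by (simp add: W_def A0_def \<mu>_def \<delta>_def add.assoc)
qed

lemma sup_bound:
 assumes P: "\<And>\<alpha>. 0 < \<alpha> ==> P \<alpha>"
 shows "AE x in M. x \<in> U 1 --> f x <= Cm * (1/4) powr (- (p * Bex)) * I 1 (5/4)"
proof -
 define C2 where "C2 = Cm * (1/4) powr (- (p * Bex)) * I 1 (5/4)"
 have C2: "0 < C2" using Cm_ge_1 I_pos[of "5/4" 1] by (simp add: C2_def)
 have mo: "I (\<kappa> ^ J) 1 <= C2 powr (\<kappa> ^ J)" for J
 proof -
  have "I (1 * \<kappa> ^ J) 1 powr (1 / (1 * \<kappa> ^ J)) <= (Cm * (5/4 - 1) powr (- (p * Bex))) powr (1/1) * I 1 (5/4) powr (1/1)"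
   using \<kappa> by (intro moser_step P) auto
  then have "I (\<kappa> ^ J) 1 powr (1 / \<kappa> ^ J) <= C2"
   using Cm_ge_1 I_nonneg[of 1 "5/4"] by (simp add: C2_def)
  then have "(I (\<kappa> ^ J) 1 powr (1 / \<kappa> ^ J)) powr (\<kappa> ^ J) <= C2 powr (\<kappa> ^ J)"
   using \<kappa> by (intro powr_mono2) auto
  then show ?thesis using \<kappa> I_nonneg by (simp add: powr_powr)
 qed
 have null: "AE x in M. x \<in> U 1 --> f x <= C2 * (1 + e)" if e: "e > 0" for e
 proof -
  define E where "E = {x \<in> space M. x \<in> U 1 \<and> C2 * (1 + e) < f x}"
  have [measurable]: "E \<in> sets M" unfolding E_def by measurable
  have Efin: "emeasure M E \<noteq> \<infinity>"
  proof -
   have "U 1 \<subseteq> U (3/2)" by (rule U_mono) simp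
   then have "emeasure M E <= emeasure M (U (3/2))" by (intro emeasure_mono) (auto simp: E_def)
   then show ?thesis using U_fin by (auto simp: top_unique)
  qed
  have mE: "measure M E <= (1 / (1 + e)) powr (\<kappa> ^ J)" for J
  proof -
   have "(\<integral>x. (C2 * (1 + e)) powr (\<kappa> ^ J) * indicat_real E x \<partial>M) <= I (\<kappa> ^ J) 1"
    unfolding I_def
   proof (rule integral_mono)
    show "integrable M (\<lambda>x. (C2 * (1 + e)) powr (\<kappa> ^ J) * indicat_real E x)"
     using Efin by (intro integrable_mult_right) (simp add: top.not_eq_extremum)
    show "integrable M (\<lambda>x. f x powr (\<kappa> ^ J) * indicator (U 1) x)" using \<kappa> by (intro integrable_f) auto
    fix x
    show "(C2 * (1 + e)) powr (\<kappa> ^ J) * indicat_real E x <= f x powr (\<kappa> ^ J) * indicator (U 1) x"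
     using C2 e \<kappa> by (cases "x \<in> E") (auto simp: E_def intro!: powr_mono2)
   qed
   then have "(C2 * (1 + e)) powr (\<kappa> ^ J) * measure M E <= C2 powr (\<kappa> ^ J)" using mo[of J] by simp
   then have "(1 + e) powr (\<kappa> ^ J) * measure M E <= 1"
    using C2 e by (simp add: powr_mult mult.assoc)
   then show ?thesis using e by (simp add: powr_divide field_simps)
  qed
  have lim: "(\<lambda>J. (1 / (1 + e)) powr (\<kappa> ^ J)) \<longlonglongrightarrow> 0"
  proof (rule tendsto_sandwich[of "\<lambda>_. 0"])
   have kJ: "real J * (\<kappa> - 1) <= \<kappa> ^ J" for J
    using Bernoulli_inequality[of "\<kappa> - 1" J] \<kappa> by (simp add: add.commute)
   show "\<forall>\<^sub>F J in sequentially. (1 / (1 + e)) powr (\<kappa> ^ J) <= ((1 / (1 + e)) powr (\<kappa> - 1)) ^ J"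
   proof (intro always_eventually allI)
    fix J
    have "(1 / (1 + e)) powr (\<kappa> ^ J) <= (1 / (1 + e)) powr (real J * (\<kappa> - 1))"
     using e kJ by (intro powr_mono') auto
    then show "(1 / (1 + e)) powr (\<kappa> ^ J) <= ((1 / (1 + e)) powr (\<kappa> - 1)) ^ J"
     using e by (simp add: powr_power mult.commute)
   qed
   have "(1 / (1 + e)) powr (\<kappa> - 1) < 1" using e \<kappa> powr_less_mono2[of "\<kappa> - 1" "1 / (1 + e)" 1] by simp
   then show "(\<lambda>J. ((1 / (1 + e)) powr (\<kappa> - 1)) ^ J) \<longlonglongrightarrow> 0" by (intro LIMSEQ_power_zero) auto
  qed auto
  have "measure M E <= 0" by (rule LIMSEQ_le_const[OF lim]) (use mE in blast)
  then have "measure M E = 0" using measure_nonneg[of M E] by linarith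
  then have "emeasure M E = 0" using Efin by (simp add: measure_def enn2real_eq_0_iff)
  then have "E \<in> null_sets M" by (simp add: null_setsI)
  then have "AE x in M. x \<notin> E" by (rule AE_not_in)
  then show ?thesis using AE_space
  proof eventually_elim
   case (elim x)
   then show ?case by (auto simp: E_def)
  qed
 qed
 have "AE x in M. \<forall>n::nat. x \<in> U 1 --> f x <= C2 * (1 + 1 / real (Suc n))"
  unfolding AE_all_countable by (intro allI null) simp
 then show ?thesis
 proof eventually_elim
  case (elim x)
  show ?case
  proof
   assume "x \<in> U 1"
   then have le: "\<forall>n. f x <= C2 * (1 + 1 / real (Suc n))" using elim by blast
   have lim: "(\<lambda>n. C2 * (1 + 1 / real (Suc n))) \<longlonglongrightarrow> C2 * (1 + 0)"
    by (rule tendsto_mult[OF tendsto_const tendsto_add[OF tendsto_const LIMSEQ_Suc[OF lim_1_over_n]]])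
   have "f x <= C2 * (1 + 0)" by (rule LIMSEQ_le_const[OF lim]) (use le in blast)
   then show "f x <= Cm * (1/4) powr (- (p * Bex)) * I 1 (5/4)" by (simp add: C2_def)
  qed
 qed
qed

end

lemma nat_power_ge:
 fixes \<kappa> y :: real
 assumes "1 < \<kappa>" obtains n :: nat where "y <= \<kappa> ^ n"
 using real_arch_pow[OF assms, of y] less_imp_le by blast

lemma power_mean_bound:
 fixes \<kappa> p C0 V T Q :: real
 assumes "1 < \<kappa>" "0 < p" "0 < T" "0 < Q"
 shows "\<exists>K>0. \<forall>(M :: 'b measure) U f c1 c2 P. moser M U f c1 c2 V \<kappa> p C0 P -->
  (\<forall>\<alpha>>0. \<alpha> <= Q / \<kappa> --> P \<alpha>) --> (\<forall>t>0. measure M {x \<in> U (3/2). t < ln (f x)} <= T / t) -->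
  (\<integral>x. f x powr Q * indicator (U (5/4)) x \<partial>M) powr (1/Q) <= K"
proof -
 define \<mu> where "\<mu> = p * moser_exp \<kappa> * (4 * \<kappa>)"
 have "1 - 1/\<kappa> \<noteq> 0" using assms by auto
 then have "moser_exp \<kappa> > 0" by (simp add: moser_exp_def)
 then have \<mu>: "\<mu> > 0" using assms by (simp add: \<mu>_def)
 obtain Ka where Ka: "Ka > 0" "\<forall>\<phi> a b A B. a < b --> 0 <= A --> (\<forall>\<sigma>. a <= \<sigma> --> \<sigma> <= b --> \<phi> \<sigma> <= B) -->
   (\<forall>\<sigma>' \<sigma>. a <= \<sigma>' --> \<sigma>' < \<sigma> --> \<sigma> <= b --> \<phi> \<sigma>' <= 3/4 * \<phi> \<sigma> + A * (\<sigma> - \<sigma>') powr (-\<mu>)) -->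
   \<phi> a <= Ka * A * (b - a) powr (-\<mu>)"
  using absorb_iteration[OF \<mu>] by blast
 obtain J0 where J0: "max Q 2 <= \<kappa> ^ J0" using nat_power_ge[OF assms(1)] by blast
 define \<gamma>0 where "\<gamma>0 = Q / \<kappa> ^ J0"
 have kp: "\<kappa> ^ J0 > 0" using assms by simp
 have g: "\<gamma>0 <= 1" "2 * \<gamma>0 <= Q" using J0 assms kp mult_left_mono[of 2 "\<kappa> ^ J0" Q] by (auto simp: \<gamma>0_def divide_le_eq)
 define A where "A = 2 * T + 2 / (T * \<gamma>0\<^sup>2) + 2 * T * (moser_const \<kappa> p C0 * (V + 2)) powr (4 * \<kappa>)"
 have A0: "0 <= A" using assms by (simp add: A_def)
 show ?thesis
 proof (intro exI[of _ "exp (Ka * A * (3/2 - 5/4) powr (-\<mu>))"] conjI allI impI)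
  fix M :: "'b measure" and U f c1 c2 P
  assume mo: "moser M U f c1 c2 V \<kappa> p C0 P" and P0: "\<forall>\<alpha>>0. \<alpha> <= Q / \<kappa> --> P \<alpha>"
   and tail0: "\<forall>t>0. measure M {x \<in> U (3/2). t < ln (f x)} <= T / t"
  have P: "P \<alpha>" if "0 < \<alpha>" "\<alpha> <= Q / \<kappa>" for \<alpha> using P0 that by blast
  have tail: "measure M {x \<in> U (3/2). t < ln (f x)} <= T / t" if "0 < t" for t using tail0 that by blast
  interpret moser M U f c1 c2 V \<kappa> p C0 P by (rule mo)
  have le: "max 0 (\<psi> Q (5/4)) <= Ka * A * (3/2 - 5/4) powr (-\<mu>)"
  proof (rule Ka(2)[rule_format, of "5/4" "3/2" A "\<lambda>\<sigma>. max 0 (\<psi> Q \<sigma>)" "max 0 (\<psi> Q (3/2))"])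
   fix \<sigma> :: real assume s: "5/4 <= \<sigma>" "\<sigma> <= 3/2"
   have "\<psi> Q \<sigma> <= \<psi> Q (3/2)" unfolding \<psi>_def
    using I_mono[of \<sigma> "3/2" Q] I_pos[of \<sigma> Q] s assms by (intro divide_right_mono) auto
   then show "max 0 (\<psi> Q \<sigma>) <= max 0 (\<psi> Q (3/2))" by auto
  next
   fix \<sigma>' \<sigma> :: real assume "5/4 <= \<sigma>'" "\<sigma>' < \<sigma>" "\<sigma> <= 3/2"
   then show "max 0 (\<psi> Q \<sigma>') <= 3/4 * max 0 (\<psi> Q \<sigma>) + A * (\<sigma> - \<sigma>') powr (-\<mu>)"
    unfolding A_def \<mu>_def by (intro bombieri_giusti_step[OF assms(4) P assms(3) \<gamma>0_def g tail]) auto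
  qed (use A0 in auto)
  have "I Q (5/4) powr (1/Q) = exp (\<psi> Q (5/4))" using I_exp_psi[of "5/4" Q] assms by (simp add: powr_def)
  also have "\<dots> <= exp (Ka * A * (3/2 - 5/4) powr (-\<mu>))" using le by simp
  finally show "(\<integral>x. f x powr Q * indicator (U (5/4)) x \<partial>M) powr (1/Q) <= exp (Ka * A * (3/2 - 5/4) powr (-\<mu>))"
   by (simp add: I_def)
 qed simp
qed

definition harnack_const :: "'b itself => real => real => real => real => real => real => real => bool" where
 "harnack_const (t :: 'b itself) \<kappa> p C0 V T l K \<longleftrightarrow> (\<forall>(M :: 'b measure) U v c1 c2 k. v \<in> borel_measurable M --> 0 < c1 --> (\<forall>x. c1 <= v x) --> (\<forall>x. v x <= c2) -->
  (\<forall>\<sigma>. U \<sigma> \<in> sets M) --> (\<forall>\<sigma>' \<sigma>. \<sigma>' <= \<sigma> --> U \<sigma>' \<subseteq> U \<sigma>) --> emeasure M (U (3/2)) \<noteq> \<infinity> --> measure M (U (3/2)) <= V --> 0 < measure M (U 1) -->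
  (\<forall>\<alpha> \<sigma>' \<sigma>. \<alpha> \<noteq> 0 --> \<alpha> <= l / \<kappa> --> 1 <= \<sigma>' --> \<sigma>' < \<sigma> --> \<sigma> <= 3/2 -->
    (\<integral>x. v x powr (\<alpha> * \<kappa>) * indicator (U \<sigma>') x \<partial>M) powr (1/\<kappa>)
     <= C0 * (1 + \<bar>\<alpha>\<bar>) powr p * (\<sigma> - \<sigma>') powr (-p) * (\<integral>x. v x powr \<alpha> * indicator (U \<sigma>) x \<partial>M)) -->
  (\<forall>t>0. measure M {x \<in> U (3/2). t < \<bar>ln (v x) - k\<bar>} <= T / t) -->
  (AE x in M. x \<in> U 1 --> (\<integral>x. v x powr l * indicator (U 1) x \<partial>M) powr (1/l) <= K * v x))"

lemma reverse_hoelder_harnack: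
 fixes \<kappa> p C0 V T l :: real
 assumes \<kappa>: "1 < \<kappa>" and p: "0 < p" and C0: "1 <= C0" and T: "0 < T" and l: "0 < l"
 shows "\<exists>K>0. harnack_const TYPE('b) \<kappa> p C0 V T l K"
proof -
 obtain K1 where K1: "K1 > 0" "\<forall>(M :: 'b measure) U f c1 c2 P. moser M U f c1 c2 V \<kappa> p C0 P -->
  (\<forall>\<alpha>>0. \<alpha> <= l / \<kappa> --> P \<alpha>) --> (\<forall>t>0. measure M {x \<in> U (3/2). t < ln (f x)} <= T / t) -->
  (\<integral>x. f x powr l * indicator (U (5/4)) x \<partial>M) powr (1/l) <= K1"
  using power_mean_bound[OF \<kappa> p T l, of V C0] by blast
 obtain K2 where K2: "K2 > 0" "\<forall>(M :: 'b measure) U f c1 c2 P. moser M U f c1 c2 V \<kappa> p C0 P -->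
  (\<forall>\<alpha>>0. \<alpha> <= 1 / \<kappa> --> P \<alpha>) --> (\<forall>t>0. measure M {x \<in> U (3/2). t < ln (f x)} <= T / t) -->
  (\<integral>x. f x powr 1 * indicator (U (5/4)) x \<partial>M) powr (1/1) <= K2"
  using power_mean_bound[OF \<kappa> p T zero_less_one, of V C0] by blast
 define K3 where "K3 = moser_const \<kappa> p C0 * (1/4) powr (- (p * moser_exp \<kappa>)) * K2"
 have mc: "moser_const \<kappa> p C0 > 0" using C0 \<kappa> by (simp add: moser_const_def)
 have K3: "K3 > 0" using K2 mc by (simp add: K3_def)
 show ?thesis unfolding harnack_const_def
 proof (intro exI[of _ "K1 * K3"] conjI allI impI)
  show "K1 * K3 > 0" using K1 K3 by simp
  fix M :: "'b measure" and U v c1 c2 k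
  assume v [measurable]: "v \<in> borel_measurable M" and c1: "0 < c1" and vc10: "\<forall>x. c1 <= v x" and vc20: "\<forall>x. v x <= c2"
   and U0: "\<forall>\<sigma>. U \<sigma> \<in> sets M" and Um0: "\<forall>\<sigma>' \<sigma>. \<sigma>' <= \<sigma> --> U \<sigma>' \<subseteq> U \<sigma>"
   and Uf: "emeasure M (U (3/2)) \<noteq> \<infinity>" and UV: "measure M (U (3/2)) <= V" and Up: "0 < measure M (U 1)"
   and rev: "\<forall>\<alpha> \<sigma>' \<sigma>. \<alpha> \<noteq> 0 --> \<alpha> <= l / \<kappa> --> 1 <= \<sigma>' --> \<sigma>' < \<sigma> --> \<sigma> <= 3/2 -->
    (\<integral>x. v x powr (\<alpha> * \<kappa>) * indicator (U \<sigma>') x \<partial>M) powr (1/\<kappa>)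
     <= C0 * (1 + \<bar>\<alpha>\<bar>) powr p * (\<sigma> - \<sigma>') powr (-p) * (\<integral>x. v x powr \<alpha> * indicator (U \<sigma>) x \<partial>M)"
   and tail0: "\<forall>t>0. measure M {x \<in> U (3/2). t < \<bar>ln (v x) - k\<bar>} <= T / t"
  have vc1: "c1 <= v x" and vc2: "v x <= c2" for x using vc10 vc20 by auto
  have U [measurable]: "U \<sigma> \<in> sets M" for \<sigma> using U0 by blast
  have Um: "U \<sigma>' \<subseteq> U \<sigma>" if "\<sigma>' <= \<sigma>" for \<sigma>' \<sigma> using Um0 that by blast
  have tail: "measure M {x \<in> U (3/2). t < \<bar>ln (v x) - k\<bar>} <= T / t" if "0 < t" for t using tail0 that by blast
  have vp: "v x > 0" for x using vc1[of x] c1 by linarith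
  have c2: "c2 > 0" using vp[of undefined] vc2[of undefined] by linarith
  have UM: "U \<sigma> \<subseteq> space M" for \<sigma> using sets.sets_into_space[OF U] .
  have fmU: "U (3/2) \<in> fmeasurable M" using Uf by (intro fmeasurableI) (auto simp: top.not_eq_extremum)
  have tail_sub: "measure M {x \<in> U (3/2). t < h x} <= T / t" if "0 < t" "\<And>x. t < h x ==> t < \<bar>ln (v x) - k\<bar>" "h \<in> borel_measurable M" for t and h :: "'b => real"
  proof -
   have [measurable]: "h \<in> borel_measurable M" by fact
   have m1: "{x \<in> U (3/2). t < h x} = {x \<in> space M. x \<in> U (3/2) \<and> t < h x}" using UM by blast
   have m2: "{x \<in> U (3/2). t < \<bar>ln (v x) - k\<bar>} = {x \<in> space M. x \<in> U (3/2) \<and> t < \<bar>ln (v x) - k\<bar>}" using UM by blast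
   have s1: "{x \<in> U (3/2). t < h x} \<in> sets M" unfolding m1 by measurable
   have s2: "{x \<in> U (3/2). t < \<bar>ln (v x) - k\<bar>} \<in> sets M" unfolding m2 by measurable
   have "{x \<in> U (3/2). t < \<bar>ln (v x) - k\<bar>} \<in> fmeasurable M" by (rule fmeasurableI2[OF fmU _ s2]) blast
   then have "measure M {x \<in> U (3/2). t < h x} <= measure M {x \<in> U (3/2). t < \<bar>ln (v x) - k\<bar>}"
    using that(2) s1 by (intro measure_mono_fmeasurable) auto
   then show ?thesis using tail[OF that(1)] by linarith
  qed
  have sc: "(\<integral>x. (v x powr a * exp (b * a)) * indicator (U \<sigma>) x \<partial>M) = exp (b * a) * (\<integral>x. v x powr a * indicator (U \<sigma>) x \<partial>M)" for a b \<sigma>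
   by (simp add: mult_ac flip: integral_mult_right_zero)
  have scaled: "(\<integral>x. (v x powr (\<alpha> * \<kappa>) * exp (b * (\<alpha> * \<kappa>))) * indicator (U \<sigma>') x \<partial>M) powr (1/\<kappa>)
     <= C0 * (1 + \<bar>\<alpha>\<bar>) powr p * (\<sigma> - \<sigma>') powr (-p) * (\<integral>x. (v x powr \<alpha> * exp (b * \<alpha>)) * indicator (U \<sigma>) x \<partial>M)"
   if "\<alpha> \<noteq> 0" "\<alpha> <= l / \<kappa>" "1 <= \<sigma>'" "\<sigma>' < \<sigma>" "\<sigma> <= 3/2" for \<alpha> b \<sigma>' \<sigma>
  proof -
   have "(exp (b * (\<alpha> * \<kappa>)) * (\<integral>x. v x powr (\<alpha> * \<kappa>) * indicator (U \<sigma>') x \<partial>M)) powr (1/\<kappa>)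
    = exp (b * \<alpha>) * (\<integral>x. v x powr (\<alpha> * \<kappa>) * indicator (U \<sigma>') x \<partial>M) powr (1/\<kappa>)"
    using \<kappa> by (subst powr_mult) (auto simp: exp_powr_real intro!: integral_nonneg_AE)
   also have "\<dots> <= exp (b * \<alpha>) * (C0 * (1 + \<bar>\<alpha>\<bar>) powr p * (\<sigma> - \<sigma>') powr (-p) * (\<integral>x. v x powr \<alpha> * indicator (U \<sigma>) x \<partial>M))"
    by (intro mult_left_mono rev[rule_format] that) simp
   finally show ?thesis unfolding sc by (simp add: mult_ac)
  qed
  have f1: "(v x * exp (-k)) powr a = v x powr a * exp ((-k) * a)" for x a using vp[of x] by (simp add: powr_mult exp_powr_real)
  have f2: "(exp k / v x) powr a = v x powr (-a) * exp ((-k) * (-a))" for x a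
   using vp[of x] by (simp add: powr_divide exp_powr_real powr_minus field_simps)
  have ln1: "ln (v x * exp (-k)) = ln (v x) - k" and ln2: "ln (exp k / v x) = k - ln (v x)" for x
   using vp[of x] by (simp_all add: ln_mult ln_div)
  have m1: "moser M U (\<lambda>x. v x * exp (-k)) (c1 * exp (-k)) (c2 * exp (-k)) V \<kappa> p C0 (\<lambda>\<alpha>. \<alpha> <= l / \<kappa>)"
  proof
   show "(\<integral>x. (v x * exp (-k)) powr (\<alpha> * \<kappa>) * indicator (U \<sigma>') x \<partial>M) powr (1/\<kappa>)
     <= C0 * (1 + \<alpha>) powr p * (\<sigma> - \<sigma>') powr (-p) * (\<integral>x. (v x * exp (-k)) powr \<alpha> * indicator (U \<sigma>) x \<partial>M)"
    if "0 < \<alpha>" "\<alpha> <= l / \<kappa>" "1 <= \<sigma>'" "\<sigma>' < \<sigma>" "\<sigma> <= 3/2" for \<alpha> \<sigma>' \<sigma>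
    unfolding f1 using scaled[of \<alpha> \<sigma>' \<sigma> "-k"] that by simp
  qed (use vc1 vc2 c1 U Um Uf UV Up \<kappa> p C0 in auto)
  have m2: "moser M U (\<lambda>x. exp k / v x) (exp k / c2) (exp k / c1) V \<kappa> p C0 (\<lambda>\<alpha>. True)"
  proof
   show "(\<integral>x. (exp k / v x) powr (\<alpha> * \<kappa>) * indicator (U \<sigma>') x \<partial>M) powr (1/\<kappa>)
     <= C0 * (1 + \<alpha>) powr p * (\<sigma> - \<sigma>') powr (-p) * (\<integral>x. (exp k / v x) powr \<alpha> * indicator (U \<sigma>) x \<partial>M)"
    if "0 < \<alpha>" "1 <= \<sigma>'" "\<sigma>' < \<sigma>" "\<sigma> <= 3/2" for \<alpha> \<sigma>' \<sigma>
   proof -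
    have "- \<alpha> <= l / \<kappa>" using that l \<kappa> divide_pos_pos[of l \<kappa>] by linarith
    then show ?thesis unfolding f2 using scaled[of "-\<alpha>" \<sigma>' \<sigma> "-k"] that by simp
   qed
   show "exp k / c2 <= exp k / v x" "exp k / v x <= exp k / c1" for x
    using vc1[of x] vc2[of x] vp[of x] c1 by (auto intro!: divide_left_mono)
  qed (use c1 c2 U Um Uf UV Up \<kappa> p C0 in auto)
  have b1: "(\<integral>x. (v x * exp (-k)) powr l * indicator (U (5/4)) x \<partial>M) powr (1/l) <= K1"
  proof (rule K1(2)[rule_format, OF m1])
   show "measure M {x \<in> U (3/2). t < ln (v x * exp (-k))} <= T / t" if "0 < t" for t
    by (rule tail_sub[OF that]) (auto simp: ln1)
  qed
  have b2: "(\<integral>x. (exp k / v x) powr 1 * indicator (U (5/4)) x \<partial>M) powr (1/1) <= K2"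
  proof (rule K2(2)[rule_format, OF m2])
   show "measure M {x \<in> U (3/2). t < ln (exp k / v x)} <= T / t" if "0 < t" for t
    by (rule tail_sub[OF that]) (auto simp: ln2)
  qed simp
  have "AE x in M. x \<in> U 1 --> exp k / v x <= moser_const \<kappa> p C0 * (1/4) powr (- (p * moser_exp \<kappa>)) * (\<integral>x. (exp k / v x) powr 1 * indicator (U (5/4)) x \<partial>M)"
   using moser.sup_bound[OF m2] unfolding moser.I_def[OF m2] by simp
  then show "AE x in M. x \<in> U 1 --> (\<integral>x. v x powr l * indicator (U 1) x \<partial>M) powr (1/l) <= K1 * K3 * v x"
  proof (eventually_elim, intro impI)
   fix x assume "x \<in> U 1 --> exp k / v x <= moser_const \<kappa> p C0 * (1/4) powr (- (p * moser_exp \<kappa>)) * (\<integral>x. (exp k / v x) powr 1 * indicator (U (5/4)) x \<partial>M)"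
    and x: "x \<in> U 1"
   then have "exp k / v x <= moser_const \<kappa> p C0 * (1/4) powr (- (p * moser_exp \<kappa>)) * (\<integral>x. (exp k / v x) powr 1 * indicator (U (5/4)) x \<partial>M)" by simp
   also have "\<dots> <= K3" unfolding K3_def
   proof (rule mult_left_mono)
    have "0 <= (\<integral>x. (exp k / v x) powr 1 * indicator (U (5/4)) x \<partial>M)" by (intro integral_nonneg_AE) auto
    then show "(\<integral>x. (exp k / v x) powr 1 * indicator (U (5/4)) x \<partial>M) <= K2" using b2 by simp
   qed (use mc in auto)
   finally have e: "exp k <= K3 * v x" using vp[of x] by (simp add: divide_le_eq)
   interpret m1: moser M U "\<lambda>x. v x * exp (-k)" "c1 * exp (-k)" "c2 * exp (-k)" V \<kappa> p C0 "\<lambda>\<alpha>. \<alpha> <= l / \<kappa>" by (rule m1)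
   have "m1.I l 1 powr (1/l) <= m1.I l (5/4) powr (1/l)" using l by (intro powr_mono2 m1.I_mono m1.I_nonneg) auto
   also have "\<dots> <= K1" using b1 by (simp add: m1.I_def)
   finally have "m1.I l 1 powr (1/l) <= K1" .
   moreover have "m1.I l 1 = exp ((-k) * l) * (\<integral>x. v x powr l * indicator (U 1) x \<partial>M)" unfolding m1.I_def f1 by (rule sc)
   moreover have "(exp ((-k) * l) * (\<integral>x. v x powr l * indicator (U 1) x \<partial>M)) powr (1/l) = exp (-k) * (\<integral>x. v x powr l * indicator (U 1) x \<partial>M) powr (1/l)"
    using l by (subst powr_mult) (auto simp: exp_powr_real intro!: integral_nonneg_AE)
   ultimately have "exp (-k) * (\<integral>x. v x powr l * indicator (U 1) x \<partial>M) powr (1/l) <= K1" by simp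
   then have "(\<integral>x. v x powr l * indicator (U 1) x \<partial>M) powr (1/l) <= K1 * exp k" by (simp add: exp_minus field_simps)
   also have "\<dots> <= K1 * (K3 * v x)" using e K1 by (intro mult_left_mono) auto
   finally show "(\<integral>x. v x powr l * indicator (U 1) x \<partial>M) powr (1/l) <= K1 * K3 * v x" by (simp add: mult.assoc)
  qed
 qed
qed

subsection \<open>Energy estimates for supersolutions\<close>

lemma test_fun_grad_outside:
 assumes "test_fun T \<psi>" "x \<notin> T"
 shows "\<psi> x = 0" "cgrad \<psi> x = 0"
proof -
 have cl: "x \<notin> closure {x. \<psi> x \<noteq> 0}" using assms by (auto simp: test_fun_def)
 have "Ck_fun (Suc 0) \<psi>" using assms(1) unfolding test_fun_def smooth_fun_def by blast
 then have C: "C1g \<psi> (cgrad \<psi>)" by (rule Ck_fun_imp_C1g)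
 have z: "\<psi> y = 0" if "y \<in> - closure {x. \<psi> x \<noteq> 0}" for y
 proof (rule ccontr)
  assume "\<psi> y \<noteq> 0"
  then have "y \<in> closure {x. \<psi> x \<noteq> 0}" by (intro closure_subset[THEN subsetD]) simp
  then show False using that by simp
 qed
 show "\<psi> x = 0" by (rule z) (rule Compl_iff[THEN iffD2, OF cl])
 show "cgrad \<psi> x = 0" by (rule C1g_zero_open[OF C, of "- closure {x. \<psi> x \<noteq> 0}"]) (rule open_Compl[OF closed_closure], erule z, rule Compl_iff[THEN iffD2, OF cl])
qed

lemma powr_between:
 fixes t :: real
 assumes "0 < d" "d <= t" "t <= m"
 shows "t powr a <= d powr a + m powr a"
proof (cases "0 <= a")
 case True
 then have "t powr a <= m powr a" using assms by (intro powr_mono2) auto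
 then show ?thesis by (simp add: add_increasing)
next
 case False
 then have "t powr a <= d powr a" using assms by (intro powr_mono2') auto
 then show ?thesis by (simp add: add_increasing2)
qed

locale supersol =
 fixes p s \<Lambda> C1 C2 :: real and \<Omega> :: "'a::euclidean_space set" and B :: "'a => real => 'a => 'a"
  and K :: "'a => 'a => real" and u :: "'a => real" and x0 :: 'a and R r :: real
 assumes p: "1 < p" and s: "0 < s" "s < 1" and \<Lambda>: "1 <= \<Lambda>" and C1: "0 < C1" and C2: "0 < C2"
  and Bm: "\<And>v \<zeta>. set_borel_measurable lebesgue \<Omega> (\<lambda>x. B x v \<zeta>)"
  and Bc: "\<And>x. x \<in> \<Omega> ==> continuous_on UNIV (\<lambda>(v, \<zeta>). B x v \<zeta>)"
  and Bg: "AE x in lebesgue. x \<in> \<Omega> --> (\<forall>v \<zeta>. B x v \<zeta> \<bullet> \<zeta> >= C1 * norm \<zeta> powr p \<and> norm (B x v \<zeta>) <= C2 * norm \<zeta> powr (p - 1))"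
  and Ks: "\<And>x y. K x y = K y x"
  and K0: "\<And>x y. x \<noteq> y ==> 0 <= K x y"
  and KL: "\<And>x y. x \<noteq> y ==> K x y <= \<Lambda> * dist x y powr (- (real DIM('a) + p * s))"
  and sup: "weak_supersolution p \<Omega> B K u"
  and BR: "ball x0 R \<subseteq> \<Omega>" and un: "AE x in lebesgue. x \<in> ball x0 R --> 0 <= u x"
  and r: "0 < r" "r <= 1" "2 * r <= R"
begin

abbreviation "S \<equiv> ball x0 (7/4 * r)"

lemma u_meas: "u \<in> borel_measurable lebesgue"
 using sup by (simp add: weak_supersolution_def Linf_def)

lemma representatives:
 obtains g ub gb M where "weak_grad_on \<Omega> u g" "\<And>x. ub x \<in> {0..M}" "AE x in lebesgue. x \<in> ball x0 R --> u x = ub x"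
  "(\<lambda>x. indicator (cball x0 (15/8 * r)) x *\<^sub>R g x) \<in> borel_measurable lebesgue"
  "AE x in lebesgue. x \<in> cball x0 (15/8 * r) --> g x = gb x" "sobC p S UNIV 0 M ub gb"
proof -
 let ?C = "cball x0 (15/8 * r)" and ?T = "ball x0 (15/8 * r)"
 have Cm [measurable]: "?C \<in> sets borel" "?T \<in> sets borel" by auto
 have TC: "?T \<subseteq> ?C" by auto
 have CR: "?C \<subseteq> ball x0 R" using r by auto
 then have C\<Omega>: "?C \<subseteq> \<Omega>" using BR by blast
 have inT: "x \<in> ?C" "x \<in> \<Omega>" "x \<in> ball x0 R" if "x \<in> ?T" for x
  using that TC CR C\<Omega> by blast+
 obtain M0 where M0: "AE x in lebesgue. \<bar>u x\<bar> <= M0" using sup by (auto simp: weak_supersolution_def Linf_def)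
 obtain u0 where u0 [measurable]: "u0 \<in> borel_measurable lborel" and u0e: "AE x in lborel. u x = u0 x"
  using completion_ex_borel_measurable_real[OF u_meas] by blast
 define M where "M = max M0 0"
 define ub where "ub x = max 0 (min M (u0 x))" for x
 have ubm [measurable]: "ub \<in> borel_measurable borel" unfolding ub_def using u0 by simp
 have ubM: "ub x \<in> {0..M}" for x by (simp add: ub_def M_def)
 have ube: "AE x in lebesgue. x \<in> ball x0 R --> u x = ub x"
  using AE_completion[OF u0e] M0 un
 proof eventually_elim
  case (elim x)
  then show ?case by (auto simp: ub_def M_def)
 qed
 obtain g where g: "weak_grad_on \<Omega> u g" and gp: "Lp_loc p \<Omega> (\<lambda>x. norm (g x))"
  using sup by (auto simp: weak_supersolution_def W1p_loc_def)
 have gi: "set_integrable lebesgue ?C (\<lambda>x. g x \<bullet> b)" if "b \<in> Basis" for b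
  using g C\<Omega> that by (auto simp: weak_grad_on_def)
 have gm: "(\<lambda>x. indicat_real ?C x * (g x \<bullet> b)) \<in> borel_measurable lebesgue" if "b \<in> Basis" for b
  using gi[OF that] unfolding set_integrable_def by (auto dest: borel_measurable_integrable)
 have "\<forall>b\<in>Basis. \<exists>h. h \<in> borel_measurable lborel \<and> (AE x in lborel. indicat_real ?C x * (g x \<bullet> b) = h x)"
  using completion_ex_borel_measurable_real[OF gm] by blast
 then obtain H where H: "\<forall>b\<in>Basis. H b \<in> borel_measurable lborel \<and> (AE x in lborel. indicat_real ?C x * (g x \<bullet> b) = H b x)"
  using bchoice[of Basis "\<lambda>b h. h \<in> borel_measurable lborel \<and> (AE x in lborel. indicat_real ?C x * (g x \<bullet> b) = h x)"] by blast
 define gb where "gb x = (\<Sum>b\<in>Basis. H b x *\<^sub>R b)" for x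
 have gbm [measurable]: "gb \<in> borel_measurable borel" unfolding gb_def
  by (intro borel_measurable_sum borel_measurable_scaleR borel_measurable_const) (use H in auto)
 have "AE x in lborel. \<forall>b\<in>Basis. indicat_real ?C x * (g x \<bullet> b) = H b x"
  by (rule AE_finite_allI) (use H in auto)
 then have gbe: "AE x in lebesgue. x \<in> ?C --> g x = gb x"
 proof (rule AE_completion[OF AE_mp], intro AE_I2 impI)
  fix x assume h: "\<forall>b\<in>Basis. indicat_real ?C x * (g x \<bullet> b) = H b x" and x: "x \<in> ?C"
  have hb: "gb x \<bullet> b = g x \<bullet> b" if "b \<in> Basis" for b
  proof -
   have "gb x \<bullet> b = H b x" using that by (simp add: gb_def)
   also have "\<dots> = indicat_real ?C x * (g x \<bullet> b)" by (rule h[THEN bspec, OF that, symmetric])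
   also have "\<dots> = g x \<bullet> b" using x by simp
   finally show ?thesis .
  qed
  show "g x = gb x" by (rule euclidean_eqI) (rule hb[symmetric])
 qed
 have gC: "(\<lambda>x. indicator ?C x *\<^sub>R g x) \<in> borel_measurable lebesgue"
 proof -
  have "(\<lambda>x. \<Sum>b\<in>Basis. (indicat_real ?C x * (g x \<bullet> b)) *\<^sub>R b) \<in> borel_measurable lebesgue"
   by (intro borel_measurable_sum borel_measurable_scaleR borel_measurable_const gm)
  moreover have "(\<Sum>b\<in>Basis. (indicat_real ?C x * (g x \<bullet> b)) *\<^sub>R b) = indicator ?C x *\<^sub>R g x" for x
   by (simp add: euclidean_representation flip: scaleR_scaleR scaleR_sum_right)
  ultimately show ?thesis by (simp only:)
 qed
 have fin: "(LBNN x. ennreal (norm (gb x) powr p) * indicator ?T x) < \<infinity>"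
 proof -
  have "set_integrable lebesgue ?C (\<lambda>x. \<bar>norm (g x)\<bar> powr p)" using gp C\<Omega> by (simp add: Lp_loc_def)
  then have "(\<integral>\<^sup>+x. ennreal (norm (indicator ?C x *\<^sub>R \<bar>norm (g x)\<bar> powr p)) \<partial>lebesgue) < \<infinity>"
   unfolding set_integrable_def integrable_iff_bounded by blast
  moreover have "(\<integral>\<^sup>+x. ennreal (norm (gb x) powr p) * indicator ?T x \<partial>lebesgue) <= (\<integral>\<^sup>+x. ennreal (norm (indicator ?C x *\<^sub>R \<bar>norm (g x)\<bar> powr p)) \<partial>lebesgue)"
  proof (rule nn_integral_mono_AE)
   show "AE x in lebesgue. ennreal (norm (gb x) powr p) * indicator ?T x <= ennreal (norm (indicator ?C x *\<^sub>R \<bar>norm (g x)\<bar> powr p))"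
    using gbe
   proof eventually_elim
    case (elim x)
    then show ?case using TC by (cases "x \<in> ?T") (auto simp: subset_iff)
   qed
  qed
  ultimately show ?thesis by (simp add: nn_integral_completion le_less_trans)
 qed
 have "sobC p S UNIV 0 M ub gb"
 proof (rule sobC_of_weak_gradient[OF ubm ubM gbm _ _ fin])
  show "7/4 * r < 15/8 * r" "1 <= p" using r p by auto
  fix \<psi> and b :: 'a assume \<psi>: "test_fun ?T \<psi>" and b: "b \<in> Basis"
  have "Ck_fun (Suc 0) \<psi>" using \<psi> unfolding test_fun_def smooth_fun_def by blast
  then have C: "C1g \<psi> (cgrad \<psi>)" by (rule Ck_fun_imp_C1g)
  note [measurable] = C1g_borel[OF C]
  note out = test_fun_grad_outside[OF \<psi>]
  have "test_fun \<Omega> \<psi>" using \<psi> TC C\<Omega> unfolding test_fun_def by blast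
  then have eq: "(LINT x:\<Omega>|lebesgue. u x * frechet_derivative \<psi> (at x) b) = - (LINT x:\<Omega>|lebesgue. (g x \<bullet> b) * \<psi> x)"
   using g b unfolding weak_grad_on_def by blast
  have fd: "frechet_derivative \<psi> (at x) b = cgrad \<psi> x \<bullet> b" for x using C1g_frechet[OF C] by simp
  have "(LINT x:\<Omega>|lebesgue. u x * frechet_derivative \<psi> (at x) b) = (\<integral>x. u x * (cgrad \<psi> x \<bullet> b) \<partial>lebesgue)"
   unfolding set_lebesgue_integral_def fd
  proof (rule Bochner_Integration.integral_cong[OF refl])
   fix x show "indicator \<Omega> x *\<^sub>R (u x * (cgrad \<psi> x \<bullet> b)) = u x * (cgrad \<psi> x \<bullet> b)"
    using inT[of x] out[of x] by (cases "x \<in> ?T") (simp_all del: mem_ball mem_cball)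
  qed
  also have "\<dots> = (\<integral>x. ub x * (cgrad \<psi> x \<bullet> b) \<partial>lebesgue)"
  proof (rule integral_cong_AE)
   show "AE x in lebesgue. u x * (cgrad \<psi> x \<bullet> b) = ub x * (cgrad \<psi> x \<bullet> b)"
    using ube
   proof eventually_elim
    case (elim x)
    then show ?case using inT[of x] out[of x] by (cases "x \<in> ?T") (simp_all del: mem_ball mem_cball)
   qed
   show "(\<lambda>x. u x * (cgrad \<psi> x \<bullet> b)) \<in> borel_measurable lebesgue"
    by (intro borel_measurable_times u_meas measurable_completion) measurable
   show "(\<lambda>x. ub x * (cgrad \<psi> x \<bullet> b)) \<in> borel_measurable lebesgue"
    by (intro measurable_completion) measurable
  qed
  also have "\<dots> = (LBINT x. ub x * (cgrad \<psi> x \<bullet> b))" by (rule integral_completion) measurable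
  finally have e1: "(LINT x:\<Omega>|lebesgue. u x * frechet_derivative \<psi> (at x) b) = (LBINT x. ub x * (cgrad \<psi> x \<bullet> b))" .
  have "(LINT x:\<Omega>|lebesgue. (g x \<bullet> b) * \<psi> x) = (\<integral>x. (indicat_real ?C x * (g x \<bullet> b)) * \<psi> x \<partial>lebesgue)"
   unfolding set_lebesgue_integral_def
  proof (rule Bochner_Integration.integral_cong[OF refl])
   fix x show "indicator \<Omega> x *\<^sub>R ((g x \<bullet> b) * \<psi> x) = (indicat_real ?C x * (g x \<bullet> b)) * \<psi> x"
    using inT[of x] out[of x] by (cases "x \<in> ?T") (simp_all del: mem_ball mem_cball)
  qed
  also have "\<dots> = (\<integral>x. (gb x \<bullet> b) * \<psi> x \<partial>lebesgue)"
  proof (rule integral_cong_AE)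
   show "AE x in lebesgue. (indicat_real ?C x * (g x \<bullet> b)) * \<psi> x = (gb x \<bullet> b) * \<psi> x"
    using gbe
   proof eventually_elim
    case (elim x)
    then show ?case using inT[of x] out[of x] by (cases "x \<in> ?T") (simp_all del: mem_ball mem_cball)
   qed
   show "(\<lambda>x. (indicat_real ?C x * (g x \<bullet> b)) * \<psi> x) \<in> borel_measurable lebesgue"
    by (rule borel_measurable_times[OF gm[OF b]]) (intro measurable_completion, measurable)
   show "(\<lambda>x. (gb x \<bullet> b) * \<psi> x) \<in> borel_measurable lebesgue"
    by (intro measurable_completion) measurable
  qed
  also have "\<dots> = (LBINT x. (gb x \<bullet> b) * \<psi> x)" by (rule integral_completion) measurable
  finally show "(LBINT x. ub x * (cgrad \<psi> x \<bullet> b)) = - (LBINT x. (gb x \<bullet> b) * \<psi> x)"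
   using eq e1 by simp
 qed
 then show ?thesis using that[OF g ubM ube gC gbe] by blast
qed

lemma nonlocal_half:
 assumes d: "0 < d" and \<rho>: "\<rho> <= 7/4 * r" and L: "0 < L"
  and x: "x \<in> ball x0 \<rho>" and y: "y \<notin> ball x0 \<rho>"
  and ux: "u x = ubx" "0 <= ubx" and uy: "y \<in> ball x0 R ==> 0 <= u y" and ny: "ny = neg_part (u y)"
  and \<eta>: "0 <= \<eta>x" "\<eta>x <= min 1 (L * norm (y - x))"
 shows "ppow p (u x - u y) * (\<eta>x powr p * (ubx + d) powr (1 - q)) * K x y
  <= 2 powr p * \<Lambda> * ((ubx + d) powr (p - q) * (min 1 (L * norm (y - x)) powr p * norm (y - x) powr (- (real DIM('a) + p * s))))
   + 2 powr p * \<Lambda> * 8 powr (real DIM('a) + p * s) * d powr (1 - p) * ((ubx + d) powr (p - q) * (ny powr (p - 1) * norm (y - x0) powr (- (real DIM('a) + p * s)) * indicator (- ball x0 R) y))"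
proof -
 define n where "n = real DIM('a) + p * s"
 define v where "v = ubx + d"
 have v: "v > 0" "d <= v" "u x <= v" using ux d by (auto simp: v_def)
 have NN0: "n > 0" using p s by (simp add: n_def add_pos_pos)
 have xy: "x \<noteq> y" using x y by blast
 define k where "k = norm (y - x) powr (- n)"
 have Kk: "K x y <= \<Lambda> * k" using KL[OF xy] by (simp add: k_def n_def dist_norm norm_minus_commute)
 have K0': "0 <= K x y" by (rule K0[OF xy])
 define m where "m = min 1 (L * norm (y - x)) powr p"
 have \<eta>p: "\<eta>x powr p <= m" "\<eta>x powr p <= 1" using \<eta> p powr_mono2[of p \<eta>x 1] by (auto simp: m_def intro!: powr_mono2)
 have m0: "m >= 0" by (simp add: m_def)
 have vv: "v powr (p - 1) * v powr (1 - q) = v powr (p - q)" by (simp add: powr_add[symmetric])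
 have ny0: "0 <= ny" by (simp add: ny neg_part_def)
 have pp: "ppow p (u x - u y) <= 2 powr p * (v powr (p - 1) + ny powr (p - 1) * indicator (- ball x0 R) y)"
 proof (cases "y \<in> ball x0 R")
  case True
  then have "ppow p (u x - u y) <= v powr (p - 1)" using uy v p by (intro ppow_le) auto
  also have "\<dots> <= 2 powr p * v powr (p - 1)"
   using mult_right_mono[of 1 "2 powr p" "v powr (p - 1)"] p by (simp add: ge_one_powr_ge_zero)
  finally show ?thesis using True by simp
 next
  case False
  have "u x - u y <= v + ny" using v by (auto simp: ny neg_part_def)
  then have "ppow p (u x - u y) <= (v + ny) powr (p - 1)" using v ny0 p by (intro ppow_le) auto
  also have "\<dots> <= 2 powr (p - 1) * (v powr (p - 1) + ny powr (p - 1))" using v ny0 p by (intro powr_add_le) auto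
  also have "\<dots> <= 2 powr p * (v powr (p - 1) + ny powr (p - 1))" by (intro mult_right_mono powr_mono) auto
  finally show ?thesis using False by simp
 qed
 let ?i = "indicat_real (- ball x0 R) y"
 have "ppow p (u x - u y) * (\<eta>x powr p * v powr (1 - q)) * K x y
  <= 2 powr p * (v powr (p - 1) + ny powr (p - 1) * ?i) * (\<eta>x powr p * v powr (1 - q)) * K x y"
  using pp K0' by (intro mult_right_mono) auto
 also have "\<dots> = 2 powr p * (v powr (p - q) * \<eta>x powr p * K x y) + 2 powr p * (ny powr (p - 1) * ?i * v powr (1 - q) * \<eta>x powr p * K x y)"
  unfolding vv[symmetric] by (simp add: algebra_simps)
 also have "\<dots> <= 2 powr p * (v powr (p - q) * m * (\<Lambda> * k)) + 2 powr p * (ny powr (p - 1) * ?i * (v powr (p - q) * d powr (1 - p)) * 1 * (\<Lambda> * 8 powr n * norm (y - x0) powr (- n)))"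
 proof (rule add_mono)
  show "2 powr p * (v powr (p - q) * \<eta>x powr p * K x y) <= 2 powr p * (v powr (p - q) * m * (\<Lambda> * k))"
   using \<eta>p(1) Kk K0' m0 by (intro mult_left_mono mult_mono) auto
  show "2 powr p * (ny powr (p - 1) * ?i * v powr (1 - q) * \<eta>x powr p * K x y)
   <= 2 powr p * (ny powr (p - 1) * ?i * (v powr (p - q) * d powr (1 - p)) * 1 * (\<Lambda> * 8 powr n * norm (y - x0) powr (- n)))"
  proof (cases "y \<in> ball x0 R")
   case False
   have vd: "v powr (1 - q) <= v powr (p - q) * d powr (1 - p)"
   proof -
    have "v powr (1 - q) = v powr (p - q) * v powr (1 - p)" by (simp add: powr_add[symmetric])
    also have "\<dots> <= v powr (p - q) * d powr (1 - p)" using v d p by (intro mult_left_mono powr_mono2') auto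
    finally show ?thesis .
   qed
   have n0: "norm (y - x0) >= R" using False by (simp add: dist_norm norm_minus_commute)
   then have pos: "norm (y - x0) > 0" using r by linarith
   have "norm (x - x0) < 7/4 * r" using x \<rho> by (simp add: dist_norm norm_minus_commute)
   moreover have "norm (y - x0) <= norm (y - x) + norm (x - x0)" using norm_triangle_ineq[of "y - x" "x - x0"] by simp
   moreover have "7/4 * r <= 7/8 * norm (y - x0)" using n0 r by linarith
   ultimately have "norm (y - x0) / 8 <= norm (y - x)" by linarith
   then have "k <= (norm (y - x0) / 8) powr (- n)" unfolding k_def using pos NN0 by (intro powr_mono2') auto
   also have "\<dots> = 8 powr n * norm (y - x0) powr (- n)" using pos by (simp add: powr_divide powr_minus field_simps)
   finally have "\<Lambda> * k <= \<Lambda> * (8 powr n * norm (y - x0) powr (- n))" using \<Lambda> by (intro mult_left_mono) auto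
   then have "K x y <= \<Lambda> * 8 powr n * norm (y - x0) powr (- n)" using Kk by (simp only: mult.assoc)
   then show ?thesis using vd \<eta>p(2) K0' \<Lambda> by (intro mult_left_mono mult_mono) auto
  qed simp
 qed
 also have "\<dots> = 2 powr p * \<Lambda> * (v powr (p - q) * (m * k)) + 2 powr p * \<Lambda> * 8 powr n * d powr (1 - p) * (v powr (p - q) * (ny powr (p - 1) * norm (y - x0) powr (- n) * ?i))"
  by (simp add: mult_ac)
 finally show ?thesis by (simp only: v_def m_def k_def n_def)
qed

lemma nonlocal_bound:
 assumes ubm [measurable]: "ub \<in> borel_measurable borel" and ubM: "\<And>x. ub x \<in> {0..M}" and ube: "AE x in lebesgue. x \<in> ball x0 R --> u x = ub x"
  and CK: "0 < CK" "\<And>L. L > 0 ==> (LBNN z. ennreal (min 1 (L * norm (z::'a)) powr p * norm z powr (- (real DIM('a) + p * s)))) <= ennreal (CK * L powr (p * s))"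
  and d: "0 < d" and tail: "(\<integral>\<^sup>+y. ennreal (neg_part (u y) powr (p - 1) * norm (y - x0) powr (- (real DIM('a) + p * s))) * indicator (- ball x0 R) y \<partial>lebesgue) <= ennreal (d powr (p - 1) * r powr (-p))"
  and \<delta>: "0 < \<delta>" "1 + \<delta> <= q" and \<rho>: "0 < \<rho>'" "\<rho>' < \<rho>" "\<rho> <= 7/4 * r"
  and \<eta>: "\<And>x. 0 <= \<eta> x" "\<And>x. \<eta> x <= 1" "\<And>x. x \<notin> ball x0 \<rho> ==> \<eta> x = 0" "\<And>x y. \<bar>\<eta> x - \<eta> y\<bar> <= min 1 (8 / (\<rho> - \<rho>') * dist x y)"
 shows "(\<integral>z. ppow p (u (fst z) - u (snd z)) * ((\<eta> (fst z) powr p * (ub (fst z) + d) powr (1 - q)) - (\<eta> (snd z) powr p * (ub (snd z) + d) powr (1 - q)))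
    * K (fst z) (snd z) \<partial>(lebesgue :: ('a \<times> 'a) measure))
  <= 2 * ((nl_const p \<delta> + 2 powr p) * \<Lambda> * CK + 2 powr p * \<Lambda> * 8 powr (real DIM('a) + p * s)) * (8 / (\<rho> - \<rho>')) powr p * (LBINT x. (ub x + d) powr (p - q) * indicator (ball x0 \<rho>) x)"
proof -
 define L where "L = 8 / (\<rho> - \<rho>')"
 have "\<rho> - \<rho>' < 2 * r" using \<rho> r by linarith
 then have L: "L > 0" "L >= 1 / r" "L >= 1" using \<rho> r by (auto simp: L_def field_simps)
 define v where "v x = ub x + d" for x
 have vd: "d <= v x" "v x <= M + d" "v x > 0" for x using ubM[of x] d by (auto simp: v_def)
 have [measurable]: "v \<in> borel_measurable borel" unfolding v_def by measurable
 have [measurable]: "ball x0 \<rho> \<in> sets borel" "- ball x0 R \<in> sets borel" by auto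
 define Va where "Va x = v x powr (p - q) * indicator (ball x0 \<rho>) x" for x
 have Va0: "Va x >= 0" for x by (simp add: Va_def)
 have Vam [measurable]: "Va \<in> borel_measurable borel" unfolding Va_def by measurable
 have iVa: "integrable lborel Va"
 proof (rule integrable_bounded_compact_support[of _ "d powr (p - q) + (M + d) powr (p - q)" x0 \<rho>])
  show "norm (Va y) <= d powr (p - q) + (M + d) powr (p - q)" for y
   using powr_between[OF d vd(1,2)[of y], of "p - q"] by (cases "y \<in> ball x0 \<rho>") (auto simp: Va_def)
 qed (auto simp: Va_def)
 define I where "I = (LBINT x. Va x)"
 have I0: "I >= 0" unfolding I_def by (intro integral_nonneg_AE) (auto simp: Va0)
 have In: "(LBNN x. ennreal (Va x)) = ennreal I" unfolding I_def using iVa Va0 by (intro nn_integral_eq_integral) auto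
 obtain u0 where u0 [measurable]: "u0 \<in> borel_measurable lborel" and u0e: "AE x in lborel. u x = u0 x"
  using completion_ex_borel_measurable_real[OF u_meas] by blast
 define nb where "nb x = neg_part (u0 x)" for x
 have [measurable]: "nb \<in> borel_measurable borel" unfolding nb_def neg_part_def using u0 by simp
 have nbe: "AE x in lebesgue. nb x = neg_part (u x)" using AE_completion[OF u0e] by eventually_elim (simp add: nb_def)
 define k where "k z = norm (z::'a) powr (- (real DIM('a) + p * s))" for z
 have [measurable]: "k \<in> borel_measurable borel" unfolding k_def by measurable
 define h where "h z = min 1 (L * norm (z::'a)) powr p * k z" for z
 have [measurable]: "h \<in> borel_measurable borel" unfolding h_def by measurable
 have h0: "h z >= 0" for z by (simp add: h_def k_def)
 define w where "w y = nb y powr (p - 1) * k (y - x0) * indicator (- ball x0 R) y" for y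
 have [measurable]: "w \<in> borel_measurable borel" unfolding w_def by measurable
 have w0: "w y >= 0" for y by (simp add: w_def k_def)
 have hint: "(LBNN y. ennreal (h (y - x))) <= ennreal (CK * L powr p)" for x
 proof -
  have "(LBNN y. ennreal (h (y - x))) = (LBNN y. ennreal (h y))"
   using nn_integral_lborel_affine[of "\<lambda>y. ennreal (h y)" 1 "- x"] by simp
  also have "\<dots> <= ennreal (CK * L powr (p * s))" unfolding h_def k_def by (rule CK(2)[OF L(1)])
  also have "\<dots> <= ennreal (CK * L powr p)" using CK L s p by (intro ennreal_leI mult_left_mono powr_mono) auto
  finally show ?thesis .
 qed
 have wint: "(LBNN y. ennreal (w y)) <= ennreal (d powr (p - 1) * L powr p)"
 proof -
  have "(LBNN y. ennreal (w y)) = (\<integral>\<^sup>+y. ennreal (w y) \<partial>lebesgue)" by (simp add: nn_integral_completion)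
  also have "\<dots> = (\<integral>\<^sup>+y. ennreal (neg_part (u y) powr (p - 1) * norm (y - x0) powr (- (real DIM('a) + p * s))) * indicator (- ball x0 R) y \<partial>lebesgue)"
  proof (rule nn_integral_cong_AE)
   show "AE y in lebesgue. ennreal (w y) = ennreal (neg_part (u y) powr (p - 1) * norm (y - x0) powr (- (real DIM('a) + p * s))) * indicator (- ball x0 R) y"
    using nbe by eventually_elim (auto simp: w_def k_def indicator_def)
  qed
  also have "\<dots> <= ennreal (d powr (p - 1) * r powr (-p))" by (rule tail)
  also have "\<dots> <= ennreal (d powr (p - 1) * L powr p)"
  proof -
   have "r powr (-p) = (1 / r) powr p" using r by (simp add: powr_minus powr_divide field_simps)
   also have "\<dots> <= L powr p" using L r p by (intro powr_mono2) auto
   finally show ?thesis by (intro ennreal_leI mult_left_mono) auto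
  qed
  finally show ?thesis .
 qed
 define a1 where "a1 = (nl_const p \<delta> + 2 powr p) * \<Lambda>"
 define a2 where "a2 = 2 powr p * \<Lambda> * 8 powr (real DIM('a) + p * s) * d powr (1 - p)"
 have nl0: "nl_const p \<delta> >= 0" using p by (simp add: nl_const_def)
 have a0: "a1 >= 0" "a2 >= 0" using nl0 \<Lambda> by (auto simp: a1_def a2_def)
 define F where "F x y = a1 * (Va x * h (y - x)) + a2 * (Va x * w y)" for x y
 have F0: "F x y >= 0" for x y using a0 Va0 h0 w0 by (simp add: F_def)
 define cc where "cc = (a1 * CK + 2 powr p * \<Lambda> * 8 powr (real DIM('a) + p * s)) * L powr p"
 have cc0: "cc >= 0" using a0 CK \<Lambda> by (simp add: cc_def)
 have Fint: "(LBNN x. LBNN y. ennreal (F x y)) <= ennreal (cc * I)"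
 proof -
  have "(LBNN y. ennreal (F x y)) <= ennreal cc * ennreal (Va x)" for x
  proof -
   have "(LBNN y. ennreal (F x y)) = (LBNN y. 1 * (ennreal (a1 * Va x) * ennreal (h (y - x)) + ennreal (a2 * Va x) * ennreal (w y)))"
    using a0 Va0[of x] h0 w0 by (intro nn_integral_cong) (simp add: F_def ennreal_plus ennreal_mult mult.assoc)
   also have "\<dots> = 1 * ((LBNN y. ennreal (a1 * Va x) * ennreal (h (y - x))) + (LBNN y. ennreal (a2 * Va x) * ennreal (w y)))"
    by (rule nn_integral_cmult_add2) measurable
   also have "(LBNN y. ennreal (a1 * Va x) * ennreal (h (y - x))) = ennreal (a1 * Va x) * (LBNN y. ennreal (h (y - x)))"
    by (rule nn_integral_cmult) measurable
   also have "(LBNN y. ennreal (a2 * Va x) * ennreal (w y)) = ennreal (a2 * Va x) * (LBNN y. ennreal (w y))"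
    by (rule nn_integral_cmult) measurable
   also have "1 * (ennreal (a1 * Va x) * (LBNN y. ennreal (h (y - x))) + ennreal (a2 * Va x) * (LBNN y. ennreal (w y)))
     <= ennreal (a1 * Va x) * ennreal (CK * L powr p) + ennreal (a2 * Va x) * ennreal (d powr (p - 1) * L powr p)"
    unfolding mult_1_left by (intro add_mono mult_left_mono hint wint) auto
   also have "\<dots> = ennreal (a1 * Va x * (CK * L powr p) + a2 * Va x * (d powr (p - 1) * L powr p))"
    using a0 Va0[of x] CK by (simp add: ennreal_plus ennreal_mult)
   also have "a1 * Va x * (CK * L powr p) + a2 * Va x * (d powr (p - 1) * L powr p) = cc * Va x"
   proof -
    have "d powr (1 - p) * d powr (p - 1) = 1" using d by (simp add: powr_add[symmetric])
    then have "a2 * d powr (p - 1) = 2 powr p * \<Lambda> * 8 powr (real DIM('a) + p * s)" unfolding a2_def by (simp add: mult.assoc)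
    then have "a2 * Va x * (d powr (p - 1) * L powr p) = 2 powr p * \<Lambda> * 8 powr (real DIM('a) + p * s) * Va x * L powr p" by (simp add: mult.commute mult.left_commute)
    then show ?thesis by (simp add: cc_def algebra_simps)
   qed
   also have "ennreal (cc * Va x) = ennreal cc * ennreal (Va x)" using cc0 Va0 by (rule ennreal_mult)
   finally show ?thesis .
  qed
  then have "(LBNN x. LBNN y. ennreal (F x y)) <= (LBNN x. ennreal cc * ennreal (Va x))" by (intro nn_integral_mono)
  also have "\<dots> = ennreal cc * ennreal I" by (subst nn_integral_cmult) (auto simp: In)
  finally show ?thesis using cc0 I0 by (simp add: ennreal_mult)
 qed
 have [measurable]: "(\<lambda>z. F (fst z) (snd z)) \<in> borel_measurable (borel \<Otimes>\<^sub>M borel)" "(\<lambda>z. F (snd z) (fst z)) \<in> borel_measurable (borel \<Otimes>\<^sub>M borel)"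
  unfolding F_def by measurable
 define Gt where "Gt z = F (fst z) (snd z) + F (snd z) (fst z)" for z
 have Gtm: "Gt \<in> borel_measurable borel" unfolding Gt_def borel_prod[symmetric] by measurable
 have Gtn: "(LBNN z. ennreal (Gt z)) <= ennreal (2 * cc * I)"
 proof -
  have "(LBNN z. ennreal (Gt z)) = (\<integral>\<^sup>+z. ennreal (Gt z) \<partial>(lborel \<Otimes>\<^sub>M lborel))" by (simp add: lborel_prod)
  also have "\<dots> = (\<integral>\<^sup>+z. 1 * (ennreal (F (fst z) (snd z)) + ennreal (F (snd z) (fst z))) \<partial>(lborel \<Otimes>\<^sub>M lborel))"
   using F0 by (simp add: Gt_def ennreal_plus)
  also have "\<dots> = 1 * ((\<integral>\<^sup>+z. ennreal (F (fst z) (snd z)) \<partial>(lborel \<Otimes>\<^sub>M lborel)) + (\<integral>\<^sup>+z. ennreal (F (snd z) (fst z)) \<partial>(lborel \<Otimes>\<^sub>M lborel)))"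
   by (rule nn_integral_cmult_add2) measurable
  also have "(\<integral>\<^sup>+z. ennreal (F (fst z) (snd z)) \<partial>(lborel \<Otimes>\<^sub>M lborel)) = (LBNN x. LBNN y. ennreal (F x y))"
   by (subst lborel.nn_integral_fst[symmetric]) auto
  also have "(\<integral>\<^sup>+z. ennreal (F (snd z) (fst z)) \<partial>(lborel \<Otimes>\<^sub>M lborel)) = (LBNN x. LBNN y. ennreal (F x y))"
   by (subst lborel_pair.nn_integral_snd[symmetric]) auto
  also have "1 * ((LBNN x. LBNN y. ennreal (F x y)) + (LBNN x. LBNN y. ennreal (F x y))) <= ennreal (cc * I) + ennreal (cc * I)"
   unfolding mult_1_left by (intro add_mono Fint)
  also have "\<dots> = ennreal (2 * cc * I)" using cc0 I0 by (simp add: ennreal_plus[symmetric] del: ennreal_plus)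
  finally show ?thesis .
 qed
 have Gt0: "Gt z >= 0" for z using F0 by (simp add: Gt_def)
 have iGt: "integrable lborel Gt" using Gtm Gtn Gt0 by (intro integrableI_bounded) (auto intro: le_less_trans)
 have iGtL: "integrable lebesgue Gt" using iGt Gtm by (simp add: integrable_completion)
 let ?J = "\<lambda>z::'a \<times> 'a. ppow p (u (fst z) - u (snd z)) * ((\<eta> (fst z) powr p * (ub (fst z) + d) powr (1 - q)) - (\<eta> (snd z) powr p * (ub (snd z) + d) powr (1 - q))) * K (fst z) (snd z)"
 have good: "AE x in lebesgue. (x \<in> ball x0 R --> u x = ub x) \<and> nb x = neg_part (u x)" using ube nbe by eventually_elim auto
 have \<rho>R: "ball x0 \<rho> \<subseteq> ball x0 R" using \<rho> r by auto
 have half: "ppow p (u x - u y) * (\<eta> x powr p * (ub x + d) powr (1 - q)) * K x y <= F x y"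
  if x: "x \<in> ball x0 \<rho>" and y: "y \<notin> ball x0 \<rho>" and gx: "u x = ub x" and gy: "y \<in> ball x0 R --> u y = ub y" and ny: "nb y = neg_part (u y)" for x y
 proof -
  have "\<eta> x <= min 1 (L * norm (y - x))" using \<eta>(4)[of x y] \<eta>(3)[OF y] \<eta>(1)[of x] by (simp add: L_def dist_norm norm_minus_commute)
  then have "ppow p (u x - u y) * (\<eta> x powr p * (ub x + d) powr (1 - q)) * K x y
   <= 2 powr p * \<Lambda> * ((ub x + d) powr (p - q) * (min 1 (L * norm (y - x)) powr p * norm (y - x) powr (- (real DIM('a) + p * s))))
   + 2 powr p * \<Lambda> * 8 powr (real DIM('a) + p * s) * d powr (1 - p) * ((ub x + d) powr (p - q) * (nb y powr (p - 1) * norm (y - x0) powr (- (real DIM('a) + p * s)) * indicator (- ball x0 R) y))"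
   by (intro nonlocal_half[OF d \<rho>(3) L(1) x y gx _ _ ny \<eta>(1)]) (use ubM[of x] ubM[of y] gy in auto)
  also have "\<dots> = 2 powr p * \<Lambda> * (Va x * h (y - x)) + a2 * (Va x * w y)"
  proof -
   have Vx: "Va x = (ub x + d) powr (p - q)" using x by (simp add: Va_def v_def)
   show ?thesis unfolding Vx h_def k_def w_def a2_def by (rule refl)
  qed
  also have "\<dots> <= F x y" unfolding F_def a1_def using nl0 \<Lambda> Va0[of x] h0[of "y - x"] by (intro add_mono mult_right_mono order_refl) auto
  finally show ?thesis .
 qed
 have pt: "?J z <= Gt z" if g1: "(fst z \<in> ball x0 R --> u (fst z) = ub (fst z)) \<and> nb (fst z) = neg_part (u (fst z))"
   and g2: "(snd z \<in> ball x0 R --> u (snd z) = ub (snd z)) \<and> nb (snd z) = neg_part (u (snd z))" for z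
 proof -
  define x y where "x = fst z" and "y = snd z"
  note g1' = g1[folded x_def] and g2' = g2[folded y_def]
  let ?P = "ppow p (u x - u y) * ((\<eta> x powr p * (ub x + d) powr (1 - q)) - (\<eta> y powr p * (ub y + d) powr (1 - q)))"
  have sw: "ppow p (u y - u x) = - ppow p (u x - u y)" using ppow_minus[of p "u x - u y"] by simp
  have "?P * K x y <= F x y + F y x"
  proof (cases "x = y")
   case True
   then show ?thesis using F0[of y y] by simp
  next
   case xy: False
   have Ksym: "0 <= K x y" "K x y <= \<Lambda> * k (y - x)" using K0[OF xy] KL[OF xy] by (auto simp: k_def dist_norm norm_minus_commute)
   show ?thesis
   proof (cases "x \<in> ball x0 \<rho>"; cases "y \<in> ball x0 \<rho>")
    assume x: "x \<in> ball x0 \<rho>" and y: "y \<in> ball x0 \<rho>"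
    have ux: "u x = ub x" "u y = ub y" using x y \<rho>R g1' g2' by auto
    have "?P = ppow p (v x - v y) * (\<eta> x powr p * v x powr (1 - q) - \<eta> y powr p * v y powr (1 - q))" by (simp add: ux v_def)
    also have "\<dots> <= nl_const p \<delta> * (v x powr (p - q) + v y powr (p - q)) * \<bar>\<eta> x - \<eta> y\<bar> powr p"
     by (rule nonlocal_ineq[OF p \<delta> vd(3) vd(3) \<eta>(1) \<eta>(1)])
    also have "\<dots> <= nl_const p \<delta> * (v x powr (p - q) + v y powr (p - q)) * min 1 (L * norm (y - x)) powr p"
     using \<eta>(4)[of x y] nl0 p by (intro mult_left_mono powr_mono2) (auto simp: L_def dist_norm norm_minus_commute)
    finally have P: "?P <= nl_const p \<delta> * (Va x + Va y) * min 1 (L * norm (y - x)) powr p" using x y by (simp add: Va_def)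
    have q0: "0 <= nl_const p \<delta> * (Va x + Va y) * min 1 (L * norm (y - x)) powr p" using nl0 Va0[of x] Va0[of y] by simp
    have "?P * K x y <= nl_const p \<delta> * (Va x + Va y) * min 1 (L * norm (y - x)) powr p * K x y" using P Ksym by (intro mult_right_mono)
    also have "\<dots> <= nl_const p \<delta> * (Va x + Va y) * min 1 (L * norm (y - x)) powr p * (\<Lambda> * k (y - x))" using q0 Ksym by (intro mult_left_mono)
    also have "\<dots> = nl_const p \<delta> * \<Lambda> * (Va x * h (y - x)) + nl_const p \<delta> * \<Lambda> * (Va y * h (y - x))" by (simp add: h_def algebra_simps)
    also have "\<dots> <= a1 * (Va x * h (y - x)) + a1 * (Va y * h (y - x))"
     unfolding a1_def using nl0 \<Lambda> Va0 h0 by (intro add_mono mult_right_mono) auto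
    also have "h (y - x) = h (x - y)" by (simp add: h_def k_def norm_minus_commute)
    finally have "?P * K x y <= a1 * (Va x * h (x - y)) + a1 * (Va y * h (x - y))" .
    moreover have "h (x - y) = h (y - x)" by (simp add: h_def k_def norm_minus_commute)
    moreover have "0 <= a2 * (Va x * w y)" "0 <= a2 * (Va y * w x)" using a0 Va0 w0 by auto
    ultimately show ?thesis by (simp add: F_def)
   next
    assume x: "x \<in> ball x0 \<rho>" and y: "y \<notin> ball x0 \<rho>"
    have "?P * K x y = ppow p (u x - u y) * (\<eta> x powr p * (ub x + d) powr (1 - q)) * K x y" using \<eta>(3)[OF y] by simp
    also have "\<dots> <= F x y" by (rule half[OF x y]) (use x \<rho>R g1' g2' in auto)
    finally show ?thesis using F0[of y x] by linarith
   next
    assume x: "x \<notin> ball x0 \<rho>" and y: "y \<in> ball x0 \<rho>"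
    have "?P * K x y = ppow p (u y - u x) * (\<eta> y powr p * (ub y + d) powr (1 - q)) * K y x"
     using \<eta>(3)[OF x] sw Ks[of x y] by simp
    also have "\<dots> <= F y x" by (rule half[OF y x]) (use y \<rho>R g1' g2' in auto)
    finally show ?thesis using F0[of x y] by linarith
   next
    assume "x \<notin> ball x0 \<rho>" "y \<notin> ball x0 \<rho>"
    then show ?thesis using \<eta>(3) F0[of x y] F0[of y x] by simp
   qed
  qed
  then show ?thesis by (simp add: Gt_def x_def y_def)
 qed
 have "AE z in lebesgue. ?J z <= Gt z" using AE_lebesgue_pair[OF good]
 proof eventually_elim
  case (elim z)
  then show ?case by (intro pt) auto
 qed
 then have "(\<integral>z. ?J z \<partial>lebesgue) <= (\<integral>z. Gt z \<partial>lebesgue)" using iGtL Gt0 by (intro integral_mono_AE') auto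
 also have "\<dots> = (LBINT z. Gt z)" using Gtm by (intro integral_completion) simp
 also have "\<dots> <= 2 * cc * I"
  using Gtn Gtm Gt0 cc0 I0 by (subst integral_eq_nn_integral) (auto intro!: enn2real_leI)
 finally show ?thesis by (simp only: cc_def a1_def I_def Va_def v_def L_def mult.assoc)
qed

end

definition energy_bound_const :: "real => real => real => real => real => real => real => real => real" where
 "energy_bound_const n p s \<Lambda> C1 C2 CK \<delta> = 2 / (\<delta> * C1) * (p * C2 * (\<delta> * C1 / (2 * p * C2)) powr (1 - p)
   + 2 * ((nl_const p \<delta> + 2 powr p) * \<Lambda> * CK + 2 powr p * \<Lambda> * 8 powr (n + p * s)))"

locale supersol_rep = supersol p s \<Lambda> C1 C2 \<Omega> B K u x0 R r
 for p s \<Lambda> C1 C2 :: real and \<Omega> :: "'a::euclidean_space set" and B :: "'a => real => 'a => 'a"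
  and K :: "'a => 'a => real" and u :: "'a => real" and x0 :: 'a and R r :: real +
 fixes g gb :: "'a => 'a" and ub :: "'a => real" and M CK d :: real
 assumes g: "weak_grad_on \<Omega> u g" and ubM: "\<And>x. ub x \<in> {0..M}" and ube: "AE x in lebesgue. x \<in> ball x0 R --> u x = ub x"
  and gC: "(\<lambda>x. indicator (cball x0 (15/8 * r)) x *\<^sub>R g x) \<in> borel_measurable lebesgue"
  and gbe: "AE x in lebesgue. x \<in> cball x0 (15/8 * r) --> g x = gb x" and sob: "sobC p S UNIV 0 M ub gb"
  and CK: "0 < CK" "\<And>L. L > 0 ==> (LBNN z. ennreal (min 1 (L * norm (z::'a)) powr p * norm z powr (- (real DIM('a) + p * s)))) <= ennreal (CK * L powr (p * s))"
  and d: "0 < d" and tail: "(\<integral>\<^sup>+y. ennreal (neg_part (u y) powr (p - 1) * norm (y - x0) powr (- (real DIM('a) + p * s))) * indicator (- ball x0 R) y \<partial>lebesgue) <= ennreal (d powr (p - 1) * r powr (-p))"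
begin

lemma energy_estimate:
 assumes \<delta>: "0 < \<delta>" "\<alpha> <= p - 1 - \<delta>" and \<rho>: "0 < \<rho>'" "\<rho>' < \<rho>" "\<rho> <= 7/4 * r"
  and \<eta>: "C1g \<eta> G" "\<And>x. 0 <= \<eta> x" "\<And>x. \<eta> x <= 1" "\<And>x. x \<notin> cball x0 ((\<rho>' + \<rho>) / 2) ==> \<eta> x = 0"
   "\<And>x. x \<notin> cball x0 ((\<rho>' + \<rho>) / 2) ==> G x = 0" "\<And>x. norm (G x) <= 8 / (\<rho> - \<rho>')"
   "\<And>x y. \<bar>\<eta> x - \<eta> y\<bar> <= min 1 (8 / (\<rho> - \<rho>') * dist x y)"
 shows "integrable lborel (\<lambda>x. \<eta> x powr p * (ub x + d) powr (\<alpha> - p) * norm (gb x) powr p)"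
  and "(LBINT x. \<eta> x powr p * (ub x + d) powr (\<alpha> - p) * norm (gb x) powr p)
   <= energy_bound_const (real DIM('a)) p s \<Lambda> C1 C2 CK \<delta> * (8 / (\<rho> - \<rho>')) powr p * (LBINT x. (ub x + d) powr \<alpha> * indicator (ball x0 \<rho>) x)"
proof -
 let ?Z = "cball x0 ((\<rho>' + \<rho>) / 2)"
 define L where "L = 8 / (\<rho> - \<rho>')"
 define q where "q = p - \<alpha>"
 have q: "1 + \<delta> <= q" using \<delta> by (simp add: q_def)
 have ubm [measurable]: "ub \<in> borel_measurable borel" and gbm [measurable]: "gb \<in> borel_measurable borel"
  and gbfin: "(LBNN x. ennreal (norm (gb x) powr p) * indicator S x) < \<infinity>"
  using sob unfolding sobC_def by blast+
 note [measurable] = C1g_borel[OF \<eta>(1)]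
 have ZS: "?Z \<subseteq> S" using \<rho> by auto
 have SC: "S \<subseteq> cball x0 (15/8 * r)" using r by auto
 have SR: "S \<subseteq> ball x0 R" using r by auto
 have S\<Omega>: "S \<subseteq> \<Omega>" using SR BR by blast
 have [measurable]: "S \<in> sets borel" by simp
 have Sfin: "emeasure lborel S < \<infinity>" using emeasure_lborel_ball_finite[of x0 "7/4 * r"] by simp
 define v where "v x = ub x + d" for x
 have vd: "d <= v x" "v x <= M + d" "v x > 0" for x using ubM[of x] d by (auto simp: v_def)
 have [measurable]: "v \<in> borel_measurable borel" unfolding v_def by measurable
 define F where "F t = (t + d) powr (1 - q)" for t
 define F' where "F' t = (1 - q) * (t + d) powr (- q)" for t
 have FD: "(F has_real_derivative F' t) (at t)" if "t \<in> {0..M}" for t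
 proof -
  have "((\<lambda>t. (t + d) powr (1 - q)) has_real_derivative (1 - q) * (t + d) powr (1 - q - 1) * 1) (at t)"
   using that d by (auto intro!: derivative_eq_intros)
  then show ?thesis by (simp add: F_def[abs_def] F'_def)
 qed
 have F'c: "continuous_on {0..M} F'" unfolding F'_def by (intro continuous_intros) (use d in auto)
 define \<zeta> where "\<zeta> x = \<eta> x powr p" for x
 define G\<zeta> where "G\<zeta> x = (p * \<eta> x powr (p - 1)) *\<^sub>R G x" for x
 have \<zeta>C: "C1g \<zeta> G\<zeta>"
 proof -
  have "C1g (\<lambda>x. max 0 (\<eta> x) powr p) (\<lambda>x. (p * max 0 (\<eta> x) powr (p - 1)) *\<^sub>R G x)"
   by (rule C1g_compose[OF \<eta>(1) pos_powr_deriv[OF p] pos_powr_deriv_cont[OF p]]) simp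
  moreover have "max 0 (\<eta> x) = \<eta> x" for x using \<eta>(2)[of x] by simp
  ultimately show ?thesis by (simp add: \<zeta>_def[abs_def] G\<zeta>_def[abs_def])
 qed
 have \<eta>1: "\<eta> x powr (p - 1) <= 1" "\<zeta> x <= 1" "0 <= \<zeta> x" for x
  using powr_mono2[of "p - 1" "\<eta> x" 1] powr_mono2[of p "\<eta> x" 1] \<eta>(2,3)[of x] p by (auto simp: \<zeta>_def)
 define A where "A = max 1 (p * L)"
 have A: "\<bar>\<zeta> x\<bar> <= A" "norm (G\<zeta> x) <= A" for x
 proof -
  show "\<bar>\<zeta> x\<bar> <= A" using \<eta>1[of x] by (auto simp: A_def)
  have "norm (G\<zeta> x) = p * (\<eta> x powr (p - 1) * norm (G x))" using p by (simp add: G\<zeta>_def)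
  also have "\<dots> <= p * (1 * L)" using \<eta>1(1)[of x] \<eta>(6)[of x] p by (intro mult_left_mono mult_mono) (auto simp: L_def)
  finally show "norm (G\<zeta> x) <= A" by (simp add: A_def)
 qed
 have \<zeta>Z: "\<zeta> x = 0" "G\<zeta> x = 0" if "x \<notin> ?Z" for x using \<eta>(4,5)[OF that] by (auto simp: \<zeta>_def G\<zeta>_def)
 obtain a1 b1 where s1: "sobC p S UNIV a1 b1 (\<lambda>x. F (ub x)) (\<lambda>x. F' (ub x) *\<^sub>R gb x)"
  by (rule sobC_chain[OF sob _ _ FD F'c]) (use p in auto)
 define \<phi> where "\<phi> x = \<zeta> x * F (ub x)" for x
 define h where "h x = \<zeta> x *\<^sub>R (F' (ub x) *\<^sub>R gb x) + F (ub x) *\<^sub>R G\<zeta> x" for x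
 obtain a2 b2 where s2: "sobC p S ?Z a2 b2 \<phi> h"
 proof (rule sobC_mult[OF s1 less_imp_le[OF p] _ Sfin \<zeta>C A, where Z' = ?Z])
  show "S \<in> sets borel" by simp
  show "\<zeta> x = 0" if "x \<notin> ?Z" for x using \<zeta>Z(1)[OF that] .
  show thesis if "sobC p S ?Z a' b' (\<lambda>x. \<zeta> x * F (ub x)) (\<lambda>x. \<zeta> x *\<^sub>R F' (ub x) *\<^sub>R gb x + F (ub x) *\<^sub>R G\<zeta> x)" for a' b'
   by (rule \<open>\<And>a2 b2. sobC p S ?Z a2 b2 \<phi> h ==> thesis\<close>) (use that in \<open>simp only: \<phi>_def[abs_def] h_def[abs_def]\<close>)
 qed
 have z\<phi>: "\<phi> x = 0" and zh: "h x = 0" if "x \<notin> ?Z" for x using \<zeta>Z[OF that] by (auto simp: \<phi>_def h_def)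
 have W: "W1p0 p S \<phi>" by (rule W1p0_of_sobC[OF s2 _ _ z\<phi> zh]) (use p \<rho> in auto)
 have wg: "weak_grad_on S \<phi> h" by (rule weak_grad_on_of_sobC(3)[OF s2 _ _ z\<phi> zh]) (use p \<rho> in auto)
 have \<phi>0: "\<forall>x. 0 <= \<phi> x" using \<eta>1(3) by (auto simp: \<phi>_def F_def)
 have clS: "compact (closure S)" "closure S \<subseteq> \<Omega>" using r BR SC by (auto simp: subset_iff)
 define NL where "NL = (\<integral>z. ppow p (u (fst z) - u (snd z)) * (\<phi> (fst z) - \<phi> (snd z)) * K (fst z) (snd z) \<partial>(lebesgue :: ('a \<times> 'a) measure))"
 have main: "0 <= (LINT x:S|lebesgue. B x (u x) (g x) \<bullet> h x) + NL"
  using sup[unfolded weak_supersolution_def] g clS W \<phi>0 wg open_ball unfolding NL_def by blast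
 define I where "I = (LBINT x. (ub x + d) powr \<alpha> * indicator (ball x0 \<rho>) x)"
 have NLb: "NL <= 2 * ((nl_const p \<delta> + 2 powr p) * \<Lambda> * CK + 2 powr p * \<Lambda> * 8 powr (real DIM('a) + p * s)) * L powr p * I"
 proof -
  have "\<eta> x = 0" if "x \<notin> ball x0 \<rho>" for x by (rule \<eta>(4)) (use that \<rho> in auto)
  from nonlocal_bound[OF ubm ubM ube CK d tail \<delta>(1) q \<rho> \<eta>(2,3) this \<eta>(7)]
  show ?thesis by (simp add: NL_def I_def \<phi>_def \<zeta>_def F_def L_def q_def)
 qed
 define E where "E x = \<eta> x powr p * v x powr (- q) * norm (gb x) powr p" for x
 have [measurable]: "E \<in> borel_measurable borel" unfolding E_def by measurable
 have EZ: "E x = 0" if "x \<notin> ?Z" for x using \<eta>(4)[OF that] by (simp add: E_def)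
 define gp where "gp x = norm (gb x) powr p * indicator S x" for x
 have [measurable]: "gp \<in> borel_measurable borel" unfolding gp_def by measurable
 have igp: "integrable lborel gp"
 proof (rule integrableI_bounded)
  have "(LBNN x. ennreal (norm (gp x))) = (LBNN x. ennreal (norm (gb x) powr p) * indicator S x)"
   by (intro nn_integral_cong) (auto simp: gp_def indicator_def)
  then show "(LBNN x. ennreal (norm (gp x))) < \<infinity>" using gbfin by simp
 qed measurable
 have iE: "integrable lborel E"
 proof (rule Bochner_Integration.integrable_bound[OF integrable_mult_right[OF igp, of "d powr (- q)"]])
  show "AE x in lborel. norm (E x) <= norm (d powr (- q) * gp x)"
  proof (rule AE_I2)
   fix x
   show "norm (E x) <= norm (d powr (- q) * gp x)"
   proof (cases "x \<in> ?Z")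
    case True
    then have xS: "x \<in> S" using ZS by blast
    have "v x powr (- q) <= d powr (- q)" using vd[of x] d q \<delta> by (intro powr_mono2') auto
    then have "\<eta> x powr p * v x powr (- q) * norm (gb x) powr p <= 1 * d powr (- q) * norm (gb x) powr p"
     using \<eta>1(2,3)[of x] by (intro mult_right_mono mult_mono) (auto simp: \<zeta>_def)
    then show ?thesis using xS by (simp add: E_def gp_def)
   qed (simp add: EZ)
  qed
 qed measurable
 define e where "e = \<delta> * C1 / (2 * p * C2)"
 have e0: "e > 0" using \<delta> C1 C2 p by (simp add: e_def)
 define Y where "Y x = v x powr \<alpha> * norm (G x) powr p" for x
 have [measurable]: "Y \<in> borel_measurable borel" unfolding Y_def by measurable
 have Yb: "norm (Y x) <= (d powr \<alpha> + (M + d) powr \<alpha>) * L powr p" for x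
  using powr_between[OF d vd(1,2)[of x], of \<alpha>] powr_mono2[of p "norm (G x)" L] \<eta>(6)[of x] p
  by (auto simp: Y_def L_def intro!: mult_mono)
 have YZ: "Y x = 0" if "x \<notin> ?Z" for x using \<eta>(5)[OF that] by (simp add: Y_def)
 have iY: "integrable lborel Y" by (rule integrable_bounded_compact_support[where x = x0 and r = "(\<rho>' + \<rho>) / 2", OF _ Yb YZ]) measurable
 define C' where "C' = p * C2 * e powr (1 - p)"
 have C'0: "C' >= 0" using p C2 by (simp add: C'_def)
 define bdd where "bdd x = - (\<delta> * C1 / 2) * E x + C' * Y x" for x
 have ibdd: "integrable lborel bdd" unfolding bdd_def by (intro Bochner_Integration.integrable_add integrable_mult_right iE iY)
 have bddm: "bdd \<in> borel_measurable borel" unfolding bdd_def by measurable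
 let ?Bh = "\<lambda>x. indicator S x *\<^sub>R (B x (u x) (g x) \<bullet> h x)"
 have hm [measurable]: "h \<in> borel_measurable borel" using s2 by (simp add: sobC_def)
 have Bhm: "?Bh \<in> borel_measurable lebesgue"
 proof -
  have "(\<lambda>x. indicator S x *\<^sub>R B x (u x) (indicator (cball x0 (15/8 * r)) x *\<^sub>R g x)) \<in> borel_measurable lebesgue"
   by (rule caratheodory_measurable[OF Bm Bc S\<Omega> _ u_meas gC]) auto
  moreover have "indicator S x *\<^sub>R B x (u x) (indicator (cball x0 (15/8 * r)) x *\<^sub>R g x) = indicator S x *\<^sub>R B x (u x) (g x)" for x
   using SC by (cases "x \<in> S") (auto simp: subset_iff)
  ultimately have "(\<lambda>x. indicator S x *\<^sub>R B x (u x) (g x)) \<in> borel_measurable lebesgue" by (simp only:)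
  then have "(\<lambda>x. (indicator S x *\<^sub>R B x (u x) (g x)) \<bullet> h x) \<in> borel_measurable lebesgue"
   by (rule borel_measurable_inner) (intro measurable_completion, measurable)
  then show ?thesis by simp
 qed
 have pw: "B x (u x) (g x) \<bullet> h x <= bdd x \<and> \<bar>B x (u x) (g x) \<bullet> h x\<bar> <= C2 * (A * (d powr (- q) * (q - 1) + d powr (1 - q))) * (2 * norm (gb x) powr p + 1)"
  if xS: "x \<in> S" and gx: "g x = gb x" and Bx: "\<forall>v \<zeta>. B x v \<zeta> \<bullet> \<zeta> >= C1 * norm \<zeta> powr p \<and> norm (B x v \<zeta>) <= C2 * norm \<zeta> powr (p - 1)" for x
 proof -
  let ?b = "B x (u x) (gb x)" and ?n = "norm (gb x)"
  have b1: "C1 * ?n powr p <= ?b \<bullet> gb x" and b2: "norm ?b <= C2 * ?n powr (p - 1)" using Bx by auto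
  have Fv: "F (ub x) = v x powr (1 - q)" "F' (ub x) = - ((q - 1) * v x powr (- q))" by (auto simp: F_def F'_def v_def algebra_simps)
  have bh: "?b \<bullet> h x = - ((q - 1) * (\<zeta> x * v x powr (- q))) * (?b \<bullet> gb x) + v x powr (1 - q) * (?b \<bullet> G\<zeta> x)"
   by (simp add: h_def inner_add_right inner_diff_right Fv mult_ac)
  have t1: "- ((q - 1) * (\<zeta> x * v x powr (- q))) * (?b \<bullet> gb x) <= - (\<delta> * C1) * E x"
  proof -
   have "(\<delta> * (\<zeta> x * v x powr (- q))) * (C1 * ?n powr p) <= ((q - 1) * (\<zeta> x * v x powr (- q))) * (?b \<bullet> gb x)"
    using q \<delta> b1 C1 \<eta>1(3)[of x] by (intro mult_mono mult_right_mono) auto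
   moreover have "(\<delta> * (\<zeta> x * v x powr (- q))) * (C1 * ?n powr p) = \<delta> * C1 * E x" by (simp add: E_def \<zeta>_def)
   ultimately show ?thesis by simp
  qed
  define X where "X = \<eta> x * v x powr (- q / p) * ?n"
  define y where "y = v x powr (\<alpha> / p) * norm (G x)"
  have X0: "X >= 0" "y >= 0" using \<eta>(2)[of x] by (auto simp: X_def y_def)
  have Xp: "X powr p = E x" using \<eta>(2)[of x] p by (simp add: X_def E_def powr_mult powr_powr)
  have yp: "y powr p = Y x" using p by (simp add: y_def Y_def powr_mult powr_powr)
  have Xy: "X powr (p - 1) * y = v x powr (1 - q) * (\<eta> x powr (p - 1) * norm (G x) * ?n powr (p - 1))"
  proof -
   have "- q / p * (p - 1) + \<alpha> / p = 1 - q" using p by (simp add: q_def field_simps)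
   then have "v x powr (- q / p * (p - 1)) * v x powr (\<alpha> / p) = v x powr (1 - q)" by (simp add: powr_add[symmetric])
   moreover have "X powr (p - 1) = \<eta> x powr (p - 1) * v x powr (- q / p * (p - 1)) * ?n powr (p - 1)"
    using \<eta>(2)[of x] by (simp add: X_def powr_mult powr_powr)
   ultimately show ?thesis by (simp add: y_def mult_ac)
  qed
  have cs: "\<bar>?b \<bullet> G\<zeta> x\<bar> <= C2 * ?n powr (p - 1) * (p * (\<eta> x powr (p - 1) * norm (G x)))"
  proof -
   have "\<bar>?b \<bullet> G\<zeta> x\<bar> <= norm ?b * norm (G\<zeta> x)" by (rule Cauchy_Schwarz_ineq2)
   also have "norm (G\<zeta> x) = p * (\<eta> x powr (p - 1) * norm (G x))" using p by (simp add: G\<zeta>_def)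
   also have "norm ?b * (p * (\<eta> x powr (p - 1) * norm (G x))) <= C2 * ?n powr (p - 1) * (p * (\<eta> x powr (p - 1) * norm (G x)))"
    using b2 p by (intro mult_right_mono) auto
   finally show ?thesis .
  qed
  have t2: "v x powr (1 - q) * (?b \<bullet> G\<zeta> x) <= \<delta> * C1 / 2 * E x + C' * Y x"
  proof -
   have "v x powr (1 - q) * (?b \<bullet> G\<zeta> x) <= v x powr (1 - q) * (C2 * ?n powr (p - 1) * (p * (\<eta> x powr (p - 1) * norm (G x))))"
    using cs by (intro mult_left_mono) auto
   also have "\<dots> = p * C2 * (X powr (p - 1) * y)" unfolding Xy by (simp add: mult_ac)
   also have "\<dots> <= p * C2 * (e * X powr p + e powr (1 - p) * y powr p)"
    using p C2 X0 e0 by (intro mult_left_mono young_powr) auto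
   also have "\<dots> = p * C2 * e * E x + C' * Y x" by (simp add: Xp yp C'_def algebra_simps)
   also have "p * C2 * e = \<delta> * C1 / 2" using p C2 by (simp add: e_def)
   finally show ?thesis .
  qed
  have up: "?b \<bullet> h x <= bdd x" unfolding bh bdd_def using t1 t2 by (simp add: algebra_simps)
  have nh: "norm (h x) <= A * (d powr (- q) * (q - 1) + d powr (1 - q)) * (?n + 1)"
  proof -
   have v1: "v x powr (- q) <= d powr (- q)" "v x powr (1 - q) <= d powr (1 - q)" using vd[of x] d q \<delta> by (auto intro!: powr_mono2')
   have "norm (h x) <= \<zeta> x * ((q - 1) * v x powr (- q) * ?n) + v x powr (1 - q) * norm (G\<zeta> x)"
    unfolding h_def Fv using \<eta>1(3)[of x] q \<delta> by (intro norm_triangle_le add_mono) (auto simp: abs_mult)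
   also have "\<dots> <= A * ((q - 1) * d powr (- q) * ?n) + d powr (1 - q) * A"
    using A[of x] v1 \<eta>1(3)[of x] q \<delta> by (intro add_mono mult_mono) (auto intro!: mult_nonneg_nonneg)
   also have "\<dots> <= A * (d powr (- q) * (q - 1) + d powr (1 - q)) * (?n + 1)"
   proof -
    have "0 <= A * (d powr (- q) * (q - 1))" "0 <= A * d powr (1 - q) * ?n" using q \<delta> by (auto simp: A_def)
    then show ?thesis by (simp add: algebra_simps)
   qed
   finally show ?thesis .
  qed
  have "\<bar>?b \<bullet> h x\<bar> <= norm ?b * norm (h x)" by (rule Cauchy_Schwarz_ineq2)
  also have "\<dots> <= (C2 * ?n powr (p - 1)) * (A * (d powr (- q) * (q - 1) + d powr (1 - q)) * (?n + 1))"
   using b2 nh C2 by (intro mult_mono) auto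
  also have "\<dots> = C2 * (A * (d powr (- q) * (q - 1) + d powr (1 - q))) * (?n powr (p - 1) * (?n + 1))" by (simp add: mult_ac)
  also have "\<dots> <= C2 * (A * (d powr (- q) * (q - 1) + d powr (1 - q))) * (2 * ?n powr p + 1)"
  proof (rule mult_left_mono)
   have "?n powr (p - 1) * ?n = ?n powr p" by (cases "?n = 0") (auto simp: powr_diff)
   moreover have "?n powr (p - 1) <= 1 + ?n powr p"
   proof (cases "?n <= 1")
    case True
    then have "?n powr (p - 1) <= 1" using p by (intro powr_le1) auto
    then show ?thesis by (simp add: add_increasing2)
   next
    case False
    then have "?n powr (p - 1) <= ?n powr p" by (intro powr_mono) auto
    then show ?thesis by simp
   qed
   ultimately show "?n powr (p - 1) * (?n + 1) <= 2 * ?n powr p + 1" by (simp add: algebra_simps)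
   show "0 <= C2 * (A * (d powr (- q) * (q - 1) + d powr (1 - q)))" using C2 q \<delta> by (auto simp: A_def intro!: mult_nonneg_nonneg)
  qed
  finally show ?thesis using up gx by simp
 qed
 define CC where "CC = C2 * (A * (d powr (- q) * (q - 1) + d powr (1 - q)))"
 have good: "AE x in lebesgue. x \<in> S --> B x (u x) (g x) \<bullet> h x <= bdd x \<and> \<bar>B x (u x) (g x) \<bullet> h x\<bar> <= CC * (2 * norm (gb x) powr p + 1)"
  using gbe Bg
 proof eventually_elim
  case (elim x)
  show ?case
  proof
   assume x: "x \<in> S"
   then show "B x (u x) (g x) \<bullet> h x <= bdd x \<and> \<bar>B x (u x) (g x) \<bullet> h x\<bar> <= CC * (2 * norm (gb x) powr p + 1)"
    unfolding CC_def using elim SC S\<Omega> by (intro pw) auto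
  qed
 qed
 have CC0: "CC >= 0" unfolding CC_def using C2 q \<delta> by (auto simp: A_def intro!: mult_nonneg_nonneg)
 have iBh: "integrable lebesgue ?Bh"
 proof (rule Bochner_Integration.integrable_bound[OF _ Bhm])
  have iS: "integrable lborel (indicat_real S)" using Sfin by simp
  have "integrable lborel (\<lambda>x. CC * (2 * gp x + indicat_real S x))" by (intro integrable_mult_right Bochner_Integration.integrable_add igp iS)
  then show "integrable lebesgue (\<lambda>x. CC * (2 * gp x + indicat_real S x))" by (subst integrable_completion) (auto dest: borel_measurable_integrable)
  show "AE x in lebesgue. norm (?Bh x) <= norm (CC * (2 * gp x + indicat_real S x))"
   using good
  proof eventually_elim
   case (elim x)
   then show ?case using CC0 by (cases "x \<in> S") (auto simp: gp_def abs_mult)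
  qed
 qed
 have bddL: "integrable lebesgue bdd" using ibdd bddm by (simp add: integrable_completion)
 have bZ: "bdd x = 0" if "x \<notin> S" for x
 proof -
  have "x \<notin> ?Z" using ZS that by blast
  from EZ[OF this] YZ[OF this] show ?thesis by (simp add: bdd_def)
 qed
 have "(LINT x:S|lebesgue. B x (u x) (g x) \<bullet> h x) <= (\<integral>x. bdd x \<partial>lebesgue)"
  unfolding set_lebesgue_integral_def
 proof (rule integral_mono_AE[OF iBh bddL])
  show "AE x in lebesgue. ?Bh x <= bdd x" using good
  proof eventually_elim
   case (elim x)
   then show ?case using bZ[of x] by (cases "x \<in> S") auto
  qed
 qed
 also have "\<dots> = (LBINT x. bdd x)" using bddm by (intro integral_completion) simp
 also have "\<dots> = - (\<delta> * C1 / 2) * (LBINT x. E x) + C' * (LBINT x. Y x)"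
  unfolding bdd_def using iE iY by (simp add: Bochner_Integration.integral_add)
 also have "\<dots> <= - (\<delta> * C1 / 2) * (LBINT x. E x) + C' * (L powr p * I)"
 proof -
  have iI: "integrable lborel (\<lambda>x. (ub x + d) powr \<alpha> * indicat_real (ball x0 \<rho>) x)"
  proof (rule integrable_bounded_compact_support[of _ "d powr \<alpha> + (M + d) powr \<alpha>" x0 \<rho>])
   show "norm ((ub y + d) powr \<alpha> * indicat_real (ball x0 \<rho>) y) <= d powr \<alpha> + (M + d) powr \<alpha>" for y
    using powr_between[OF d vd(1,2)[of y], of \<alpha>] by (cases "y \<in> ball x0 \<rho>") (auto simp: v_def)
   show "(\<lambda>x. (ub x + d) powr \<alpha> * indicat_real (ball x0 \<rho>) x) \<in> borel_measurable borel"
    using borel_open[OF open_ball] by measurable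
  qed auto
  have "(LBINT x. Y x) <= (LBINT x. L powr p * ((ub x + d) powr \<alpha> * indicat_real (ball x0 \<rho>) x))"
  proof (rule integral_mono[OF iY integrable_mult_right[OF iI]])
   fix x
   show "Y x <= L powr p * ((ub x + d) powr \<alpha> * indicat_real (ball x0 \<rho>) x)"
   proof (cases "x \<in> ball x0 \<rho>")
    case True
    have "norm (G x) powr p <= L powr p" using \<eta>(6)[of x] p by (intro powr_mono2) (auto simp: L_def)
    then show ?thesis using True by (simp add: Y_def v_def mult.commute[of _ "norm (G x) powr p"] mult_right_mono)
   next
    case False
    then have "x \<notin> ?Z" using \<rho> by auto
    then show ?thesis using YZ by simp
   qed
  qed
  then have "(LBINT x. Y x) <= L powr p * I" by (simp add: I_def)
  then show ?thesis using C'0 by (intro add_left_mono mult_left_mono) auto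
 qed
 finally have loc: "(LINT x:S|lebesgue. B x (u x) (g x) \<bullet> h x) <= - (\<delta> * C1 / 2) * (LBINT x. E x) + C' * (L powr p * I)" .
 define N2 where "N2 = 2 * ((nl_const p \<delta> + 2 powr p) * \<Lambda> * CK + 2 powr p * \<Lambda> * 8 powr (real DIM('a) + p * s))"
 have "\<delta> * C1 / 2 * (LBINT x. E x) <= (C' + N2) * (L powr p * I)"
  using main loc NLb unfolding N2_def[symmetric] by (simp add: algebra_simps)
 then have "2 / (\<delta> * C1) * (\<delta> * C1 / 2 * (LBINT x. E x)) <= 2 / (\<delta> * C1) * ((C' + N2) * (L powr p * I))"
  using \<delta> C1 by (intro mult_left_mono) auto
 moreover have "2 / (\<delta> * C1) * (\<delta> * C1 / 2 * (LBINT x. E x)) = (LBINT x. E x)" using \<delta> C1 by simp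
 moreover have "2 / (\<delta> * C1) * (C' + N2) = energy_bound_const (real DIM('a)) p s \<Lambda> C1 C2 CK \<delta>" by (simp only: energy_bound_const_def C'_def e_def N2_def)
 ultimately have "(LBINT x. E x) <= energy_bound_const (real DIM('a)) p s \<Lambda> C1 C2 CK \<delta> * L powr p * I"
  by (metis mult.assoc)
 moreover have Eeq: "E = (\<lambda>x. \<eta> x powr p * (ub x + d) powr (\<alpha> - p) * norm (gb x) powr p)" by (simp add: E_def[abs_def] v_def q_def)
 ultimately show "(LBINT x. \<eta> x powr p * (ub x + d) powr (\<alpha> - p) * norm (gb x) powr p)
   <= energy_bound_const (real DIM('a)) p s \<Lambda> C1 C2 CK \<delta> * (8 / (\<rho> - \<rho>')) powr p * (LBINT x. (ub x + d) powr \<alpha> * indicator (ball x0 \<rho>) x)"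
  by (simp add: I_def L_def)
 show "integrable lborel (\<lambda>x. \<eta> x powr p * (ub x + d) powr (\<alpha> - p) * norm (gb x) powr p)" using iE unfolding Eeq .
qed

end

lemma sobolev_sobC:
 fixes w :: "'a::euclidean_space => real"
 assumes sob: "sobC p S Z a b w g" and p: "1 < p" and \<kappa>: "1 < \<kappa>" and S [measurable]: "S \<in> sets borel"
  and Z: "closed Z" "Z \<subseteq> S" "S \<subseteq> ball x0 \<rho>" and wZ: "\<And>x. x \<notin> Z ==> w x = 0" and D: "0 <= D"
  and Sob: "\<And>f G. C1g f G ==> (\<And>x. x \<notin> ball x0 \<rho> ==> f x = 0) ==>
    (LBINT x. \<bar>f x\<bar> powr (\<kappa> * p)) powr (1 / \<kappa>) <= D * (LBINT x. norm (G x) powr p)"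
 shows "(LBINT x. \<bar>w x\<bar> powr (\<kappa> * p)) powr (1 / \<kappa>) <= D * (2 powr p * (LBINT x. norm (g x) powr p * indicator S x))"
proof -
 obtain wk Gk where w [measurable]: "w \<in> borel_measurable borel" and g [measurable]: "g \<in> borel_measurable borel"
  and wab: "\<And>x. w x \<in> {a..b}"
  and fin: "(LBNN x. ennreal (norm (g x) powr p) * indicator S x) < \<infinity>"
  and C1: "\<And>k. C1g (wk k) (Gk k)" and wkab: "\<And>k x. wk k x \<in> {a..b}" and wkZ: "\<And>k x. x \<notin> Z ==> wk k x = 0"
  and AE: "AE x in lborel. x \<in> S --> (\<lambda>k. wk k x) \<longlonglongrightarrow> w x"
  and Lp: "(\<lambda>k. LBNN x. ennreal (norm (Gk k x - g x) powr p) * indicator S x) \<longlonglongrightarrow> 0"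
  by (rule sobCE[OF sob]) (rule that)
 note [measurable] = C1g_borel[OF C1]
 have [measurable]: "ball x0 \<rho> \<in> sets borel" by simp
 have \<kappa>p: "\<kappa> * p > 0" using p \<kappa> by simp
 define c where "c = max \<bar>a\<bar> \<bar>b\<bar>"
 have wc: "\<bar>wk k x\<bar> <= c" for k x using wkab[of k x] by (auto simp: c_def)
 have ZB: "x \<notin> Z" if "x \<notin> ball x0 \<rho>" for x using that Z by blast
 have lim1: "(\<lambda>k. LBINT x. \<bar>wk k x\<bar> powr (\<kappa> * p)) \<longlonglongrightarrow> (LBINT x. \<bar>w x\<bar> powr (\<kappa> * p))"
 proof (rule integral_dominated_convergence[where w = "\<lambda>x. c powr (\<kappa> * p) * indicat_real (ball x0 \<rho>) x"])
  show "integrable lborel (\<lambda>x. c powr (\<kappa> * p) * indicat_real (ball x0 \<rho>) x)"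
   using emeasure_lborel_ball_finite[of x0 \<rho>] by (intro integrable_mult_right) simp
  show "AE x in lborel. (\<lambda>k. \<bar>wk k x\<bar> powr (\<kappa> * p)) \<longlonglongrightarrow> \<bar>w x\<bar> powr (\<kappa> * p)"
   using AE
  proof eventually_elim
   case (elim x)
   have "(\<lambda>k. wk k x) \<longlonglongrightarrow> w x"
   proof (cases "x \<in> S")
    case False
    then have "x \<notin> Z" using Z by blast
    then show ?thesis using wkZ wZ by simp
   qed (use elim in blast)
   then have "(\<lambda>k. \<bar>wk k x\<bar>) \<longlonglongrightarrow> \<bar>w x\<bar>" by (rule tendsto_rabs)
   then show ?case by (rule tendsto_powr'[OF _ tendsto_const]) (use \<kappa>p in auto)
  qed
  show "AE x in lborel. norm (\<bar>wk k x\<bar> powr (\<kappa> * p)) <= c powr (\<kappa> * p) * indicat_real (ball x0 \<rho>) x" for k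
  proof (rule AE_I2)
   fix x
   have "\<bar>wk k x\<bar> powr (\<kappa> * p) <= c powr (\<kappa> * p)" using wc \<kappa>p by (intro powr_mono2) auto
   then show "norm (\<bar>wk k x\<bar> powr (\<kappa> * p)) <= c powr (\<kappa> * p) * indicat_real (ball x0 \<rho>) x"
    using wkZ[OF ZB, of x k] by (cases "x \<in> ball x0 \<rho>") (auto simp del: mem_ball)
  qed
 qed measurable
 have GZ: "Gk k x = 0" if "x \<notin> Z" for k x
  by (rule C1g_zero_open[OF C1 open_Compl[OF Z(1)]]) (use wkZ that in auto)
 define J where "J = (LBINT x. norm (g x) powr p * indicator S x)"
 have ig: "integrable lborel (\<lambda>x. norm (g x) powr p * indicator S x)"
 proof (rule integrableI_bounded)
  have "(LBNN x. ennreal (norm (norm (g x) powr p * indicator S x))) = (LBNN x. ennreal (norm (g x) powr p) * indicator S x)"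
   by (intro nn_integral_cong) (auto simp: indicator_def)
  then show "(LBNN x. ennreal (norm (norm (g x) powr p * indicator S x))) < \<infinity>" using fin by simp
 qed measurable
 have iG: "integrable lborel (\<lambda>x. norm (Gk k x) powr p)" for k
 proof -
  have "continuous_on UNIV (Gk k)" using C1[of k] by (rule C1g_cont)
  then have "continuous_on UNIV (\<lambda>x. norm (Gk k x) powr p)" using p by (intro continuous_on_powr' continuous_intros) auto
  then have "bounded ((\<lambda>x. norm (Gk k x) powr p) ` cball x0 \<rho>)"
   by (intro compact_imp_bounded compact_continuous_image compact_cball) (rule continuous_on_subset, assumption, simp)
  then obtain m where "\<forall>y\<in>(\<lambda>x. norm (Gk k x) powr p) ` cball x0 \<rho>. norm y <= m" unfolding bounded_iff by blast
  then have m: "\<bar>norm (Gk k x) powr p\<bar> <= m" if "x \<in> cball x0 \<rho>" for x using that by auto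
  have o: "norm (Gk k x) powr p = 0" if "x \<notin> cball x0 \<rho>" for x
  proof -
   have "x \<notin> ball x0 \<rho>" using that by auto
   from GZ[OF ZB[OF this]] show ?thesis by simp
  qed
  show ?thesis
  proof (rule integrable_bounded_compact_support[where M = "max m 0" and x = x0 and r = \<rho>, OF _ _ o])
   show "norm (norm (Gk k y) powr p) <= max m 0" for y using m[of y] o[of y] by (cases "y \<in> cball x0 \<rho>") (auto simp del: mem_cball)
  qed measurable
 qed
 have id: "integrable lborel (\<lambda>x. norm (Gk k x - g x) powr p * indicator S x)" for k
 proof (rule Bochner_Integration.integrable_bound[OF integrable_mult_right[OF Bochner_Integration.integrable_add[OF iG[of k] ig], of "2 powr p"]])
  show "AE x in lborel. norm (norm (Gk k x - g x) powr p * indicator S x) <= norm (2 powr p * (norm (Gk k x) powr p + norm (g x) powr p * indicator S x))"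
   using norm_add_powr_le[of p "Gk k x" "- g x" for x] p by (intro AE_I2) (auto simp: indicator_def)
 qed measurable
 have le: "(LBINT x. norm (Gk k x) powr p) <= 2 powr p * ((LBINT x. norm (Gk k x - g x) powr p * indicator S x) + J)" for k
 proof -
  have "(LBINT x. norm (Gk k x) powr p) <= (LBINT x. 2 powr p * (norm (Gk k x - g x) powr p * indicator S x + norm (g x) powr p * indicator S x))"
  proof (rule integral_mono[OF iG])
   show "integrable lborel (\<lambda>x. 2 powr p * (norm (Gk k x - g x) powr p * indicator S x + norm (g x) powr p * indicator S x))"
    by (intro integrable_mult_right Bochner_Integration.integrable_add id ig)
   fix x
   show "norm (Gk k x) powr p <= 2 powr p * (norm (Gk k x - g x) powr p * indicator S x + norm (g x) powr p * indicator S x)"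
   proof (cases "x \<in> S")
    case False
    then have "x \<notin> Z" using Z by blast
    then show ?thesis using GZ by simp
   qed (use norm_add_powr_le[of p "Gk k x - g x" "g x"] p in simp)
  qed
  also have "\<dots> = 2 powr p * ((LBINT x. norm (Gk k x - g x) powr p * indicator S x) + J)"
   unfolding J_def integral_mult_right_zero by (simp add: Bochner_Integration.integral_add[OF id ig])
  finally show ?thesis .
 qed
 have lim2: "(\<lambda>k. LBINT x. norm (Gk k x - g x) powr p * indicator S x) \<longlonglongrightarrow> 0"
 proof (rule nn_integral_tendsto_0_imp_integral)
  show "(\<lambda>k. LBNN x. ennreal (norm (Gk k x - g x) powr p * indicator S x)) \<longlonglongrightarrow> 0"
   using Lp by (simp add: ennreal_mult' ennreal_indicator)
 qed auto
 have "(\<lambda>k. (LBINT x. \<bar>wk k x\<bar> powr (\<kappa> * p)) powr (1 / \<kappa>)) \<longlonglongrightarrow> (LBINT x. \<bar>w x\<bar> powr (\<kappa> * p)) powr (1 / \<kappa>)"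
  by (rule tendsto_powr'[OF lim1 tendsto_const]) (use \<kappa> in \<open>auto intro!: always_eventually\<close>)
 moreover have "(\<lambda>k. D * (2 powr p * ((LBINT x. norm (Gk k x - g x) powr p * indicator S x) + J))) \<longlonglongrightarrow> D * (2 powr p * (0 + J))"
  by (intro tendsto_intros lim2)
 moreover have "(LBINT x. \<bar>wk k x\<bar> powr (\<kappa> * p)) powr (1 / \<kappa>) <= D * (2 powr p * ((LBINT x. norm (Gk k x - g x) powr p * indicator S x) + J))" for k
  by (rule order_trans[OF Sob[OF C1 wkZ[OF ZB]] mult_left_mono[OF le D]])
 ultimately have "(LBINT x. \<bar>w x\<bar> powr (\<kappa> * p)) powr (1 / \<kappa>) <= D * (2 powr p * (0 + J))"
  by (intro LIMSEQ_le) auto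
 then show ?thesis by (simp add: J_def)
qed

lemma poincare_sobC:
 fixes w :: "'a::euclidean_space => real"
 assumes sob: "sobC p S UNIV a b w g" and p: "1 <= p" and S [measurable]: "S \<in> sets borel" and Sfin: "emeasure lborel S < \<infinity>"
  and \<rho>: "\<rho> > 0" "ball x0 \<rho> \<subseteq> S"
 shows "(LBNN x. LBNN y. ennreal \<bar>w x - w y\<bar> * indicator (ball x0 \<rho>) x * indicator (ball x0 \<rho>) y)
  <= ennreal (2 * \<rho> * 2 ^ DIM('a)) * emeasure lborel (ball x0 \<rho>) * (LBNN x. ennreal (norm (g x)) * indicator (ball x0 \<rho>) x)"
proof -
 obtain wk Gk where w [measurable]: "w \<in> borel_measurable borel" and g [measurable]: "g \<in> borel_measurable borel"
  and wab: "\<And>x. w x \<in> {a..b}"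
  and fin: "(LBNN x. ennreal (norm (g x) powr p) * indicator S x) < \<infinity>"
  and C1: "\<And>k. C1g (wk k) (Gk k)" and wkab: "\<And>k x. wk k x \<in> {a..b}" and wkZ: "\<And>k x. x \<notin> UNIV ==> wk k x = 0"
  and AE: "AE x in lborel. x \<in> S --> (\<lambda>k. wk k x) \<longlonglongrightarrow> w x"
  and Lp: "(\<lambda>k. LBNN x. ennreal (norm (Gk k x - g x) powr p) * indicator S x) \<longlonglongrightarrow> 0"
  by (rule sobCE[OF sob]) (rule that)
 note [measurable] = C1g_borel[OF C1]
 let ?B = "ball x0 \<rho>"
 have [measurable]: "?B \<in> sets borel" by simp
 let ?i = "\<lambda>x. indicator ?B x :: ennreal"
 define c where "c = 2 * max \<bar>a\<bar> \<bar>b\<bar>"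
 have wc: "\<bar>wk k x - w x\<bar> <= c" for k x using wkab[of k x] wab[of x] by (auto simp: c_def)
 define Ak where "Ak k = (LBNN x. ennreal \<bar>wk k x - w x\<bar> * ?i x)" for k
 define Bk where "Bk k = (LBNN x. ennreal (norm (Gk k x - g x)) * indicator S x)" for k
 have limB: "Bk \<longlonglongrightarrow> 0" unfolding Bk_def[abs_def]
  by (rule Lp_tendsto_imp_L1[OF _ S Sfin _ p Lp]) auto
 have limA: "Ak \<longlonglongrightarrow> 0"
 proof -
  have "Ak \<longlonglongrightarrow> (LBNN (x::'a). 0)" unfolding Ak_def[abs_def]
  proof (rule nn_integral_dominated_convergence[where w = "\<lambda>x. ennreal c * ?i x"])
   show "AE x in lborel. ennreal \<bar>wk j x - w x\<bar> * ?i x <= ennreal c * ?i x" for j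
    using wc by (intro AE_I2 mult_right_mono ennreal_leI) auto
   show "(LBNN x. ennreal c * ?i x) < \<infinity>"
    using emeasure_lborel_ball_finite[of x0 \<rho>] by (subst nn_integral_cmult_indicator) (auto simp: ennreal_mult_less_top)
   show "AE x in lborel. (\<lambda>k. ennreal \<bar>wk k x - w x\<bar> * ?i x) \<longlonglongrightarrow> 0"
    using AE
   proof eventually_elim
    case (elim x)
    show ?case
    proof (cases "x \<in> ?B")
     case True
     then have "(\<lambda>k. wk k x) \<longlonglongrightarrow> w x" using elim \<rho> by blast
     then have "(\<lambda>k. \<bar>wk k x - w x\<bar>) \<longlonglongrightarrow> 0" by (simp add: tendsto_rabs_zero LIM_zero)
     then have "(\<lambda>k. ennreal \<bar>wk k x - w x\<bar>) \<longlonglongrightarrow> ennreal 0" by (rule tendsto_ennrealI)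
     then show ?thesis using True by simp
    qed simp
   qed
  qed measurable
  then show ?thesis by simp
 qed
 define c1 where "c1 = ennreal (2 * \<rho> * 2 ^ DIM('a)) * emeasure lborel ?B"
 have Bf: "emeasure lborel ?B < top" using emeasure_lborel_ball_finite[of x0 \<rho>] by simp
 have c1: "c1 < top" unfolding c1_def using Bf by (simp add: ennreal_mult_less_top)
 let ?Lh = "(LBNN x. LBNN y. ennreal \<bar>w x - w y\<bar> * ?i x * ?i y)" and ?J = "(LBNN x. ennreal (norm (g x)) * ?i x)"
 have le: "?Lh <= c1 * (Bk k + ?J) + (emeasure lborel ?B * Ak k + emeasure lborel ?B * Ak k)" for k
 proof -
  have pt: "ennreal \<bar>w x - w y\<bar> * ?i x * ?i y <= ennreal \<bar>wk k x - wk k y\<bar> * ?i x * ?i y + ((ennreal \<bar>wk k x - w x\<bar> * ?i x) * ?i y + ?i x * (ennreal \<bar>wk k y - w y\<bar> * ?i y))" for x y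
  proof (cases "x \<in> ?B \<and> y \<in> ?B")
   case True
   have "\<bar>w x - w y\<bar> <= \<bar>wk k x - wk k y\<bar> + (\<bar>wk k x - w x\<bar> + \<bar>wk k y - w y\<bar>)" by linarith
   then have "ennreal \<bar>w x - w y\<bar> <= ennreal (\<bar>wk k x - wk k y\<bar> + (\<bar>wk k x - w x\<bar> + \<bar>wk k y - w y\<bar>))" by (rule ennreal_leI)
   also have "\<dots> = ennreal \<bar>wk k x - wk k y\<bar> + (ennreal \<bar>wk k x - w x\<bar> + ennreal \<bar>wk k y - w y\<bar>)" by simp
   finally show ?thesis using True by simp
  qed auto
  have "?Lh <= (LBNN x. LBNN y. ennreal \<bar>wk k x - wk k y\<bar> * ?i x * ?i y + ((ennreal \<bar>wk k x - w x\<bar> * ?i x) * ?i y + ?i x * (ennreal \<bar>wk k y - w y\<bar> * ?i y)))"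
   by (intro nn_integral_mono pt)
  also have "\<dots> = (LBNN x. (LBNN y. ennreal \<bar>wk k x - wk k y\<bar> * ?i x * ?i y) + ((ennreal \<bar>wk k x - w x\<bar> * ?i x) * emeasure lborel ?B + ?i x * Ak k))"
   unfolding Ak_def by (intro nn_integral_cong) (simp add: nn_integral_add nn_integral_cmult)
  also have "\<dots> = (LBNN x. LBNN y. ennreal \<bar>wk k x - wk k y\<bar> * ?i x * ?i y) + (Ak k * emeasure lborel ?B + emeasure lborel ?B * Ak k)"
   by (subst nn_integral_add, measurable, subst nn_integral_add, measurable, subst nn_integral_multc, measurable, subst nn_integral_multc, measurable) (simp add: Ak_def)
  also have "\<dots> <= c1 * (LBNN x. ennreal (norm (Gk k x)) * ?i x) + (Ak k * emeasure lborel ?B + emeasure lborel ?B * Ak k)"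
   unfolding c1_def by (intro add_right_mono poincare_C1[OF C1 \<rho>(1)])
  also have "(LBNN x. ennreal (norm (Gk k x)) * ?i x) <= (LBNN x. ennreal (norm (Gk k x - g x)) * indicator S x + ennreal (norm (g x)) * ?i x)"
  proof (rule nn_integral_mono)
   fix x
   show "ennreal (norm (Gk k x)) * ?i x <= ennreal (norm (Gk k x - g x)) * indicator S x + ennreal (norm (g x)) * ?i x"
   proof (cases "x \<in> ?B")
    case True
    then have xS: "x \<in> S" using \<rho> by blast
    have "ennreal (norm (Gk k x)) <= ennreal (norm (Gk k x - g x) + norm (g x))" using norm_triangle_ineq[of "Gk k x - g x" "g x"] by (intro ennreal_leI) simp
    then show ?thesis using True xS by (simp add: ennreal_plus)
   qed simp
  qed
  also have "\<dots> = Bk k + ?J" unfolding Bk_def by (rule nn_integral_add) measurable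
  finally show ?thesis by (simp add: mult.commute[of "Ak k"] mult_left_mono add_right_mono)
 qed
 have "(\<lambda>k. c1 * (Bk k + ?J) + (emeasure lborel ?B * Ak k + emeasure lborel ?B * Ak k)) \<longlonglongrightarrow> c1 * (0 + ?J) + (emeasure lborel ?B * 0 + emeasure lborel ?B * 0)"
  by (intro tendsto_add ennreal_tendsto_cmult c1 Bf limA limB tendsto_const)
 from LIMSEQ_le_const[OF this] le have "?Lh <= c1 * (0 + ?J) + (emeasure lborel ?B * 0 + emeasure lborel ?B * 0)" by blast
 then show ?thesis by (simp add: c1_def)
qed

definition hoelder_bound_const :: "real => real => real => real => real => real" where
 "hoelder_bound_const n p \<kappa> D e = D * 2 powr (p - n * (1 - 1 / \<kappa>)) * 32 powr p * (\<bar>e\<bar> + 1)"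

definition log_bound_const :: "nat => real => real => real" where
 "log_bound_const n p e = 6 * 2 ^ n * (1 + \<bar>e\<bar> * 32 powr p) * (unit_ball_vol (real n) * 2 ^ n)"

context supersol_rep
begin

lemma ub_borel [measurable]: "ub \<in> borel_measurable borel" and gb_borel [measurable]: "gb \<in> borel_measurable borel"
 using sob unfolding sobC_def by blast+

lemma v_bounds: "d <= ub x + d" "ub x + d <= M + d" "0 < ub x + d"
 using ubM[of x] d by auto

lemma integrable_v_powr: "integrable lborel (\<lambda>x. (ub x + d) powr \<alpha> * indicat_real (ball x0 \<rho>) x)"
proof (rule integrable_bounded_compact_support[of _ "d powr \<alpha> + (M + d) powr \<alpha>" x0 \<rho>])
 show "norm ((ub y + d) powr \<alpha> * indicat_real (ball x0 \<rho>) y) <= d powr \<alpha> + (M + d) powr \<alpha>" for y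
  using powr_between[OF d v_bounds(1,2)[of y], of \<alpha>] by (cases "y \<in> ball x0 \<rho>") auto
 show "(\<lambda>x. (ub x + d) powr \<alpha> * indicat_real (ball x0 \<rho>) x) \<in> borel_measurable borel"
  using borel_open[OF open_ball] by measurable
qed auto

lemma reverse_hoelder_step:
 assumes \<kappa>: "1 < \<kappa>" and D: "0 < D"
  and Sob: "\<And>\<rho> f G. 0 < \<rho> ==> C1g f G ==> (\<And>x. x \<notin> ball x0 \<rho> ==> f x = 0) ==>
    (LBINT x. \<bar>f x\<bar> powr (\<kappa> * p)) powr (1 / \<kappa>) <= D * \<rho> powr (p - real DIM('a) * (1 - 1 / \<kappa>)) * (LBINT x. norm (G x) powr p)"
  and \<delta>: "0 < \<delta>" "\<alpha> <= p - 1 - \<delta>" and \<sigma>: "1 <= \<sigma>'" "\<sigma>' < \<sigma>" "\<sigma> <= 3/2"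
 shows "(LBINT x. (ub x + d) powr (\<alpha> * \<kappa>) * indicator (ball x0 (\<sigma>' * r)) x) powr (1 / \<kappa>)
  <= hoelder_bound_const (real DIM('a)) p \<kappa> D (energy_bound_const (real DIM('a)) p s \<Lambda> C1 C2 CK \<delta>) * (1 + \<bar>\<alpha>\<bar>) powr p * (\<sigma> - \<sigma>') powr (-p) * r powr (real DIM('a) / \<kappa> - real DIM('a))
   * (LBINT x. (ub x + d) powr \<alpha> * indicator (ball x0 (\<sigma> * r)) x)"
proof -
 define \<rho>' where "\<rho>' = \<sigma>' * r"
 define \<rho> where "\<rho> = \<sigma> * r"
 have \<rho>: "0 < \<rho>'" "\<rho>' < \<rho>" "\<rho> <= 7/4 * r" using \<sigma> r unfolding \<rho>'_def \<rho>_def by (auto intro!: mult_right_mono)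
 let ?Z = "cball x0 ((\<rho>' + \<rho>) / 2)"
 obtain \<eta> G where \<eta>: "C1g \<eta> G" "\<And>x. 0 <= \<eta> x" "\<And>x. \<eta> x <= 1" "\<And>x. x \<in> ball x0 \<rho>' ==> \<eta> x = 1"
  "\<And>x. x \<notin> ?Z ==> \<eta> x = 0" "\<And>x. x \<notin> ?Z ==> G x = 0"
  "\<And>x. norm (G x) <= 8 / (\<rho> - \<rho>')" "\<And>x y. \<bar>\<eta> x - \<eta> y\<bar> <= min 1 (8 / (\<rho> - \<rho>') * dist x y)"
  by (rule cutoff[OF \<rho>(1,2), of x0]) (rule that)
 note en = energy_estimate[OF \<delta> \<rho> \<eta>(1,2,3,5,6,7,8)]
 note [measurable] = C1g_borel[OF \<eta>(1)]
 have [measurable]: "S \<in> sets borel" "ball x0 \<rho> \<in> sets borel" by simp_all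
 define L where "L = 8 / (\<rho> - \<rho>')"
 define v where "v x = ub x + d" for x
 have [measurable]: "v \<in> borel_measurable borel" unfolding v_def by measurable
 define I where "I = (LBINT x. (ub x + d) powr \<alpha> * indicator (ball x0 \<rho>) x)"
 have I0: "I >= 0" unfolding I_def by (intro integral_nonneg_AE AE_I2) auto
 define E where "E x = \<eta> x powr p * (ub x + d) powr (\<alpha> - p) * norm (gb x) powr p" for x
 have ZS: "?Z \<subseteq> S" using \<rho> by auto
 have Sfin: "emeasure lborel S < \<infinity>" using emeasure_lborel_ball_finite[of x0 "7/4 * r"] by simp
 define F where "F t = (t + d) powr (\<alpha> / p)" for t
 define F' where "F' t = \<alpha> / p * (t + d) powr (\<alpha> / p - 1)" for t
 have FD: "(F has_real_derivative F' t) (at t)" if "t \<in> {0..M}" for t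
 proof -
  have "((\<lambda>t. (t + d) powr (\<alpha> / p)) has_real_derivative \<alpha> / p * (t + d) powr (\<alpha> / p - 1) * 1) (at t)"
   using that d by (auto intro!: derivative_eq_intros)
  then show ?thesis by (simp add: F_def[abs_def] F'_def)
 qed
 have F'c: "continuous_on {0..M} F'" unfolding F'_def by (intro continuous_intros) (use d in auto)
 obtain a1 b1 where s1: "sobC p S UNIV a1 b1 (\<lambda>x. F (ub x)) (\<lambda>x. F' (ub x) *\<^sub>R gb x)"
  by (rule sobC_chain[OF sob _ _ FD F'c]) (use p in auto)
 define f where "f x = \<eta> x * F (ub x)" for x
 define h where "h x = \<eta> x *\<^sub>R (F' (ub x) *\<^sub>R gb x) + F (ub x) *\<^sub>R G x" for x
 have "\<exists>a2 b2. sobC p S ?Z a2 b2 f h"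
 proof (rule sobC_mult[OF s1 less_imp_le[OF p] _ Sfin \<eta>(1), where Z' = ?Z and A = "max 1 L"])
  show "\<eta> x = 0" if "x \<notin> ?Z" for x using \<eta>(5)[OF that] .
  show "\<bar>\<eta> x\<bar> <= max 1 L" "norm (G x) <= max 1 L" for x using \<eta>(2,3,7)[of x] by (auto simp: L_def)
  fix a b assume "sobC p S ?Z a b (\<lambda>x. \<eta> x * F (ub x)) (\<lambda>x. \<eta> x *\<^sub>R F' (ub x) *\<^sub>R gb x + F (ub x) *\<^sub>R G x)"
  then show "\<exists>a2 b2. sobC p S ?Z a2 b2 f h" unfolding f_def[abs_def] h_def[abs_def] by blast
 qed simp
 then obtain a2 b2 where s2: "sobC p S ?Z a2 b2 f h" by blast
 define J where "J = (LBINT x. norm (h x) powr p * indicator S x)"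
 have fZ: "f x = 0" if "x \<notin> ?Z" for x using \<eta>(5)[OF that] by (simp add: f_def)
 have S2: "S \<subseteq> ball x0 (2 * r)" using r by auto
 have r2: "0 < 2 * r" using r by simp
 have step1: "(LBINT x. \<bar>f x\<bar> powr (\<kappa> * p)) powr (1 / \<kappa>) <= D * (2 * r) powr (p - real DIM('a) * (1 - 1 / \<kappa>)) * (2 powr p * J)"
  unfolding J_def by (rule sobolev_sobC[OF s2 p \<kappa> _ closed_cball ZS S2 fZ _ Sob[OF r2]]) (use D in auto)
 have "J <= (LBINT x. 2 powr p * ((1 + \<bar>\<alpha>\<bar>) powr p * E x + L powr p * ((ub x + d) powr \<alpha> * indicator (ball x0 \<rho>) x)))"
  unfolding J_def
 proof (rule integral_mono')
  show "integrable lborel (\<lambda>x. 2 powr p * ((1 + \<bar>\<alpha>\<bar>) powr p * E x + L powr p * ((ub x + d) powr \<alpha> * indicator (ball x0 \<rho>) x)))"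
   unfolding E_def by (intro integrable_mult_right Bochner_Integration.integrable_add en integrable_v_powr)
  fix x
  show "0 <= 2 powr p * ((1 + \<bar>\<alpha>\<bar>) powr p * E x + L powr p * ((ub x + d) powr \<alpha> * indicator (ball x0 \<rho>) x))"
   by (simp add: E_def)
  show "norm (h x) powr p * indicator S x <= 2 powr p * ((1 + \<bar>\<alpha>\<bar>) powr p * E x + L powr p * ((ub x + d) powr \<alpha> * indicator (ball x0 \<rho>) x))"
  proof (cases "x \<in> ?Z")
   case False
   then have "h x = 0" using \<eta>(5,6)[OF False] by (simp add: h_def)
   then show ?thesis by (simp add: E_def)
  next
   case True
   then have xb: "x \<in> ball x0 \<rho>" using \<rho> by auto
   have "norm (h x) powr p <= 2 powr p * (norm (\<eta> x *\<^sub>R (F' (ub x) *\<^sub>R gb x)) powr p + norm (F (ub x) *\<^sub>R G x) powr p)"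
    unfolding h_def by (rule norm_add_powr_le) (use p in simp)
   also have "\<dots> <= 2 powr p * ((1 + \<bar>\<alpha>\<bar>) powr p * E x + L powr p * (ub x + d) powr \<alpha>)"
   proof (intro mult_left_mono add_mono)
    have "norm (\<eta> x *\<^sub>R (F' (ub x) *\<^sub>R gb x)) powr p = (\<bar>\<alpha>\<bar> / p) powr p * E x"
    proof -
     have "norm (\<eta> x *\<^sub>R (F' (ub x) *\<^sub>R gb x)) = \<bar>\<alpha>\<bar> / p * (\<eta> x * v x powr (\<alpha> / p - 1) * norm (gb x))"
      using \<eta>(2)[of x] p by (simp add: F'_def v_def abs_mult)
     moreover have "(v x powr (\<alpha> / p - 1)) powr p = v x powr (\<alpha> - p)" using p by (simp add: powr_powr left_diff_distrib)
     moreover have "(\<eta> x * v x powr (\<alpha> / p - 1) * norm (gb x)) powr p = \<eta> x powr p * (v x powr (\<alpha> / p - 1)) powr p * norm (gb x) powr p"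
      using \<eta>(2)[of x] by (simp add: powr_mult)
     moreover have "(\<bar>\<alpha>\<bar> / p * (\<eta> x * v x powr (\<alpha> / p - 1) * norm (gb x))) powr p = (\<bar>\<alpha>\<bar> / p) powr p * (\<eta> x * v x powr (\<alpha> / p - 1) * norm (gb x)) powr p"
      by (rule powr_mult)
     ultimately show ?thesis by (simp only: E_def v_def)
    qed
    also have "\<dots> <= (1 + \<bar>\<alpha>\<bar>) powr p * E x"
    proof (intro mult_right_mono powr_mono2)
     have "\<bar>\<alpha>\<bar> / p <= \<bar>\<alpha>\<bar>" using p by (simp add: divide_le_eq mult_left_mono[of 1 p "\<bar>\<alpha>\<bar>", simplified])
     then show "\<bar>\<alpha>\<bar> / p <= 1 + \<bar>\<alpha>\<bar>" by simp
    qed (use p in \<open>auto simp: E_def\<close>)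
    finally show "norm (\<eta> x *\<^sub>R (F' (ub x) *\<^sub>R gb x)) powr p <= (1 + \<bar>\<alpha>\<bar>) powr p * E x" .
    have "norm (F (ub x) *\<^sub>R G x) powr p = (ub x + d) powr \<alpha> * norm (G x) powr p"
     using p by (simp add: F_def powr_mult powr_powr)
    also have "\<dots> <= (ub x + d) powr \<alpha> * L powr p" using \<eta>(7)[of x] p by (intro mult_left_mono powr_mono2) (auto simp: L_def)
    finally show "norm (F (ub x) *\<^sub>R G x) powr p <= L powr p * (ub x + d) powr \<alpha>" by (simp add: mult.commute)
   qed simp
   also have "\<dots> = 2 powr p * ((1 + \<bar>\<alpha>\<bar>) powr p * E x + L powr p * ((ub x + d) powr \<alpha> * indicator (ball x0 \<rho>) x))" using xb by simp
   finally show ?thesis using p by (cases "x \<in> S") (auto simp: E_def simp del: mem_ball)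
  qed
 qed
 also have "\<dots> = 2 powr p * ((1 + \<bar>\<alpha>\<bar>) powr p * (LBINT x. E x) + L powr p * I)"
 proof -
  have i1: "integrable lborel (\<lambda>x. (1 + \<bar>\<alpha>\<bar>) powr p * E x)" unfolding E_def by (intro integrable_mult_right en)
  have i2: "integrable lborel (\<lambda>x. L powr p * ((ub x + d) powr \<alpha> * indicat_real (ball x0 \<rho>) x))" by (intro integrable_mult_right integrable_v_powr)
  show ?thesis unfolding integral_mult_right_zero Bochner_Integration.integral_add[OF i1 i2] I_def ..
 qed
 also have "\<dots> <= 2 powr p * ((1 + \<bar>\<alpha>\<bar>) powr p * (\<bar>energy_bound_const (real DIM('a)) p s \<Lambda> C1 C2 CK \<delta>\<bar> * L powr p * I) + (1 + \<bar>\<alpha>\<bar>) powr p * (L powr p * I))"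
 proof (intro mult_left_mono add_mono)
  have "(LBINT x. E x) <= energy_bound_const (real DIM('a)) p s \<Lambda> C1 C2 CK \<delta> * L powr p * I" using en(2) by (simp add: E_def L_def I_def)
  also have "\<dots> <= \<bar>energy_bound_const (real DIM('a)) p s \<Lambda> C1 C2 CK \<delta>\<bar> * L powr p * I" using I0 by (intro mult_right_mono) auto
  finally show "(LBINT x. E x) <= \<bar>energy_bound_const (real DIM('a)) p s \<Lambda> C1 C2 CK \<delta>\<bar> * L powr p * I" .
  have "1 <= (1 + \<bar>\<alpha>\<bar>) powr p" using p by (intro ge_one_powr_ge_zero) auto
  then show "L powr p * I <= (1 + \<bar>\<alpha>\<bar>) powr p * (L powr p * I)"
   using mult_right_mono[of 1 "(1 + \<bar>\<alpha>\<bar>) powr p" "L powr p * I"] I0 by simp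
 qed auto
 also have "\<dots> = 2 powr p * (1 + \<bar>\<alpha>\<bar>) powr p * (\<bar>energy_bound_const (real DIM('a)) p s \<Lambda> C1 C2 CK \<delta>\<bar> + 1) * (L powr p * I)" by (simp add: algebra_simps)
 finally have step2: "J <= 2 powr p * (1 + \<bar>\<alpha>\<bar>) powr p * (\<bar>energy_bound_const (real DIM('a)) p s \<Lambda> C1 C2 CK \<delta>\<bar> + 1) * (L powr p * I)" .
 have "(LBINT x. (ub x + d) powr (\<alpha> * \<kappa>) * indicator (ball x0 \<rho>') x) <= (LBINT x. \<bar>f x\<bar> powr (\<kappa> * p))"
 proof (rule integral_mono')
  show "integrable lborel (\<lambda>x. \<bar>f x\<bar> powr (\<kappa> * p))"
  proof (rule integrable_bounded_compact_support[where M = "max \<bar>a2\<bar> \<bar>b2\<bar> powr (\<kappa> * p)" and x = x0 and r = "(\<rho>' + \<rho>) / 2"])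
   show "(\<lambda>x. \<bar>f x\<bar> powr (\<kappa> * p)) \<in> borel_measurable borel" unfolding f_def F_def by measurable
   have "f y \<in> {a2..b2}" for y using s2 unfolding sobC_def by blast
   then have "\<bar>f y\<bar> <= max \<bar>a2\<bar> \<bar>b2\<bar>" for y by (smt (verit, best) atLeastAtMost_iff)
   then show "norm (\<bar>f y\<bar> powr (\<kappa> * p)) <= max \<bar>a2\<bar> \<bar>b2\<bar> powr (\<kappa> * p)" for y using p \<kappa> by (auto intro!: powr_mono2)
   show "\<bar>f y\<bar> powr (\<kappa> * p) = 0" if "y \<notin> ?Z" for y using fZ[OF that] by simp
  qed
  fix x
  show "(ub x + d) powr (\<alpha> * \<kappa>) * indicator (ball x0 \<rho>') x <= \<bar>f x\<bar> powr (\<kappa> * p)"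
  proof (cases "x \<in> ball x0 \<rho>'")
   case True
   have "\<bar>f x\<bar> powr (\<kappa> * p) = (ub x + d) powr (\<alpha> * \<kappa>)" using \<eta>(4)[OF True] p by (simp add: f_def F_def powr_powr mult.commute)
   then show ?thesis by (simp add: indicator_def)
  qed simp
 qed auto
 then have "(LBINT x. (ub x + d) powr (\<alpha> * \<kappa>) * indicator (ball x0 \<rho>') x) powr (1 / \<kappa>) <= (LBINT x. \<bar>f x\<bar> powr (\<kappa> * p)) powr (1 / \<kappa>)"
  using \<kappa> by (intro powr_mono2) (auto intro!: integral_nonneg_AE)
 also note step1
 also have "D * (2 * r) powr (p - real DIM('a) * (1 - 1 / \<kappa>)) * (2 powr p * J)
  <= D * (2 * r) powr (p - real DIM('a) * (1 - 1 / \<kappa>)) * (2 powr p * (2 powr p * (1 + \<bar>\<alpha>\<bar>) powr p * (\<bar>energy_bound_const (real DIM('a)) p s \<Lambda> C1 C2 CK \<delta>\<bar> + 1) * (L powr p * I)))"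
  using step2 D by (intro mult_left_mono) auto
 also have "\<dots> = hoelder_bound_const (real DIM('a)) p \<kappa> D (energy_bound_const (real DIM('a)) p s \<Lambda> C1 C2 CK \<delta>) * (1 + \<bar>\<alpha>\<bar>) powr p * (\<sigma> - \<sigma>') powr (-p) * r powr (real DIM('a) / \<kappa> - real DIM('a)) * I"
 proof -
  have "L = 8 / ((\<sigma> - \<sigma>') * r)" by (simp add: L_def \<rho>_def \<rho>'_def left_diff_distrib)
  then have Lp: "L powr p = 8 powr p * (\<sigma> - \<sigma>') powr (-p) * r powr (-p)" by (simp only: powr_divide powr_mult powr_minus) (simp add: divide_simps)
  have p32: "(32::real) powr p = 2 powr p * 2 powr p * 8 powr p" by (simp add: powr_mult[symmetric])
  define e where "e = p - real DIM('a) * (1 - 1 / \<kappa>)"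
  have re: "r powr e * r powr (-p) = r powr (real DIM('a) / \<kappa> - real DIM('a))" by (simp add: powr_add[symmetric] e_def algebra_simps)
  have "(2 * r) powr e = 2 powr e * r powr e" using r by (simp add: powr_mult)
  then show ?thesis unfolding hoelder_bound_const_def Lp p32 re[symmetric] e_def[symmetric] by (simp add: mult_ac)
 qed
 finally show ?thesis by (simp add: \<rho>'_def \<rho>_def I_def)
qed

lemma gradient_ln_integral:
 "(LBNN x. ennreal (norm ((1 / (ub x + d)) *\<^sub>R gb x)) * indicator (ball x0 (3/2 * r)) x)
  <= ennreal ((1 + \<bar>energy_bound_const (real DIM('a)) p s \<Lambda> C1 C2 CK (p - 1)\<bar> * 32 powr p) * (unit_ball_vol (real DIM('a)) * 2 ^ DIM('a)) * r ^ DIM('a) / r)"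
proof -
 let ?B = "ball x0 (3/2 * r)"
 have [measurable]: "?B \<in> sets borel" by simp
 have \<rho>: "0 < 3/2 * r" "3/2 * r < 7/4 * r" "7/4 * r <= 7/4 * r" and \<delta>: "0 < p - 1" "0 <= p - 1 - (p - 1)" using r p by auto
 let ?Z = "cball x0 ((3/2 * r + 7/4 * r) / 2)" and ?L = "8 / (7/4 * r - 3/2 * r)"
 obtain \<eta> G where \<eta>: "C1g \<eta> G" "\<And>x. 0 <= \<eta> x" "\<And>x. \<eta> x <= 1" "\<And>x. x \<in> ?B ==> \<eta> x = 1"
  "\<And>x. x \<notin> ?Z ==> \<eta> x = 0" "\<And>x. x \<notin> ?Z ==> G x = 0"
  "\<And>x. norm (G x) <= ?L" "\<And>x y. \<bar>\<eta> x - \<eta> y\<bar> <= min 1 (?L * dist x y)"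
  by (rule cutoff[OF \<rho>(1,2), of x0]) (rule that)
 note en = energy_estimate[OF \<delta> \<rho> \<eta>(1,2,3,5,6,7,8)]
 define E where "E x = \<eta> x powr p * (ub x + d) powr (0 - p) * norm (gb x) powr p" for x
 define V where "V = unit_ball_vol (real DIM('a)) * 2 ^ DIM('a) * r ^ DIM('a)"
 have V0: "V >= 0" using r by (simp add: V_def)
 have vol: "measure lborel (ball x0 (c * r)) <= V" if "0 <= c" "c <= 2" for c
 proof -
  have "measure lborel (ball x0 (c * r)) = unit_ball_vol (real DIM('a)) * (c * r) ^ DIM('a)" using that r by (intro content_ball) auto
  also have "\<dots> <= unit_ball_vol (real DIM('a)) * (2 * r) ^ DIM('a)" using that r by (intro mult_left_mono power_mono mult_right_mono) auto
  finally show ?thesis by (simp add: V_def power_mult_distrib)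
 qed
 define e where "e = \<bar>energy_bound_const (real DIM('a)) p s \<Lambda> C1 C2 CK (p - 1)\<bar>"
 have EI: "(LBINT x. E x) <= e * (32 / r) powr p * V"
 proof -
  have "(LBINT x. E x) <= energy_bound_const (real DIM('a)) p s \<Lambda> C1 C2 CK (p - 1) * ?L powr p * (LBINT x. (ub x + d) powr 0 * indicator (ball x0 (7/4 * r)) x)"
   using en(2) by (simp add: E_def)
  also have "(LBINT x. (ub x + d) powr 0 * indicator (ball x0 (7/4 * r)) x) = measure lborel (ball x0 (7/4 * r))"
  proof -
   have "(ub x + d) powr 0 = 1" for x using v_bounds(3)[of x] by simp
   then show ?thesis by simp
  qed
  also have "energy_bound_const (real DIM('a)) p s \<Lambda> C1 C2 CK (p - 1) * ?L powr p * measure lborel (ball x0 (7/4 * r)) <= e * ?L powr p * V"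
   unfolding e_def by (intro mult_mono vol) auto
  also have "?L = 32 / r" using r by (simp add: field_simps)
  finally show ?thesis .
 qed
 have iE: "integrable lborel E" using en(1) by (simp add: E_def[abs_def])
 have E0: "E x >= 0" for x by (simp add: E_def)
 have pt: "ennreal (norm ((1 / (ub x + d)) *\<^sub>R gb x)) * indicator ?B x <= ennreal (1 / r) * indicator ?B x + ennreal (r powr (p - 1)) * ennreal (E x)" for x
 proof (cases "x \<in> ?B")
  case True
  let ?t = "norm ((1 / (ub x + d)) *\<^sub>R gb x)"
  have v0: "ub x + d > 0" by (rule v_bounds)
  have "?t <= 1 / r + (1 / r) powr (1 - p) * ?t powr p" using r p by (intro le_eps_powr) auto
  also have "(1 / r) powr (1 - p) = r powr (p - 1)" using r by (simp add: powr_divide powr_minus[symmetric] powr_minus_divide[symmetric])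
  also have "?t powr p = E x"
  proof -
   have "?t = norm (gb x) / (ub x + d)" using v0 by simp
   then show ?thesis using v0 \<eta>(4)[OF True] by (simp add: E_def powr_divide powr_minus_divide)
  qed
  finally have "ennreal ?t <= ennreal (1 / r + r powr (p - 1) * E x)" by (rule ennreal_leI)
  also have "\<dots> = ennreal (1 / r) + ennreal (r powr (p - 1)) * ennreal (E x)" using r E0 by (simp add: ennreal_plus ennreal_mult)
  finally show ?thesis using True by simp
 qed simp
 have "(LBNN x. ennreal (norm ((1 / (ub x + d)) *\<^sub>R gb x)) * indicator ?B x)
  <= (LBNN x. ennreal (1 / r) * indicator ?B x + ennreal (r powr (p - 1)) * ennreal (E x))"
  by (rule nn_integral_mono) (rule pt)
 also have "\<dots> = ennreal (1 / r) * emeasure lborel ?B + ennreal (r powr (p - 1)) * (LBNN x. ennreal (E x))"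
 proof -
  have [measurable]: "E \<in> borel_measurable borel" using borel_measurable_integrable[OF iE] by simp
  have "(LBNN x. ennreal (1 / r) * indicator ?B x + ennreal (r powr (p - 1)) * ennreal (E x))
   = (LBNN x. ennreal (1 / r) * indicator ?B x) + (LBNN x. ennreal (r powr (p - 1)) * ennreal (E x))"
   by (rule nn_integral_add) measurable
  moreover have "(LBNN x. ennreal (1 / r) * indicator ?B x) = ennreal (1 / r) * emeasure lborel ?B"
   by (rule nn_integral_cmult_indicator) simp
  moreover have "(LBNN x. ennreal (r powr (p - 1)) * ennreal (E x)) = ennreal (r powr (p - 1)) * (LBNN x. ennreal (E x))"
   by (rule nn_integral_cmult) measurable
  ultimately show ?thesis by (simp only:)
 qed
 also have "(LBNN x. ennreal (E x)) = ennreal (LBINT x. E x)" by (rule nn_integral_eq_integral[OF iE]) (simp add: E0)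
 also have "emeasure lborel ?B = ennreal (measure lborel ?B)" using emeasure_lborel_ball_finite[of x0 "3/2 * r"] by (intro emeasure_eq_ennreal_measure) auto
 also have "ennreal (1 / r) * ennreal (measure lborel ?B) + ennreal (r powr (p - 1)) * ennreal (LBINT x. E x)
  <= ennreal (1 / r) * ennreal V + ennreal (r powr (p - 1)) * ennreal (e * (32 / r) powr p * V)"
  by (intro add_mono mult_left_mono ennreal_leI EI vol) auto
 also have "\<dots> = ennreal (1 / r * V + r powr (p - 1) * (e * (32 / r) powr p * V))"
  using r V0 by (simp add: ennreal_mult[symmetric] ennreal_plus[symmetric] e_def del: ennreal_plus)
 also have "1 / r * V + r powr (p - 1) * (e * (32 / r) powr p * V) = (1 + e * 32 powr p) * V / r"
 proof -
  have "r powr (p - 1) = r powr p / r" using r by (simp add: powr_diff)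
  then show ?thesis using r by (simp add: powr_divide field_simps)
 qed
 finally show ?thesis by (simp add: e_def V_def mult.assoc)
qed

lemma log_estimate:
 "\<exists>k. \<forall>t>0. measure lborel {x \<in> ball x0 (3/2 * r). t < \<bar>ln (ub x + d) - k\<bar>} <= log_bound_const DIM('a) p (energy_bound_const (real DIM('a)) p s \<Lambda> C1 C2 CK (p - 1)) * r ^ DIM('a) / t"
proof -
 let ?B = "ball x0 (3/2 * r)"
 let ?i = "\<lambda>x. indicator ?B x :: ennreal"
 have [measurable]: "?B \<in> sets borel" by simp
 define w where "w x = ln (ub x + d)" for x
 have [measurable]: "w \<in> borel_measurable borel" unfolding w_def by measurable
 have Sfin: "emeasure lborel S < \<infinity>" using emeasure_lborel_ball_finite[of x0 "7/4 * r"] by simp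
 have FD: "((\<lambda>t. ln (t + d)) has_real_derivative 1 / (t + d)) (at t)" if "t \<in> {0..M}" for t
  using that d by (auto intro!: derivative_eq_intros)
 have F'c: "continuous_on {0..M} (\<lambda>t. 1 / (t + d))" by (intro continuous_intros) (use d in auto)
 obtain a1 b1 where s1: "sobC p S UNIV a1 b1 w (\<lambda>x. (1 / (ub x + d)) *\<^sub>R gb x)"
  unfolding w_def[abs_def] by (rule sobC_chain[OF sob _ _ FD F'c]) (use p in auto)
 define W where "W = log_bound_const DIM('a) p (energy_bound_const (real DIM('a)) p s \<Lambda> C1 C2 CK (p - 1)) * r ^ DIM('a) / 2"
 have lc: "log_bound_const DIM('a) p (energy_bound_const (real DIM('a)) p s \<Lambda> C1 C2 CK (p - 1)) > 0" unfolding log_bound_const_def by (intro mult_pos_pos add_pos_nonneg) auto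
 then have W0: "W > 0" using r by (simp add: W_def)
 have r32: "3/2 * r > 0" "?B \<subseteq> S" using r by auto
 have eB: "emeasure lborel ?B = ennreal (measure lborel ?B)" using emeasure_lborel_ball_finite[of x0 "3/2 * r"] by (intro emeasure_eq_ennreal_measure) auto
 have mB: "measure lborel ?B > 0" using r32 by (simp add: content_ball_pos)
 have "(LBNN x. LBNN y. ennreal \<bar>w x - w y\<bar> * ?i x * ?i y)
  <= ennreal (2 * (3/2 * r) * 2 ^ DIM('a)) * emeasure lborel ?B * (LBNN x. ennreal (norm ((1 / (ub x + d)) *\<^sub>R gb x)) * ?i x)"
  by (rule poincare_sobC[OF s1 _ _ Sfin r32]) (use p in auto)
 also have "\<dots> <= ennreal (2 * (3/2 * r) * 2 ^ DIM('a)) * emeasure lborel ?B * ennreal (log_bound_const DIM('a) p (energy_bound_const (real DIM('a)) p s \<Lambda> C1 C2 CK (p - 1)) / (6 * 2 ^ DIM('a)) * r ^ DIM('a) / r)"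
  using gradient_ln_integral by (intro mult_left_mono) (auto simp: log_bound_const_def)
 also have "\<dots> = ennreal (measure lborel ?B * W)"
  unfolding eB using r lc by (simp add: ennreal_mult[symmetric] W_def field_simps)
 finally have dbl: "(LBNN x. LBNN y. ennreal \<bar>w x - w y\<bar> * ?i x * ?i y) <= ennreal (measure lborel ?B * W)" .
 have "\<exists>x\<in>?B. (LBNN y. ennreal \<bar>w x - w y\<bar> * ?i y) <= ennreal (2 * W)"
 proof (rule ccontr)
  assume "\<not> ?thesis"
  then have big: "ennreal (2 * W) <= (LBNN y. ennreal \<bar>w x - w y\<bar> * ?i y)" if "x \<in> ?B" for x using that by (meson linear)
  have "ennreal (2 * W) * emeasure lborel ?B = (LBNN x. ennreal (2 * W) * ?i x)" by (rule nn_integral_cmult_indicator[symmetric]) simp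
  also have "\<dots> <= (LBNN x. LBNN y. ennreal \<bar>w x - w y\<bar> * ?i x * ?i y)"
  proof (rule nn_integral_mono)
   fix x show "ennreal (2 * W) * ?i x <= (LBNN y. ennreal \<bar>w x - w y\<bar> * ?i x * ?i y)"
    using big[of x] by (cases "x \<in> ?B") (simp_all del: mem_ball)
  qed
  also note dbl
  finally have "ennreal (2 * W * measure lborel ?B) <= ennreal (measure lborel ?B * W)" unfolding eB using W0 by (simp add: ennreal_mult)
  then have "2 * W * measure lborel ?B <= measure lborel ?B * W" using W0 by (simp add: ennreal_le_iff)
  moreover have "0 < W * measure lborel ?B" using W0 mB by (rule mult_pos_pos)
  ultimately show False by (simp only: mult.assoc mult.commute[of "measure lborel ?B"])
 qed
 then obtain z where z: "(LBNN y. ennreal \<bar>w z - w y\<bar> * ?i y) <= ennreal (2 * W)" by blast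
 have "measure lborel {x \<in> ?B. t < \<bar>w x - w z\<bar>} <= 2 * W / t" if t: "t > 0" for t
 proof -
  let ?A = "{x \<in> ?B. t < \<bar>w x - w z\<bar>}"
  have A: "?A \<in> sets lborel" by measurable
  have Af: "emeasure lborel ?A = ennreal (measure lborel ?A)"
  proof (rule emeasure_eq_ennreal_measure)
   have "emeasure lborel ?A <= emeasure lborel ?B" by (intro emeasure_mono) auto
   then show "emeasure lborel ?A \<noteq> top" unfolding eB by (rule neq_top_trans[OF ennreal_neq_top])
  qed
  have "ennreal (t * measure lborel ?A) = (LBNN y. ennreal t * indicator ?A y)"
   unfolding nn_integral_cmult_indicator[OF A] Af using t by (intro ennreal_mult) auto
  also have "\<dots> <= (LBNN y. ennreal \<bar>w z - w y\<bar> * ?i y)"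
  proof (rule nn_integral_mono)
   fix y show "ennreal t * indicator ?A y <= ennreal \<bar>w z - w y\<bar> * ?i y"
    by (cases "y \<in> ?A") (auto intro!: ennreal_leI)
  qed
  also note z
  finally have "t * measure lborel ?A <= 2 * W" using W0 by (simp add: ennreal_le_iff)
  then show ?thesis using t by (simp add: field_simps)
 qed
 then show ?thesis by (intro exI[of _ "w z"]) (simp add: w_def W_def)
qed

end

lemma (in supersol_rep) weak_harnack_representative:
 assumes \<kappa>: "1 < \<kappa>" and D: "0 < D"
  and Sob: "\<And>\<rho> f G. 0 < \<rho> ==> C1g f G ==> (\<And>x. x \<notin> ball x0 \<rho> ==> f x = 0) ==>
    (LBINT x. \<bar>f x\<bar> powr (\<kappa> * p)) powr (1 / \<kappa>) <= D * \<rho> powr (p - real DIM('a) * (1 - 1 / \<kappa>)) * (LBINT x. norm (G x) powr p)"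
  and \<delta>: "0 < \<delta>" and l: "l / \<kappa> = p - 1 - \<delta>" "0 < l"
  and C0: "hoelder_bound_const (real DIM('a)) p \<kappa> D (energy_bound_const (real DIM('a)) p s \<Lambda> C1 C2 CK \<delta>) <= C0"
  and T: "log_bound_const DIM('a) p (energy_bound_const (real DIM('a)) p s \<Lambda> C1 C2 CK (p - 1)) <= T"
  and HK: "harnack_const TYPE('a) \<kappa> p C0 (unit_ball_vol (real DIM('a)) * (3/2) ^ DIM('a)) T l Kc"
 shows "AE x in lborel. x \<in> ball x0 r -->
  (r powr (- real DIM('a)) * (LBINT x. (ub x + d) powr l * indicator (ball x0 r) x)) powr (1 / l) <= Kc * (ub x + d)"
proof -
 define c where "c = r powr (- real DIM('a))"
 have c0: "c > 0" using r by (simp add: c_def)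
 have cr: "c * r ^ DIM('a) = 1" using r by (simp add: c_def powr_minus powr_realpow)
 define M' where "M' = density lborel (\<lambda>x::'a. ennreal c)"
 define U where "U \<sigma> = ball x0 (\<sigma> * r)" for \<sigma>
 have [measurable]: "U \<sigma> \<in> sets borel" for \<sigma> by (simp add: U_def)
 have sM: "sets M' = sets borel" by (simp add: M'_def)
 have bM: "borel_measurable M' = (borel_measurable borel :: ('a => real) set)" by (rule measurable_cong_sets[OF sM refl])
 have int: "(\<integral>x. f x \<partial>M') = c * (LBINT x. f x)" if "f \<in> borel_measurable borel" for f :: "'a => real"
  unfolding M'_def using that c0 by (subst integral_density) auto
 have mea: "measure M' A = c * measure lborel A" if "A \<in> sets borel" for A
  unfolding M'_def using that c0 by (subst measure_density_const) auto
 have em: "measure lborel (U \<sigma>) = unit_ball_vol (real DIM('a)) * \<sigma> ^ DIM('a) * r ^ DIM('a)" if "0 <= \<sigma>" for \<sigma>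
  unfolding U_def using that r by (subst content_ball) (auto simp: power_mult_distrib)
 obtain k where k: "\<forall>t>0. measure lborel {x \<in> ball x0 (3/2 * r). t < \<bar>ln (ub x + d) - k\<bar>} <= log_bound_const DIM('a) p (energy_bound_const (real DIM('a)) p s \<Lambda> C1 C2 CK (p - 1)) * r ^ DIM('a) / t"
  using log_estimate by blast
 have vm: "(\<lambda>x. (ub x + d) powr a * indicat_real (U \<sigma>) x) \<in> borel_measurable borel" for a \<sigma> by measurable
 have "AE x in M'. x \<in> U 1 --> (\<integral>x. (ub x + d) powr l * indicator (U 1) x \<partial>M') powr (1/l) <= Kc * (ub x + d)"
 proof (rule HK[unfolded harnack_const_def, rule_format, where M = M' and U = U and v = "\<lambda>x. ub x + d" and ?c1.0 = d and ?c2.0 = "M + d" and k = k])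
  show "(\<lambda>x. ub x + d) \<in> borel_measurable M'" unfolding bM by measurable
  show "0 < d" by (rule d)
  show "d <= ub x + d" "ub x + d <= M + d" for x by (rule v_bounds)+
  show "U \<sigma> \<in> sets M'" for \<sigma> unfolding sM by measurable
  show "U \<sigma>' \<subseteq> U \<sigma>" if "\<sigma>' <= \<sigma>" for \<sigma>' \<sigma> unfolding U_def using that r by (intro subset_ball mult_right_mono) auto
  show "emeasure M' (U (3/2)) \<noteq> \<infinity>" unfolding M'_def U_def using emeasure_lborel_ball_finite[of x0 "3/2 * r"]
   by (subst emeasure_density_const) (auto simp: ennreal_mult_eq_top_iff)
  have "measure M' (U (3/2)) = unit_ball_vol (real DIM('a)) * (3/2) ^ DIM('a) * (c * r ^ DIM('a))" by (subst mea) (auto simp: em)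
  then show "measure M' (U (3/2)) <= unit_ball_vol (real DIM('a)) * (3/2) ^ DIM('a)" by (simp add: cr)
  show "0 < measure M' (U 1)" using c0 r by (subst mea) (auto simp: em)
  show "(\<integral>x. (ub x + d) powr (\<alpha> * \<kappa>) * indicator (U \<sigma>') x \<partial>M') powr (1/\<kappa>)
     <= C0 * (1 + \<bar>\<alpha>\<bar>) powr p * (\<sigma> - \<sigma>') powr (-p) * (\<integral>x. (ub x + d) powr \<alpha> * indicator (U \<sigma>) x \<partial>M')"
   if \<alpha>: "\<alpha> \<noteq> 0" "\<alpha> <= l / \<kappa>" and \<sigma>: "1 <= \<sigma>'" "\<sigma>' < \<sigma>" "\<sigma> <= 3/2" for \<alpha> \<sigma>' \<sigma>
  proof -
   define I1 where "I1 = (LBINT x. (ub x + d) powr (\<alpha> * \<kappa>) * indicator (U \<sigma>') x)"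
   define I2 where "I2 = (LBINT x. (ub x + d) powr \<alpha> * indicator (U \<sigma>) x)"
   have I0: "I1 >= 0" "I2 >= 0" unfolding I1_def I2_def by (auto intro!: integral_nonneg_AE)
   define H where "H = hoelder_bound_const (real DIM('a)) p \<kappa> D (energy_bound_const (real DIM('a)) p s \<Lambda> C1 C2 CK \<delta>)"
   have "I1 powr (1 / \<kappa>) <= H * (1 + \<bar>\<alpha>\<bar>) powr p * (\<sigma> - \<sigma>') powr (-p) * r powr (real DIM('a) / \<kappa> - real DIM('a)) * I2"
    unfolding I1_def I2_def U_def H_def using \<alpha> l by (intro reverse_hoelder_step[OF \<kappa> D Sob \<delta> _ \<sigma>]) auto
   then have "c powr (1 / \<kappa>) * I1 powr (1 / \<kappa>) <= c powr (1 / \<kappa>) * (H * (1 + \<bar>\<alpha>\<bar>) powr p * (\<sigma> - \<sigma>') powr (-p) * r powr (real DIM('a) / \<kappa> - real DIM('a)) * I2)"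
    by (intro mult_left_mono) auto
   also have "\<dots> = (c powr (1 / \<kappa>) * r powr (real DIM('a) / \<kappa> - real DIM('a))) * (H * (1 + \<bar>\<alpha>\<bar>) powr p * (\<sigma> - \<sigma>') powr (-p) * I2)" by (simp only: mult_ac)
   also have "c powr (1 / \<kappa>) * r powr (real DIM('a) / \<kappa> - real DIM('a)) = c" by (simp add: c_def powr_powr powr_add[symmetric])
   also have "c * (H * (1 + \<bar>\<alpha>\<bar>) powr p * (\<sigma> - \<sigma>') powr (-p) * I2) <= c * (C0 * (1 + \<bar>\<alpha>\<bar>) powr p * (\<sigma> - \<sigma>') powr (-p) * I2)"
    using C0 c0 I0 unfolding H_def[symmetric] by (intro mult_left_mono mult_right_mono) auto
   also have "\<dots> = C0 * (1 + \<bar>\<alpha>\<bar>) powr p * (\<sigma> - \<sigma>') powr (-p) * (c * I2)" by (simp only: mult_ac)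
   finally show ?thesis unfolding int[OF vm] I1_def[symmetric] I2_def[symmetric] powr_mult .
  qed
  show "measure M' {x \<in> U (3/2). t < \<bar>ln (ub x + d) - k\<bar>} <= T / t" if t: "t > 0" for t
  proof -
   have "measure M' {x \<in> U (3/2). t < \<bar>ln (ub x + d) - k\<bar>} = c * measure lborel {x \<in> ball x0 (3/2 * r). t < \<bar>ln (ub x + d) - k\<bar>}"
    by (subst mea) (measurable, simp add: U_def)
   also have "\<dots> <= c * (log_bound_const DIM('a) p (energy_bound_const (real DIM('a)) p s \<Lambda> C1 C2 CK (p - 1)) * r ^ DIM('a) / t)"
    using k t c0 by (intro mult_left_mono) auto
   also have "\<dots> = (c * r ^ DIM('a)) * (log_bound_const DIM('a) p (energy_bound_const (real DIM('a)) p s \<Lambda> C1 C2 CK (p - 1)) / t)" by simp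
   also have "\<dots> <= T / t" unfolding cr using T t by (simp add: divide_right_mono)
   finally show ?thesis .
  qed
 qed
 then have "AE x in lborel. 0 < ennreal c --> x \<in> U 1 --> (\<integral>x. (ub x + d) powr l * indicator (U 1) x \<partial>M') powr (1/l) <= Kc * (ub x + d)"
  unfolding M'_def by (subst (asm) AE_density) auto
 then show ?thesis unfolding int[OF vm] using c0 by (simp add: U_def c_def)
qed

lemma le_ess_inf_on:
 assumes z: "AE x in lebesgue. x \<in> A --> z <= u x" and m: "AE x in lebesgue. u x <= m"
  and A: "A \<in> sets lebesgue" "emeasure lebesgue A \<noteq> 0"
 shows "z <= ess_inf_on A u"
 unfolding ess_inf_on_def
proof (rule cSup_upper)
 show "z \<in> {z. AE x in lebesgue. x \<in> A --> z <= u x}" using z by simp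
 show "bdd_above {z. AE x in lebesgue. x \<in> A --> z <= u x}"
 proof (rule bdd_aboveI)
  fix y assume "y \<in> {z. AE x in lebesgue. x \<in> A --> z <= u x}"
  then have y: "AE x in lebesgue. x \<in> A --> y <= u x" by simp
  show "y <= m"
  proof (rule ccontr)
   assume "\<not> y <= m"
   have "AE x in lebesgue. x \<notin> A" using y m
   proof eventually_elim
    case (elim x)
    then show ?case using \<open>\<not> y <= m\<close> by auto
   qed
   then have "A \<in> null_sets lebesgue" using A by (simp add: AE_iff_null_sets)
   then show False using A by auto
  qed
 qed
qed

lemma (in supersol) tail_le:
 assumes CK: "0 < CK" "\<And>L. L > 0 ==> (LBNN z. ennreal (min 1 (L * norm (z::'a)) powr p * norm z powr (- (real DIM('a) + p * s)))) <= ennreal (CK * L powr (p * s))"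
  and d: "(r / R) powr (p / (p - 1)) * Tail p s (\<lambda>y. neg_part (u y)) x0 R <= d"
 shows "(\<integral>\<^sup>+y. ennreal (neg_part (u y) powr (p - 1) * norm (y - x0) powr (- (real DIM('a) + p * s))) * indicator (- ball x0 R) y \<partial>lebesgue) <= ennreal (d powr (p - 1) * r powr (-p))"
proof -
 define n where "n = real DIM('a) + p * s"
 have R0: "R > 0" using r by linarith
 define f where "f y = neg_part (u y) powr (p - 1) * norm (y - x0) powr (- n) * indicat_real (- ball x0 R) y" for y
 have f0: "f y >= 0" for y by (simp add: f_def)
 have [measurable]: "- ball x0 R \<in> sets borel" by auto
 have fm: "f \<in> borel_measurable lebesgue"
 proof -
  have a: "(\<lambda>y. neg_part (u y)) \<in> borel_measurable lebesgue" unfolding neg_part_def using u_meas by measurable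
  have b: "(\<lambda>y. norm (y - x0) powr (- n) * indicat_real (- ball x0 R) y) \<in> borel_measurable lebesgue"
   by (intro measurable_completion) measurable
  show ?thesis unfolding f_def[abs_def] mult.assoc by (rule borel_measurable_times[OF powr_real_measurable[OF a borel_measurable_const] b])
 qed
 obtain M0 where M0: "AE x in lebesgue. \<bar>u x\<bar> <= M0" using sup by (auto simp: weak_supersolution_def Linf_def)
 define m where "m = max M0 0 powr (p - 1)"
 let ?h = "\<lambda>z::'a. ennreal (min 1 (1 / R * norm z) powr p * norm z powr (- n))"
 have "(\<integral>\<^sup>+y. ennreal (f y) \<partial>lebesgue) <= (\<integral>\<^sup>+y. ennreal m * ?h (y - x0) \<partial>lebesgue)"
 proof (rule nn_integral_mono_AE)
  show "AE y in lebesgue. ennreal (f y) <= ennreal m * ?h (y - x0)"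
   using M0
  proof eventually_elim
   case (elim y)
   show ?case
   proof (cases "y \<in> ball x0 R")
    case False
    then have "R <= norm (y - x0)" by (simp add: dist_norm norm_minus_commute)
    then have "1 <= 1 / R * norm (y - x0)" using R0 by (simp add: field_simps)
    then have m1: "min 1 (1 / R * norm (y - x0)) = 1" by simp
    have "neg_part (u y) powr (p - 1) <= m" unfolding m_def using elim p by (intro powr_mono2) (auto simp: neg_part_def)
    then have "f y <= m * norm (y - x0) powr (- n)" using False by (simp add: f_def mult_right_mono)
    then have "ennreal (f y) <= ennreal (m * norm (y - x0) powr (- n))" by (rule ennreal_leI)
    then show ?thesis unfolding m1 by (simp add: ennreal_mult m_def)
   qed (simp add: f_def)
  qed
 qed
 also have "\<dots> = (LBNN y. ennreal m * ?h (y - x0))" by (rule nn_integral_completion)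
 also have "\<dots> = ennreal m * (LBNN y. ?h (y - x0))" by (rule nn_integral_cmult) measurable
 also have "(LBNN y. ?h (y - x0)) = (LBNN z. ?h z)"
  using nn_integral_lborel_affine[of ?h 1 "- x0"] by simp
 also have "ennreal m * (LBNN z. ?h z) <= ennreal m * ennreal (CK * (1 / R) powr (p * s))"
  unfolding n_def using R0 by (intro mult_left_mono CK) auto
 also have "\<dots> < \<infinity>" by (simp add: ennreal_mult_less_top)
 finally have fin: "(\<integral>\<^sup>+y. ennreal (f y) \<partial>lebesgue) < \<infinity>" .
 have fi: "integrable lebesgue f" by (rule integrableI_nonneg[OF fm _ fin]) (simp add: f0)
 define I where "I = (\<integral>y. f y \<partial>lebesgue)"
 have I0: "I >= 0" unfolding I_def by (simp add: f0)
 have "(LINT y:(UNIV - ball x0 R)|lebesgue. \<bar>neg_part (u y)\<bar> powr (p - 1) / dist y x0 powr n) = I"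
  unfolding I_def set_lebesgue_integral_def
 proof (rule Bochner_Integration.integral_cong[OF refl])
  fix y show "indicator (UNIV - ball x0 R) y *\<^sub>R (\<bar>neg_part (u y)\<bar> powr (p - 1) / dist y x0 powr n) = f y"
   by (simp add: f_def indicator_def dist_norm powr_minus_divide neg_part_def)
 qed
 then have T: "Tail p s (\<lambda>y. neg_part (u y)) x0 R = (R powr p * I) powr (1 / (p - 1))" by (simp add: Tail_def n_def)
 define T' where "T' = (r / R) powr (p / (p - 1)) * Tail p s (\<lambda>y. neg_part (u y)) x0 R"
 have "T' powr (p - 1) = (r / R) powr p * (R powr p * I)" unfolding T'_def T powr_mult powr_powr using p R0 I0 r by simp
 also have "\<dots> = r powr p * I" using R0 r by (simp add: powr_divide)
 finally have T1: "T' powr (p - 1) = r powr p * I" .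
 have "T' powr (p - 1) <= d powr (p - 1)" using d p by (intro powr_mono2) (auto simp: T'_def[symmetric], simp add: T'_def T)
 then have "r powr p * I * r powr (-p) <= d powr (p - 1) * r powr (-p)" unfolding T1 by (intro mult_right_mono) auto
 then have Id: "I <= d powr (p - 1) * r powr (-p)" using r by (simp add: powr_minus_divide pos_le_divide_eq mult.commute)
 have "(\<integral>\<^sup>+y. ennreal (neg_part (u y) powr (p - 1) * norm (y - x0) powr (- n)) * indicator (- ball x0 R) y \<partial>lebesgue) = (\<integral>\<^sup>+y. ennreal (f y) \<partial>lebesgue)"
  by (intro nn_integral_cong) (simp add: f_def indicator_def)
 also have "\<dots> = ennreal I" unfolding I_def by (rule nn_integral_eq_integral[OF fi]) (simp add: f0)
 also have "\<dots> <= ennreal (d powr (p - 1) * r powr (-p))" using Id by (rule ennreal_leI)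
 finally show ?thesis by (simp add: n_def)
qed

lemma (in supersol) weak_harnack:
 assumes CK: "0 < CK" "\<And>L. L > 0 ==> (LBNN z. ennreal (min 1 (L * norm (z::'a)) powr p * norm z powr (- (real DIM('a) + p * s)))) <= ennreal (CK * L powr (p * s))"
  and \<kappa>: "1 < \<kappa>" and D: "0 < D"
  and Sob: "\<And>\<rho> f G. 0 < \<rho> ==> C1g f G ==> (\<And>x. x \<notin> ball x0 \<rho> ==> f x = 0) ==>
    (LBINT x. \<bar>f x\<bar> powr (\<kappa> * p)) powr (1 / \<kappa>) <= D * \<rho> powr (p - real DIM('a) * (1 - 1 / \<kappa>)) * (LBINT x. norm (G x) powr p)"
  and \<delta>: "0 < \<delta>" and l: "l / \<kappa> = p - 1 - \<delta>" "0 < l"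
  and C0: "hoelder_bound_const (real DIM('a)) p \<kappa> D (energy_bound_const (real DIM('a)) p s \<Lambda> C1 C2 CK \<delta>) <= C0"
  and T: "log_bound_const DIM('a) p (energy_bound_const (real DIM('a)) p s \<Lambda> C1 C2 CK (p - 1)) <= T"
  and HK: "harnack_const TYPE('a) \<kappa> p C0 (unit_ball_vol (real DIM('a)) * (3/2) ^ DIM('a)) T l Kc"
  and Kc: "0 < Kc" and c: "c = (2 ^ DIM('a) / unit_ball_vol (real DIM('a))) powr (1 / l) * Kc"
 shows "((1 / measure lebesgue (ball x0 (r / 2))) * (LINT x:ball x0 (r / 2)|lebesgue. u x powr l)) powr (1 / l)
  <= c * ess_inf_on (ball x0 r) u + c * (r / R) powr (p / (p - 1)) * Tail p s (\<lambda>y. neg_part (u y)) x0 R"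
proof -
 obtain g ub gb M where g: "weak_grad_on \<Omega> u g" and ubM: "\<And>x. ub x \<in> {0..M}" and ube: "AE x in lebesgue. x \<in> ball x0 R --> u x = ub x"
  and gC: "(\<lambda>x. indicator (cball x0 (15/8 * r)) x *\<^sub>R g x) \<in> borel_measurable lebesgue"
  and gbe: "AE x in lebesgue. x \<in> cball x0 (15/8 * r) --> g x = gb x" and sob: "sobC p S UNIV 0 M ub gb"
  by (rule representatives) (rule that)
 define T' where "T' = (r / R) powr (p / (p - 1)) * Tail p s (\<lambda>y. neg_part (u y)) x0 R"
 have T'0: "T' >= 0" by (simp add: T'_def Tail_def)
 define N where "N = real DIM('a)"
 define \<omega> where "\<omega> = unit_ball_vol (real DIM('a))"
 have \<omega>: "\<omega> > 0" by (simp add: \<omega>_def)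
 define c1 where "c1 = (2 ^ DIM('a) / \<omega>) powr (1 / l)"
 have c10: "c1 > 0" using \<omega> by (simp add: c1_def)
 have BR2: "ball x0 (r / 2) \<subseteq> ball x0 R" "ball x0 r \<subseteq> ball x0 R" using r by auto
 have [measurable]: "ball x0 (r / 2) \<in> sets borel" "ball x0 r \<in> sets borel" by simp_all
 have [measurable]: "ub \<in> borel_measurable borel" using sob unfolding sobC_def by blast
 define lhs where "lhs = ((1 / measure lebesgue (ball x0 (r / 2))) * (LINT x:ball x0 (r / 2)|lebesgue. u x powr l)) powr (1 / l)"
 have key: "lhs <= c1 * Kc * (ess_inf_on (ball x0 r) u + (T' + \<epsilon>))" if \<epsilon>: "\<epsilon> > 0" for \<epsilon>
 proof -
  define d where "d = T' + \<epsilon>"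
  have d0: "d > 0" using T'0 \<epsilon> by (simp add: d_def)
  have tl: "(\<integral>\<^sup>+y. ennreal (neg_part (u y) powr (p - 1) * norm (y - x0) powr (- (real DIM('a) + p * s))) * indicator (- ball x0 R) y \<partial>lebesgue) <= ennreal (d powr (p - 1) * r powr (-p))"
   by (rule tail_le[OF CK]) (use \<epsilon> in \<open>simp_all add: d_def T'_def\<close>)
  have rep: "supersol_rep p s \<Lambda> C1 C2 \<Omega> B K u x0 R r g gb ub M CK d"
   by (intro supersol_rep.intro supersol_axioms supersol_rep_axioms.intro g ubM ube gC gbe sob CK d0 tl)
  define A where "A = (r powr (- real DIM('a)) * (LBINT x. (ub x + d) powr l * indicator (ball x0 r) x)) powr (1 / l)"
  have hk: "AE x in lborel. x \<in> ball x0 r --> A <= Kc * (ub x + d)"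
   unfolding A_def by (rule supersol_rep.weak_harnack_representative[OF rep \<kappa> D Sob \<delta> l C0 T HK])
  have "AE x in lebesgue. x \<in> ball x0 r --> A / Kc - d <= u x"
   using AE_completion[OF hk] ube
  proof eventually_elim
   case (elim x)
   show ?case
   proof
    assume x: "x \<in> ball x0 r"
    then have "x \<in> ball x0 R" using BR2 by blast
    then have "A <= Kc * (u x + d)" using elim x by (simp del: mem_ball)
    then show "A / Kc - d <= u x" using Kc by (simp add: field_simps)
   qed
  qed
  moreover obtain M0 where M0: "AE x in lebesgue. \<bar>u x\<bar> <= M0" using sup by (auto simp: weak_supersolution_def Linf_def)
  then have "AE x in lebesgue. u x <= M0" by eventually_elim auto
  moreover have "emeasure lebesgue (ball x0 r) \<noteq> 0"
   using content_ball_pos[of r x0] r by (auto simp: measure_def zero_less_iff_neq_zero)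
  ultimately have "A / Kc - d <= ess_inf_on (ball x0 r) u" by (intro le_ess_inf_on) auto
  then have A: "A <= Kc * (ess_inf_on (ball x0 r) u + d)" using Kc by (simp add: field_simps)
  have "(LINT x:ball x0 (r / 2)|lebesgue. u x powr l) = (LINT x:ball x0 (r / 2)|lebesgue. ub x powr l)"
   unfolding set_lebesgue_integral_def
  proof (rule integral_cong_AE)
   show "(\<lambda>x. indicat_real (ball x0 (r / 2)) x *\<^sub>R u x powr l) \<in> borel_measurable lebesgue"
    by (intro borel_measurable_scaleR powr_real_measurable u_meas borel_measurable_const borel_measurable_indicator) simp
   show "(\<lambda>x. indicat_real (ball x0 (r / 2)) x *\<^sub>R ub x powr l) \<in> borel_measurable lebesgue"
    by (intro measurable_completion) measurable
   show "AE x in lebesgue. indicat_real (ball x0 (r / 2)) x *\<^sub>R u x powr l = indicat_real (ball x0 (r / 2)) x *\<^sub>R ub x powr l"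
    using ube
   proof eventually_elim
    case (elim x)
    then show ?case using BR2 by (cases "x \<in> ball x0 (r / 2)") (auto simp del: mem_ball)
   qed
  qed
  also have "\<dots> = (LBINT x. indicat_real (ball x0 (r / 2)) x *\<^sub>R ub x powr l)"
   by (rule lebesgue_set_integral_borel) measurable
  also have "\<dots> <= (LBINT x. (ub x + d) powr l * indicator (ball x0 r) x)"
  proof (rule integral_mono')
   show "integrable lborel (\<lambda>x. (ub x + d) powr l * indicator (ball x0 r) x)" by (rule supersol_rep.integrable_v_powr[OF rep])
   fix x
   have "ub x powr l <= (ub x + d) powr l" using ubM[of x] d0 l by (intro powr_mono2) auto
   moreover have "x \<in> ball x0 r" if "x \<in> ball x0 (r / 2)" using that r by auto
   ultimately show "indicat_real (ball x0 (r / 2)) x *\<^sub>R ub x powr l <= (ub x + d) powr l * indicator (ball x0 r) x"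
    by (cases "x \<in> ball x0 (r / 2)") (auto simp del: mem_ball)
  qed simp
  finally have le: "(LINT x:ball x0 (r / 2)|lebesgue. u x powr l) <= (LBINT x. (ub x + d) powr l * indicator (ball x0 r) x)" .
  have I0: "0 <= (LINT x:ball x0 (r / 2)|lebesgue. u x powr l)" unfolding set_lebesgue_integral_def by simp
  have mb: "1 / measure lebesgue (ball x0 (r / 2)) = 2 ^ DIM('a) / \<omega> * r powr (- real DIM('a))"
  proof -
   have "measure lebesgue (ball x0 (r / 2)) = measure lborel (ball x0 (r / 2))" by simp
   also have "\<dots> = \<omega> * (r / 2) ^ DIM('a)" unfolding \<omega>_def using r by (intro content_ball) auto
   finally show ?thesis using r \<omega> by (simp add: powr_minus powr_realpow field_simps power_divide)
  qed
  have "lhs <= (2 ^ DIM('a) / \<omega> * r powr (- real DIM('a)) * (LBINT x. (ub x + d) powr l * indicator (ball x0 r) x)) powr (1 / l)"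
   unfolding lhs_def mb using le I0 \<omega> l by (intro powr_mono2 mult_left_mono) auto
  also have "\<dots> = c1 * A" unfolding c1_def A_def mult.assoc by (rule powr_mult)
  also have "\<dots> <= c1 * (Kc * (ess_inf_on (ball x0 r) u + d))" using A c10 by (intro mult_left_mono) auto
  finally show ?thesis by (simp add: d_def mult.assoc)
 qed
 have "lhs <= c1 * Kc * (ess_inf_on (ball x0 r) u + T')"
 proof (rule field_le_epsilon)
  fix e :: real assume e: "e > 0"
  have ck: "c1 * Kc > 0" using c10 Kc by simp
  from key[of "e / (c1 * Kc)"] e ck have "lhs <= c1 * Kc * (ess_inf_on (ball x0 r) u + (T' + e / (c1 * Kc)))" by simp
  also have "\<dots> = c1 * Kc * (ess_inf_on (ball x0 r) u + T') + e" using c10 Kc by (simp add: distrib_left)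
  finally show "lhs <= c1 * Kc * (ess_inf_on (ball x0 r) u + T') + e" .
 qed
 moreover have "c = c1 * Kc" by (simp add: c c1_def \<omega>_def)
 ultimately show ?thesis by (simp add: lhs_def T'_def distrib_left mult.assoc)
qed

lemma sobolev_exponent:
 assumes "1 < p" "0 < l" "l < kappa n p * (p - 1)" "2 <= n"
 obtains \<kappa> where "1 < \<kappa>" "real n * (1 - 1 / \<kappa>) < p" "l < \<kappa> * (p - 1)"
proof -
 have "l / (p - 1) < kappa n p" using assms by (simp add: divide_less_eq)
 moreover have "1 < kappa n p" using assms by (simp add: kappa_def)
 ultimately obtain \<kappa> where \<kappa>: "max 1 (l / (p - 1)) < \<kappa>" "\<kappa> < kappa n p" using dense[of "max 1 (l / (p - 1))" "kappa n p"] by auto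
 have k1: "1 < \<kappa>" "l < \<kappa> * (p - 1)" using \<kappa> assms by (auto simp: divide_less_eq)
 have "real n * (1 - 1 / \<kappa>) < p"
 proof (cases "p < real n")
  case True
  then have "\<kappa> * (real n - p) < real n" using \<kappa> by (simp add: kappa_def less_divide_eq)
  then show ?thesis using k1 by (simp add: field_simps)
 next
  case False
  then have "\<kappa> < 2" using \<kappa> by (simp add: kappa_def)
  then have "1 - 1 / \<kappa> < 1" using k1 by simp
  then have "real n * (1 - 1 / \<kappa>) < real n * 1" using assms by (intro mult_strict_left_mono) auto
  then show ?thesis using False by simp
 qed
 then show ?thesis using that k1 by blast
qed

theorem mainTheorem8:
  fixes p s \<Lambda> C\<^sub>1 C\<^sub>2 l :: real
  assumes "DIM('a::euclidean_space) \<ge> 2"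
    and "1 < p" and "0 < s" and "s < 1" and "1 \<le> \<Lambda>" and "0 < C\<^sub>1" and "0 < C\<^sub>2"
    and "0 < l" and "l < kappa DIM('a) p * (p - 1)"
  shows "\<exists>c>0. \<forall>(\<Omega>::'a set) (\<B>::'a \<Rightarrow> real \<Rightarrow> 'a \<Rightarrow> 'a) (K::'a \<Rightarrow> 'a \<Rightarrow> real)
              (u::'a \<Rightarrow> real) (x0::'a) (R::real) (r::real).
      smooth_bounded_domain \<Omega> \<and>
      (\<forall>v \<zeta>. set_borel_measurable lebesgue \<Omega> (\<lambda>x. \<B> x v \<zeta>)) \<and>
      (\<forall>x\<in>\<Omega>. continuous_on UNIV (\<lambda>(v, \<zeta>). \<B> x v \<zeta>)) \<and>
      (AE x in lebesgue. x \<in> \<Omega> \<longrightarrow> (\<forall>v \<zeta>.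
          \<B> x v \<zeta> \<bullet> \<zeta> \<ge> C\<^sub>1 * norm \<zeta> powr p \<and> norm (\<B> x v \<zeta>) \<le> C\<^sub>2 * norm \<zeta> powr (p - 1))) \<and>
      (\<lambda>z. K (fst z) (snd z)) \<in> borel_measurable (lebesgue :: ('a \<times> 'a) measure) \<and>
      (\<forall>x y. K x y = K y x) \<and>
      (\<forall>x y. x \<noteq> y \<longrightarrow> (1 / \<Lambda>) * dist x y powr (- (real DIM('a) + p * s)) \<le> K x y \<and>
                        K x y \<le> \<Lambda> * dist x y powr (- (real DIM('a) + p * s))) \<and>
      weak_supersolution p \<Omega> \<B> K u \<and>
      ball x0 R \<subseteq> \<Omega> \<and>
      (AE x in lebesgue. x \<in> ball x0 R \<longrightarrow> 0 \<le> u x) \<and>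
      ball x0 r \<subseteq> ball x0 (R / 2) \<and> 0 < r \<and> r \<le> 1
      \<longrightarrow>
      ((1 / measure lebesgue (ball x0 (r / 2))) *
          (LINT x:ball x0 (r / 2)|lebesgue. u x powr l)) powr (1 / l)
        \<le> c * ess_inf_on (ball x0 r) u
          + c * (r / R) powr (p / (p - 1)) * Tail p s (\<lambda>y. neg_part (u y)) x0 R"
proof -
 let ?N = "real DIM('a)"
 obtain \<kappa> where \<kappa>: "1 < \<kappa>" "?N * (1 - 1 / \<kappa>) < p" "l < \<kappa> * (p - 1)"
  by (rule sobolev_exponent[OF assms(2) assms(8,9) assms(1)])
 obtain D where D: "D > 0" "\<And>(x0::'a) \<rho> f G. \<rho> > 0 ==> C1g f G ==> (\<And>x. x \<notin> ball x0 \<rho> ==> f x = 0) ==>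
   (LBINT x. \<bar>f x\<bar> powr (\<kappa> * p)) powr (1 / \<kappa>) <= D * \<rho> powr (p - ?N * (1 - 1 / \<kappa>)) * (LBINT x. norm (G x) powr p)"
  apply (rule sobolev_C1[OF assms(2) \<kappa>(1,2) assms(1)])
  subgoal premises prems for S by (rule prems(1)[OF prems(2,3)])
  done
 obtain CK where CK: "CK > 0" "\<And>L. L > 0 ==> (LBNN z. ennreal (min 1 (L * norm (z::'a)) powr p * norm z powr (- (real DIM('a) + p * s)))) <= ennreal (CK * L powr (p * s))"
  by (rule nonlocal_kernel_integral[OF assms(2,3,4), where 'a = 'a]) (rule that)
 define \<delta> where "\<delta> = p - 1 - l / \<kappa>"
 have \<delta>: "\<delta> > 0" "l / \<kappa> = p - 1 - \<delta>" using \<kappa> by (auto simp: \<delta>_def divide_less_eq mult.commute)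
 define e where "e = energy_bound_const ?N p s \<Lambda> C\<^sub>1 C\<^sub>2 CK"
 define C0 where "C0 = max 1 (hoelder_bound_const ?N p \<kappa> D (e \<delta>))"
 define T where "T = max 1 (log_bound_const DIM('a) p (e (p - 1)))"
 have C0: "1 <= C0" "hoelder_bound_const ?N p \<kappa> D (energy_bound_const ?N p s \<Lambda> C\<^sub>1 C\<^sub>2 CK \<delta>) <= C0" by (auto simp: C0_def e_def)
 have T: "0 < T" "log_bound_const DIM('a) p (energy_bound_const ?N p s \<Lambda> C\<^sub>1 C\<^sub>2 CK (p - 1)) <= T" by (auto simp: T_def e_def)
 have p0: "0 < p" using assms(2) by simp
 obtain Kc where Kc: "Kc > 0" and HK: "harnack_const TYPE('a) \<kappa> p C0 (unit_ball_vol (real DIM('a)) * (3/2) ^ DIM('a)) T l Kc"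
  using reverse_hoelder_harnack[where 'b = 'a, OF \<kappa>(1) p0 C0(1) T(1) assms(8)] by blast
 define c where "c = (2 ^ DIM('a) / unit_ball_vol (real DIM('a))) powr (1 / l) * Kc"
 have "2 ^ DIM('a) / unit_ball_vol (real DIM('a)) > 0" by (intro divide_pos_pos) simp_all
 then have c0: "c > 0" unfolding c_def by (intro mult_pos_pos Kc powr_gt_zero[THEN iffD2] less_imp_neq[THEN not_sym])
 show ?thesis
 proof (intro exI[of _ c] conjI allI impI c0, elim conjE)
  fix \<Omega> :: "'a set" and \<B> :: "'a => real => 'a => 'a" and K :: "'a => 'a => real" and u :: "'a => real" and x0 :: 'a and R r :: real
  assume Bm: "\<forall>v \<zeta>. set_borel_measurable lebesgue \<Omega> (\<lambda>x. \<B> x v \<zeta>)"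
   and Bc: "\<forall>x\<in>\<Omega>. continuous_on UNIV (\<lambda>(v, \<zeta>). \<B> x v \<zeta>)"
   and Bg: "AE x in lebesgue. x \<in> \<Omega> --> (\<forall>v \<zeta>. \<B> x v \<zeta> \<bullet> \<zeta> >= C\<^sub>1 * norm \<zeta> powr p \<and> norm (\<B> x v \<zeta>) <= C\<^sub>2 * norm \<zeta> powr (p - 1))"
   and Ks: "\<forall>x y. K x y = K y x"
   and KL: "\<forall>x y. x \<noteq> y --> (1 / \<Lambda>) * dist x y powr (- (real DIM('a) + p * s)) <= K x y \<and> K x y <= \<Lambda> * dist x y powr (- (real DIM('a) + p * s))"
   and sup: "weak_supersolution p \<Omega> \<B> K u" and BR: "ball x0 R \<subseteq> \<Omega>"
   and un: "AE x in lebesgue. x \<in> ball x0 R --> 0 <= u x"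
   and r: "ball x0 r \<subseteq> ball x0 (R / 2)" "0 < r" "r <= 1"
  have "2 * r <= R" using r by (simp add: ball_subset_ball_iff)
  have K0: "0 <= K x y" if "x \<noteq> y" for x y
  proof -
   have "0 <= (1 / \<Lambda>) * dist x y powr (- (real DIM('a) + p * s))" using assms(5) by simp
   then show ?thesis using KL that by (meson order_trans)
  qed
  have sp: "supersol p s \<Lambda> C\<^sub>1 C\<^sub>2 \<Omega> \<B> K u x0 R r"
  proof (rule supersol.intro)
   show "continuous_on UNIV (\<lambda>(v, \<zeta>). \<B> x v \<zeta>)" if "x \<in> \<Omega>" for x using Bc that by blast
   show "K x y <= \<Lambda> * dist x y powr (- (real DIM('a) + p * s))" if "x \<noteq> y" for x y using KL that by blast
  qed (use assms Bm Bg Ks K0 sup BR un r \<open>2 * r <= R\<close> in blast)+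
  show "((1 / measure lebesgue (ball x0 (r / 2))) * (LINT x:ball x0 (r / 2)|lebesgue. u x powr l)) powr (1 / l)
    <= c * ess_inf_on (ball x0 r) u + c * (r / R) powr (p / (p - 1)) * Tail p s (\<lambda>y. neg_part (u y)) x0 R"
   by (rule supersol.weak_harnack[OF sp CK \<kappa>(1) D \<delta> assms(8) C0(2) T(2) HK Kc c_def])
 qed
qed

end
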